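(* Finitely generated unit $\mathbf{F}$-modules are $F$-holonomic. In particular, for any ideal $I$ of $R$ and any $i\ge0$, the local cohomology module $H^i_I(R)$ (with its natural Frobenius action) is $F$-holonomic.
   Context: Fix a prime $p$ and an integer $n\ge1$. Let $R=\mathbb{F}_p[x_1,\ldots,x_n]$ and let $\mathbf{F}=R\{F\}/(Fr-r^pF\mid r\in R)$ be the ring of Frobenius operators, i.e. the free noncommutative $\mathbb{F}_p$-algebra on $x_1,\ldots,x_n,F$ modulo the two-sided ideal generated by $x_ix_j-x_jx_i$ and $x_i^pF-Fx_i$. All modules are left modules. For an $\mathbf{F}$-module $M$, $\mathcal{F}_R(M)$ is the base change of $M$ along the Frobenius $R\to R$, and the structure morphism $\theta_M:\mathcal{F}_R(M)\to M$ is the $R$-linear map $\theta_M(r\otimes m)=rF(m)$. $M$ is unit if $\theta_M$ is an isomorphism. The complexity of a monomial of $\mathbf{F}$ is the length of the shortest word in the symbols $x_1,\ldots,x_n,F$ representing it. The Bernstein filtration is $\mathcal{B}_i$ = the $\mathbb{F}_p$-span of all monomials of complexity at most $i$ ($\mathcal{B}_i=0$ for $i<0$), and $\mathbf{A}=\mathrm{gr}_{\mathcal{B}}(\mathbf{F})=\bigoplus_i\mathcal{B}_i/\mathcal{B}_{i-1}$. A $\mathcal{B}$-compatible filtration on $M$ is a chain $\Omega_0\subseteq\Omega_1\subseteq\cdots$ of finite-dimensional $\mathbb{F}_p$-subspaces with $\bigcup_i\Omega_i=M$ and $\mathcal{B}_i\Omega_j\subseteq\Omega_{i+j}$ (with $\Omega_i=0$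 for $i<0$). It is great if $\mathrm{gr}_\Omega(M)=\bigoplus_i\Omega_i/\Omega_{i-1}$ is finitely presented over $\mathbf{A}$; then $\mathrm{HS}_{(M,\Omega)}(t)=\sum_{i\ge 0}\dim_{\mathbb{F}_p}(\Omega_i/\Omega_{i-1})t^i$ is a rational function. An $\mathbf{F}$-module $M$ is $F$-holonomic if it admits a great filtration $\Omega$ and has Bernstein dimension $0$, i.e. $\mathrm{HS}_{(M,\Omega)}(t)$ has no pole at $t=1$ (this does not depend on the great filtration $\Omega$). Equivalently, $M$ is finitely generated over $\mathbf{F}$ and both $\mathrm{Ker}(\theta_M)$ and $\mathrm{Coker}(\theta_M)$ are finite length $R$-modules. *)

theory Defs
  imports
    "HOL-Algebra.QuotRing"
    "HOL-Algebra.Ideal_Product"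
    "HOL-Library.Poly_Mapping"
    "HOL-Computational_Algebra.Polynomial_FPS"
    "Berlekamp_Zassenhaus.Finite_Field"
    "Jordan_Normal_Form.VS_Connect"
begin

hide_const (open) Multiset.mult
hide_const (open) Polynomial.smult
hide_const (open) Modules.module

section \<open>Left modules over a ring that need not be commutative\<close>

text \<open>The axioms are those of the locale \<open>module\<close> of HOL-Algebra, which insists on a
  commutative ring of scalars.  In the module records built below the fields \<open>mult\<close>
  and \<open>one\<close> carry no meaning.\<close>

locale left_module = R?: ring R + M?: abelian_group M
  for R :: "('a, 'r) ring_scheme" (structure) and M :: "('a, 'm, 's) module_scheme" (structure) +
  assumes smult_closed: "\<lbrakk>a \<in> carrier R; x \<in> carrier M\<rbrakk> \<Longrightarrow> a \<odot>\<^bsub>M\<^esub> x \<in> carrier M"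
    and smult_l_distr: "\<lbrakk>a \<in> carrier R; b \<in> carrier R; x \<in> carrier M\<rbrakk> \<Longrightarrow>
      (a \<oplus> b) \<odot>\<^bsub>M\<^esub> x = a \<odot>\<^bsub>M\<^esub> x \<oplus>\<^bsub>M\<^esub> b \<odot>\<^bsub>M\<^esub> x"
    and smult_r_distr: "\<lbrakk>a \<in> carrier R; x \<in> carrier M; y \<in> carrier M\<rbrakk> \<Longrightarrow>
      a \<odot>\<^bsub>M\<^esub> (x \<oplus>\<^bsub>M\<^esub> y) = a \<odot>\<^bsub>M\<^esub> x \<oplus>\<^bsub>M\<^esub> a \<odot>\<^bsub>M\<^esub> y"
    and smult_assoc: "\<lbrakk>a \<in> carrier R; b \<in> carrier R; x \<in> carrier M\<rbrakk> \<Longrightarrow>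
      (a \<otimes> b) \<odot>\<^bsub>M\<^esub> x = a \<odot>\<^bsub>M\<^esub> (b \<odot>\<^bsub>M\<^esub> x)"
    and smult_one: "x \<in> carrier M \<Longrightarrow> \<one> \<odot>\<^bsub>M\<^esub> x = x"

definition regular_module :: "'a ring \<Rightarrow> ('a, 'a) module" where
  "regular_module R = \<lparr>carrier = carrier R, mult = mult R, one = one R,
     zero = zero R, add = add R, smult = mult R\<rparr>"

definition restrict_scalars :: "('a \<Rightarrow> 'b) \<Rightarrow> ('b, 'm) module \<Rightarrow> ('a, 'm) module" where
  "restrict_scalars h M = \<lparr>carrier = carrier M, mult = mult M, one = one M,
     zero = zero M, add = add M, smult = (\<lambda>a x. h a \<odot>\<^bsub>M\<^esub> x)\<rparr>"

definition quotient_module :: "('a, 'm) module \<Rightarrow> 'm set \<Rightarrow> ('a, 'm set) module" where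
  "quotient_module M N = \<lparr>carrier = a_rcosets\<^bsub>M\<^esub> N, mult = undefined, one = undefined,
     zero = N, add = set_add M, smult = (\<lambda>a X. \<Union>x\<in>X. N +>\<^bsub>M\<^esub> (a \<odot>\<^bsub>M\<^esub> x))\<rparr>"

definition generated_submodule :: "'a ring \<Rightarrow> ('a, 'm) module \<Rightarrow> 'm set \<Rightarrow> 'm set" where
  "generated_submodule R M S = \<Inter> {N. Module.submodule N R M \<and> S \<subseteq> N}"

definition finitely_generated :: "'a ring \<Rightarrow> ('a, 'm) module \<Rightarrow> bool" where
  "finitely_generated R M \<longleftrightarrow>
     (\<exists>S. finite S \<and> S \<subseteq> carrier M \<and> generated_submodule R M S = carrier M)"

text \<open>\<open>ring.func_space R {..<n}\<close> is the free left module \<open>R\<^sup>n\<close>.\<close>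

definition finitely_presented :: "'a ring \<Rightarrow> ('a, 'm) module \<Rightarrow> bool" where
  "finitely_presented R M \<longleftrightarrow>
     (\<exists>(n :: nat) h. h \<in> module_hom R (ring.func_space R {..<n}) M
        \<and> h ` carrier (ring.func_space R {..<n}) = carrier M
        \<and> finitely_generated R ((ring.func_space R {..<n})
            \<lparr>carrier := {v \<in> carrier (ring.func_space R {..<n}). h v = \<zero>\<^bsub>M\<^esub>}\<rparr>))"


section \<open>The polynomial ring and the ring of Frobenius operators\<close>

text \<open>The prime is \<open>p = CARD('p)\<close>, the field \<open>\<bbbF>\<^sub>p\<close> is \<open>'p mod_ring\<close>, and the
  variables \<open>x\<^sub>i\<close> are indexed by the (nonempty) finite type \<open>'n\<close>.\<close>

type_synonym ('p, 'n) pol = "('n \<Rightarrow>\<^sub>0 nat) \<Rightarrow>\<^sub>0 'p mod_ring"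

abbreviation pol_ring :: "('p::prime_card, 'n::finite) pol ring" where
  "pol_ring \<equiv> class_ring"

definition pol_const :: "'p::prime_card mod_ring \<Rightarrow> ('p, 'n::finite) pol" where
  "pol_const c = Poly_Mapping.single 0 c"

definition pol_var :: "'n::finite \<Rightarrow> ('p::prime_card, 'n) pol" where
  "pol_var i = Poly_Mapping.single (Poly_Mapping.single i 1) 1"

datatype 'n letter = X 'n | Fr

datatype 'n fword = Word (letters: "'n letter list")

instantiation fword :: (type) monoid_add
begin
definition zero_fword :: "'a fword" where "0 = Word []"
definition plus_fword :: "'a fword \<Rightarrow> 'a fword \<Rightarrow> 'a fword"
  where "u + v = Word (letters u @ letters v)"
instance by standard (auto simp: zero_fword_def plus_fword_def)
end

type_synonym ('p, 'n) free_alg = "'n fword \<Rightarrow>\<^sub>0 'p mod_ring"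

type_synonym ('p, 'n) frob_op = "('p, 'n) free_alg set"

definition free_monomial :: "'n::finite letter list \<Rightarrow> ('p::prime_card, 'n) free_alg" where
  "free_monomial w = Poly_Mapping.single (Word w) 1"

definition frob_relations :: "('p::prime_card, 'n::finite) free_alg set" where
  "frob_relations =
     {free_monomial [X i, X j] - free_monomial [X j, X i] | i j. True} \<union>
     {free_monomial (replicate CARD('p) (X i) @ [Fr]) - free_monomial [Fr, X i] | i. True}"

definition frob_ideal :: "('p::prime_card, 'n::finite) free_alg set" where
  "frob_ideal = Idl\<^bsub>class_ring\<^esub> frob_relations"

definition frob_ring :: "('p::prime_card, 'n::finite) frob_op ring" where
  "frob_ring = class_ring Quot frob_ideal"

definition frob_class :: "('p::prime_card, 'n::finite) free_alg \<Rightarrow> ('p, 'n) frob_op" where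
  "frob_class a = frob_ideal +>\<^bsub>class_ring\<^esub> a"

definition frob_monomial :: "'n::finite letter list \<Rightarrow> ('p::prime_card, 'n) frob_op" where
  "frob_monomial w = frob_class (free_monomial w)"

definition fp_to_frob :: "'p::prime_card mod_ring \<Rightarrow> ('p, 'n::finite) frob_op" where
  "fp_to_frob c = frob_class (Poly_Mapping.single 0 c)"

definition pol_to_frob :: "('p::prime_card, 'n::finite) pol \<Rightarrow> ('p, 'n) frob_op" where
  "pol_to_frob = (THE h. h \<in> Ring.ring_hom pol_ring frob_ring \<and>
     (\<forall>i. h (pol_var i) = frob_monomial [X i]))"
  \<comment> \<open>exists and is unique, see \<open>pol_to_frob_characterization\<close> at the end\<close>


section \<open>Unit modules\<close>

text \<open>The base change of \<open>N\<close> along the Frobenius of \<open>R\<close> is the tensor product \<open>R \<otimes> N\<close>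
  over \<open>R\<close> in which \<open>r s\<^sup>p \<otimes> m = r \<otimes> s m\<close>: the free abelian group on the pairs
  \<open>(r, m)\<close> modulo the tensor relations, with \<open>R\<close> acting on the left factor.\<close>

definition free_pairs :: "(('p::prime_card, 'n::finite) pol, 'm) module
    \<Rightarrow> (('p, 'n) pol, ('p, 'n) pol \<times> 'm \<Rightarrow>\<^sub>0 int) module" where
  "free_pairs N = \<lparr>carrier = {c. Poly_Mapping.keys c \<subseteq> UNIV \<times> carrier N},
     mult = undefined, one = undefined, zero = 0, add = (+),
     smult = (\<lambda>r. frag_extend (\<lambda>(s, m). frag_of (r * s, m)))\<rparr>"

definition frobenius_tensor_relations :: "(('p::prime_card, 'n::finite) pol, 'm) module
    \<Rightarrow> (('p, 'n) pol \<times> 'm \<Rightarrow>\<^sub>0 int) set" where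
  "frobenius_tensor_relations N =
     {frag_of (r + s, m) - frag_of (r, m) - frag_of (s, m) | r s m. m \<in> carrier N} \<union>
     {frag_of (r, m \<oplus>\<^bsub>N\<^esub> m') - frag_of (r, m) - frag_of (r, m')
        | r m m'. m \<in> carrier N \<and> m' \<in> carrier N} \<union>
     {frag_of (r * s ^ CARD('p), m) - frag_of (r, s \<odot>\<^bsub>N\<^esub> m) | r s m. m \<in> carrier N}"

definition frobenius_base_change :: "(('p::prime_card, 'n::finite) pol, 'm) module
    \<Rightarrow> (('p, 'n) pol, (('p, 'n) pol \<times> 'm \<Rightarrow>\<^sub>0 int) set) module" where
  "frobenius_base_change N = quotient_module (free_pairs N)
     (generated_submodule pol_ring (free_pairs N) (frobenius_tensor_relations N))"

text \<open>\<open>\<theta>\<^sub>M (r \<otimes> m) = r F(m)\<close>, extended additively; its value on a class is computed from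
  any representative.\<close>

definition structure_morphism :: "(('p::prime_card, 'n::finite) frob_op, 'm) module
    \<Rightarrow> (('p, 'n) pol \<times> 'm \<Rightarrow>\<^sub>0 int) set \<Rightarrow> 'm" where
  "structure_morphism M C = the_elem
     ((\<lambda>c. \<Oplus>\<^bsub>M\<^esub>k\<in>Poly_Mapping.keys c.
        [Poly_Mapping.lookup c k] \<cdot>\<^bsub>M\<^esub>
          (pol_to_frob (fst k) \<odot>\<^bsub>M\<^esub> (frob_monomial [Fr] \<odot>\<^bsub>M\<^esub> snd k))) ` C)"

definition unit_frob_module :: "(('p::prime_card, 'n::finite) frob_op, 'm) module \<Rightarrow> bool" where
  "unit_frob_module M \<longleftrightarrow> left_module frob_ring M \<and>
     (let N = restrict_scalars pol_to_frob M in
        structure_morphism M \<in> module_hom pol_ring (frobenius_base_change N) N \<and>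
        bij_betw (structure_morphism M) (carrier (frobenius_base_change N)) (carrier N))"


section \<open>The Bernstein filtration and F-holonomic modules\<close>

definition complexity :: "('p::prime_card, 'n::finite) frob_op \<Rightarrow> nat" where
  "complexity u = (LEAST k. \<exists>w. length w = k \<and> frob_monomial w = u)"

abbreviation fp_space :: "(('p::prime_card, 'n::finite) frob_op, 'm) module
    \<Rightarrow> ('p mod_ring, 'm) module" where
  "fp_space M \<equiv> restrict_scalars fp_to_frob M"

definition bernstein :: "nat \<Rightarrow> ('p::prime_card, 'n::finite) frob_op set" where
  "bernstein i = LinearCombinations.module.span class_ring (fp_space (regular_module frob_ring))
     {u \<in> range frob_monomial. complexity u \<le> i}"

text \<open>The step of index \<open>i - 1\<close> of a filtration that vanishes in negative degrees.\<close>

definition filt_pred :: "('a, 'm) module \<Rightarrow> (nat \<Rightarrow> 'm set) \<Rightarrow> nat \<Rightarrow> 'm set" where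
  "filt_pred M \<Omega> i = (case i of 0 \<Rightarrow> {\<zero>\<^bsub>M\<^esub>} | Suc j \<Rightarrow> \<Omega> j)"

definition gr_piece :: "(('p::prime_card, 'n::finite) frob_op, 'm) module
    \<Rightarrow> (nat \<Rightarrow> 'm set) \<Rightarrow> nat \<Rightarrow> ('p mod_ring, 'm set) module" where
  "gr_piece M \<Omega> i = quotient_module ((fp_space M)\<lparr>carrier := \<Omega> i\<rparr>) (filt_pred M \<Omega> i)"

text \<open>Elements of a direct sum of graded pieces are families with finite support.  A class
  \<open>[a]\<close> of degree \<open>i\<close> acts on a class \<open>[x]\<close> of degree \<open>j\<close> by \<open>[a] [x] = [a x]\<close> in degree
  \<open>i + j\<close>.\<close>

definition gr_smult :: "(('p::prime_card, 'n::finite) frob_op, 'm) module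
    \<Rightarrow> (nat \<Rightarrow> 'm set) \<Rightarrow> nat \<Rightarrow> nat \<Rightarrow> ('p, 'n) frob_op set \<Rightarrow> 'm set \<Rightarrow> 'm set" where
  "gr_smult M \<Omega> i j A Y = (\<Union>a\<in>A. \<Union>x\<in>Y. filt_pred M \<Omega> (i + j) +>\<^bsub>M\<^esub> (a \<odot>\<^bsub>M\<^esub> x))"

definition gr_module :: "(('p::prime_card, 'n::finite) frob_op, 'm) module
    \<Rightarrow> (nat \<Rightarrow> 'm set) \<Rightarrow> (nat \<Rightarrow> ('p, 'n) frob_op set, nat \<Rightarrow> 'm set) module" where
  "gr_module M \<Omega> = \<lparr>
     carrier = {f. (\<forall>i. f i \<in> carrier (gr_piece M \<Omega> i)) \<and>
                   finite {i. f i \<noteq> \<zero>\<^bsub>gr_piece M \<Omega> i\<^esub>}},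
     mult = undefined, one = undefined,
     zero = (\<lambda>i. \<zero>\<^bsub>gr_piece M \<Omega> i\<^esub>),
     add = (\<lambda>f g i. f i \<oplus>\<^bsub>gr_piece M \<Omega> i\<^esub> g i),
     smult = (\<lambda>a f k. \<Oplus>\<^bsub>gr_piece M \<Omega> k\<^esub>i\<in>{..k}. gr_smult M \<Omega> i (k - i) (a i) (f (k - i)))\<rparr>"

definition bernstein_gr :: "(nat \<Rightarrow> ('p::prime_card, 'n::finite) frob_op set) ring" where
  "bernstein_gr = (let G = gr_module (regular_module frob_ring) bernstein in
     \<lparr>carrier = carrier G, mult = smult G,
      one = (\<lambda>i. if i = 0 then {\<zero>\<^bsub>frob_ring\<^esub>} +>\<^bsub>frob_ring\<^esub> \<one>\<^bsub>frob_ring\<^esub> else zero G i),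
      zero = zero G, add = add G\<rparr>)"

definition compatible_filtration :: "(('p::prime_card, 'n::finite) frob_op, 'm) module
    \<Rightarrow> (nat \<Rightarrow> 'm set) \<Rightarrow> bool" where
  "compatible_filtration M \<Omega> \<longleftrightarrow>
     (\<forall>i. VectorSpace.subspace class_ring (\<Omega> i) (fp_space M) \<and>
          vectorspace.fin_dim class_ring ((fp_space M)\<lparr>carrier := \<Omega> i\<rparr>)) \<and>
     (\<forall>i. \<Omega> i \<subseteq> \<Omega> (Suc i)) \<and>
     (\<Union>i. \<Omega> i) = carrier M \<and>
     (\<forall>i j. \<forall>b\<in>bernstein i. \<forall>x\<in>\<Omega> j. b \<odot>\<^bsub>M\<^esub> x \<in> \<Omega> (i + j))"

definition great_filtration :: "(('p::prime_card, 'n::finite) frob_op, 'm) module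
    \<Rightarrow> (nat \<Rightarrow> 'm set) \<Rightarrow> bool" where
  "great_filtration M \<Omega> \<longleftrightarrow>
     compatible_filtration M \<Omega> \<and> finitely_presented bernstein_gr (gr_module M \<Omega>)"

definition hilbert_series :: "(('p::prime_card, 'n::finite) frob_op, 'm) module
    \<Rightarrow> (nat \<Rightarrow> 'm set) \<Rightarrow> rat fps" where
  "hilbert_series M \<Omega> = Abs_fps (\<lambda>i. of_nat (vectorspace.dim class_ring (gr_piece M \<Omega> i)))"

definition rational_without_pole_at :: "'a::field fps \<Rightarrow> 'a \<Rightarrow> bool" where
  "rational_without_pole_at H a \<longleftrightarrow>
     (\<exists>P Q. poly Q a \<noteq> 0 \<and> fps_of_poly Q * H = fps_of_poly P)"

definition F_holonomic :: "(('p::prime_card, 'n::finite) frob_op, 'm) module \<Rightarrow> bool" where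
  "F_holonomic M \<longleftrightarrow> left_module frob_ring M \<and>
     (\<exists>\<Omega>. great_filtration M \<Omega> \<and> rational_without_pole_at (hilbert_series M \<Omega>) 1)"


section \<open>Local cohomology\<close>

text \<open>Injectivity is tested on inclusions \<open>K \<subseteq> N\<close> of modules carried by the type of the ring
  itself, as HOL has no quantification over types.  This family contains the inclusions of
  the ideals into the ring, so by Baer's criterion nothing is lost.\<close>

definition injective_module :: "'a ring \<Rightarrow> ('a, 'e) module \<Rightarrow> bool" where
  "injective_module R E \<longleftrightarrow> module R E \<and>
     (\<forall>(N :: ('a, 'a) module) K. module R N \<and> Module.submodule K R N \<longrightarrow>
        (\<forall>h \<in> module_hom R (N\<lparr>carrier := K\<rparr>) E.
           \<exists>g \<in> module_hom R N E. \<forall>x\<in>K. g x = h x))"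

text \<open>\<open>0 \<rightarrow> R \<rightarrow> E 0 \<rightarrow> E 1 \<rightarrow> \<dots>\<close> with augmentation \<open>\<epsilon>\<close> and differentials \<open>d\<close>\<close>

definition injective_resolution :: "'a ring \<Rightarrow> (nat \<Rightarrow> ('a, 'e) module)
    \<Rightarrow> (nat \<Rightarrow> 'e \<Rightarrow> 'e) \<Rightarrow> ('a \<Rightarrow> 'e) \<Rightarrow> bool" where
  "injective_resolution R E d \<epsilon> \<longleftrightarrow>
     (\<forall>i. injective_module R (E i)) \<and>
     \<epsilon> \<in> module_hom R (regular_module R) (E 0) \<and> inj_on \<epsilon> (carrier R) \<and>
     (\<forall>i. d i \<in> module_hom R (E i) (E (Suc i))) \<and>
     \<epsilon> ` carrier R = {x \<in> carrier (E 0). d 0 x = \<zero>\<^bsub>E 1\<^esub>} \<and>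
     (\<forall>i. d i ` carrier (E i) = {x \<in> carrier (E (Suc i)). d (Suc i) x = \<zero>\<^bsub>E (Suc (Suc i))\<^esub>})"

definition torsion_part :: "'a ring \<Rightarrow> 'a set \<Rightarrow> ('a, 'e) module \<Rightarrow> 'e set" where
  "torsion_part R I E =
     {x \<in> carrier E. \<exists>k::nat. \<forall>a \<in> I [^]\<^bsub>ideals_set R\<^esub> k. a \<odot>\<^bsub>E\<^esub> x = \<zero>\<^bsub>E\<^esub>}"

definition lc_cocycles :: "'a ring \<Rightarrow> 'a set \<Rightarrow> (nat \<Rightarrow> ('a, 'e) module)
    \<Rightarrow> (nat \<Rightarrow> 'e \<Rightarrow> 'e) \<Rightarrow> nat \<Rightarrow> 'e set" where
  "lc_cocycles R I E d i = {x \<in> torsion_part R I (E i). d i x = \<zero>\<^bsub>E (Suc i)\<^esub>}"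

definition lc_coboundaries :: "'a ring \<Rightarrow> 'a set \<Rightarrow> (nat \<Rightarrow> ('a, 'e) module)
    \<Rightarrow> (nat \<Rightarrow> 'e \<Rightarrow> 'e) \<Rightarrow> nat \<Rightarrow> 'e set" where
  "lc_coboundaries R I E d i =
     (case i of 0 \<Rightarrow> {\<zero>\<^bsub>E 0\<^esub>} | Suc j \<Rightarrow> d j ` torsion_part R I (E j))"

definition local_cohomology :: "'a ring \<Rightarrow> 'a set \<Rightarrow> (nat \<Rightarrow> ('a, 'e) module)
    \<Rightarrow> (nat \<Rightarrow> 'e \<Rightarrow> 'e) \<Rightarrow> nat \<Rightarrow> ('a, 'e set) module" where
  "local_cohomology R I E d i =
     quotient_module ((E i)\<lparr>carrier := lc_cocycles R I E d i\<rparr>) (lc_coboundaries R I E d i)"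

text \<open>A chain map \<open>\<phi>\<close> from \<open>E\<close> to its restriction of scalars along the Frobenius which lifts
  the Frobenius of \<open>R\<close>.  As \<open>R\<close> is regular, its Frobenius is flat, so restriction of scalars
  along it preserves injectives; hence \<open>\<phi>\<close> exists and is unique up to homotopy, and the
  map it induces on local cohomology is the natural Frobenius action.\<close>

definition frobenius_lift :: "(nat \<Rightarrow> (('p::prime_card, 'n::finite) pol, 'e) module)
    \<Rightarrow> (nat \<Rightarrow> 'e \<Rightarrow> 'e) \<Rightarrow> (('p, 'n) pol \<Rightarrow> 'e) \<Rightarrow> (nat \<Rightarrow> 'e \<Rightarrow> 'e) \<Rightarrow> bool" where
  "frobenius_lift E d \<epsilon> \<phi> \<longleftrightarrow>
     (\<forall>i. \<phi> i \<in> module_hom pol_ring (E i) (restrict_scalars (\<lambda>r. r ^ CARD('p)) (E i))) \<and>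
     (\<forall>i. \<forall>x \<in> carrier (E i). \<phi> (Suc i) (d i x) = d i (\<phi> i x)) \<and>
     (\<forall>r. \<phi> 0 (\<epsilon> r) = \<epsilon> (r ^ CARD('p)))"

definition lc_frobenius :: "(nat \<Rightarrow> (('p::prime_card, 'n::finite) pol, 'e) module)
    \<Rightarrow> (nat \<Rightarrow> 'e \<Rightarrow> 'e) \<Rightarrow> (nat \<Rightarrow> 'e \<Rightarrow> 'e) \<Rightarrow> ('p, 'n) pol set \<Rightarrow> nat \<Rightarrow> 'e set \<Rightarrow> 'e set" where
  "lc_frobenius E d \<phi> I i C =
     (\<Union>x\<in>C. lc_coboundaries pol_ring I E d i +>\<^bsub>E i\<^esub> \<phi> i x)"

text \<open>The module over the ring of Frobenius operators given by an \<open>R\<close>-module \<open>N\<close> and a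
  Frobenius action \<open>\<psi>\<close> on it: \<open>x\<^sub>i\<close> acts by multiplication and \<open>F\<close> by \<open>\<psi>\<close>.  When \<open>\<psi>\<close> is
  \<open>p\<close>-linear the defining relations act by zero, so the representative \<open>a\<close> is immaterial.\<close>

primrec letter_action :: "(('p::prime_card, 'n::finite) pol, 'm) module \<Rightarrow> ('m \<Rightarrow> 'm)
    \<Rightarrow> 'n letter \<Rightarrow> 'm \<Rightarrow> 'm" where
  "letter_action N \<psi> (X i) m = pol_var i \<odot>\<^bsub>N\<^esub> m"
| "letter_action N \<psi> Fr m = \<psi> m"

definition free_alg_action :: "(('p::prime_card, 'n::finite) pol, 'm) module \<Rightarrow> ('m \<Rightarrow> 'm)
    \<Rightarrow> ('p, 'n) free_alg \<Rightarrow> 'm \<Rightarrow> 'm" where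
  "free_alg_action N \<psi> a m = (\<Oplus>\<^bsub>N\<^esub>w\<in>Poly_Mapping.keys a.
     pol_const (Poly_Mapping.lookup a w) \<odot>\<^bsub>N\<^esub> foldr (letter_action N \<psi>) (letters w) m)"

definition frob_module_of :: "(('p::prime_card, 'n::finite) pol, 'm) module \<Rightarrow> ('m \<Rightarrow> 'm)
    \<Rightarrow> (('p, 'n) frob_op, 'm) module" where
  "frob_module_of N \<psi> = \<lparr>carrier = carrier N, mult = mult N, one = one N,
     zero = zero N, add = add N,
     smult = (\<lambda>u m. free_alg_action N \<psi> (SOME a. a \<in> u) m)\<rparr>"

definition local_cohomology_frob :: "('p::prime_card, 'n::finite) pol set
    \<Rightarrow> (nat \<Rightarrow> (('p, 'n) pol, 'e) module) \<Rightarrow> (nat \<Rightarrow> 'e \<Rightarrow> 'e) \<Rightarrow> (nat \<Rightarrow> 'e \<Rightarrow> 'e) \<Rightarrow> nat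
    \<Rightarrow> (('p, 'n) frob_op, 'e set) module" where
  "local_cohomology_frob I E d \<phi> i =
     frob_module_of (local_cohomology pol_ring I E d i) (lc_frobenius E d \<phi> I i)"


section \<open>The ring homomorphism \<open>pol_to_frob\<close> is well defined\<close>

lemma ideal_frob_ideal: "ideal frob_ideal class_ring"
  unfolding frob_ideal_def by (rule ring.genideal_ideal[OF class_ring.ring_axioms]) simp

lemma frob_class_hom: "(frob_class :: ('p::prime_card, 'n::finite) free_alg \<Rightarrow> _) \<in> Ring.ring_hom class_ring frob_ring"
proof -
  have "(frob_class :: ('p::prime_card, 'n::finite) free_alg \<Rightarrow> _) = (+>\<^bsub>class_ring\<^esub>) frob_ideal" by (auto simp: frob_class_def)
  then show ?thesis
    unfolding frob_ring_def using ideal.rcos_ring_hom[OF ideal_frob_ideal] by metis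
qed

lemma ring_frob_ring: "ring frob_ring"
  unfolding frob_ring_def by (rule ideal.quotient_is_ring[OF ideal_frob_ideal])

lemma frob_ideal_closed:
  "a \<in> frob_ideal \<Longrightarrow> b \<in> frob_ideal \<Longrightarrow> a + b \<in> frob_ideal"
  "a \<in> frob_ideal \<Longrightarrow> c * a \<in> frob_ideal"
  "a \<in> frob_ideal \<Longrightarrow> a * c \<in> frob_ideal"
  "0 \<in> frob_ideal"
proof -
  interpret ideal frob_ideal class_ring by (rule ideal_frob_ideal)
  show "a \<in> frob_ideal \<Longrightarrow> b \<in> frob_ideal \<Longrightarrow> a + b \<in> frob_ideal" using a_closed by simp
  show "a \<in> frob_ideal \<Longrightarrow> c * a \<in> frob_ideal" using I_l_closed[of a c] by simp
  show "a \<in> frob_ideal \<Longrightarrow> a * c \<in> frob_ideal" using I_r_closed[of a c] by simp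
  show "0 \<in> frob_ideal" using zero_closed by simp
qed

lemma frob_ideal_uminus: "a \<in> frob_ideal \<Longrightarrow> - a \<in> frob_ideal"
  using frob_ideal_closed(2)[of a "-1"] by simp

lemma frob_ideal_sum: "(\<And>i. i \<in> A \<Longrightarrow> f i \<in> frob_ideal) \<Longrightarrow> sum f A \<in> frob_ideal"
  by (induction A rule: infinite_finite_induct) (auto intro: frob_ideal_closed)

lemma frob_class_eqI:
  fixes a b :: "('p::prime_card, 'n::finite) free_alg"
  assumes "a - b \<in> frob_ideal"
  shows "frob_class a = frob_class b"
proof -
  have cl: "frob_class a = {h + a | h. h \<in> frob_ideal}" for a :: "('p, 'n) free_alg"
    unfolding frob_class_def a_r_coset_def r_coset_def by auto
  have sub: "frob_class a \<subseteq> frob_class b" if "a - b \<in> frob_ideal" for a b :: "('p, 'n) free_alg"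
  proof
    fix x assume "x \<in> frob_class a"
    then obtain h where "h \<in> frob_ideal" "x = h + a" unfolding cl by blast
    then have "h + (a - b) \<in> frob_ideal" "x = (h + (a - b)) + b"
      using that by (simp_all add: frob_ideal_closed(1))
    then show "x \<in> frob_class b" unfolding cl by blast
  qed
  have "b - a \<in> frob_ideal" using frob_ideal_uminus[OF assms] by simp
  then show ?thesis using sub[OF assms] sub by blast
qed

lemma free_monomial_append: "free_monomial (u @ v) = free_monomial u * free_monomial v"
  by (simp add: free_monomial_def mult_single plus_fword_def)

lemma free_monomial_move:
  assumes "set v \<subseteq> range X"
  shows "free_monomial (X i # v @ w) - free_monomial (v @ X i # w) \<in> (frob_ideal :: ('p::prime_card, 'n::finite) free_alg set)"
  using assms
proof (induction v)
  case Nil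
  then show ?case by (simp add: frob_ideal_closed)
next
  case (Cons a v)
  then obtain j where a: "a = X j" by auto
  have "free_monomial [X i, X j] - free_monomial [X j, X i] \<in> (frob_relations :: ('p, 'n) free_alg set)"
    by (auto simp: frob_relations_def)
  then have "free_monomial [X i, X j] - free_monomial [X j, X i] \<in> (frob_ideal :: ('p, 'n) free_alg set)"
    unfolding frob_ideal_def using ring.genideal_self[OF class_ring.ring_axioms, of frob_relations] by auto
  from frob_ideal_closed(3)[OF this, of "free_monomial (v @ w)"]
  have 1: "free_monomial (X i # X j # v @ w) - free_monomial (X j # X i # v @ w) \<in> (frob_ideal :: ('p, 'n) free_alg set)"
    by (simp add: left_diff_distrib flip: free_monomial_append)
  have "free_monomial (X i # v @ w) - free_monomial (v @ X i # w) \<in> (frob_ideal :: ('p, 'n) free_alg set)"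
    using Cons by auto
  from frob_ideal_closed(2)[OF this, of "free_monomial [X j]"]
  have 2: "free_monomial (X j # X i # v @ w) - free_monomial (X j # v @ X i # w) \<in> (frob_ideal :: ('p, 'n) free_alg set)"
    by (simp add: right_diff_distrib flip: free_monomial_append)
  from frob_ideal_closed(1)[OF 1 2] show ?case by (simp add: a)
qed

lemma free_monomial_perm:
  assumes "mset u = mset v" "set u \<subseteq> range X"
  shows "free_monomial u - free_monomial v \<in> (frob_ideal :: ('p::prime_card, 'n::finite) free_alg set)"
  using assms
proof (induction u arbitrary: v)
  case Nil
  then show ?case by (simp add: frob_ideal_closed)
next
  case (Cons a u)
  then obtain i where a: "a = X i" by auto
  from Cons.prems have "a \<in> set v" by (metis list.set_intros(1) mset_eq_setD)
  then obtain v1 v2 where v: "v = v1 @ a # v2" by (meson split_list)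
  have "mset u = mset (v1 @ v2)" using Cons.prems v by simp
  then have "free_monomial u - free_monomial (v1 @ v2) \<in> (frob_ideal :: ('p, 'n) free_alg set)" using Cons by auto
  from frob_ideal_closed(2)[OF this, of "free_monomial [X i]"]
  have 1: "free_monomial (X i # u) - free_monomial (X i # v1 @ v2) \<in> (frob_ideal :: ('p, 'n) free_alg set)"
    by (simp add: right_diff_distrib flip: free_monomial_append)
  have "set v1 \<subseteq> set (a # u)" using Cons.prems(1) v by (metis Un_upper1 mset_eq_setD set_append)
  then have "set v1 \<subseteq> range X" using Cons.prems(2) by auto
  from frob_ideal_closed(1)[OF 1 free_monomial_move[OF this, of i v2]]
  show ?case by (simp add: a v)
qed

lemma pm_sum_singles: "r = (\<Sum>k\<in>Poly_Mapping.keys r. Poly_Mapping.single k (Poly_Mapping.lookup r k))"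
  by (rule poly_mapping_eqI)
    (auto simp: lookup_sum lookup_single when_def sum.delta' in_keys_iff)

lemma pol_to_frob_exists:
  "\<exists>h. h \<in> Ring.ring_hom (pol_ring :: ('p::prime_card, 'n::finite) pol ring) (frob_ring :: ('p, 'n) frob_op ring) \<and>
     (\<forall>i. h (pol_var i) = frob_monomial [X i])"
proof -
  obtain xs :: "'n list" where xs: "set xs = UNIV" "distinct xs"
    using finite_distinct_list[of "UNIV :: 'n set"] by auto
  define W where "W \<alpha> = concat (map (\<lambda>i. replicate (Poly_Mapping.lookup \<alpha> i) (X i)) xs)"
    for \<alpha> :: "'n \<Rightarrow>\<^sub>0 nat"
  have W_add: "mset (W (\<alpha> + \<beta>)) = mset (W \<alpha> @ W \<beta>)" for \<alpha> \<beta>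
    unfolding W_def by (induction xs) (auto simp: lookup_add replicate_add)
  have W_X: "set (W \<alpha>) \<subseteq> range X" for \<alpha>
    unfolding W_def by auto
  have W0: "W 0 = []" unfolding W_def by auto
  have W1: "W (Poly_Mapping.single i 1) = [X i]" for i
  proof -
    have *: "concat (map (\<lambda>j. replicate (Poly_Mapping.lookup (Poly_Mapping.single i 1) j) (X j)) ys)
        = (if i \<in> set ys then [X i] else [])" if "distinct ys" for ys
      using that by (induction ys) (auto simp: lookup_single when_def)
    show ?thesis unfolding W_def using *[OF xs(2)] xs(1) by simp
  qed
  define g :: "('p, 'n) pol \<Rightarrow> ('p, 'n) free_alg"
    where "g r = (\<Sum>\<alpha>\<in>Poly_Mapping.keys r. Poly_Mapping.single (Word (W \<alpha>)) (Poly_Mapping.lookup r \<alpha>))" for r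
  have g_sup: "g r = (\<Sum>\<alpha>\<in>A. Poly_Mapping.single (Word (W \<alpha>)) (Poly_Mapping.lookup r \<alpha>))"
    if "finite A" "Poly_Mapping.keys r \<subseteq> A" for r A
    unfolding g_def by (rule sum.mono_neutral_left) (use that in \<open>auto simp: in_keys_iff\<close>)
  have g_add: "g (r + s) = g r + g s" for r s
  proof -
    let ?A = "Poly_Mapping.keys r \<union> Poly_Mapping.keys s"
    have "Poly_Mapping.keys (r + s) \<subseteq> ?A" by (rule keys_add)
    then show ?thesis
      using g_sup[of ?A r] g_sup[of ?A s] g_sup[of ?A "r + s"]
      by (simp add: lookup_add single_add sum.distrib)
  qed
  have g0: "g 0 = 0" by (simp add: g_def)
  have g_sum: "g (sum f A) = (\<Sum>x\<in>A. g (f x))" for f :: "'z \<Rightarrow> _" and A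
    by (induction A rule: infinite_finite_induct) (auto simp: g_add g0)
  have g_single: "g (Poly_Mapping.single \<alpha> c) = Poly_Mapping.single (Word (W \<alpha>)) c" for \<alpha> c
    using g_sup[of "{\<alpha>}" "Poly_Mapping.single \<alpha> c"] by (simp add: lookup_single)
  have mono: "g (Poly_Mapping.single \<alpha> a * Poly_Mapping.single \<beta> b)
      - g (Poly_Mapping.single \<alpha> a) * g (Poly_Mapping.single \<beta> b) \<in> frob_ideal" for \<alpha> \<beta> a b
  proof -
    have "free_monomial (W (\<alpha> + \<beta>)) - free_monomial (W \<alpha> @ W \<beta>) \<in> (frob_ideal :: ('p,'n) free_alg set)"
      by (rule free_monomial_perm[OF W_add W_X])
    from frob_ideal_closed(2)[OF this, of "Poly_Mapping.single 0 (a * b)"]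
    show ?thesis
      by (simp add: free_monomial_def right_diff_distrib mult_single g_single plus_fword_def zero_fword_def)
  qed
  have g_mult: "g (r * s) - g r * g s \<in> frob_ideal" for r s
  proof -
    let ?m = "\<lambda>r k. Poly_Mapping.single k (Poly_Mapping.lookup r k)"
    have "r * s = (\<Sum>a\<in>Poly_Mapping.keys r. \<Sum>b\<in>Poly_Mapping.keys s. ?m r a * ?m s b)"
      using arg_cong2[OF pm_sum_singles[of r] pm_sum_singles[of s], of "(*)"] by (simp only: sum_product)
    then have 1: "g (r * s) = (\<Sum>a\<in>Poly_Mapping.keys r. \<Sum>b\<in>Poly_Mapping.keys s. g (?m r a * ?m s b))"
      by (simp add: g_sum)
    have "g r * g s = (\<Sum>a\<in>Poly_Mapping.keys r. \<Sum>b\<in>Poly_Mapping.keys s. g (?m r a) * g (?m s b))"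
      by (simp add: g_single) (simp add: g_def sum_product)
    with 1 have "g (r * s) - g r * g s = (\<Sum>a\<in>Poly_Mapping.keys r. \<Sum>b\<in>Poly_Mapping.keys s.
        g (?m r a * ?m s b) - g (?m r a) * g (?m s b))"
      by (simp add: sum_subtractf)
    then show ?thesis using mono by (auto intro!: frob_ideal_sum)
  qed
  have g1: "g 1 = 1"
    using g_single[of 0 1] by (simp add: W0 flip: zero_fword_def)
  note hom = ring_hom_mult[OF frob_class_hom] ring_hom_add[OF frob_class_hom] ring_hom_one[OF frob_class_hom]
    ring_hom_closed[OF frob_class_hom]
  have "(\<lambda>r. frob_class (g r)) \<in> Ring.ring_hom pol_ring (frob_ring :: ('p, 'n) frob_op ring)"
    using hom frob_class_eqI[OF g_mult] by (intro ring_hom_memI) (simp_all add: g_add g1)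
  moreover have "frob_class (g (pol_var i)) = frob_monomial [X i]" for i
    unfolding pol_var_def frob_monomial_def free_monomial_def g_single W1 ..
  ultimately show ?thesis by blast
qed

lemma pol_hom_unique:
  fixes h h' :: "('p::prime_card, 'n::finite) pol \<Rightarrow> 'b"
  assumes S: "ring S" and h: "h \<in> Ring.ring_hom pol_ring S" and h': "h' \<in> Ring.ring_hom pol_ring S"
    and var: "\<And>i. h (pol_var i) = h' (pol_var i)"
  shows "h = h'"
proof -
  define T where "T = {r. h r = h' r}"
  have one: "1 \<in> T" using ring_hom_one[OF h] ring_hom_one[OF h'] by (auto simp: T_def)
  have add: "r + s \<in> T" if "r \<in> T" "s \<in> T" for r s
    using that ring_hom_add[OF h, of r s] ring_hom_add[OF h', of r s] by (auto simp: T_def)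
  have mult: "r * s \<in> T" if "r \<in> T" "s \<in> T" for r s
    using that ring_hom_mult[OF h, of r s] ring_hom_mult[OF h', of r s] by (auto simp: T_def)
  have zero: "0 \<in> T"
    using ring_hom_zero[OF h class_ring.ring_axioms S] ring_hom_zero[OF h' class_ring.ring_axioms S]
    by (auto simp: T_def)
  have nat: "of_nat k \<in> T" for k
    by (induction k) (auto intro: zero one add)
  have const: "pol_const c \<in> T" for c
  proof -
    have "c = of_int (to_int_mod_ring c)" by (simp add: of_int_of_int_mod_ring)
    also have "\<dots> = of_nat (nat (to_int_mod_ring c))"
      by (metis int_nat_eq of_int_of_nat_eq range_to_int_mod_ring atLeastLessThan_iff rangeI)
    finally show ?thesis unfolding pol_const_def by (metis nat single_of_nat)
  qed
  have pow: "r ^ k \<in> T" if "r \<in> T" for r k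
    using that by (induction k) (auto intro: one mult)
  have vp: "Poly_Mapping.single (Poly_Mapping.single i k) 1 = (pol_var i ^ k :: ('p,'n) pol)" for i k
    proof (induction k)
      case (Suc k)
      have "Poly_Mapping.single i (Suc k) = Poly_Mapping.single i 1 + Poly_Mapping.single i k"
        by (simp flip: single_add)
      then show ?case unfolding power_Suc Suc[symmetric] by (simp only: pol_var_def mult_single mult_1)
    qed simp
  have mon_sum: "Poly_Mapping.single (\<Sum>i\<in>A. Poly_Mapping.single i (f i)) 1 \<in> T" if "finite A" for A f
    using that
  proof induction
    case (insert x A)
    have "Poly_Mapping.single (Poly_Mapping.single x (f x)) 1 *
        Poly_Mapping.single (\<Sum>i\<in>A. Poly_Mapping.single i (f i)) 1 \<in> T"
      unfolding vp using insert var by (intro mult pow) (auto simp: T_def)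
    then show ?case using insert by (simp add: mult_single)
  qed (auto simp: one)
  have mon: "Poly_Mapping.single \<alpha> 1 \<in> T" for \<alpha>
    using mon_sum[of "Poly_Mapping.keys \<alpha>" "Poly_Mapping.lookup \<alpha>"] by (simp flip: pm_sum_singles)
  have "Poly_Mapping.single \<alpha> c \<in> T" for \<alpha> c
    using mult[OF const[of c] mon[of \<alpha>]] by (simp add: pol_const_def mult_single)
  then have "(\<Sum>k\<in>A. Poly_Mapping.single k (f k)) \<in> T" for A f
    by (induction A rule: infinite_finite_induct) (auto intro: zero add)
  then have "r \<in> T" for r
    by (subst pm_sum_singles[of r])
  then show ?thesis by (auto simp: T_def)
qed

lemma pol_to_frob_characterization:
  "(pol_to_frob :: ('a::prime_card,'b::finite) pol \<Rightarrow> ('a,'b) frob_op) \<in> Ring.ring_hom pol_ring frob_ring"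
  "(pol_to_frob (pol_var i :: ('a,'b) pol)) = frob_monomial [X i]"
proof -
  have "\<exists>!h. h \<in> Ring.ring_hom (pol_ring :: ('a,'b) pol ring) (frob_ring :: ('a,'b) frob_op ring) \<and>
     (\<forall>i. h (pol_var i) = frob_monomial [X i])"
    using pol_to_frob_exists by (rule ex_ex1I) (auto intro!: pol_hom_unique[OF ring_frob_ring])
  from theI'[OF this, folded pol_to_frob_def]
  show "(pol_to_frob :: ('a,'b) pol \<Rightarrow> ('a,'b) frob_op) \<in> Ring.ring_hom pol_ring frob_ring"
    "(pol_to_frob (pol_var i :: ('a,'b) pol)) = frob_monomial [X i]"
    by simp_all
qed

end

theory Submission
  imports Defs "HOL-Algebra.Subrings" "HOL-Library.List_Lenlexorder"
begin

hide_const (open) Modules.module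

text \<open>Let \<open>M\<close> be finitely generated and suppose that every \<open>m \<in> M\<close> is uniquely
  \<open>\<Sum>\<^sub>c x\<^sup>c F(m\<^sub>c)\<close>, where \<open>c\<close> runs through the exponents with all entries below \<open>p\<close>; this is what
  being unit means, as these monomials are a basis of \<open>R\<close> over \<open>R\<^sup>p\<close>.  Enlarging the
  generators to a finite set \<open>T\<close> with \<open>T \<subseteq> R F(T)\<close>, the steps \<open>\<Omega>\<^sub>i\<close> of the filtration generated
  by \<open>T\<close> satisfy \<open>\<Omega>\<^sub>i = \<Oplus>\<^sub>c x\<^sup>c F(\<Omega>\<^bsub>i-1-|c|\<^esub>)\<close> for large \<open>i\<close>.  Hence the Hilbert series times
  \<open>1 - \<Sum>\<^sub>c t\<^bsup>1+|c|\<^esup>\<close> is a polynomial, and this factor is \<open>1 - p\<^sup>n \<noteq> 0\<close> at \<open>t = 1\<close>; the same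
  recursion shows that all relations of \<open>gr M\<close> come from bounded degree.

  For local cohomology, the resolution coinduced from \<open>E\<close> along the Frobenius again resolves \<open>R\<close>,
  since \<open>Hom(R, R\<^sup>p)\<close> is free over \<open>R\<close> on the coefficient of the top monomial, and the Frobenius
  lift \<open>\<phi>\<close> turns into an \<open>R\<close>-linear comparison map \<open>\<Theta>\<close> from it to \<open>E\<close>.  A homotopy inverse of \<open>\<Theta>\<close>
  yields the unique decomposition and moves a class killed by the \<open>p\<^bsup>e+1\<^esup>\<close>-th powers of \<open>I\<close> into
  the \<open>R F\<close>-span of classes killed by the \<open>p\<^sup>e\<close>-th powers; so \<open>H\<^sup>i\<^sub>I(R)\<close> is generated over \<open>\<^bold>F\<close> by the
  image of the Noetherian module \<open>Ext\<^sup>i(R/I, R)\<close>.\<close>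

section \<open>Exponent vectors\<close>

text \<open>The ring A is not left Noetherian: the left ideals A F x_1^k with k >= 0 form an
  infinite direct sum. Finite presentation of gr M thus does not follow from finite generation, and
  the relations have to be bounded by hand. The recursion for the filtration does this because in A
  a product x_j x^c F whose exponent overflows is zero. Both halves end in one criterion,
  \<open>F_holonomic_if_unit\<close>, which asks for generators and for existence and uniqueness of
  the expansions \<open>comb f\<close>, without mention of base change. In the second half nothing
  is known about E beyond its being an injective resolution, so no explicit complex is at hand.
  Coinduction is right adjoint to restriction along the Frobenius, hence keeps injectives, and since
  R is self-dual over R^p it does the work of base change. An element of the coinduced module is
  killed by all a^p with a in J exactly when its values are killed by J; this is why each use of the
  comparison lowers the Frobenius power by one.\<close>

definition digits :: "nat \<Rightarrow> ('n::finite \<Rightarrow> nat) set" where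
  "digits q = {c. \<forall>i. c i < q}"

definition weight :: "('n::finite \<Rightarrow> nat) \<Rightarrow> nat" where
  "weight c = sum c UNIV"

definition unit_exp :: "'n::finite \<Rightarrow> 'n \<Rightarrow> nat" where
  "unit_exp j = (\<lambda>i. if i = j then 1 else 0)"

lemma finite_digits: "finite (digits q :: ('n::finite \<Rightarrow> nat) set)"
proof -
  have "(digits q :: ('n \<Rightarrow> nat) set) = (UNIV :: 'n set) \<rightarrow>\<^sub>E {..<q}"
    by (auto simp: digits_def PiE_def Pi_def)
  then show ?thesis by (simp add: finite_PiE)
qed

lemma card_digits: "card (digits q :: ('n::finite \<Rightarrow> nat) set) = q ^ CARD('n)"
proof -
  have "(digits q :: ('n \<Rightarrow> nat) set) = (UNIV :: 'n set) \<rightarrow>\<^sub>E {..<q}"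
    by (auto simp: digits_def PiE_def Pi_def)
  then show ?thesis by (simp add: card_PiE)
qed

lemma weight_add: "weight (\<lambda>i. a i + b i) = weight a + weight b"
  by (simp add: weight_def sum.distrib)

lemma weight_mult: "weight (\<lambda>i. q * a i) = q * weight a"
  by (simp add: weight_def sum_distrib_left)

lemma weight_unit [simp]: "weight (unit_exp j) = 1"
  by (simp add: weight_def unit_exp_def)

lemma weight_digits_le:
  assumes "c \<in> digits q"
  shows "weight (c :: 'n::finite \<Rightarrow> nat) \<le> CARD('n) * (q - 1)"
proof -
  have "weight c \<le> (\<Sum>i\<in>(UNIV::'n set). q - 1)"
    unfolding weight_def by (rule sum_mono) (use assms in \<open>metis Suc_leI Suc_pred' digits_def gr_implies_not_zero less_Suc_eq_le mem_Collect_eq neq0_conv\<close>)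
  then show ?thesis by simp
qed

lemma weight_zero [simp]: "weight (\<lambda>_. 0) = 0"
  by (simp add: weight_def)

lemma exp_split_unit:
  assumes "weight a > 0"
  obtains j b where "a = (\<lambda>i. unit_exp j i + b i)" "weight a = Suc (weight b)"
proof -
  obtain j where j: "a j > 0" using assms unfolding weight_def by (metis gr0I sum.neutral less_irrefl)
  let ?b = "\<lambda>i. a i - unit_exp j i"
  have "a = (\<lambda>i. unit_exp j i + ?b i)" using j by (auto simp: unit_exp_def fun_eq_iff)
  moreover from this have "weight a = Suc (weight ?b)"
    using weight_add[of "unit_exp j" ?b] by simp
  ultimately show ?thesis by (rule that)
qed

lemma finite_weight_le: "finite {a :: 'n::finite \<Rightarrow> nat. weight a \<le> k}"
proof (rule finite_subset[OF _ finite_digits[of "Suc k"]])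
  show "{a :: 'n \<Rightarrow> nat. weight a \<le> k} \<subseteq> digits (Suc k)"
  proof
    fix a :: "'n \<Rightarrow> nat" assume a: "a \<in> {a. weight a \<le> k}"
    have "a i \<le> weight a" for i unfolding weight_def by (rule member_le_sum) auto
    with a show "a \<in> digits (Suc k)" unfolding digits_def by (auto simp: less_Suc_eq_le intro: order_trans)
  qed
qed


section \<open>The free algebra\<close>

definition var_list :: "'n::finite list" where
  "var_list = (SOME xs. set xs = UNIV \<and> distinct xs)"

lemma var_list: "set (var_list :: 'n::finite list) = UNIV" "distinct (var_list :: 'n list)"
proof -
  have "\<exists>xs :: 'n list. set xs = UNIV \<and> distinct xs" using finite_distinct_list[of "UNIV :: 'n set"] by auto
  from someI_ex[OF this] show "set (var_list :: 'n list) = UNIV" "distinct (var_list :: 'n list)"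
    by (auto simp: var_list_def)
qed

definition xword :: "('n::finite \<Rightarrow> nat) \<Rightarrow> 'n letter list" where
  "xword a = concat (map (\<lambda>i. replicate (a i) (X i)) var_list)"

lemma count_xword: "count (mset (xword a)) l = (case l of X i \<Rightarrow> a i | Fr \<Rightarrow> 0)"
proof -
  have "count (mset (concat (map (\<lambda>i. replicate (a i) (X i)) xs))) l
      = (case l of X i \<Rightarrow> if i \<in> set xs then a i else 0 | Fr \<Rightarrow> 0)" if "distinct xs" for xs
    using that by (induction xs) (auto split: letter.splits)
  from this[OF var_list(2)] show ?thesis
    unfolding xword_def by (simp add: var_list(1) split: letter.splits)
qed

lemma set_xword: "set (xword a) \<subseteq> range X"
  by (auto simp: xword_def)

lemma length_xword [simp]: "length (xword a) = weight a"
proof -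
  have "length (xword a) = (\<Sum>i\<leftarrow>var_list. a i)"
    by (simp add: xword_def length_concat comp_def)
  also have "\<dots> = weight a"
    using var_list by (simp add: weight_def sum.distinct_set_conv_list[OF var_list(2), symmetric] flip: var_list(1))
  finally show ?thesis .
qed

lemma mset_xword_add: "mset (xword (\<lambda>i. a i + b i)) = mset (xword a @ xword b)"
  by (rule multiset_eqI) (auto simp: count_xword split: letter.splits)

lemma xword_zero [simp]: "xword (\<lambda>_. 0) = []"
  by (simp add: xword_def)

lemma mset_xword_unit: "mset (xword (unit_exp j)) = mset [X j]"
  by (rule multiset_eqI) (auto simp: count_xword unit_exp_def split: letter.splits)

lemma xword_unit: "xword (unit_exp j) = [X j]"
  using mset_xword_unit[of j] by (metis mset_single_iff_right mset_zero_iff_right mset.simps(2) mset.simps(1))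

definition free_upto :: "nat \<Rightarrow> ('p::prime_card, 'n::finite) free_alg set" where
  "free_upto i = {a. \<forall>w\<in>Poly_Mapping.keys a. length (letters w) \<le> i}"

lemma free_upto_zero [simp]: "0 \<in> free_upto i"
  by (simp add: free_upto_def)

lemma free_upto_add: "a \<in> free_upto i \<Longrightarrow> b \<in> free_upto i \<Longrightarrow> a + b \<in> free_upto i"
  using keys_add[of a b] by (auto simp: free_upto_def)

lemma free_upto_uminus: "a \<in> free_upto i \<Longrightarrow> - a \<in> free_upto i"
  by (simp add: free_upto_def)

lemma free_upto_diff: "a \<in> free_upto i \<Longrightarrow> b \<in> free_upto i \<Longrightarrow> a - b \<in> free_upto i"
  using free_upto_add[of a i "- b"] free_upto_uminus[of b i] by simp

lemma free_upto_sum: "(\<And>x. x \<in> A \<Longrightarrow> f x \<in> free_upto i) \<Longrightarrow> sum f A \<in> free_upto i"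
  by (induction A rule: infinite_finite_induct) (auto intro: free_upto_add)

lemma free_upto_mono: "i \<le> j \<Longrightarrow> free_upto i \<subseteq> free_upto j"
  by (auto simp: free_upto_def)

lemma free_upto_mult: "a \<in> free_upto i \<Longrightarrow> b \<in> free_upto j \<Longrightarrow> a * b \<in> free_upto (i + j)"
  using keys_mult[of a b] by (fastforce simp: free_upto_def plus_fword_def)

lemma free_upto_monomial [simp]: "free_monomial w \<in> free_upto i \<longleftrightarrow> length w \<le> i"
  by (simp add: free_upto_def free_monomial_def)

lemma free_upto_const [simp]: "Poly_Mapping.single 0 c \<in> free_upto i"
  by (simp add: free_upto_def zero_fword_def)

lemma free_upto_one [simp]: "1 \<in> free_upto i"
  using free_upto_const[of 1 i] by simp

lemma finite_free_upto: "finite (free_upto i :: ('p::prime_card, 'n::finite) free_alg set)"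
proof -
  let ?W = "Word ` {w :: 'n letter list. length w \<le> i}"
  have UL: "(UNIV :: 'n letter set) = insert Fr (range X)"
    by (metis UNIV_eq_I insertCI letter.exhaust rangeI)
  have "finite (UNIV :: 'n letter set)" unfolding UL by simp
  then have W: "finite ?W" using finite_lists_length_le[of "UNIV :: 'n letter set" i] by simp
  have "inj_on Poly_Mapping.lookup (free_upto i :: ('p,'n) free_alg set)"
    by (rule inj_onI) (simp add: lookup_inject)
  moreover have "Poly_Mapping.lookup ` (free_upto i :: ('p,'n) free_alg set)
      \<subseteq> {f. \<forall>x. (x \<in> ?W \<longrightarrow> f x \<in> UNIV) \<and> (x \<notin> ?W \<longrightarrow> f x = 0)}"
  proof (clarify, intro conjI impI)
    fix a :: "('p,'n) free_alg" and w assume a: "a \<in> free_upto i" and w: "w \<notin> ?W"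
    have "w \<notin> Poly_Mapping.keys a"
    proof
      assume "w \<in> Poly_Mapping.keys a"
      with a have "length (letters w) \<le> i" by (auto simp: free_upto_def)
      then have "Word (letters w) \<in> ?W" by blast
      with w show False by simp
    qed
    then show "Poly_Mapping.lookup a w = 0" by (simp add: in_keys_iff)
  qed simp
  moreover have "finite {f :: _ \<Rightarrow> 'p mod_ring. \<forall>x. (x \<in> ?W \<longrightarrow> f x \<in> UNIV) \<and> (x \<notin> ?W \<longrightarrow> f x = 0)}"
    by (rule finite_set_of_finite_funs[OF W]) simp
  ultimately show ?thesis by (meson finite_imageD finite_subset)
qed

lemma free_alg_expand:
  "a = (\<Sum>w\<in>Poly_Mapping.keys a. Poly_Mapping.single 0 (Poly_Mapping.lookup a w) * free_monomial (letters w))"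
proof -
  have "Poly_Mapping.single 0 (Poly_Mapping.lookup a w) * free_monomial (letters w)
      = Poly_Mapping.single w (Poly_Mapping.lookup a w)" for w
    by (simp add: free_monomial_def mult_single zero_fword_def plus_fword_def)
  then show ?thesis using pm_sum_singles[of a] by simp
qed

lemma mod_ring_of_nat: obtains k where "(c :: 'p::prime_card mod_ring) = of_nat k"
proof -
  have "c = of_int (to_int_mod_ring c)" by (simp add: of_int_of_int_mod_ring)
  also have "\<dots> = of_nat (nat (to_int_mod_ring c))"
    by (metis int_nat_eq of_int_of_nat_eq range_to_int_mod_ring atLeastLessThan_iff rangeI)
  finally show ?thesis by (rule that)
qed

lemma single_0_of_nat: "Poly_Mapping.single 0 (of_nat k) = of_nat k"
  by (rule single_of_nat)

text \<open>Each coefficient in F_p is a sum of copies of 1, so scalar multiples of words come out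
  of the additive case.\<close>

lemma free_upto_induct [consumes 1, case_names zero add monomial]:
  assumes "a \<in> free_upto i" "P 0" "\<And>x y. P x \<Longrightarrow> P y \<Longrightarrow> P (x + y)"
    and "\<And>w. length w \<le> i \<Longrightarrow> P (free_monomial w)"
  shows "P (a :: ('p::prime_card, 'n::finite) free_alg)"
proof -
  have nat: "P (of_nat k * x)" if "P x" for x k
    by (induction k) (auto simp: assms(2) distrib_right intro: assms(3) that)
  have "P (Poly_Mapping.single 0 c * free_monomial (letters w))" if "w \<in> Poly_Mapping.keys a" for c w
  proof -
    obtain k where "c = of_nat k" by (rule mod_ring_of_nat)
    then show ?thesis using nat[OF assms(4), of "letters w" k] assms(1) that
      by (auto simp: single_0_of_nat free_upto_def)
  qed
  then have "P (\<Sum>w\<in>A. Poly_Mapping.single 0 (Poly_Mapping.lookup a w) * free_monomial (letters w))"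
    if "A \<subseteq> Poly_Mapping.keys a" for A
    using that by (induction A rule: infinite_finite_induct) (auto intro: assms)
  then show ?thesis by (subst free_alg_expand) simp
qed

lemma free_upto_ex: "\<exists>i. (a :: ('p::prime_card, 'n::finite) free_alg) \<in> free_upto i"
proof -
  have "\<exists>i. \<forall>w\<in>A. length (letters w) \<le> i" if "finite A" for A :: "'n fword set"
    using finite_nat_set_iff_bounded_le[of "(\<lambda>w. length (letters w)) ` A"] that by auto
  from this[of "Poly_Mapping.keys a"] show ?thesis by (simp add: free_upto_def)
qed

lemma frob_ideal_relation:
  "free_monomial (replicate CARD('p) (X i) @ [Fr]) - free_monomial [Fr, X i]
     \<in> (frob_ideal :: ('p::prime_card, 'n::finite) free_alg set)"
proof -
  have "free_monomial (replicate CARD('p) (X i) @ [Fr]) - free_monomial [Fr, X i]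
      \<in> (frob_relations :: ('p, 'n) free_alg set)"
    by (auto simp: frob_relations_def)
  then show ?thesis
    unfolding frob_ideal_def using ring.genideal_self[OF class_ring.ring_axioms, of frob_relations] by auto
qed


section \<open>Left modules over the ring of Frobenius operators\<close>

context abelian_monoid
begin

text \<open>The submonoid generated by A. In a module over F_p the negative of an element is a
  multiple of it, so there this is the F_p-span, reached through addition alone.\<close>

inductive_set asums :: "'a set \<Rightarrow> 'a set" for A where
  zero: "\<zero> \<in> asums A"
| add: "x \<in> A \<Longrightarrow> y \<in> asums A \<Longrightarrow> x \<oplus> y \<in> asums A"

lemma asums_closed: "A \<subseteq> carrier G \<Longrightarrow> asums A \<subseteq> carrier G"
proof
  fix x assume "A \<subseteq> carrier G" "x \<in> asums A"
  from this(2,1) show "x \<in> carrier G" by induction auto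
qed

lemma asums_superset: "A \<subseteq> carrier G \<Longrightarrow> A \<subseteq> asums A"
  using asums.add[OF _ asums.zero] by (metis r_zero subset_iff)

lemma asums_add:
  assumes "A \<subseteq> carrier G" "x \<in> asums A" "y \<in> asums A"
  shows "x \<oplus> y \<in> asums A"
  using assms(2)
proof induction
  case zero
  have "y \<in> carrier G" using assms(1,3) asums_closed by blast
  then show ?case using assms(3) by simp
next
  case (add u x)
  then have "u \<oplus> x \<oplus> y = u \<oplus> (x \<oplus> y)" using assms asums_closed by (auto intro!: a_assoc)
  then show ?case using add by (metis asums.add)
qed

lemma asums_least:
  assumes "A \<subseteq> H" "\<zero> \<in> H" "\<And>x y. x \<in> H \<Longrightarrow> y \<in> H \<Longrightarrow> x \<oplus> y \<in> H"
  shows "asums A \<subseteq> H"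
proof
  fix x assume "x \<in> asums A"
  then show "x \<in> H" using assms by induction auto
qed

lemma asums_mono: "A \<subseteq> B \<Longrightarrow> asums A \<subseteq> asums B"
proof
  fix x assume "A \<subseteq> B" "x \<in> asums A"
  from this(2,1) show "x \<in> asums B" by induction (auto intro: asums.intros)
qed

lemma asums_chain:
  assumes "x \<in> asums (\<Union>i::nat. A i)" "mono A"
  shows "\<exists>i. x \<in> asums (A i)"
  using assms(1)
proof induction
  case zero
  then show ?case by (auto intro: asums.zero)
next
  case (add x y)
  then obtain i j where "x \<in> A i" "y \<in> asums (A j)" by auto
  moreover have "A i \<subseteq> A (max i j)" "A j \<subseteq> A (max i j)" using monoD[OF assms(2)] by auto
  ultimately have "x \<oplus> y \<in> asums (A (max i j))" using asums_mono[of "A j" "A (max i j)"] by (intro asums.add) auto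
  then show ?case ..
qed

lemma finsum_mem:
  assumes "\<And>x. x \<in> A \<Longrightarrow> f x \<in> H" "\<zero> \<in> H" "\<And>x y. x \<in> H \<Longrightarrow> y \<in> H \<Longrightarrow> x \<oplus> y \<in> H" "H \<subseteq> carrier G"
  shows "finsum G f A \<in> H"
  using assms(1)
proof (induction A rule: infinite_finite_induct)
  case (insert x F)
  then have "f \<in> F \<rightarrow> carrier G" "f x \<in> carrier G" using assms(4) by auto
  then show ?case using insert assms by (subst finsum_insert) auto
qed (auto simp: assms)

end

lemma finsum_additive:
  assumes "abelian_monoid G" "abelian_monoid G'" "h \<in> carrier G \<rightarrow> carrier G'" "h \<zero>\<^bsub>G\<^esub> = \<zero>\<^bsub>G'\<^esub>"
    "\<And>x y. x \<in> carrier G \<Longrightarrow> y \<in> carrier G \<Longrightarrow> h (x \<oplus>\<^bsub>G\<^esub> y) = h x \<oplus>\<^bsub>G'\<^esub> h y"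
    "f \<in> A \<rightarrow> carrier G"
  shows "h (finsum G f A) = finsum G' (\<lambda>x. h (f x)) A"
proof -
  interpret G: abelian_monoid G by fact
  interpret G': abelian_monoid G' by fact
  show ?thesis using assms(6)
  proof (induction A rule: infinite_finite_induct)
    case (infinite A)
    then show ?case using assms by (simp add: G.finsum_infinite G'.finsum_infinite)
  next
    case (insert x F)
    have "h \<circ> f \<in> F \<rightarrow> carrier G'" "h (f x) \<in> carrier G'" using insert assms by (auto simp: Pi_def)
    then show ?case using insert assms by (simp add: Pi_def)
  qed (auto simp: assms)
qed

locale frob_left_module = left_module frob_ring M
  for M :: "(('p::prime_card, 'n::finite) frob_op, 'm) module"
begin

definition act :: "('p, 'n) free_alg \<Rightarrow> 'm \<Rightarrow> 'm" where
  "act a m = frob_class a \<odot>\<^bsub>M\<^esub> m"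

definition mon :: "('n \<Rightarrow> nat) \<Rightarrow> 'm \<Rightarrow> 'm" where
  "mon a m = act (free_monomial (xword a)) m"

definition frob :: "'m \<Rightarrow> 'm" where
  "frob m = act (free_monomial [Fr]) m"

definition var :: "'n \<Rightarrow> 'm \<Rightarrow> 'm" where
  "var i m = act (free_monomial [X i]) m"

lemmas hom = ring_hom_mult[OF frob_class_hom[where ?'p = 'p and ?'n = 'n]] ring_hom_add[OF frob_class_hom[where ?'p = 'p and ?'n = 'n]]
  ring_hom_one[OF frob_class_hom[where ?'p = 'p and ?'n = 'n]] ring_hom_closed[OF frob_class_hom[where ?'p = 'p and ?'n = 'n]]

lemma act_closed [simp, intro]: "m \<in> carrier M \<Longrightarrow> act a m \<in> carrier M"
  unfolding act_def using hom(4)[of a] by (intro smult_closed) auto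

lemma act_add_l: "m \<in> carrier M \<Longrightarrow> act (a + b) m = act a m \<oplus>\<^bsub>M\<^esub> act b m"
  unfolding act_def using hom(2)[of a b] hom(4) by (simp add: smult_l_distr)

lemma act_add_r: "m \<in> carrier M \<Longrightarrow> m' \<in> carrier M \<Longrightarrow> act a (m \<oplus>\<^bsub>M\<^esub> m') = act a m \<oplus>\<^bsub>M\<^esub> act a m'"
  unfolding act_def using hom(4) by (simp add: smult_r_distr)

lemma act_mult: "m \<in> carrier M \<Longrightarrow> act (a * b) m = act a (act b m)"
  unfolding act_def using hom(1)[of a b] hom(4) by (simp add: smult_assoc)

lemma act_one: "m \<in> carrier M \<Longrightarrow> act 1 m = m"
  unfolding act_def using hom(3) by (simp add: smult_one)

lemma act_cong: "a - b \<in> frob_ideal \<Longrightarrow> act a m = act b m"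
  unfolding act_def using frob_class_eqI by metis

lemma act_zero_l [simp]: "m \<in> carrier M \<Longrightarrow> act 0 m = \<zero>\<^bsub>M\<^esub>"
  using act_add_l[of m 0 0] act_closed[of m 0] by (metis M.add.r_cancel_one' add_0)

lemma act_zero_r [simp]: "act a \<zero>\<^bsub>M\<^esub> = \<zero>\<^bsub>M\<^esub>"
  using act_add_r[of "\<zero>\<^bsub>M\<^esub>" "\<zero>\<^bsub>M\<^esub>" a] act_closed[of "\<zero>\<^bsub>M\<^esub>" a]
  by (metis M.add.r_cancel_one' M.zero_closed M.r_zero)

lemma act_uminus_l: "m \<in> carrier M \<Longrightarrow> act (- a) m = \<ominus>\<^bsub>M\<^esub> act a m"
  using act_add_l[of m "- a" a] by (metis M.minus_equality act_closed act_zero_l ab_left_minus)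

lemma act_finsum: "f \<in> A \<rightarrow> carrier M \<Longrightarrow> act a (finsum M f A) = (\<Oplus>\<^bsub>M\<^esub>x\<in>A. act a (f x))"
  by (rule finsum_additive) (auto simp: act_add_r M.abelian_monoid_axioms)

lemma of_nat_mem:
  assumes "m \<in> H" "H \<subseteq> carrier M" "\<zero>\<^bsub>M\<^esub> \<in> H" "\<And>x y. x \<in> H \<Longrightarrow> y \<in> H \<Longrightarrow> x \<oplus>\<^bsub>M\<^esub> y \<in> H"
  shows "act (of_nat k) m \<in> H"
  by (induction k) (use assms in \<open>auto simp: act_add_l act_one\<close>)

lemma const_mem:
  assumes "m \<in> H" "H \<subseteq> carrier M" "\<zero>\<^bsub>M\<^esub> \<in> H" "\<And>x y. x \<in> H \<Longrightarrow> y \<in> H \<Longrightarrow> x \<oplus>\<^bsub>M\<^esub> y \<in> H"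
  shows "act (Poly_Mapping.single 0 c) m \<in> H"
proof -
  obtain k where "c = of_nat k" by (rule mod_ring_of_nat)
  then show ?thesis using of_nat_mem[OF assms] by (simp add: single_0_of_nat)
qed

lemma uminus_mem:
  assumes "m \<in> H" "H \<subseteq> carrier M" "\<zero>\<^bsub>M\<^esub> \<in> H" "\<And>x y. x \<in> H \<Longrightarrow> y \<in> H \<Longrightarrow> x \<oplus>\<^bsub>M\<^esub> y \<in> H"
  shows "\<ominus>\<^bsub>M\<^esub> m \<in> H"
proof -
  have "act (- 1) m = \<ominus>\<^bsub>M\<^esub> m" using assms by (subst act_uminus_l) (auto simp: act_one)
  moreover have "(- 1 :: ('p, 'n) free_alg) = Poly_Mapping.single 0 (- 1)" by (simp add: single_uminus)
  ultimately show ?thesis using const_mem[OF assms, of "- 1"] by simp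
qed

lemma act_word_perm:
  assumes "mset u = mset v" "set u \<subseteq> range X"
  shows "act (free_monomial u) m = act (free_monomial v) m"
  by (rule act_cong[OF free_monomial_perm[OF assms]])

lemma act_append: "m \<in> carrier M \<Longrightarrow> act (free_monomial (u @ v)) m = act (free_monomial u) (act (free_monomial v) m)"
  by (simp add: free_monomial_append act_mult)

lemma act_Nil [simp]: "m \<in> carrier M \<Longrightarrow> act (free_monomial []) m = m"
  using act_one by (simp add: free_monomial_def flip: zero_fword_def)

lemma act_Cons: "m \<in> carrier M \<Longrightarrow>
    act (free_monomial (l # w)) m = (case l of X i \<Rightarrow> var i | Fr \<Rightarrow> frob) (act (free_monomial w) m)"
  using act_append[of m "[l]" w] by (auto simp: var_def frob_def split: letter.splits)

lemma mon_closed [simp, intro]: "m \<in> carrier M \<Longrightarrow> mon a m \<in> carrier M"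
  and frob_closed [simp, intro]: "m \<in> carrier M \<Longrightarrow> frob m \<in> carrier M"
  and var_closed [simp, intro]: "m \<in> carrier M \<Longrightarrow> var i m \<in> carrier M"
  by (auto simp: mon_def frob_def var_def)

lemma mon_add: "m \<in> carrier M \<Longrightarrow> m' \<in> carrier M \<Longrightarrow> mon a (m \<oplus>\<^bsub>M\<^esub> m') = mon a m \<oplus>\<^bsub>M\<^esub> mon a m'"
  and frob_add: "m \<in> carrier M \<Longrightarrow> m' \<in> carrier M \<Longrightarrow> frob (m \<oplus>\<^bsub>M\<^esub> m') = frob m \<oplus>\<^bsub>M\<^esub> frob m'"
  and var_add: "m \<in> carrier M \<Longrightarrow> m' \<in> carrier M \<Longrightarrow> var i (m \<oplus>\<^bsub>M\<^esub> m') = var i m \<oplus>\<^bsub>M\<^esub> var i m'"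
  by (simp_all add: mon_def frob_def var_def act_add_r)

lemma mon_zero_r [simp]: "mon a \<zero>\<^bsub>M\<^esub> = \<zero>\<^bsub>M\<^esub>"
  and frob_zero [simp]: "frob \<zero>\<^bsub>M\<^esub> = \<zero>\<^bsub>M\<^esub>"
  and var_zero [simp]: "var i \<zero>\<^bsub>M\<^esub> = \<zero>\<^bsub>M\<^esub>"
  by (simp_all add: mon_def frob_def var_def)

lemma mon_mon: "m \<in> carrier M \<Longrightarrow> mon a (mon b m) = mon (\<lambda>i. a i + b i) m"
  unfolding mon_def act_append[symmetric] by (rule act_word_perm[symmetric, OF mset_xword_add set_xword])

lemma mon_zero [simp]: "m \<in> carrier M \<Longrightarrow> mon (\<lambda>_. 0) m = m"
  by (simp add: mon_def)

lemma var_mon: "m \<in> carrier M \<Longrightarrow> var j (mon b m) = mon (\<lambda>i. unit_exp j i + b i) m"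
  using mon_mon[of m "unit_exp j" b] by (simp add: var_def mon_def xword_unit)

lemma var_eq_mon: "var j m = mon (unit_exp j) m"
  by (simp add: var_def mon_def xword_unit)

lemma frob_var: "m \<in> carrier M \<Longrightarrow> frob (var i m) = act (free_monomial (replicate CARD('p) (X i))) (frob m)"
  using act_cong[OF frob_ideal_relation, of i m] by (simp add: frob_def var_def flip: act_append)

lemma frob_xs:
  assumes "m \<in> carrier M" "set w \<subseteq> range X"
  shows "frob (act (free_monomial w) m) = act (free_monomial (concat (map (replicate CARD('p)) w))) (frob m)"
  using assms(2)
proof (induction w)
  case (Cons l w)
  then obtain i where l: "l = X i" by auto
  then show ?case using Cons assms(1) by (simp add: act_Cons frob_var act_append)
qed (simp add: assms)

lemma frob_mon: 
  assumes "m \<in> carrier M"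
  shows "frob (mon a m) = mon (\<lambda>i. CARD('p) * a i) (frob m)"
proof -
  have 1: "count (mset (concat (map (replicate q) w))) l = q * count (mset w) l" for q w and l :: "'n letter"
    by (induction w) auto
  have "mset (concat (map (replicate CARD('p)) (xword a))) = mset (xword (\<lambda>i. CARD('p) * a i))"
    by (rule multiset_eqI, subst 1) (auto simp: count_xword split: letter.splits)
  moreover have "set (concat (map (replicate CARD('p)) (xword a))) \<subseteq> range X"
    using set_xword[of a] by (auto simp: set_replicate_conv_if split: if_splits)
  ultimately show ?thesis
    unfolding mon_def frob_xs[OF assms set_xword] by (intro act_word_perm)
qed

text \<open>Since the coefficients are multiples of \<open>1\<close>, closure under addition suffices.\<close>

lemma act_mem:
  assumes "a \<in> free_upto i" "H \<subseteq> carrier M" "\<zero>\<^bsub>M\<^esub> \<in> H" "\<And>x y. x \<in> H \<Longrightarrow> y \<in> H \<Longrightarrow> x \<oplus>\<^bsub>M\<^esub> y \<in> H"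
    "m \<in> carrier M" "\<And>w. length w \<le> i \<Longrightarrow> act (free_monomial w) m \<in> H"
  shows "act a m \<in> H"
  using assms(1) by (induction rule: free_upto_induct) (use assms in \<open>auto simp: act_add_l\<close>)

end

lemma (in abelian_monoid) asums_image:
  assumes "A \<subseteq> carrier G" "B \<subseteq> carrier G" "h \<zero> = \<zero>"
    and add: "\<And>x y. x \<in> carrier G \<Longrightarrow> y \<in> carrier G \<Longrightarrow> h (x \<oplus> y) = h x \<oplus> h y"
    and im: "\<And>x. x \<in> A \<Longrightarrow> h x \<in> asums B" and "x \<in> asums A"
  shows "h x \<in> asums B"
  using assms(6)
proof induction
  case zero
  then show ?case using assms by (simp add: asums.zero)
next
  case (add x y)
  then have "h (x \<oplus> y) = h x \<oplus> h y" using assms asums_closed by (metis subsetD)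
  then show ?case using add im asums_add[OF assms(2)] by simp
qed

section \<open>Roots of unit modules\<close>

context frob_left_module
begin

definition comb :: "(('n \<Rightarrow> nat) \<Rightarrow> 'm) \<Rightarrow> 'm" where
  "comb f = (\<Oplus>\<^bsub>M\<^esub>c\<in> digits CARD('p). mon c (frob (f c)))"

definition frob_multiples :: "'m set \<Rightarrow> 'm set" where
  "frob_multiples T = {mon a (frob t) | a t. t \<in> T}"

definition frob_multiples_upto :: "nat \<Rightarrow> 'm set \<Rightarrow> 'm set" where
  "frob_multiples_upto \<delta> T = {mon a (frob t) | a t. weight a \<le> \<delta> \<and> t \<in> T}"

text \<open>Says that S generates M over the ring of Frobenius operators: a set closed under
  addition and under all letters is closed under F_p-multiples and words, hence under every
  operator.\<close>

definition frob_generated :: "'m set \<Rightarrow> bool" where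
  "frob_generated S \<longleftrightarrow> (\<forall>H. S \<subseteq> H \<and> H \<subseteq> carrier M \<and> \<zero>\<^bsub>M\<^esub> \<in> H \<and> (\<forall>x\<in>H. \<forall>y\<in>H. x \<oplus>\<^bsub>M\<^esub> y \<in> H) \<and>
     (\<forall>x\<in>H. frob x \<in> H \<and> (\<forall>j. var j x \<in> H)) \<longrightarrow> H = carrier M)"

lemma frob_generatedD:
  assumes "frob_generated S" "S \<subseteq> H" "H \<subseteq> carrier M" "\<zero>\<^bsub>M\<^esub> \<in> H"
    "\<And>x y. x \<in> H \<Longrightarrow> y \<in> H \<Longrightarrow> x \<oplus>\<^bsub>M\<^esub> y \<in> H" "\<And>x. x \<in> H \<Longrightarrow> frob x \<in> H" "\<And>x j. x \<in> H \<Longrightarrow> var j x \<in> H"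
  shows "H = carrier M"
  using assms(1)[unfolded frob_generated_def, THEN spec[of _ H]] assms(2-) by simp

lemma comb_closed [simp, intro]: "f \<in> digits CARD('p) \<rightarrow> carrier M \<Longrightarrow> comb f \<in> carrier M"
  unfolding comb_def by (intro M.finsum_closed) auto

lemma comb_add:
  assumes "f \<in> digits CARD('p) \<rightarrow> carrier M" "g \<in> digits CARD('p) \<rightarrow> carrier M"
  shows "comb (\<lambda>c. f c \<oplus>\<^bsub>M\<^esub> g c) = comb f \<oplus>\<^bsub>M\<^esub> comb g"
proof -
  have "comb (\<lambda>c. f c \<oplus>\<^bsub>M\<^esub> g c) = (\<Oplus>\<^bsub>M\<^esub>c\<in> digits CARD('p). mon c (frob (f c)) \<oplus>\<^bsub>M\<^esub> mon c (frob (g c)))"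
    unfolding comb_def by (intro M.finsum_cong') (use assms in \<open>auto simp: frob_add mon_add Pi_def\<close>)
  also have "\<dots> = comb f \<oplus>\<^bsub>M\<^esub> comb g"
    unfolding comb_def by (rule M.finsum_addf) (use assms in auto)
  finally show ?thesis .
qed

lemma comb_single:
  assumes "c \<in> digits CARD('p)" "x \<in> carrier M"
  shows "comb (\<lambda>c'. if c' = c then x else \<zero>\<^bsub>M\<^esub>) = mon c (frob x)"
proof -
  have "comb (\<lambda>c'. if c' = c then x else \<zero>\<^bsub>M\<^esub>) = (\<Oplus>\<^bsub>M\<^esub>c'\<in> digits CARD('p). if c = c' then mon c' (frob x) else \<zero>\<^bsub>M\<^esub>)"
    unfolding comb_def by (intro M.finsum_cong') (use assms in \<open>auto\<close>)
  also have "\<dots> = mon c (frob x)"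
    using assms by (intro M.finsum_singleton finite_digits) auto
  finally show ?thesis .
qed

text \<open>Every generator is a combination of Frobenius images of finitely many elements of \<open>M\<close>, and
  these lie in the \<open>R\<close>-span of finitely many Frobenius iterates of the generators.\<close>

lemma root_exists:
  assumes S: "finite S" "S \<subseteq> carrier M" "frob_generated S"
    and decomp: "\<And>m. m \<in> carrier M \<Longrightarrow> \<exists>f \<in> digits CARD('p) \<rightarrow> carrier M. m = comb f"
  shows "\<exists>T \<delta>. finite T \<and> S \<subseteq> T \<and> T \<subseteq> carrier M \<and> T \<subseteq> M.asums (frob_multiples_upto \<delta> T)"
proof -
  define T where "T e = (\<Union>k\<le>e. (frob ^^ k) ` S)" for e
  define A where "A e = {mon a t | a t. t \<in> T e}" for e
  define H where "H = (\<Union>e. M.asums (A e))"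
  have itc: "(frob ^^ k) s \<in> carrier M" if "s \<in> carrier M" for k s
    using that by (induction k) auto
  have Tc: "T e \<subseteq> carrier M" for e using itc S unfolding T_def by auto
  have Tf: "finite (T e)" for e using S unfolding T_def by auto
  have Tm: "e \<le> e' \<Longrightarrow> T e \<subseteq> T e'" for e e' unfolding T_def by (auto intro: order_trans)
  have Tfrob: "t \<in> T e \<Longrightarrow> frob t \<in> T (Suc e)" for t e
    unfolding T_def by clarify (metis (no_types, lifting) Suc_le_mono UN_iff atMost_iff comp_apply funpow.simps(2) image_eqI)
  have Am: "e \<le> e' \<Longrightarrow> A e \<subseteq> A e'" for e e' using Tm[of e e'] unfolding A_def by blast
  have Ac: "A e \<subseteq> carrier M" for e using Tc[of e] unfolding A_def by auto
  have Hm: "e \<le> e' \<Longrightarrow> M.asums (A e) \<subseteq> M.asums (A e')" for e e' using M.asums_mono Am by blast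
  have Hc: "H \<subseteq> carrier M" using M.asums_closed[OF Ac] unfolding H_def by auto
  \<comment> \<open>H is the R-span of all Frobenius iterates of S. It is stable under F because F
    x^a = x^(p a) F, and it contains S, so it is all of M.\<close>
  have H_eq: "H = carrier M"
  proof (rule frob_generatedD[OF S(3)])
    show "S \<subseteq> H"
    proof
      fix s assume s: "s \<in> S"
      then have "mon (\<lambda>_. 0) s \<in> A 0" unfolding A_def T_def by force
      then have "s \<in> A 0" using s S by auto
      then show "s \<in> H" using M.asums_superset[OF Ac] unfolding H_def by blast
    qed
    show "x \<oplus>\<^bsub>M\<^esub> y \<in> H" if "x \<in> H" "y \<in> H" for x y
    proof -
      from that obtain e e' where "x \<in> M.asums (A e)" "y \<in> M.asums (A e')" unfolding H_def by auto
      then have "x \<in> M.asums (A (max e e'))" "y \<in> M.asums (A (max e e'))"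
        using Hm[of e "max e e'"] Hm[of e' "max e e'"] by auto
      then show ?thesis using M.asums_add[OF Ac] unfolding H_def by blast
    qed
    show "frob x \<in> H" if xH: "x \<in> H" for x
    proof -
      obtain e where x: "x \<in> M.asums (A e)" using xH unfolding H_def by auto
      have "frob x \<in> M.asums (A (Suc e))"
      proof (rule M.asums_image[OF Ac Ac _ _ _ x])
        fix y assume "y \<in> A e"
        then obtain a t where t: "y = mon a t" "t \<in> T e" unfolding A_def by auto
        then have "frob y = mon (\<lambda>i. CARD('p) * a i) (frob t)" using Tc[of e] frob_mon by auto
        then have "frob y \<in> A (Suc e)" using Tfrob[OF t(2)] unfolding A_def by auto
        then show "frob y \<in> M.asums (A (Suc e))" using M.asums_superset[OF Ac] by auto
      qed (auto simp: frob_add)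
      then show ?thesis unfolding H_def by auto
    qed
    show "var j x \<in> H" if xH: "x \<in> H" for x j
    proof -
      obtain e where x: "x \<in> M.asums (A e)" using xH unfolding H_def by auto
      have "var j x \<in> M.asums (A e)"
      proof (rule M.asums_image[OF Ac Ac _ _ _ x])
        fix y assume "y \<in> A e"
        then obtain a t where t: "y = mon a t" "t \<in> T e" unfolding A_def by auto
        then have "var j y = mon (\<lambda>i. unit_exp j i + a i) t" using Tc[of e] var_mon by auto
        then have "var j y \<in> A e" using t unfolding A_def by auto
        then show "var j y \<in> M.asums (A e)" using M.asums_superset[OF Ac] by auto
      qed (auto simp: var_add)
      then show ?thesis unfolding H_def by auto
    qed
  qed (use Hc in \<open>auto simp: H_def intro: M.asums.zero\<close>)
  have Bc: "frob_multiples (T e) \<subseteq> carrier M" for e using Tc[of e] unfolding frob_multiples_def by auto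
  have "\<exists>e. s \<in> M.asums (frob_multiples (T e))" if "s \<in> S" for s
  proof -
    obtain f where f: "f \<in> digits CARD('p) \<rightarrow> carrier M" "s = comb f" using decomp \<open>s \<in> S\<close> S by auto
    then have "\<forall>c\<in> digits CARD('p). \<exists>e. f c \<in> M.asums (A e)" using H_eq unfolding H_def by blast
    then obtain e where e: "\<And>c. c \<in> digits CARD('p) \<Longrightarrow> f c \<in> M.asums (A (e c))" by metis
    define E where "E = Max (e ` digits CARD('p))"
    have fE: "f c \<in> M.asums (A E)" if "c \<in> digits CARD('p)" for c
      using e[OF that] Hm[of "e c" E] Max_ge[OF finite_imageI[OF finite_digits] imageI[OF that], of e]
      unfolding E_def by auto
    \<comment> \<open>Applying x^c F to x^a t gives x^(c + p a) F(t), again a multiple of the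
      Frobenius image of an element of T E.\<close>
    have "mon c (frob (f c)) \<in> M.asums (frob_multiples (T E))" if c: "c \<in> digits CARD('p)" for c
    proof (rule M.asums_image[OF Ac Bc _ _ _ fE[OF c], where h = "\<lambda>x. mon c (frob x)"])
      fix y assume "y \<in> A E"
      then obtain a t where t: "y = mon a t" "t \<in> T E" unfolding A_def by auto
      then have "mon c (frob y) = mon (\<lambda>i. c i + CARD('p) * a i) (frob t)" using Tc[of E] by (auto simp: frob_mon mon_mon)
      then have "mon c (frob y) \<in> frob_multiples (T E)" using t unfolding frob_multiples_def by auto
      then show "mon c (frob y) \<in> M.asums (frob_multiples (T E))" using M.asums_superset[OF Bc] by auto
    qed (auto simp: frob_add mon_add)
    then have "s \<in> M.asums (frob_multiples (T E))"
      unfolding f(2) comb_def using M.asums_add[OF Bc] M.asums_closed[OF Bc]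
      by (intro M.finsum_mem) (auto intro: M.asums.zero)
    then show ?thesis ..
  qed
  then obtain e where e: "\<And>s. s \<in> S \<Longrightarrow> s \<in> M.asums (frob_multiples (T (e s)))" by metis
  define E where "E = Max (insert 0 (e ` S))"
  have fm_mono: "U \<subseteq> V \<Longrightarrow> frob_multiples U \<subseteq> frob_multiples V" for U V unfolding frob_multiples_def by auto
  have SE: "s \<in> M.asums (frob_multiples (T E))" if "s \<in> S" for s
    using e[OF that] M.asums_mono[OF fm_mono[OF Tm[of "e s" E]]] that S(1) unfolding E_def by auto
  \<comment> \<open>An iterate F^k(s) with k > 0 is F of an element of T E; only the elements of S
    themselves rely on the expansion found above.\<close>
  have TE: "t \<in> M.asums (frob_multiples (T E))" if "t \<in> T E" for t
  proof -
    from that obtain k s where k: "k \<le> E" "s \<in> S" "t = (frob ^^ k) s" unfolding T_def by auto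
    show ?thesis
    proof (cases k)
      case (Suc k')
      let ?t = "(frob ^^ k') s"
      have "?t \<in> T E" using k Suc unfolding T_def by auto
      moreover from this have "t = mon (\<lambda>_. 0) (frob ?t)" using k Suc Tc[of E] by auto
      ultimately have "t \<in> frob_multiples (T E)" unfolding frob_multiples_def by blast
      then show ?thesis using M.asums_superset[OF Bc] by auto
    qed (use k SE in auto)
  qed
  \<comment> \<open>Finitely many elements involve finitely many exponents, so one bound \<delta> on
    the weights serves the whole set.\<close>
  have un: "frob_multiples (T E) = (\<Union>\<delta>. frob_multiples_upto \<delta> (T E))"
    unfolding frob_multiples_def frob_multiples_upto_def by auto
  have mono: "mono (\<lambda>\<delta>. frob_multiples_upto \<delta> (T E))"
    unfolding frob_multiples_upto_def by (rule monoI) (auto intro: order_trans)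
  have "\<exists>\<delta>. t \<in> M.asums (frob_multiples_upto \<delta> (T E))" if "t \<in> T E" for t
    using TE[OF that] unfolding un by (rule M.asums_chain[OF _ mono])
  then obtain d where d: "\<And>t. t \<in> T E \<Longrightarrow> t \<in> M.asums (frob_multiples_upto (d t) (T E))" by metis
  define \<delta> where "\<delta> = Max (insert 0 (d ` T E))"
  have "t \<in> M.asums (frob_multiples_upto \<delta> (T E))" if "t \<in> T E" for t
    using d[OF that] M.asums_mono[OF monoD[OF mono, of "d t" \<delta>]] that Tf[of E] unfolding \<delta>_def by auto
  moreover have "S \<subseteq> T E" unfolding T_def by (rule order_trans[OF _ UN_upper[of 0]]) simp_all
  ultimately show ?thesis
    using Tf[of E] Tc[of E] by (intro exI[of _ "T E"] exI[of _ \<delta>] conjI subsetI) auto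
qed

end


section \<open>The filtration of a module with a root\<close>

text \<open>\<open>stable\<close> is one more than n (p - 1), the largest weight of a digit vector,
  so it is the largest length of a word x^c F. From \<open>stable\<close> on, the truncated
  difference i - 1 - |c| is a true one.\<close>

locale frob_root = frob_left_module M
  for M :: "(('p::prime_card, 'n::finite) frob_op, 'm) module" +
  fixes S :: "'m set" and \<delta> stable :: nat
  assumes finite_S: "finite S" and S_closed: "S \<subseteq> carrier M"
    and generated: "frob_generated S"
    and unique: "\<And>f g c. f \<in> digits CARD('p) \<rightarrow> carrier M \<Longrightarrow> g \<in> digits CARD('p) \<rightarrow> carrier M \<Longrightarrow> comb f = comb g \<Longrightarrow>
      c \<in> digits CARD('p) \<Longrightarrow> f c = g c"
    and stable: "stable = 1 + CARD('n) * (CARD('p) - 1)"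
    and root: "S \<subseteq> M.asums (frob_multiples_upto \<delta> S)"
begin

text \<open>The bound \<delta> + 2 makes the root fit the filtration. Expanding x^a s through the
  root and splitting off p-th powers divides a weight of at most (\<delta> + 2 + i) + \<delta> - |c|
  by p >= 2, and the outcome must not exceed \<delta> + 2 + (i - 1 - |c|).\<close>

definition gens :: "'m set" where
  "gens = {mon a s | a s. weight a \<le> \<delta> + 2 \<and> s \<in> S}"

definition gen_list :: "'m list" where
  "gen_list = (SOME xs. set xs = gens)"

abbreviation "rk \<equiv> length gen_list"

definition ev :: "(nat \<Rightarrow> ('p, 'n) free_alg) \<Rightarrow> 'm" where
  "ev u = (\<Oplus>\<^bsub>M\<^esub>k\<in>{..<rk}. act (u k) (gen_list ! k))"

definition tuples :: "nat \<Rightarrow> (nat \<Rightarrow> ('p, 'n) free_alg) set" where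
  "tuples i = {u. \<forall>k<rk. u k \<in> free_upto i}"

text \<open>The product of the Bernstein step of degree i with \<open>gens\<close>. Written as an
  image of tuples, it exhibits the relations of the graded module as the tuples that
  \<open>ev\<close> sends into the previous step.\<close>

definition \<Omega> :: "nat \<Rightarrow> 'm set" where
  "\<Omega> i = ev ` tuples i"

lemma stable_weight: "(c :: 'n \<Rightarrow> nat) \<in> digits CARD('p) \<Longrightarrow> stable \<le> i \<Longrightarrow> weight c + 1 \<le> i"
proof -
  assume "c \<in> digits CARD('p)" "stable \<le> i"
  from weight_digits_le[OF this(1)] this(2) show "weight c + 1 \<le> i" unfolding stable by simp
qed

lemma finite_gens: "finite gens"
proof -
  have "gens = (\<lambda>(a, s). mon a s) ` ({a. weight a \<le> \<delta> + 2} \<times> S)" by (auto simp: gens_def)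
  then show ?thesis
    by (simp only:) (intro finite_imageI finite_cartesian_product finite_S finite_weight_le)
qed

lemma gens_closed: "gens \<subseteq> carrier M"
  using S_closed by (auto simp: gens_def)

lemma set_gen_list: "set gen_list = gens"
  unfolding gen_list_def by (rule someI_ex) (use finite_list[OF finite_gens] in auto)

lemma gen_list_closed [simp]: "k < rk \<Longrightarrow> gen_list ! k \<in> carrier M"
  using gens_closed set_gen_list nth_mem by blast

lemma ev_closed [simp, intro]: "ev u \<in> carrier M"
  unfolding ev_def by (intro M.finsum_closed) auto

lemma ev_cong: "(\<And>k. k < rk \<Longrightarrow> u k = w k) \<Longrightarrow> ev u = ev w"
  unfolding ev_def by (intro M.finsum_cong') auto

lemma ev_cong_ideal: "(\<And>k. k < rk \<Longrightarrow> u k - w k \<in> frob_ideal) \<Longrightarrow> ev u = ev w"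
  unfolding ev_def by (intro M.finsum_cong') (auto simp: act_cong)

lemma ev_add: "ev (\<lambda>k. u k + w k) = ev u \<oplus>\<^bsub>M\<^esub> ev w"
proof -
  have "ev (\<lambda>k. u k + w k) = (\<Oplus>\<^bsub>M\<^esub>k\<in>{..<rk}. act (u k) (gen_list ! k) \<oplus>\<^bsub>M\<^esub> act (w k) (gen_list ! k))"
    unfolding ev_def by (intro M.finsum_cong') (auto simp: act_add_l)
  then show ?thesis unfolding ev_def by (simp add: M.finsum_addf Pi_def)
qed

lemma ev_mult: "ev (\<lambda>k. a * u k) = act a (ev u)"
proof -
  have "act a (ev u) = (\<Oplus>\<^bsub>M\<^esub>k\<in>{..<rk}. act a (act (u k) (gen_list ! k)))"
    unfolding ev_def by (rule act_finsum) auto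
  also have "\<dots> = ev (\<lambda>k. a * u k)"
    unfolding ev_def by (intro M.finsum_cong') (auto simp: act_mult)
  finally show ?thesis ..
qed

lemma ev_zero [simp]: "ev (\<lambda>_. 0) = \<zero>\<^bsub>M\<^esub>"
proof -
  have "ev (\<lambda>_. 0) = (\<Oplus>\<^bsub>M\<^esub>k\<in>{..<rk}. \<zero>\<^bsub>M\<^esub>)"
    unfolding ev_def by (intro M.finsum_cong') auto
  then show ?thesis by simp
qed

lemma ev_uminus: "ev (\<lambda>k. - u k) = \<ominus>\<^bsub>M\<^esub> ev u"
  using ev_mult[of "- 1" u] by (simp add: act_uminus_l act_one)

lemma ev_diff: "ev (\<lambda>k. u k - w k) = ev u \<ominus>\<^bsub>M\<^esub> ev w"
  using ev_add[of u "\<lambda>k. - w k"] by (simp add: ev_uminus a_minus_def)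

lemma ev_sum: "ev (\<lambda>k. \<Sum>x\<in>A. U x k) = (\<Oplus>\<^bsub>M\<^esub>x\<in>A. ev (U x))"
  by (induction A rule: infinite_finite_induct) (auto simp: ev_add)

lemma ev_single: 
  assumes "k < rk"
  shows "ev (\<lambda>l. if l = k then a else 0) = act a (gen_list ! k)"
proof -
  have "ev (\<lambda>l. if l = k then a else 0) = (\<Oplus>\<^bsub>M\<^esub>l\<in>{..<rk}. if k = l then act a (gen_list ! l) else \<zero>\<^bsub>M\<^esub>)"
    unfolding ev_def by (intro M.finsum_cong') auto
  also have "\<dots> = act a (gen_list ! k)"
    using assms by (intro M.finsum_singleton) auto
  finally show ?thesis .
qed

lemma tuples_zero: "(\<lambda>_. 0) \<in> tuples i"
  by (simp add: tuples_def)

lemma tuples_add: "u \<in> tuples i \<Longrightarrow> w \<in> tuples i \<Longrightarrow> (\<lambda>k. u k + w k) \<in> tuples i"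
  by (simp add: tuples_def free_upto_add)

lemma tuples_diff: "u \<in> tuples i \<Longrightarrow> w \<in> tuples i \<Longrightarrow> (\<lambda>k. u k - w k) \<in> tuples i"
  by (simp add: tuples_def free_upto_diff)

lemma tuples_mult: "a \<in> free_upto i \<Longrightarrow> u \<in> tuples j \<Longrightarrow> (\<lambda>k. a * u k) \<in> tuples (i + j)"
  by (simp add: tuples_def free_upto_mult)

lemma tuples_mono: "i \<le> j \<Longrightarrow> tuples i \<subseteq> tuples j"
  using free_upto_mono by (auto simp: tuples_def)

lemma tuples_sum: "(\<And>x. x \<in> A \<Longrightarrow> U x \<in> tuples i) \<Longrightarrow> (\<lambda>k. \<Sum>x\<in>A. U x k) \<in> tuples i"
  by (auto simp: tuples_def intro: free_upto_sum)

lemma \<Omega>_closed: "\<Omega> i \<subseteq> carrier M"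
  by (auto simp: \<Omega>_def)

lemma \<Omega>_zero: "\<zero>\<^bsub>M\<^esub> \<in> \<Omega> i"
  unfolding \<Omega>_def by (rule image_eqI[where x = "\<lambda>_. 0"]) (simp_all add: tuples_zero)

lemma \<Omega>_add: "x \<in> \<Omega> i \<Longrightarrow> y \<in> \<Omega> i \<Longrightarrow> x \<oplus>\<^bsub>M\<^esub> y \<in> \<Omega> i"
  unfolding \<Omega>_def by (elim imageE, hypsubst, fold ev_add) (intro imageI tuples_add)

lemma \<Omega>_uminus: "x \<in> \<Omega> i \<Longrightarrow> \<ominus>\<^bsub>M\<^esub> x \<in> \<Omega> i"
  using uminus_mem[OF _ \<Omega>_closed \<Omega>_zero \<Omega>_add] .

lemma \<Omega>_mono: "i \<le> j \<Longrightarrow> \<Omega> i \<subseteq> \<Omega> j"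
  unfolding \<Omega>_def using tuples_mono by blast

lemma \<Omega>_act: "a \<in> free_upto i \<Longrightarrow> x \<in> \<Omega> j \<Longrightarrow> act a x \<in> \<Omega> (i + j)"
  unfolding \<Omega>_def by (elim imageE, hypsubst, fold ev_mult) (intro imageI tuples_mult)

lemma finite_\<Omega>: "finite (\<Omega> i)"
proof -
  let ?U = "PiE {..<rk} (\<lambda>_. free_upto i :: ('p, 'n) free_alg set)"
  have "\<Omega> i \<subseteq> ev ` ?U"
  proof
    fix x assume "x \<in> \<Omega> i"
    then obtain u where u: "u \<in> tuples i" "x = ev u" by (auto simp: \<Omega>_def)
    then have "x = ev (restrict u {..<rk})" using ev_cong[of u "restrict u {..<rk}"] by simp
    then show "x \<in> ev ` ?U" using u by (auto simp: tuples_def)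
  qed
  then show ?thesis by (rule finite_subset) (simp add: finite_PiE finite_free_upto)
qed

lemma \<Omega>_word: 
  assumes "g \<in> gens"
  shows "act (free_monomial w) g \<in> \<Omega> (length w)"
proof -
  obtain k where k: "k < rk" "g = gen_list ! k" using assms set_gen_list by (metis in_set_conv_nth)
  then have "act (free_monomial w) g = ev (\<lambda>l. if l = k then free_monomial w else 0)"
    by (simp add: ev_single)
  moreover have "(\<lambda>l. if l = k then free_monomial w else 0) \<in> tuples (length w)"
    by (auto simp: tuples_def)
  ultimately show ?thesis unfolding \<Omega>_def by blast
qed

lemma \<Omega>_least:
  assumes H: "H \<subseteq> carrier M" "\<zero>\<^bsub>M\<^esub> \<in> H" "\<And>x y. x \<in> H \<Longrightarrow> y \<in> H \<Longrightarrow> x \<oplus>\<^bsub>M\<^esub> y \<in> H"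
    and w: "\<And>w g. length w \<le> i \<Longrightarrow> g \<in> gens \<Longrightarrow> act (free_monomial w) g \<in> H"
  shows "\<Omega> i \<subseteq> H"
proof
  fix x assume "x \<in> \<Omega> i"
  then obtain u where u: "u \<in> tuples i" "x = ev u" by (auto simp: \<Omega>_def)
  have "act (u k) (gen_list ! k) \<in> H" if "k < rk" for k
  proof (rule act_mem[OF _ H])
    show "u k \<in> free_upto i" using u that by (simp add: tuples_def)
    show "act (free_monomial v) (gen_list ! k) \<in> H" if "length v \<le> i" for v
      using w[OF that] \<open>k < rk\<close> set_gen_list nth_mem by blast
  qed (use that in auto)
  then show "x \<in> H" unfolding u ev_def by (intro M.finsum_mem H) auto
qed

lemma \<Omega>_mon_le: "s \<in> S \<Longrightarrow> weight a \<le> \<delta> + 2 + i \<Longrightarrow> mon a s \<in> \<Omega> i"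
proof (induction i arbitrary: a)
  case 0
  then have "mon a s \<in> gens" by (auto simp: gens_def)
  then show ?case using \<Omega>_word[of "mon a s" "[]"] gens_closed by auto
next
  case (Suc i)
  show ?case
  proof (cases "weight a > 0")
    case True
    then obtain j b where b: "a = (\<lambda>i. unit_exp j i + b i)" "weight a = Suc (weight b)" by (rule exp_split_unit)
    then have "mon b s \<in> \<Omega> i" using Suc by auto
    from \<Omega>_act[OF _ this, of "free_monomial [X j]" 1] show ?thesis
      using b var_mon[of s j b] Suc S_closed by (auto simp: var_def)
  next
    case False
    then have "mon a s \<in> \<Omega> i" using Suc by auto
    then show ?thesis using \<Omega>_mono[of i "Suc i"] by auto
  qed
qed

lemma \<Omega>_exhaustive: "(\<Union>i. \<Omega> i) = carrier M"
proof (rule frob_generatedD[OF generated])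
  show "S \<subseteq> (\<Union>i. \<Omega> i)"
    using \<Omega>_mon_le[of _ "\<lambda>_. 0" 0] S_closed by fastforce
  show "x \<oplus>\<^bsub>M\<^esub> y \<in> (\<Union>i. \<Omega> i)" if "x \<in> (\<Union>i. \<Omega> i)" "y \<in> (\<Union>i. \<Omega> i)" for x y
  proof -
    from that obtain i j where "x \<in> \<Omega> i" "y \<in> \<Omega> j" by auto
    then have "x \<in> \<Omega> (max i j)" "y \<in> \<Omega> (max i j)" using \<Omega>_mono[of i "max i j"] \<Omega>_mono[of j "max i j"] by auto
    then show ?thesis using \<Omega>_add by blast
  qed
  show "frob x \<in> (\<Union>i. \<Omega> i)" if "x \<in> (\<Union>i. \<Omega> i)" for x
    using that \<Omega>_act[of "free_monomial [Fr]" 1] by (fastforce simp: frob_def)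
  show "var j x \<in> (\<Union>i. \<Omega> i)" if "x \<in> (\<Union>i. \<Omega> i)" for x j
    using that \<Omega>_act[of "free_monomial [X j]" 1] by (fastforce simp: var_def)
qed (use \<Omega>_closed in blast, use \<Omega>_zero in blast)

definition xF :: "('n \<Rightarrow> nat) \<Rightarrow> ('p, 'n) free_alg" where
  "xF c = free_monomial (xword c @ [Fr])"

lemma xF_upto: "xF c \<in> free_upto (weight c + 1)"
  by (simp add: xF_def)

lemma act_xF: "m \<in> carrier M \<Longrightarrow> act (xF c) m = mon c (frob m)"
  by (simp add: xF_def mon_def frob_def act_append)

lemma \<Omega>_xF: "y \<in> \<Omega> j \<Longrightarrow> mon c (frob y) \<in> \<Omega> (weight c + 1 + j)"
  using \<Omega>_act[OF xF_upto, of y j c] \<Omega>_closed[of j] by (auto simp: act_xF subset_iff)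

lemma comb_\<Omega>:
  assumes "stable \<le> i" "\<And>c. c \<in> digits CARD('p) \<Longrightarrow> f c \<in> \<Omega> (i - 1 - weight c)"
  shows "comb f \<in> \<Omega> i"
  unfolding comb_def
proof (rule M.finsum_mem[OF _ \<Omega>_zero \<Omega>_add \<Omega>_closed])
  fix c :: "'n \<Rightarrow> nat" assume c: "c \<in> digits CARD('p)"
  from \<Omega>_xF[OF assms(2)[OF c], of c] show "mon c (frob (f c)) \<in> \<Omega> i"
    using stable_weight[OF c assms(1)] by simp
qed

lemma digit_carry:
  assumes "c \<in> digits CARD('p)"
  obtains (small) "(\<lambda>i. unit_exp j i + c i) \<in> digits CARD('p)" "weight (\<lambda>i. unit_exp j i + c i) = weight c + 1"
  | (carry) c' where "c' \<in> digits CARD('p)" "(\<lambda>i. unit_exp j i + c i) = (\<lambda>i. c' i + CARD('p) * unit_exp j i)"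
      "weight c' + CARD('p) = weight c + 1"
proof (cases "Suc (c j) < CARD('p)")
  case True
  then have "(\<lambda>i. unit_exp j i + c i) \<in> digits CARD('p)" using assms by (auto simp: digits_def unit_exp_def)
  then show ?thesis by (rule small) (simp only: weight_add weight_unit add.commute)
next
  case False
  then have cj: "Suc (c j) = CARD('p)" using assms by (auto simp: digits_def intro!: Suc_leI antisym)
  define c' where "c' = c(j := 0)"
  have "c' \<in> digits CARD('p)" using assms by (auto simp: digits_def c'_def)
  moreover have eq: "(\<lambda>i. unit_exp j i + c i) = (\<lambda>i. c' i + CARD('p) * unit_exp j i)"
    using cj by (auto simp: c'_def unit_exp_def)
  moreover have "weight c' + CARD('p) = weight c + 1"
    using arg_cong[OF eq, of weight] unfolding weight_add weight_mult weight_unit by simp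
  ultimately show ?thesis by (rule carry)
qed

text \<open>Moving \<open>x\<^sub>j\<close> past \<open>x\<^sup>c F\<close> costs nothing extra, since \<open>x\<^sub>j\<^sup>p F = F x\<^sub>j\<close> lowers the complexity.\<close>

lemma word_normal_form:
  assumes "g \<in> gens"
  shows "(\<exists>a s. s \<in> S \<and> weight a \<le> \<delta> + 2 + length w \<and> act (free_monomial w) g = mon a s) \<or>
    (\<exists>c j y. c \<in> digits CARD('p) \<and> y \<in> \<Omega> j \<and> weight c + 1 + j \<le> length w \<and> act (free_monomial w) g = mon c (frob y))"
proof (induction w)
  case Nil
  have "act (free_monomial []) g = g" using assms gens_closed by (auto simp: subset_iff)
  then show ?case using assms by (auto simp: gens_def)
next
  case (Cons l w)
  let ?m = "act (free_monomial w) g"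
  have mc: "?m \<in> carrier M" using assms gens_closed by auto
  show ?case
  proof (cases l)
    case Fr
    have "act (free_monomial (l # w)) g = mon (\<lambda>_. 0) (frob ?m)"
      using assms gens_closed mc Fr by (simp add: act_Cons subset_iff)
    moreover have "(\<lambda>_. 0) \<in> digits CARD('p)" by (simp add: digits_def)
    moreover have "?m \<in> \<Omega> (length w)" using \<Omega>_word assms .
    ultimately show ?thesis by (intro disjI2 exI[of _ "\<lambda>_. 0"] exI[of _ "length w"] exI[of _ ?m]) simp
  next
    case (X j)
    have eq: "act (free_monomial (l # w)) g = var j ?m"
      using assms gens_closed mc X by (simp add: act_Cons subset_iff)
    from Cons show ?thesis
    proof (elim disjE exE conjE)
      fix a s assume a: "s \<in> S" "weight a \<le> \<delta> + 2 + length w" "?m = mon a s"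
      then have "var j ?m = mon (\<lambda>i. unit_exp j i + a i) s" using S_closed by (auto simp: var_mon)
      then show ?thesis unfolding eq using a
        by (intro disjI1 exI[of _ "\<lambda>i. unit_exp j i + a i"] exI[of _ s]) (auto simp: weight_add)
    next
      fix c i y assume c: "c \<in> digits CARD('p)" "y \<in> \<Omega> i" "weight c + 1 + i \<le> length w" "?m = mon c (frob y)"
      then have y: "y \<in> carrier M" using \<Omega>_closed by auto
      have v: "var j ?m = mon (\<lambda>i. unit_exp j i + c i) (frob y)" unfolding c using y by (auto simp: var_mon)
      from c(1) show ?thesis
      proof (cases rule: digit_carry[of c j])
        case small
        then show ?thesis unfolding eq v using c
          by (intro disjI2 exI[of _ "\<lambda>i. unit_exp j i + c i"] exI[of _ i] exI[of _ y]) auto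
      next
        \<comment> \<open>Here x_j^p F = F x_j turns the overflow into a letter acting on y. The
          weight of the digit part falls by p - 1 >= 1, which pays for raising the degree of y by
          one.\<close>
        case (carry c')
        have "mon (\<lambda>i. unit_exp j i + c i) (frob y) = mon c' (frob (mon (unit_exp j) y))"
          unfolding carry(2) using y by (simp add: frob_mon mon_mon)
        moreover have "mon (unit_exp j) y \<in> \<Omega> (1 + i)"
          unfolding var_eq_mon[symmetric] var_def using c by (intro \<Omega>_act) auto
        moreover have "weight c' + 1 + (1 + i) \<le> length (l # w)"
          using carry(3) c(3) prime_card[where 'a = 'p, THEN prime_ge_2_nat] by simp
        ultimately show ?thesis unfolding eq v using carry(1)
          by (intro disjI2 exI[of _ c'] exI[of _ "1 + i"] exI[of _ "mon (unit_exp j) y"]) auto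
      qed
    qed
  qed
qed

text \<open>This is the existence half of the direct sum. By the normal form only the words that end
  up as x^a s are not yet of the shape x^c F(y), and the root converts these.\<close>

lemma \<Omega>_decompose:
  assumes i: "stable \<le> i" and x: "x \<in> \<Omega> i"
  obtains f where "\<And>c. c \<in> digits CARD('p) \<Longrightarrow> f c \<in> \<Omega> (i - 1 - weight c)" "x = comb f"
proof -
  define Q where "Q = {comb f | f. \<forall>c\<in> digits CARD('p). f c \<in> \<Omega> (i - 1 - weight c)}"
  have Qc: "Q \<subseteq> carrier M" unfolding Q_def using \<Omega>_closed by blast
  have Q0: "\<zero>\<^bsub>M\<^esub> \<in> Q"
  proof -
    have "comb (\<lambda>_. \<zero>\<^bsub>M\<^esub>) = \<zero>\<^bsub>M\<^esub>" by (simp add: comb_def)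
    moreover have "comb (\<lambda>_. \<zero>\<^bsub>M\<^esub>) \<in> Q" unfolding Q_def using \<Omega>_zero by blast
    ultimately show ?thesis by simp
  qed
  have Qa: "x \<oplus>\<^bsub>M\<^esub> y \<in> Q" if "x \<in> Q" "y \<in> Q" for x y
  proof -
    from that obtain f g where f: "\<forall>c\<in> digits CARD('p). f c \<in> \<Omega> (i - 1 - weight c)" "x = comb f"
      and g: "\<forall>c\<in> digits CARD('p). g c \<in> \<Omega> (i - 1 - weight c)" "y = comb g" unfolding Q_def by blast
    then have "x \<oplus>\<^bsub>M\<^esub> y = comb (\<lambda>c. f c \<oplus>\<^bsub>M\<^esub> g c)"
      using \<Omega>_closed by (subst comb_add) (auto simp: Pi_def subset_iff)
    moreover have "\<forall>c\<in> digits CARD('p). f c \<oplus>\<^bsub>M\<^esub> g c \<in> \<Omega> (i - 1 - weight c)" using f g \<Omega>_add by auto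
    ultimately show ?thesis unfolding Q_def by blast
  qed
  have Q1: "mon c (frob y) \<in> Q" if "c \<in> digits CARD('p)" "y \<in> \<Omega> j" "weight c + 1 + j \<le> i" for c y j
  proof -
    have "y \<in> \<Omega> (i - 1 - weight c)" using that \<Omega>_mono[of j "i - 1 - weight c"]
      by (auto simp: subset_iff)
    moreover have "y \<in> carrier M" using that \<Omega>_closed by auto
    ultimately have "comb (\<lambda>c'. if c' = c then y else \<zero>\<^bsub>M\<^esub>) \<in> Q"
      unfolding Q_def using \<Omega>_zero
      by (intro CollectI exI[of _ "\<lambda>c'. if c' = c then y else \<zero>\<^bsub>M\<^esub>"]) auto
    then show ?thesis using comb_single[OF that(1)] \<open>y \<in> carrier M\<close> by simp
  qed
  \<comment> \<open>With s a sum of x^b F(t) and a + b = c + p q one has x^(a+b) F(t) = x^c F(x^q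
    t), so only the weight of q has to be bounded.\<close>
  have Q2: "mon a s \<in> Q" if s: "s \<in> S" and a: "weight a \<le> \<delta> + 2 + i" for a s
  proof -
    have s': "s \<in> M.asums (frob_multiples_upto \<delta> S)" using root s by auto
    have fc: "frob_multiples_upto \<delta> S \<subseteq> carrier M" using S_closed by (auto simp: frob_multiples_upto_def)
    have "mon a s \<in> M.asums Q"
    proof (rule M.asums_image[OF fc Qc _ _ _ s'])
      fix z assume "z \<in> frob_multiples_upto \<delta> S"
      then obtain b t where b: "z = mon b (frob t)" "weight b \<le> \<delta>" "t \<in> S" by (auto simp: frob_multiples_upto_def)
      let ?c = "\<lambda>i. (a i + b i) mod CARD('p)" and ?q = "\<lambda>i. (a i + b i) div CARD('p)"
      have ab: "(\<lambda>i. a i + b i) = (\<lambda>i. ?c i + CARD('p) * ?q i)" by auto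
      have t: "t \<in> carrier M" using b S_closed by auto
      have c: "?c \<in> digits CARD('p)" by (auto simp: digits_def)
      have "mon a z = mon ?c (frob (mon ?q t))"
        unfolding b using t by (simp add: mon_mon frob_mon)
      moreover have "mon ?c (frob (mon ?q t)) \<in> Q"
      proof (rule Q1[OF c])
        have "weight a + weight b = weight ?c + CARD('p) * weight ?q"
          using arg_cong[OF ab, of weight] unfolding weight_add weight_mult .
        \<comment> \<open>Halving suffices for every prime, and it replaces the nonlinear term p |q|
          by a linear one.\<close>
        moreover have "2 * weight ?q \<le> CARD('p) * weight ?q"
          using prime_card[where 'a = 'p, THEN prime_ge_2_nat] by simp
        ultimately have "weight ?q \<le> \<delta> + 2 + (i - 1 - weight ?c)"
          using a b(2) stable_weight[OF c i] by linarith
        then show "mon ?q t \<in> \<Omega> (i - 1 - weight ?c)" by (rule \<Omega>_mon_le[OF b(3)])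
        show "weight ?c + 1 + (i - 1 - weight ?c) \<le> i" using stable_weight[OF c i] by simp
      qed
      ultimately show "mon a z \<in> M.asums Q" using M.asums_superset[OF Qc] by auto
    qed (auto simp: mon_add)
    then show ?thesis using M.asums_least[OF order.refl Q0 Qa] by blast
  qed
  have "\<Omega> i \<subseteq> Q"
  proof (rule \<Omega>_least[OF Qc Q0 Qa])
    fix w :: "'n letter list" and g assume w: "length w \<le> i" and g: "g \<in> gens"
    from word_normal_form[OF g, of w] show "act (free_monomial w) g \<in> Q"
    proof (elim disjE exE conjE)
      fix a s assume "s \<in> S" "weight a \<le> \<delta> + 2 + length w" "act (free_monomial w) g = mon a s"
      then show ?thesis using Q2[of s a] w by simp
    next
      fix c j y assume "c \<in> digits CARD('p)" "y \<in> \<Omega> j" "weight c + 1 + j \<le> length w"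
        "act (free_monomial w) g = mon c (frob y)"
      then show ?thesis using Q1[of c y j] w by simp
    qed
  qed
  then show ?thesis using x that unfolding Q_def by blast
qed

text \<open>Uniqueness of the coefficients upgrades \<open>\<Omega>_decompose\<close> from some
  expansion to every expansion, so membership can be tested coefficient by coefficient.\<close>

lemma comb_\<Omega>_iff:
  assumes "stable \<le> i" "f \<in> digits CARD('p) \<rightarrow> carrier M"
  shows "comb f \<in> \<Omega> i \<longleftrightarrow> (\<forall>c\<in> digits CARD('p). f c \<in> \<Omega> (i - 1 - weight c))"
proof
  assume "comb f \<in> \<Omega> i"
  from \<Omega>_decompose[OF assms(1) this] obtain g
    where g: "\<And>c. c \<in> digits CARD('p) \<Longrightarrow> g c \<in> \<Omega> (i - 1 - weight c)" "comb f = comb g" by metis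
  then have "f c = g c" if "c \<in> digits CARD('p)" for c
    using unique[OF assms(2) _ g(2) that] \<Omega>_closed by auto
  then show "\<forall>c\<in> digits CARD('p). f c \<in> \<Omega> (i - 1 - weight c)" using g by auto
qed (use comb_\<Omega> assms in auto)

text \<open>Counting stands in for a direct sum of vector spaces: every step is finite, and
  dimensions are recovered later as exponents of p.\<close>

lemma card_\<Omega>:
  assumes "stable \<le> i"
  shows "card (\<Omega> i) = (\<Prod>c\<in>(digits CARD('p) :: ('n \<Rightarrow> nat) set). card (\<Omega> (i - 1 - weight c)))"
proof -
  let ?P = "PiE (digits CARD('p) :: ('n \<Rightarrow> nat) set) (\<lambda>c. \<Omega> (i - 1 - weight c))"
  have Pc: "f \<in> ?P \<Longrightarrow> f \<in> digits CARD('p) \<rightarrow> carrier M" for f using \<Omega>_closed by (auto simp: PiE_def Pi_def)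
  have "bij_betw comb ?P (\<Omega> i)"
  proof (rule bij_betw_imageI)
    show "inj_on comb ?P"
    proof (rule inj_onI)
      fix f g assume fg: "f \<in> ?P" "g \<in> ?P" "comb f = comb g"
      show "f = g" by (rule PiE_ext[OF fg(1,2)]) (rule unique[OF Pc Pc], use fg in auto)
    qed
    show "comb ` ?P = \<Omega> i"
    proof
      show "comb ` ?P \<subseteq> \<Omega> i" using comb_\<Omega>[OF assms] by (auto simp: PiE_def Pi_def)
      show "\<Omega> i \<subseteq> comb ` ?P"
      proof
        fix x assume "x \<in> \<Omega> i"
        from \<Omega>_decompose[OF assms this] obtain f
          where f: "\<And>c. c \<in> digits CARD('p) \<Longrightarrow> f c \<in> \<Omega> (i - 1 - weight c)" "x = comb f" by metis
        have "comb f = comb (restrict f (digits CARD('p)))"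
          unfolding comb_def using f(1)[THEN subsetD[OF \<Omega>_closed]] by (intro M.finsum_cong') auto
        then show "x \<in> comb ` ?P" using f by auto
      qed
    qed
  qed
  from bij_betw_same_card[OF this] show ?thesis by (simp add: card_PiE finite_digits)
qed

end

text \<open>Splits off the first letter of every word, with a' receiving the empty word. The
  induction in \<open>relations_generated\<close> then only has to follow left multiplication by one
  letter.\<close>

lemma free_upto_Suc:
  assumes "(a :: ('p::prime_card, 'n::finite) free_alg) \<in> free_upto (Suc d)"
  shows "\<exists>a' \<in> free_upto d. \<exists>f \<in> free_upto d. \<exists>b. (\<forall>j. b j \<in> free_upto d) \<and>
    a = a' + (\<Sum>j\<in>UNIV. free_monomial [X j] * b j) + free_monomial [Fr] * f"
  using assms
proof (induction rule: free_upto_induct)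
  case zero
  show ?case by (intro bexI[of _ 0] exI[of _ "\<lambda>_. 0"]) auto
next
  case (add x y)
  then obtain a f b a' f' b' where "a \<in> free_upto d" "f \<in> free_upto d" "\<forall>j. b j \<in> free_upto d"
      "x = a + (\<Sum>j\<in>UNIV. free_monomial [X j] * b j) + free_monomial [Fr] * f"
    and "a' \<in> free_upto d" "f' \<in> free_upto d" "\<forall>j. b' j \<in> free_upto d"
      "y = a' + (\<Sum>j\<in>UNIV. free_monomial [X j] * b' j) + free_monomial [Fr] * f'" by blast
  then show ?case
    by (intro bexI[of _ "a + a'"] bexI[of _ "f + f'"] exI[of _ "\<lambda>j. b j + b' j"])
      (auto simp: algebra_simps sum.distrib intro: free_upto_add)
next
  case (monomial w)
  show ?case
  proof (cases w)
    case Nil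
    then show ?thesis by (intro bexI[of _ "free_monomial w"] bexI[of _ 0] exI[of _ "\<lambda>_. 0"]) auto
  next
    case (Cons l v)
    with monomial have v: "free_monomial v \<in> (free_upto d :: ('p, 'n) free_alg set)" by simp
    show ?thesis
    proof (cases l)
      case Fr
      then show ?thesis using v Cons
        by (intro bexI[of _ 0] bexI[of _ "free_monomial v"] exI[of _ "\<lambda>_. 0"]) (auto simp flip: free_monomial_append)
    next
      case (X j)
      have "(\<Sum>i\<in>UNIV. free_monomial [X i] * (if i = j then free_monomial v else 0))
          = (\<Sum>i\<in>UNIV. if j = i then free_monomial [X i] * free_monomial v else (0 :: ('p, 'n) free_alg))"
        by (rule sum.cong) auto
      then show ?thesis using v Cons X
        by (intro bexI[of _ 0] exI[of _ "\<lambda>i. if i = j then free_monomial v else 0"])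
          (auto simp flip: free_monomial_append)
    qed
  qed
qed

section \<open>Relations of the graded module come from bounded degree\<close>

context frob_root
begin

definition \<Omega>_pred :: "nat \<Rightarrow> 'm set" where
  "\<Omega>_pred d = filt_pred M \<Omega> d"

lemma \<Omega>_pred_simps [simp]: "\<Omega>_pred 0 = {\<zero>\<^bsub>M\<^esub>}" "\<Omega>_pred (Suc d) = \<Omega> d"
  by (simp_all add: \<Omega>_pred_def filt_pred_def)

text \<open>The carry of \<open>digit_carry\<close>, now for words modulo the defining relations. In
  the second case the right-hand word is shorter than the left-hand one, so the product of x_j and
  x^c F vanishes in the associated graded ring.\<close>

lemma xF_reorder:
  assumes "c \<in> digits CARD('p)"
  obtains (small) c' where "c' \<in> digits CARD('p)" "weight c' = weight c + 1"
      "free_monomial [X j] * xF c - xF c' \<in> (frob_ideal :: ('p, 'n) free_alg set)"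
  | (carry) c' where "weight c' + CARD('p) = weight c + 1"
      "free_monomial [X j] * xF c - xF c' * free_monomial [X j] \<in> (frob_ideal :: ('p, 'n) free_alg set)"
proof -
  have m1: "mset (X j # xword c) = mset (xword (\<lambda>i. unit_exp j i + c i))"
    using mset_xword_add[of "unit_exp j" c] by (simp add: xword_unit)
  have s1: "set (X j # xword c) \<subseteq> range X" using set_xword by auto
  from frob_ideal_closed(3)[OF free_monomial_perm[OF m1 s1], of "free_monomial [Fr]"]
  have 1: "free_monomial [X j] * xF c - xF (\<lambda>i. unit_exp j i + c i) \<in> (frob_ideal :: ('p, 'n) free_alg set)"
    by (simp add: xF_def left_diff_distrib flip: free_monomial_append)
  from assms show ?thesis
  proof (cases rule: digit_carry[of c j])
    case small
    with 1 show ?thesis by (intro that(1)) auto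
  next
    case (carry c')
    have "mset (xword (\<lambda>i. CARD('p) * unit_exp j i)) = mset (replicate CARD('p) (X j))"
      by (rule multiset_eqI) (auto simp: count_xword unit_exp_def split: letter.splits)
    then have m2: "mset (xword (\<lambda>i. unit_exp j i + c i)) = mset (xword c' @ replicate CARD('p) (X j))"
      unfolding carry(2) by (simp add: mset_xword_add del: mset_replicate)
    from frob_ideal_closed(3)[OF free_monomial_perm[OF m2 set_xword], of "free_monomial [Fr]"]
    have 2: "xF (\<lambda>i. unit_exp j i + c i) - free_monomial (xword c' @ replicate CARD('p) (X j) @ [Fr])
        \<in> (frob_ideal :: ('p, 'n) free_alg set)"
      by (simp add: xF_def left_diff_distrib flip: free_monomial_append)
    from frob_ideal_closed(2)[OF frob_ideal_relation[of j], of "free_monomial (xword c')"]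
    have 3: "free_monomial (xword c' @ replicate CARD('p) (X j) @ [Fr]) - xF c' * free_monomial [X j]
        \<in> (frob_ideal :: ('p, 'n) free_alg set)"
      by (simp add: xF_def right_diff_distrib flip: free_monomial_append)
    have "free_monomial [X j] * xF c - xF c' * free_monomial [X j] \<in> (frob_ideal :: ('p, 'n) free_alg set)"
      using frob_ideal_closed(1)[OF frob_ideal_closed(1)[OF 1 2] 3] by simp
    with carry(3) show ?thesis by (intro that(2)) auto
  qed
qed

text \<open>\<open>T d\<close> stands for the tuples of degree \<open>d\<close> whose class is a consequence of the relations of
  degree at most \<open>stable\<close>.  Above that degree every tuple can be rewritten as \<open>\<Sum>\<^sub>c x\<^sup>c F w\<^sub>c\<close>, and for
  such a tuple a relation among the generators splits into relations among the \<open>w\<^sub>c\<close>.\<close>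

lemma relations_generated:
  fixes T :: "nat \<Rightarrow> (nat \<Rightarrow> ('p, 'n) free_alg) set"
  assumes T_sub: "\<And>d. T d \<subseteq> tuples d"
    and T_add: "\<And>d u w. u \<in> T d \<Longrightarrow> w \<in> T d \<Longrightarrow> (\<lambda>k. u k + w k) \<in> T d"
    and T_lower: "\<And>d u. u \<in> tuples d \<Longrightarrow> u \<in> T (Suc d)"
    and T_zero: "\<And>d. (\<lambda>_. 0) \<in> T d"
    and T_mult: "\<And>d e a u. a \<in> free_upto e \<Longrightarrow> u \<in> T d \<Longrightarrow> (\<lambda>k. a * u k) \<in> T (e + d)"
    and T_cong: "\<And>d u w. u \<in> T d \<Longrightarrow> w \<in> tuples d \<Longrightarrow> (\<And>k. k < rk \<Longrightarrow> w k - u k \<in> frob_ideal) \<Longrightarrow> w \<in> T d"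
    and T_base: "\<And>d u. d \<le> stable \<Longrightarrow> u \<in> tuples d \<Longrightarrow> ev u \<in> \<Omega>_pred d \<Longrightarrow> u \<in> T d"
    and T_ev: "\<And>d u. u \<in> T d \<Longrightarrow> ev u \<in> \<Omega>_pred d"
    and u: "u \<in> tuples d" "ev u \<in> \<Omega>_pred d"
  shows "u \<in> T d"
proof -
  let ?D = "digits CARD('p) :: ('n \<Rightarrow> nat) set"
  \<comment> \<open>\<open>Red d\<close> consists of the tuples that agree with a sum of x^c F w_c
    up to an element of T d. The goal is that it exhausts \<open>tuples d\<close> once d >=
    \<open>stable\<close>.\<close>
  define Red where "Red d = {u \<in> tuples d. \<exists>w. (\<forall>c\<in>?D. w c \<in> tuples (d - 1 - weight c)) \<and>
      (\<lambda>k. u k - (\<Sum>c\<in>?D. xF c * w c k)) \<in> T d}" for d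
  have xFw: "(\<lambda>k. xF c * w k) \<in> tuples d" if "c \<in> ?D" "w \<in> tuples (d - 1 - weight c)" "stable \<le> d" for c w d
    using tuples_mult[OF xF_upto that(2), of c] stable_weight[OF that(1,3)] by simp
  have Red_T: "u \<in> Red d" if "u \<in> T d" for u d
    using that T_sub tuples_zero unfolding Red_def
    by (intro CollectI conjI exI[of _ "\<lambda>_ _. 0"]) auto
  have Red_add: "(\<lambda>k. u k + v k) \<in> Red d" if uv: "u \<in> Red d" "v \<in> Red d" for u v d
  proof -
    obtain w w' where w: "\<forall>c\<in>?D. w c \<in> tuples (d - 1 - weight c)" "(\<lambda>k. u k - (\<Sum>c\<in>?D. xF c * w c k)) \<in> T d"
      and w': "\<forall>c\<in>?D. w' c \<in> tuples (d - 1 - weight c)" "(\<lambda>k. v k - (\<Sum>c\<in>?D. xF c * w' c k)) \<in> T d"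
      using uv unfolding Red_def by blast
    have "(\<lambda>k. u k + v k - (\<Sum>c\<in>?D. xF c * (w c k + w' c k))) \<in> T d"
      using T_add[OF w(2) w'(2)] by (simp add: algebra_simps sum.distrib)
    moreover have "\<forall>c\<in>?D. (\<lambda>k. w c k + w' c k) \<in> tuples (d - 1 - weight c)" using w w' tuples_add by auto
    moreover have "(\<lambda>k. u k + v k) \<in> tuples d" using uv tuples_add unfolding Red_def by auto
    ultimately show ?thesis unfolding Red_def by (intro CollectI conjI exI[of _ "\<lambda>c k. w c k + w' c k"]) auto
  qed
  have Red_zero: "(\<lambda>_. 0) \<in> Red d" for d by (rule Red_T[OF T_zero])
  have Red_sum: "(\<lambda>k. \<Sum>x\<in>A. U x k) \<in> Red d" if "\<And>x. x \<in> A \<Longrightarrow> U x \<in> Red d" for A :: "'y set" and U d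
    using that by (induction A rule: infinite_finite_induct) (auto intro: Red_add Red_zero)
  have Red_xF: "(\<lambda>k. xF c * w k) \<in> Red d" if c: "c \<in> ?D" "w \<in> tuples (d - 1 - weight c)" "stable \<le> d" for c w d
  proof -
    define W where "W c' = (if c' = c then w else (\<lambda>_. 0))" for c'
    have "(\<Sum>c'\<in>?D. xF c' * W c' k) = (\<Sum>c'\<in>?D. if c = c' then xF c' * w k else 0)" for k
      unfolding W_def by (rule sum.cong) auto
    then have "(\<Sum>c'\<in>?D. xF c' * W c' k) = xF c * w k" for k
      using c(1) by (simp add: finite_digits)
    then have "(\<lambda>k. xF c * w k - (\<Sum>c\<in>?D. xF c * W c k)) \<in> T d" using T_zero by simp
    moreover have "\<forall>c'\<in>?D. W c' \<in> tuples (d - 1 - weight c')" using c tuples_zero by (auto simp: W_def)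
    ultimately show ?thesis using xFw[OF c] unfolding Red_def by blast
  qed
  have Red_cong: "v \<in> Red d" if "u \<in> Red d" "v \<in> tuples d" "\<And>k. k < rk \<Longrightarrow> v k - u k \<in> frob_ideal" "stable \<le> d" for u v d
  proof -
    from that(1) obtain w where w: "\<forall>c\<in>?D. w c \<in> tuples (d - 1 - weight c)" "(\<lambda>k. u k - (\<Sum>c\<in>?D. xF c * w c k)) \<in> T d"
      unfolding Red_def by blast
    have "(\<lambda>k. v k - (\<Sum>c\<in>?D. xF c * w c k)) \<in> T d"
    proof (rule T_cong[OF w(2)])
      show "(\<lambda>k. v k - (\<Sum>c\<in>?D. xF c * w c k)) \<in> tuples d"
        using xFw[OF _ _ that(4)] w(1) by (intro tuples_diff[OF that(2)] tuples_sum) auto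
    qed (use that in auto)
    then show ?thesis using w that(2) unfolding Red_def by blast
  qed
  have Red_X: "(\<lambda>k. free_monomial [X j] * u k) \<in> Red (Suc d)" if u: "u \<in> Red d" "stable \<le> d" for u d j
  proof -
    obtain w where w: "\<forall>c\<in>?D. w c \<in> tuples (d - 1 - weight c)" "(\<lambda>k. u k - (\<Sum>c\<in>?D. xF c * w c k)) \<in> T d"
      using u(1) unfolding Red_def by blast
    have 1: "(\<lambda>k. free_monomial [X j] * (u k - (\<Sum>c\<in>?D. xF c * w c k))) \<in> Red (Suc d)"
      using T_mult[OF _ w(2), of "free_monomial [X j]" 1] by (intro Red_T) simp
    have 2: "(\<lambda>k. free_monomial [X j] * (xF c * w c k)) \<in> Red (Suc d)" if c: "c \<in> ?D" for c
    proof -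
      have wc: "w c \<in> tuples (d - 1 - weight c)" using w c by auto
      have tup: "(\<lambda>k. free_monomial [X j] * (xF c * w c k)) \<in> tuples (Suc d)"
        using tuples_mult[OF _ xFw[OF c wc u(2)], of "free_monomial [X j]" 1] by simp
      have cong: "free_monomial [X j] * (xF c * w c k) - y * w c k \<in> frob_ideal"
        if "free_monomial [X j] * xF c - y \<in> frob_ideal" for y k
        using frob_ideal_closed(3)[OF that, of "w c k"] by (simp add: left_diff_distrib mult.assoc)
      from c show ?thesis
      proof (cases rule: xF_reorder[of c j])
        case (small c')
        have "d - 1 - weight c = Suc d - 1 - weight c'" using small(2) by simp
        with wc have "(\<lambda>k. xF c' * w c k) \<in> Red (Suc d)" using u(2) by (intro Red_xF[OF small(1)]) auto
        from Red_cong[OF this tup cong[OF small(3)]] u(2) show ?thesis by simp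
      next
        \<comment> \<open>After the carry the tuple has degree at most d, so in degree d + 1 it
          counts as zero and lies in T by \<open>T_lower\<close>.\<close>
        case (carry c')
        have "(\<lambda>k. xF c' * (free_monomial [X j] * w c k)) \<in> tuples (weight c' + 1 + (1 + (d - 1 - weight c)))"
          using wc by (intro tuples_mult xF_upto) auto
        moreover have "weight c' + 1 + (1 + (d - 1 - weight c)) \<le> d"
          using carry(1) prime_card[where 'a = 'p, THEN prime_ge_2_nat] stable_weight[OF c u(2)] by simp
        ultimately have "(\<lambda>k. (xF c' * free_monomial [X j]) * w c k) \<in> tuples d"
          using tuples_mono by (auto simp: mult.assoc)
        from Red_cong[OF Red_T[OF T_lower[OF this]] tup cong[OF carry(2)]] u(2) show ?thesis by simp
      qed
    qed
    have "(\<lambda>k. free_monomial [X j] * (u k - (\<Sum>c\<in>?D. xF c * w c k)) + (\<Sum>c\<in>?D. free_monomial [X j] * (xF c * w c k)))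
        \<in> Red (Suc d)"
      by (rule Red_add[OF 1 Red_sum[OF 2]])
    then show ?thesis by (simp add: right_diff_distrib sum_distrib_left)
  qed
  have all_Red: "tuples d \<subseteq> Red d" if "stable \<le> d" for d
    using that
  proof (induction d rule: dec_induct)
    case base
    show ?case
    proof
      fix u assume u: "u \<in> tuples stable"
      then have "ev u \<in> \<Omega> stable" by (auto simp: \<Omega>_def)
      from \<Omega>_decompose[OF order.refl this] obtain f
        where f: "\<And>c. c \<in> ?D \<Longrightarrow> f c \<in> \<Omega> (stable - 1 - weight c)" "ev u = comb f" by metis
      then have "\<forall>c\<in>?D. \<exists>w \<in> tuples (stable - 1 - weight c). f c = ev w" unfolding \<Omega>_def by blast
      then obtain w where w: "\<And>c. c \<in> ?D \<Longrightarrow> w c \<in> tuples (stable - 1 - weight c)" "\<And>c. c \<in> ?D \<Longrightarrow> f c = ev (w c)"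
        by metis
      let ?r = "\<lambda>k. u k - (\<Sum>c\<in>?D. xF c * w c k)"
      have "ev (\<lambda>k. \<Sum>c\<in>?D. xF c * w c k) = comb f"
        unfolding ev_sum comb_def by (intro M.finsum_cong') (auto simp: ev_mult act_xF w(2))
      then have "ev ?r = ev u \<ominus>\<^bsub>M\<^esub> ev u" using ev_diff[of u] f(2) by simp
      then have "ev ?r = \<zero>\<^bsub>M\<^esub>" unfolding a_minus_def using M.r_neg[OF ev_closed] by (rule trans)
      moreover have "?r \<in> tuples stable" using xFw w u by (intro tuples_diff tuples_sum) auto
      moreover have "\<zero>\<^bsub>M\<^esub> \<in> \<Omega>_pred stable" by (cases stable) (auto simp: \<Omega>_zero)
      ultimately have "?r \<in> T stable" by (intro T_base) auto
      then show "u \<in> Red stable" using u w(1) unfolding Red_def by blast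
    qed
  next
    \<comment> \<open>Above \<open>stable\<close> only the first letter matters: shorter words lie
      in T, variables carry \<open>Red\<close> to the next degree, and a word beginning with F
      contributes to the summand with c = 0.\<close>
    case (step d)
    show ?case
    proof
      fix u assume u: "u \<in> tuples (Suc d)"
      define Q where "Q k q \<longleftrightarrow> fst q \<in> free_upto d \<and> fst (snd q) \<in> free_upto d \<and> (\<forall>j. snd (snd q) j \<in> free_upto d) \<and>
          u k = fst q + (\<Sum>j\<in>UNIV. free_monomial [X j] * snd (snd q) j) + free_monomial [Fr] * fst (snd q)" for k q
      have "\<exists>q. Q k q" if "k < rk" for k
      proof -
        have "u k \<in> free_upto (Suc d)" using u that by (simp add: tuples_def)
        from free_upto_Suc[OF this] obtain a f b where "a \<in> free_upto d" "f \<in> free_upto d" "\<forall>j. b j \<in> free_upto d"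
          "u k = a + (\<Sum>j\<in>UNIV. free_monomial [X j] * b j) + free_monomial [Fr] * f" by blast
        then have "Q k (a, f, b)" by (simp add: Q_def)
        then show ?thesis ..
      qed
      then obtain q where q: "\<And>k. k < rk \<Longrightarrow> Q k (q k)" by metis
      define a f b where "a k = fst (q k)" and "f k = fst (snd (q k))" and "b k = snd (snd (q k))" for k
      have ab: "a k \<in> free_upto d \<and> f k \<in> free_upto d \<and> (\<forall>j. b k j \<in> free_upto d) \<and>
          u k = a k + (\<Sum>j\<in>UNIV. free_monomial [X j] * b k j) + free_monomial [Fr] * f k" if "k < rk" for k
        using q[OF that] by (simp add: Q_def a_def f_def b_def)
      have "a \<in> tuples d" "f \<in> tuples d" and b: "\<And>j. (\<lambda>k. b k j) \<in> tuples d" using ab by (auto simp: tuples_def)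
      then have 1: "a \<in> Red (Suc d)" using T_lower Red_T by auto
      have 2: "(\<lambda>k. \<Sum>j\<in>UNIV. free_monomial [X j] * b k j) \<in> Red (Suc d)"
        using step b by (intro Red_sum Red_X) auto
      have x0: "xF (\<lambda>_. 0) = free_monomial [Fr]" by (simp add: xF_def)
      have 3: "(\<lambda>k. free_monomial [Fr] * f k) \<in> Red (Suc d)"
        unfolding x0[symmetric] using \<open>f \<in> tuples d\<close> step by (intro Red_xF) (auto simp: digits_def)
      have "(\<lambda>k. a k + (\<Sum>j\<in>UNIV. free_monomial [X j] * b k j) + free_monomial [Fr] * f k) \<in> Red (Suc d)"
        by (rule Red_add[OF Red_add[OF 1 2] 3])
      then show "u \<in> Red (Suc d)"
        by (rule Red_cong) (use u ab step frob_ideal_closed(4) in auto)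
    qed
  qed
  show ?thesis using u
  proof (induction d arbitrary: u rule: less_induct)
    case (less d)
    show ?case
    proof (cases "d \<le> stable")
      case True
      then show ?thesis using less T_base by auto
    next
      case False
      then have "u \<in> Red d" using all_Red[of d] less by auto
      then obtain w where w: "\<forall>c\<in>?D. w c \<in> tuples (d - 1 - weight c)" "(\<lambda>k. u k - (\<Sum>c\<in>?D. xF c * w c k)) \<in> T d"
        unfolding Red_def by blast
      \<comment> \<open>The sum s of the x^c F w_c is congruent to u, so its value drops to degree d
        - 1. Since still d - 1 >= \<open>stable\<close>, \<open>comb_\<Omega>_iff\<close> applies
        there and lowers the value of every w_c by one step, which is what the induction hypothesis
        asks for.\<close>
      have st: "stable \<le> d - 1" "stable \<le> d" using False by auto
      let ?s = "\<lambda>k. \<Sum>c\<in>?D. xF c * w c k"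
      have pred: "\<Omega>_pred e = \<Omega> (e - 1)" if "e > 0" for e using that by (cases e) auto
      have "ev (\<lambda>k. u k - ?s k) \<in> \<Omega> (d - 1)" "ev u \<in> \<Omega> (d - 1)"
        using T_ev[OF w(2)] less.prems(2) pred False by auto
      then have "ev (\<lambda>k. u k + - (u k - ?s k)) \<in> \<Omega> (d - 1)"
        unfolding ev_add[of u] ev_uminus by (intro \<Omega>_add \<Omega>_uminus)
      moreover have "(\<lambda>k. u k + - (u k - ?s k)) = ?s" by simp
      ultimately have "ev ?s \<in> \<Omega> (d - 1)" by (simp only:)
      moreover have "ev ?s = comb (\<lambda>c. ev (w c))"
        unfolding ev_sum comb_def by (intro M.finsum_cong') (auto simp: ev_mult act_xF)
      ultimately have ew: "ev (w c) \<in> \<Omega> (d - 1 - 1 - weight c)" if "c \<in> ?D" for c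
        using comb_\<Omega>_iff[OF st(1), of "\<lambda>c. ev (w c)"] that by auto
      have "(\<lambda>k. xF c * w c k) \<in> T d" if c: "c \<in> ?D" for c
      proof -
        have le: "weight c + 1 \<le> d - 1" by (rule stable_weight[OF c st(1)])
        then have "d - 1 - 1 - weight c = d - 1 - weight c - 1" "d - 1 - weight c > 0" by auto
        then have "ev (w c) \<in> \<Omega>_pred (d - 1 - weight c)" using ew[OF c] by (simp add: pred)
        then have "w c \<in> T (d - 1 - weight c)" using w(1) c le by (intro less.IH) auto
        from T_mult[OF xF_upto this, of c] show ?thesis using le by simp
      qed
      moreover have "(\<lambda>k. \<Sum>c\<in>A. xF c * w c k) \<in> T d" if "\<And>c. c \<in> A \<Longrightarrow> (\<lambda>k. xF c * w c k) \<in> T d" for A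
        using that by (induction A rule: infinite_finite_induct) (auto intro: T_add T_zero)
      ultimately have "?s \<in> T d" by blast
      from T_add[OF w(2) this] show ?thesis by simp
    qed
  qed
qed

end

section \<open>Quotient modules\<close>

lemma (in abelian_group) mem_coset_self:
  assumes "subgroup N (add_monoid G)" "x \<in> carrier G"
  shows "x \<in> N +>\<^bsub>G\<^esub> x"
  using subgroup.one_closed[OF assms(1)] assms(2) unfolding a_r_coset_def' by force

lemma (in abelian_group) coset_eq_iff:
  assumes "subgroup N (add_monoid G)" "x \<in> carrier G" "y \<in> carrier G"
  shows "N +>\<^bsub>G\<^esub> x = N +>\<^bsub>G\<^esub> y \<longleftrightarrow> x \<ominus> y \<in> N"
proof -
  interpret N: additive_subgroup N G using assms by (simp add: additive_subgroup_def)
  have N: "N \<subseteq> carrier G" by (rule N.a_subset)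
  show ?thesis
  proof
    assume "N +>\<^bsub>G\<^esub> x = N +>\<^bsub>G\<^esub> y"
    moreover have "x \<in> N +>\<^bsub>G\<^esub> x" by (rule mem_coset_self[OF assms(1,2)])
    ultimately obtain n where n: "n \<in> N" "x = n \<oplus> y" unfolding a_r_coset_def' by auto
    then have "x \<ominus> y = n" using assms N by (simp add: minus_eq a_assoc r_neg subset_iff)
    then show "x \<ominus> y \<in> N" using n by simp
  next
    assume d: "x \<ominus> y \<in> N"
    have "x = (x \<ominus> y) \<oplus> y" using assms by (simp add: minus_eq a_assoc l_neg)
    then have "x \<in> N +>\<^bsub>G\<^esub> y" using d unfolding a_r_coset_def' by auto
    then show "N +>\<^bsub>G\<^esub> x = N +>\<^bsub>G\<^esub> y" using a_repr_independence[OF _ assms(3) N.a_subgroup] by simp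
  qed
qed

lemma (in abelian_group) coset_add:
  assumes "subgroup N (add_monoid G)" "x \<in> carrier G" "y \<in> carrier G"
  shows "set_add G (N +>\<^bsub>G\<^esub> x) (N +>\<^bsub>G\<^esub> y) = N +>\<^bsub>G\<^esub> (x \<oplus> y)"
proof -
  interpret N: abelian_subgroup N G
    using assms abelian_group_axioms by (intro abelian_subgroupI3) (simp_all add: additive_subgroup_def)
  show ?thesis by (rule N.a_rcos_sum[OF assms(2,3)])
qed

lemma (in abelian_group) coset_zero:
  assumes "subgroup N (add_monoid G)"
  shows "N +>\<^bsub>G\<^esub> \<zero> = N"
proof -
  have "N \<subseteq> carrier G" using subgroup.subset[OF assms] by simp
  then show ?thesis unfolding a_r_coset_def' by (force simp: subset_iff)
qed

locale module_with_submodule = module R M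
  for R :: "('a, 'r) ring_scheme" (structure) and M :: "('a, 'm) module" (structure) +
  fixes N :: "'m set"
  assumes N: "Module.submodule N R M"
begin

lemma quotient_carrier: "carrier (quotient_module M N) = (\<lambda>x. N +>\<^bsub>M\<^esub> x) ` carrier M"
  by (auto simp: quotient_module_def A_RCOSETS_def')

lemma quotient_add:
  assumes "x \<in> carrier M" "y \<in> carrier M"
  shows "(N +>\<^bsub>M\<^esub> x) \<oplus>\<^bsub>quotient_module M N\<^esub> (N +>\<^bsub>M\<^esub> y) = N +>\<^bsub>M\<^esub> (x \<oplus>\<^bsub>M\<^esub> y)"
  using M.coset_add[OF submodule.axioms(1)[OF N]] assms by (simp add: quotient_module_def)

lemma quotient_zero: "\<zero>\<^bsub>quotient_module M N\<^esub> = N +>\<^bsub>M\<^esub> \<zero>\<^bsub>M\<^esub>"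
  using M.coset_zero[OF submodule.axioms(1)[OF N]] by (simp add: quotient_module_def)

lemma quotient_smult:
  assumes a: "a \<in> carrier R" and x: "x \<in> carrier M"
  shows "a \<odot>\<^bsub>quotient_module M N\<^esub> (N +>\<^bsub>M\<^esub> x) = N +>\<^bsub>M\<^esub> (a \<odot>\<^bsub>M\<^esub> x)"
proof -
  have Nc: "N \<subseteq> carrier M" using submoduleE(1)[OF N] .
  have "N +>\<^bsub>M\<^esub> (a \<odot>\<^bsub>M\<^esub> y) = N +>\<^bsub>M\<^esub> (a \<odot>\<^bsub>M\<^esub> x)" if "y \<in> N +>\<^bsub>M\<^esub> x" for y
  proof -
    obtain n where n: "n \<in> N" "y = n \<oplus>\<^bsub>M\<^esub> x" using \<open>y \<in> _\<close> unfolding a_r_coset_def' by auto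
    have nc: "n \<in> carrier M" using n Nc by auto
    have "a \<odot>\<^bsub>M\<^esub> y \<ominus>\<^bsub>M\<^esub> a \<odot>\<^bsub>M\<^esub> x = a \<odot>\<^bsub>M\<^esub> n"
      using a x nc unfolding n(2) by (simp add: smult_r_distr M.minus_eq M.a_assoc M.r_neg)
    also have "\<dots> \<in> N" using submoduleE(4)[OF N a n(1)] .
    finally show ?thesis
      using M.coset_eq_iff[OF submodule.axioms(1)[OF N]] a x nc n(2) by simp
  qed
  moreover have "x \<in> N +>\<^bsub>M\<^esub> x" by (rule M.mem_coset_self[OF submodule.axioms(1)[OF N] x])
  ultimately have "(\<Union>y\<in>N +>\<^bsub>M\<^esub> x. N +>\<^bsub>M\<^esub> (a \<odot>\<^bsub>M\<^esub> y)) = N +>\<^bsub>M\<^esub> (a \<odot>\<^bsub>M\<^esub> x)" by blast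
  then show ?thesis by (simp add: quotient_module_def)
qed

lemma quotient_module: "module R (quotient_module M N)"
proof -
  note q = quotient_add quotient_zero quotient_smult
  have "abelian_group (quotient_module M N)"
  proof (rule abelian_groupI; (unfold quotient_carrier)?)
    show "\<exists>y\<in>(\<lambda>x. N +>\<^bsub>M\<^esub> x) ` carrier M. y \<oplus>\<^bsub>quotient_module M N\<^esub> x = \<zero>\<^bsub>quotient_module M N\<^esub>"
      if x: "x \<in> (\<lambda>x. N +>\<^bsub>M\<^esub> x) ` carrier M" for x
    proof -
      from x obtain x' where x': "x' \<in> carrier M" "x = N +>\<^bsub>M\<^esub> x'" by auto
      then show ?thesis by (intro bexI[of _ "N +>\<^bsub>M\<^esub> (\<ominus>\<^bsub>M\<^esub> x')"]) (auto simp: q M.l_neg)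
    qed
  qed (auto simp: q M.a_ac)
  then show ?thesis
    by (intro moduleI R.is_cring; (unfold quotient_carrier)?)
      (auto simp: q smult_l_distr smult_r_distr smult_assoc1)
qed

end


section \<open>Vector spaces over a finite field\<close>

lemma (in vectorspace) card_eq_power_dim:
  assumes "finite (carrier V)"
  shows "fin_dim" "card (carrier V) = card (carrier K) ^ dim"
proof -
  have "span (carrier V) = carrier V"
    using in_own_span[of "carrier V"] span_is_subset2[of "carrier V"] by auto
  then show fd: fin_dim using assms unfolding fin_dim_def by auto
  obtain A where A: "finite A" "basis A" using finite_basis_exists[OF fd] by auto
  then have Ac: "A \<subseteq> carrier V" by (simp add: basis_def)
  have "bij_betw (\<lambda>a. lincomb a A) (A \<rightarrow>\<^sub>E carrier K) (carrier V)"
  proof (rule bij_betwI')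
    have ex1: "\<exists>!a. a \<in> A \<rightarrow>\<^sub>E carrier K \<and> lincomb a A = v" if "v \<in> carrier V" for v
      using basis_criterion[OF A(1) Ac] A(2) that by blast
    have cl: "lincomb a A \<in> carrier V" if "a \<in> A \<rightarrow>\<^sub>E carrier K" for a
      using that A Ac by (intro lincomb_closed) auto
    show "lincomb x A = lincomb y A \<longleftrightarrow> x = y" if "x \<in> A \<rightarrow>\<^sub>E carrier K" "y \<in> A \<rightarrow>\<^sub>E carrier K" for x y
      using ex1[OF cl[OF that(1)]] that by metis
    show "\<And>x. x \<in> A \<rightarrow>\<^sub>E carrier K \<Longrightarrow> lincomb x A \<in> carrier V" by (rule cl)
    show "\<exists>x\<in>A \<rightarrow>\<^sub>E carrier K. v = lincomb x A" if "v \<in> carrier V" for v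
      using ex1[OF that] by metis
  qed
  from bij_betw_same_card[OF this] show "card (carrier V) = card (carrier K) ^ dim"
    using A by (simp add: card_PiE dim_basis)
qed

section \<open>Filtered modules and their associated graded modules\<close>

context frob_left_module
begin

lemma fp_space_simps [simp]:
  "carrier (fp_space M) = carrier M" "add (fp_space M) = add M" "zero (fp_space M) = zero M"
  "c \<odot>\<^bsub>fp_space M\<^esub> x = act (Poly_Mapping.single 0 c) x"
  by (simp_all add: restrict_scalars_def act_def fp_to_frob_def)

lemma fp_vectorspace: "vectorspace class_ring (fp_space M)"
proof (unfold vectorspace_def, intro conjI)
  show "field (class_ring :: 'p mod_ring ring)" by (rule class_field)
  show "module class_ring (fp_space M)"
  proof (rule moduleI)
    show "cring (class_ring :: 'p mod_ring ring)" by (rule class_cring.cring_axioms)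
    show "abelian_group (fp_space M)"
      by (rule abelian_groupI) (auto simp: M.a_ac intro!: bexI[of _ "\<ominus>\<^bsub>M\<^esub> _"] M.l_neg)
  qed (auto simp: act_add_l act_add_r act_one single_add mult_single simp flip: act_mult)
qed

end

text \<open>Used twice, for \<Omega> on M and for the Bernstein filtration on the regular module, so
  that the graded ring is computed by the lemmas about graded modules.\<close>

locale frob_filtered = frob_left_module M
  for M :: "(('p::prime_card, 'n::finite) frob_op, 'm) module" +
  fixes W :: "nat \<Rightarrow> 'm set"
  assumes W_closed: "W i \<subseteq> carrier M" and W_zero: "\<zero>\<^bsub>M\<^esub> \<in> W i"
    and W_add: "x \<in> W i \<Longrightarrow> y \<in> W i \<Longrightarrow> x \<oplus>\<^bsub>M\<^esub> y \<in> W i"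
    and W_Suc: "W i \<subseteq> W (Suc i)" and finite_W: "finite (W i)"
    and W_act: "a \<in> free_upto i \<Longrightarrow> x \<in> W j \<Longrightarrow> act a x \<in> W (i + j)"
begin

abbreviation "P \<equiv> filt_pred M W"

definition coset :: "nat \<Rightarrow> 'm \<Rightarrow> 'm set" where
  "coset i x = P i +>\<^bsub>M\<^esub> x"

lemma P_simps [simp]: "P 0 = {\<zero>\<^bsub>M\<^esub>}" "P (Suc i) = W i"
  by (simp_all add: filt_pred_def)

lemma P_sub: "P i \<subseteq> W i"
  using W_zero W_Suc by (cases i) auto

lemma P_closed: "P i \<subseteq> carrier M"
  using P_sub W_closed by blast

lemma P_zero: "\<zero>\<^bsub>M\<^esub> \<in> P i"
  using W_zero by (cases i) auto

lemma P_add: "x \<in> P i \<Longrightarrow> y \<in> P i \<Longrightarrow> x \<oplus>\<^bsub>M\<^esub> y \<in> P i"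
  using W_add by (cases i) auto

lemma W_uminus: "x \<in> W i \<Longrightarrow> \<ominus>\<^bsub>M\<^esub> x \<in> W i"
  using uminus_mem[OF _ W_closed W_zero W_add] .

lemma P_uminus: "x \<in> P i \<Longrightarrow> \<ominus>\<^bsub>M\<^esub> x \<in> P i"
  using uminus_mem[OF _ P_closed P_zero P_add] .

lemma P_subgroup: "subgroup (P i) (add_monoid M)"
  using P_closed P_zero P_add P_uminus
  by (intro M.add.subgroupI) (auto simp: a_inv_def, blast)

lemma act_P: "a \<in> free_upto i \<Longrightarrow> x \<in> P j \<Longrightarrow> act a x \<in> P (i + j)"
  by (cases j) (auto simp: W_act P_zero)

lemma act_P_left: "i > 0 \<Longrightarrow> a \<in> free_upto (i - 1) \<Longrightarrow> x \<in> W j \<Longrightarrow> act a x \<in> P (i + j)"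
  using W_act[of a "i - 1" x j] by (cases i) auto

lemma coset_eq_iff: "x \<in> carrier M \<Longrightarrow> y \<in> carrier M \<Longrightarrow> coset i x = coset i y \<longleftrightarrow> x \<ominus>\<^bsub>M\<^esub> y \<in> P i"
  unfolding coset_def by (rule M.coset_eq_iff[OF P_subgroup])

lemma coset_zero: "coset i \<zero>\<^bsub>M\<^esub> = P i"
  unfolding coset_def by (rule M.coset_zero[OF P_subgroup])

lemma coset_eq_P: "x \<in> carrier M \<Longrightarrow> coset i x = P i \<longleftrightarrow> x \<in> P i"
  using coset_eq_iff[of x "\<zero>\<^bsub>M\<^esub>" i] M.minus_equality[of "\<zero>\<^bsub>M\<^esub>" "\<zero>\<^bsub>M\<^esub>"]
  by (simp add: coset_zero M.minus_eq)

lemma coset_memD: "y \<in> coset i x \<Longrightarrow> \<exists>b\<in>P i. y = b \<oplus>\<^bsub>M\<^esub> x"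
  unfolding coset_def a_r_coset_def' by auto

lemma coset_self: "x \<in> carrier M \<Longrightarrow> x \<in> coset i x"
  unfolding coset_def by (rule M.mem_coset_self[OF P_subgroup])

abbreviation "fpW i \<equiv> (fp_space M)\<lparr>carrier := W i\<rparr>"

lemma fp_submodule:
  assumes "H \<subseteq> carrier M" "\<zero>\<^bsub>M\<^esub> \<in> H" "\<And>x y. x \<in> H \<Longrightarrow> y \<in> H \<Longrightarrow> x \<oplus>\<^bsub>M\<^esub> y \<in> H"
  shows "LinearCombinations.submodule class_ring H (fp_space M)"
proof -
  interpret V: vectorspace class_ring "fp_space M" by (rule fp_vectorspace)
  show ?thesis
    by (rule LinearCombinations.submodule.intro) (use assms const_mem in \<open>auto simp: V.module_axioms\<close>)
qed

lemma fpW_vectorspace: "vectorspace class_ring (fpW i)"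
  using vectorspace.subspace_is_vs[OF fp_vectorspace]
    fp_submodule[OF W_closed W_zero W_add] fp_vectorspace
  by (simp add: VectorSpace.subspace_def)

lemma P_submodule: "Module.submodule (P i) class_ring (fpW i)"
proof -
  interpret V: vectorspace class_ring "fpW i" by (rule fpW_vectorspace)
  have inv: "\<ominus>\<^bsub>fpW i\<^esub> x = \<ominus>\<^bsub>M\<^esub> x" if "x \<in> W i" for x
  proof (rule V.minus_equality)
    show "(\<ominus>\<^bsub>M\<^esub> x) \<oplus>\<^bsub>fpW i\<^esub> x = \<zero>\<^bsub>fpW i\<^esub>" using that W_closed by (auto simp: M.l_neg subset_iff)
  qed (use that W_uminus in auto)
  show ?thesis
    by (rule V.submoduleI) (use P_sub P_zero P_add P_uminus const_mem[OF _ P_closed P_zero P_add] in \<open>auto simp: inv subset_iff\<close>)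
qed

lemma coset_fpW: "P i +>\<^bsub>fpW i\<^esub> x = coset i x"
  by (simp add: coset_def a_r_coset_def r_coset_def)

lemma gr_piece_vectorspace: "vectorspace class_ring (gr_piece M W i)"
proof -
  interpret V: vectorspace class_ring "fpW i" by (rule fpW_vectorspace)
  interpret Q: module_with_submodule class_ring "fpW i" "P i"
    by (intro module_with_submodule.intro module_with_submodule_axioms.intro V.module_axioms P_submodule)
  show ?thesis unfolding gr_piece_def vectorspace_def
    using Q.quotient_module class_field by auto
qed

lemma gr_piece_carrier: "carrier (gr_piece M W i) = coset i ` W i"
proof -
  interpret V: vectorspace class_ring "fpW i" by (rule fpW_vectorspace)
  interpret Q: module_with_submodule class_ring "fpW i" "P i"
    by (intro module_with_submodule.intro module_with_submodule_axioms.intro V.module_axioms P_submodule)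
  show ?thesis unfolding gr_piece_def Q.quotient_carrier by (simp add: coset_fpW)
qed

lemma gr_piece_zero: "\<zero>\<^bsub>gr_piece M W i\<^esub> = P i"
  by (simp add: gr_piece_def quotient_module_def)

lemma gr_piece_add: "x \<in> W i \<Longrightarrow> y \<in> W i \<Longrightarrow> coset i x \<oplus>\<^bsub>gr_piece M W i\<^esub> coset i y = coset i (x \<oplus>\<^bsub>M\<^esub> y)"
proof -
  interpret V: vectorspace class_ring "fpW i" by (rule fpW_vectorspace)
  interpret Q: module_with_submodule class_ring "fpW i" "P i"
    by (intro module_with_submodule.intro module_with_submodule_axioms.intro V.module_axioms P_submodule)
  show "x \<in> W i \<Longrightarrow> y \<in> W i \<Longrightarrow> coset i x \<oplus>\<^bsub>gr_piece M W i\<^esub> coset i y = coset i (x \<oplus>\<^bsub>M\<^esub> y)"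
    unfolding gr_piece_def using Q.quotient_add[of x y] by (simp add: coset_fpW)
qed

lemma gr_piece_finsum:
  assumes "f \<in> A \<rightarrow> W i"
  shows "(\<Oplus>\<^bsub>gr_piece M W i\<^esub>x\<in>A. coset i (f x)) = coset i (\<Oplus>\<^bsub>M\<^esub>x\<in>A. f x)"
proof -
  interpret G: vectorspace class_ring "gr_piece M W i" by (rule gr_piece_vectorspace)
  show ?thesis using assms
  proof (induction A rule: infinite_finite_induct)
    case (insert x F)
    have "(\<Oplus>\<^bsub>M\<^esub>x\<in>F. f x) \<in> W i"
      using insert by (intro M.finsum_mem W_zero W_add W_closed) auto
    moreover have "(\<lambda>x. coset i (f x)) \<in> F \<rightarrow> carrier (gr_piece M W i)" "coset i (f x) \<in> carrier (gr_piece M W i)"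
      using insert by (auto simp: gr_piece_carrier)
    moreover have "f \<in> F \<rightarrow> carrier M" "f x \<in> carrier M" using insert W_closed by auto
    ultimately show ?case using insert by (simp add: gr_piece_add)
  qed (simp_all add: coset_zero gr_piece_zero G.finsum_infinite M.finsum_infinite)
qed

text \<open>Lagrange's theorem for the subgroup P i of W i, whose quotient is a vector space over
  F_p.\<close>

lemma card_W: "CARD('p) ^ vectorspace.dim class_ring (gr_piece M W i) * card (P i) = card (W i)"
proof -
  interpret V: vectorspace class_ring "fpW i" by (rule fpW_vectorspace)
  interpret G: vectorspace class_ring "gr_piece M W i" by (rule gr_piece_vectorspace)
  have sub: "subgroup (P i) (add_monoid (fpW i))" by (rule submodule.axioms(1)[OF P_submodule])
  have "carrier (gr_piece M W i) = a_rcosets\<^bsub>fpW i\<^esub> P i" by (simp add: gr_piece_def quotient_module_def)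
  then have "card (carrier (gr_piece M W i)) * card (P i) = card (W i)"
    using V.add.lagrange[OF sub] by (simp add: A_RCOSETS_def Coset.order_def)
  moreover have "finite (carrier (gr_piece M W i))" by (simp add: gr_piece_carrier finite_W)
  moreover have "CARD('p mod_ring) = CARD('p)" by (rule CARD_mod_ring)
  ultimately show ?thesis using G.card_eq_power_dim(2) by simp
qed

end

section \<open>The Bernstein filtration and its associated graded ring\<close>

lemma carrier_frob_ring: "carrier frob_ring = range (frob_class :: ('p::prime_card, 'n::finite) free_alg \<Rightarrow> _)"
  by (auto simp: frob_ring_def FactRing_def A_RCOSETS_def' frob_class_def)

lemma frob_class_eq_iff: "frob_class a = frob_class b \<longleftrightarrow> a - b \<in> frob_ideal"
proof
  assume eq: "frob_class a = frob_class b"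
  have "a \<in> frob_class a" unfolding frob_class_def a_r_coset_def' using frob_ideal_closed(4) by force
  then show "a - b \<in> frob_ideal" unfolding eq unfolding frob_class_def a_r_coset_def' by auto
qed (rule frob_class_eqI)

lemma left_module_regular: "left_module frob_ring (regular_module frob_ring)"
proof -
  interpret ring frob_ring by (rule ring_frob_ring)
  have "abelian_group (regular_module frob_ring)"
  proof (rule abelian_groupI)
    fix x assume x: "x \<in> carrier (regular_module frob_ring)"
    show "\<exists>y\<in>carrier (regular_module frob_ring). y \<oplus>\<^bsub>regular_module frob_ring\<^esub> x = \<zero>\<^bsub>regular_module frob_ring\<^esub>"
      using x by (intro bexI[of _ "\<ominus>\<^bsub>frob_ring\<^esub> x"]) (simp_all add: regular_module_def l_neg)
  qed (simp_all add: regular_module_def a_ac)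
  then show ?thesis
    unfolding left_module_def left_module_axioms_def using ring_axioms
    by (simp add: regular_module_def l_distr r_distr m_assoc)
qed

interpretation Reg: frob_left_module "regular_module frob_ring"
  by (rule frob_left_module.intro[OF left_module_regular])

lemma Reg_simps:
  "carrier (regular_module frob_ring) = range frob_class"
  "\<zero>\<^bsub>regular_module frob_ring\<^esub> = frob_class 0"
  "frob_class a \<oplus>\<^bsub>regular_module frob_ring\<^esub> frob_class b = frob_class (a + b)"
  "Reg.act a (frob_class b) = frob_class (a * b)"
proof -
  note h = ring_hom_zero[OF frob_class_hom class_ring.ring_axioms ring_frob_ring]
    ring_hom_add[OF frob_class_hom] ring_hom_mult[OF frob_class_hom]
  show "carrier (regular_module frob_ring) = range frob_class"
    by (simp add: regular_module_def carrier_frob_ring)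
  show "\<zero>\<^bsub>regular_module frob_ring\<^esub> = frob_class 0" using h(1)[symmetric] by (simp add: regular_module_def)
  show "frob_class a \<oplus>\<^bsub>regular_module frob_ring\<^esub> frob_class b = frob_class (a + b)"
    using h(2)[of a b] by (simp add: regular_module_def)
  show "Reg.act a (frob_class b) = frob_class (a * b)"
    unfolding Reg.act_def using h(3)[of a b] by (simp add: regular_module_def)
qed

lemma Reg_finsum: "(\<Oplus>\<^bsub>regular_module frob_ring\<^esub>x\<in>A. frob_class (f x)) = frob_class (sum f A)"
proof (induction A rule: infinite_finite_induct)
  case (infinite A)
  then show ?case by (simp add: Reg.M.finsum_infinite Reg_simps)
next
  case (insert x F)
  then show ?case using Reg.M.finsum_insert[of F x "\<lambda>x. frob_class (f x)"] by (simp add: Reg_simps Pi_def)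
qed (simp add: Reg_simps)

text \<open>The least length in \<open>complexity\<close> is attained, so a monomial of complexity
  at most i is represented by a word of length at most i. This trades the span for the image of
  \<open>free_upto i\<close>, where degrees are visible.\<close>

lemma bernstein_eq: "bernstein i = frob_class ` (free_upto i :: ('p::prime_card, 'n::finite) free_alg set)"
proof -
  let ?V = "fp_space (regular_module (frob_ring :: ('p, 'n) frob_op ring))"
  let ?S = "{u \<in> range frob_monomial. complexity u \<le> i} :: ('p, 'n) frob_op set"
  interpret V: vectorspace class_ring ?V by (rule Reg.fp_vectorspace)
  have S: "?S \<subseteq> carrier ?V" by (auto simp: Reg_simps frob_monomial_def)
  have sm: "LinearCombinations.submodule class_ring (V.span ?S) ?V" by (rule V.span_is_submodule[OF S])
  have "frob_class a \<in> V.span ?S" if "a \<in> free_upto i" for a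
    using that
  proof (induction rule: free_upto_induct)
    case zero
    show ?case using LinearCombinations.submodule.zero_closed[OF sm] by (simp add: Reg_simps)
  next
    case (add x y)
    then show ?case using LinearCombinations.submodule.m_closed[OF sm, of "frob_class x" "frob_class y"] by (simp add: Reg_simps)
  next
    case (monomial w)
    have "complexity (frob_monomial w :: ('p, 'n) frob_op) \<le> length w"
      unfolding complexity_def by (rule Least_le) auto
    then have "frob_monomial w \<in> ?S" using monomial by auto
    then show ?case using V.in_own_span[OF S] by (auto simp: frob_monomial_def)
  qed
  moreover have "V.span ?S \<subseteq> frob_class ` free_upto i"
  proof (rule V.span_is_subset)
    show "?S \<subseteq> frob_class ` free_upto i"
    proof clarify
      fix w :: "'n letter list" assume c: "complexity (frob_monomial w :: ('p, 'n) frob_op) \<le> i"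
      have "\<exists>v. length v = complexity (frob_monomial w :: ('p, 'n) frob_op) \<and> frob_monomial v = (frob_monomial w :: ('p, 'n) frob_op)"
        unfolding complexity_def by (rule LeastI) auto
      then obtain v :: "'n letter list" where v: "length v = complexity (frob_monomial w :: ('p, 'n) frob_op)"
        "frob_monomial v = (frob_monomial w :: ('p, 'n) frob_op)" by blast
      with c have "length v \<le> i" by simp
      with v(2) show "frob_monomial w \<in> (frob_class ` free_upto i :: ('p, 'n) frob_op set)"
        by (metis frob_monomial_def free_upto_monomial imageI)
    qed
    show "LinearCombinations.submodule class_ring (frob_class ` free_upto i) ?V"
    proof (rule LinearCombinations.submodule.intro)
      show "\<And>v w. v \<in> frob_class ` free_upto i \<Longrightarrow> w \<in> frob_class ` free_upto i \<Longrightarrow> v \<oplus>\<^bsub>?V\<^esub> w \<in> frob_class ` free_upto i"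
        by (auto simp: Reg_simps free_upto_add)
      show "\<And>c v. c \<in> carrier class_ring \<Longrightarrow> v \<in> frob_class ` free_upto i \<Longrightarrow> c \<odot>\<^bsub>?V\<^esub> v \<in> frob_class ` free_upto i"
        using free_upto_mult[OF free_upto_const[of _ 0], of _ i] by (auto simp: Reg_simps intro!: imageI)
    qed (auto simp: V.module_axioms Reg_simps)
  qed
  ultimately show ?thesis unfolding bernstein_def by blast
qed

interpretation Reg: frob_filtered "regular_module frob_ring" bernstein
proof (unfold_locales; (unfold bernstein_eq)?)
  show "frob_class ` free_upto i \<subseteq> frob_class ` free_upto (Suc i)" for i
    using free_upto_mono[of i "Suc i"] by auto
qed (auto simp: Reg_simps free_upto_add finite_free_upto free_upto_mult)

section \<open>Representatives in the free algebra for elements of the graded ring\<close>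

definition free_below :: "nat \<Rightarrow> ('p::prime_card, 'n::finite) free_alg set" where
  "free_below i = (case i of 0 \<Rightarrow> {0} | Suc j \<Rightarrow> free_upto j)"

definition bcoset :: "nat \<Rightarrow> ('p::prime_card, 'n::finite) free_alg \<Rightarrow> ('p, 'n) frob_op set" where
  "bcoset i a = Reg.coset i (frob_class a)"

lemma Reg_P: "Reg.P i = frob_class ` free_below i"
  by (cases i) (auto simp: free_below_def bernstein_eq Reg_simps)

lemma bcoset_eq_iff: "bcoset i a = bcoset i b \<longleftrightarrow> (\<exists>e\<in>free_below i. a - b - e \<in> frob_ideal)"
proof -
  have "\<ominus>\<^bsub>regular_module frob_ring\<^esub> frob_class b = frob_class (- b)"
    using Reg.act_uminus_l[of "frob_class b" 1] by (simp add: Reg_simps)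
  then have "frob_class a \<ominus>\<^bsub>regular_module frob_ring\<^esub> frob_class b = frob_class (a - b)"
    by (simp add: Reg_simps a_minus_def)
  then show ?thesis
    unfolding bcoset_def by (subst Reg.coset_eq_iff) (auto simp: Reg_simps Reg_P frob_class_eq_iff)
qed

lemma bcoset_memD: "z \<in> bcoset i a \<Longrightarrow> \<exists>e\<in>free_below i. z = frob_class (e + a)"
  unfolding bcoset_def by (drule Reg.coset_memD) (auto simp: Reg_P Reg_simps)

lemma bcoset_self: "frob_class a \<in> bcoset i a"
  unfolding bcoset_def by (rule Reg.coset_self) (simp add: Reg_simps)

lemma Reg_coset_zero: "Reg.coset i (frob_class 0) = Reg.P i"
  by (metis Reg.coset_zero Reg_simps(2))

text \<open>Power series over the free algebra provide a ready-made associative convolution product.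
  Those with coefficient i in \<open>free_upto i\<close> and finitely many nonzero coefficients
  represent the elements of the graded ring.\<close>

definition bseq :: "('p::prime_card, 'n::finite) free_alg fps set" where
  "bseq = {A. (\<forall>i. fps_nth A i \<in> free_upto i) \<and> (\<exists>N. \<forall>i\<ge>N. fps_nth A i = 0)}"

definition bcls :: "('p::prime_card, 'n::finite) free_alg fps \<Rightarrow> nat \<Rightarrow> ('p, 'n) frob_op set" where
  "bcls A = (\<lambda>i. bcoset i (fps_nth A i))"

context frob_filtered
begin

lemma act_below: "e \<in> free_below i \<Longrightarrow> x \<in> W j \<Longrightarrow> act e x \<in> P (i + j)"
  using act_P_left[of i e x j] P_zero W_closed[of j] by (cases i) (auto simp: free_below_def)

text \<open>The union in \<open>gr_smult\<close> is a single coset: altering a by an element of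
  lower degree, or x by an element of P j, alters the product by an element of P (i + j).\<close>

lemma gr_smult_coset:
  assumes a: "a \<in> free_upto i" and x: "x \<in> W j"
  shows "gr_smult M W i j (bcoset i a) (coset j x) = coset (i + j) (act a x)"
proof -
  have xc: "x \<in> carrier M" using x W_closed by auto
  have "P (i + j) +>\<^bsub>M\<^esub> (a' \<odot>\<^bsub>M\<^esub> x') = coset (i + j) (act a x)" if a': "a' \<in> bcoset i a" and x': "x' \<in> coset j x" for a' x'
  proof -
    obtain e where e: "e \<in> free_below i" "a' = frob_class (e + a)" using bcoset_memD[OF a'] by auto
    obtain y where y: "y \<in> P j" "x' = y \<oplus>\<^bsub>M\<^esub> x" using coset_memD[OF x'] by auto
    have yc: "y \<in> carrier M" using y P_closed by auto
    have x'W: "x' \<in> W j" unfolding y(2) by (rule W_add[OF subsetD[OF P_sub y(1)] x])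
    have x'c: "x' \<in> carrier M" using x'W W_closed by auto
    have "act (e + a) x' = (act e x' \<oplus>\<^bsub>M\<^esub> act a y) \<oplus>\<^bsub>M\<^esub> act a x"
      using x'c yc xc y(2) by (simp add: act_add_l act_add_r M.a_ac)
    moreover have "act e x' \<oplus>\<^bsub>M\<^esub> act a y \<in> P (i + j)"
      using P_add act_below[OF e(1) x'W] act_P[OF a y(1)] by auto
    ultimately have "act (e + a) x' \<ominus>\<^bsub>M\<^esub> act a x \<in> P (i + j)"
      using P_closed x'c yc xc by (simp add: M.minus_eq M.a_assoc M.r_neg subset_iff)
    then have "coset (i + j) (act (e + a) x') = coset (i + j) (act a x)"
      using x'c xc by (simp add: coset_eq_iff)
    then show ?thesis by (simp add: e(2) coset_def act_def)
  qed
  then show ?thesis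
    unfolding gr_smult_def using bcoset_self[of a i] coset_self[OF xc, of j] by blast
qed

definition gcls :: "(nat \<Rightarrow> 'm) \<Rightarrow> nat \<Rightarrow> 'm set" where
  "gcls m = (\<lambda>i. coset i (m i))"

definition gseq :: "(nat \<Rightarrow> 'm) set" where
  "gseq = {m. (\<forall>i. m i \<in> W i) \<and> (\<exists>N. \<forall>i\<ge>N. m i = \<zero>\<^bsub>M\<^esub>)}"

lemma gr_zero: "\<zero>\<^bsub>gr_module M W\<^esub> = (\<lambda>i. P i)"
  by (simp add: gr_module_def gr_piece_zero)

lemma gr_carrier: "carrier (gr_module M W) = gcls ` gseq"
proof
  show "gcls ` gseq \<subseteq> carrier (gr_module M W)"
  proof clarify
    fix m assume m: "m \<in> gseq"
    then obtain N where N: "\<And>i. i \<ge> N \<Longrightarrow> m i = \<zero>\<^bsub>M\<^esub>" unfolding gseq_def by blast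
    then have "{i. gcls m i \<noteq> P i} \<subseteq> {..<N}"
      by (auto simp: gcls_def coset_zero not_le[symmetric])
    then have "finite {i. gcls m i \<noteq> P i}" by (rule finite_subset) simp
    then show "gcls m \<in> carrier (gr_module M W)"
      using m by (auto simp: gr_module_def gr_piece_carrier gr_piece_zero gseq_def gcls_def)
  qed
  show "carrier (gr_module M W) \<subseteq> gcls ` gseq"
  proof
    fix f assume "f \<in> carrier (gr_module M W)"
    then have f: "\<And>i. f i \<in> coset i ` W i" "finite {i. f i \<noteq> P i}"
      by (auto simp: gr_module_def gr_piece_carrier gr_piece_zero)
    \<comment> \<open>A zero class is represented by zero, so that finite support passes from f to
      m.\<close>
    have "\<exists>x\<in>W i. f i = coset i x \<and> (f i = P i \<longrightarrow> x = \<zero>\<^bsub>M\<^esub>)" for i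
      using f(1)[of i] W_zero coset_zero by (cases "f i = P i") auto
    then obtain m where m: "\<And>i. m i \<in> W i \<and> f i = coset i (m i) \<and> (f i = P i \<longrightarrow> m i = \<zero>\<^bsub>M\<^esub>)" by metis
    obtain N where N: "\<forall>i\<in>{i. f i \<noteq> P i}. i < N"
      using f(2) finite_nat_set_iff_bounded by blast
    have "m i = \<zero>\<^bsub>M\<^esub>" if "N \<le> i" for i
    proof -
      have "f i = P i" using N that by fastforce
      then show ?thesis using m[of i] by blast
    qed
    then have "m \<in> gseq" using m unfolding gseq_def by blast
    moreover have "f = gcls m" using m by (auto simp: gcls_def)
    ultimately show "f \<in> gcls ` gseq" by blast
  qed
qed

lemma gr_add: "m \<in> gseq \<Longrightarrow> m' \<in> gseq \<Longrightarrow> gcls m \<oplus>\<^bsub>gr_module M W\<^esub> gcls m' = gcls (\<lambda>i. m i \<oplus>\<^bsub>M\<^esub> m' i)"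
  by (auto simp: gr_module_def gcls_def gseq_def gr_piece_add)

lemma gr_smult:
  assumes "A \<in> bseq" "m \<in> gseq"
  shows "bcls A \<odot>\<^bsub>gr_module M W\<^esub> gcls m = gcls (\<lambda>k. \<Oplus>\<^bsub>M\<^esub>i\<in>{..k}. act (fps_nth A i) (m (k - i)))"
proof
  fix k
  interpret G: vectorspace class_ring "gr_piece M W k" by (rule gr_piece_vectorspace)
  have mem: "act (fps_nth A i) (m (k - i)) \<in> W k" if "i \<le> k" for i
    using W_act[of "fps_nth A i" i "m (k - i)" "k - i"] assms that by (auto simp: bseq_def gseq_def)
  have "(bcls A \<odot>\<^bsub>gr_module M W\<^esub> gcls m) k
      = (\<Oplus>\<^bsub>gr_piece M W k\<^esub>i\<in>{..k}. gr_smult M W i (k - i) (bcls A i) (gcls m (k - i)))"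
    by (simp add: gr_module_def)
  also have "\<dots> = (\<Oplus>\<^bsub>gr_piece M W k\<^esub>i\<in>{..k}. coset k (act (fps_nth A i) (m (k - i))))"
  proof (rule G.finsum_cong')
    fix i assume "i \<in> {..k}"
    then show "gr_smult M W i (k - i) (bcls A i) (gcls m (k - i)) = coset k (act (fps_nth A i) (m (k - i)))"
      using gr_smult_coset[of "fps_nth A i" i "m (k - i)" "k - i"] assms by (auto simp: bseq_def gseq_def bcls_def gcls_def)
  qed (use mem in \<open>auto simp: gr_piece_carrier\<close>)
  also have "\<dots> = coset k (\<Oplus>\<^bsub>M\<^esub>i\<in>{..k}. act (fps_nth A i) (m (k - i)))"
    by (rule gr_piece_finsum) (use mem in auto)
  finally show "(bcls A \<odot>\<^bsub>gr_module M W\<^esub> gcls m) k = gcls (\<lambda>k. \<Oplus>\<^bsub>M\<^esub>i\<in>{..k}. act (fps_nth A i) (m (k - i))) k"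
    by (simp add: gcls_def)
qed

end

lemma bcls_gcls: "bcls A = Reg.gcls (\<lambda>i. frob_class (fps_nth A i))"
  by (simp add: bcls_def Reg.gcls_def bcoset_def)

lemma gseq_bseq: "(\<lambda>i. frob_class (fps_nth A i)) \<in> Reg.gseq" if "A \<in> bseq"
  using that by (fastforce simp: Reg.gseq_def bseq_def bernstein_eq Reg_simps)

lemma bseq_fps:
  shows "0 \<in> bseq" "1 \<in> bseq" "A \<in> bseq \<Longrightarrow> B \<in> bseq \<Longrightarrow> A + B \<in> bseq" "A \<in> bseq \<Longrightarrow> - A \<in> bseq"
    "A \<in> bseq \<Longrightarrow> B \<in> bseq \<Longrightarrow> A * B \<in> bseq"
proof -
  show "0 \<in> bseq" by (simp add: bseq_def)
  show "1 \<in> bseq" by (auto simp: bseq_def fps_one_def intro: exI[of _ 1])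
  show "- A \<in> bseq" if "A \<in> bseq" using that by (auto simp: bseq_def free_upto_uminus)
  show "A + B \<in> bseq" if AB: "A \<in> bseq" "B \<in> bseq"
  proof -
    obtain N N' where "\<forall>i\<ge>N. fps_nth A i = 0" "\<forall>i\<ge>N'. fps_nth B i = 0" using AB by (auto simp: bseq_def)
    then have "\<forall>i\<ge>max N N'. fps_nth (A + B) i = 0" by simp
    then show ?thesis using AB unfolding bseq_def
      by (intro CollectI conjI allI exI[of _ "max N N'"]) (auto intro: free_upto_add)
  qed
  show "A * B \<in> bseq" if AB: "A \<in> bseq" "B \<in> bseq"
  proof -
    obtain N N' where N: "\<forall>i\<ge>N. fps_nth A i = 0" "\<forall>i\<ge>N'. fps_nth B i = 0" using AB by (auto simp: bseq_def)
    have "fps_nth (A * B) k = 0" if "k \<ge> N + N'" for k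
      unfolding fps_mult_nth
    proof (rule sum.neutral, rule ballI)
      fix i assume "i \<in> {0..k}"
      then have "i \<ge> N \<or> k - i \<ge> N'" using that by auto
      then show "fps_nth A i * fps_nth B (k - i) = 0" using N by auto
    qed
    moreover have "fps_nth (A * B) k \<in> free_upto k" for k
      unfolding fps_mult_nth
    proof (rule free_upto_sum)
      fix i assume "i \<in> {0..k}"
      then show "fps_nth A i * fps_nth B (k - i) \<in> free_upto k"
        using free_upto_mult[of "fps_nth A i" i "fps_nth B (k - i)" "k - i"] AB by (auto simp: bseq_def)
    qed
    ultimately show ?thesis unfolding bseq_def by blast
  qed
qed

lemma bernstein_gr_simps:
  fixes A B :: "('p::prime_card, 'n::finite) free_alg fps"
  shows "carrier bernstein_gr = bcls ` (bseq :: ('p, 'n) free_alg fps set)"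
    and "\<one>\<^bsub>bernstein_gr\<^esub> = bcls (1 :: ('p, 'n) free_alg fps)"
    and "\<zero>\<^bsub>bernstein_gr\<^esub> = bcls (0 :: ('p, 'n) free_alg fps)"
    and "A \<in> bseq \<Longrightarrow> B \<in> bseq \<Longrightarrow> bcls A \<oplus>\<^bsub>bernstein_gr\<^esub> bcls B = bcls (A + B)"
    and "A \<in> bseq \<Longrightarrow> B \<in> bseq \<Longrightarrow> bcls A \<otimes>\<^bsub>bernstein_gr\<^esub> bcls B = bcls (A * B)"
proof -
  have "Reg.gcls ` Reg.gseq \<subseteq> bcls ` (bseq :: ('p, 'n) free_alg fps set)"
  proof clarify
    fix m :: "nat \<Rightarrow> ('p, 'n) frob_op" assume m: "m \<in> Reg.gseq"
    have "\<exists>a\<in>free_upto i. m i = frob_class a \<and> (m i = frob_class 0 \<longrightarrow> a = 0)" for i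
    proof (cases "m i = frob_class 0")
      case False
      have "m i \<in> frob_class ` free_upto i" using m unfolding Reg.gseq_def bernstein_eq by blast
      then show ?thesis using False by blast
    qed (intro bexI[of _ 0], simp_all)
    then obtain a where a: "\<And>i. a i \<in> free_upto i \<and> m i = frob_class (a i) \<and> (m i = frob_class 0 \<longrightarrow> a i = 0)" by metis
    from m obtain N where "\<And>i. i \<ge> N \<Longrightarrow> m i = frob_class 0" unfolding Reg.gseq_def Reg_simps by blast
    then have "\<forall>i\<ge>N. a i = 0" using a by blast
    then have "Abs_fps a \<in> bseq" using a by (auto simp: bseq_def)
    moreover have "Reg.gcls m = bcls (Abs_fps a)" using a by (simp add: bcls_gcls flip: a[THEN conjunct2, THEN conjunct1])
    ultimately show "Reg.gcls m \<in> bcls ` bseq" by blast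
  qed
  moreover have "bcls ` (bseq :: ('p, 'n) free_alg fps set) \<subseteq> Reg.gcls ` Reg.gseq" using gseq_bseq by (auto simp: bcls_gcls)
  ultimately show "carrier bernstein_gr = bcls ` (bseq :: ('p, 'n) free_alg fps set)"
    by (simp add: bernstein_gr_def Let_def Reg.gr_carrier)
  show z: "\<zero>\<^bsub>bernstein_gr\<^esub> = bcls (0 :: ('p, 'n) free_alg fps)"
    by (simp add: bernstein_gr_def Let_def Reg.gr_zero bcls_def bcoset_def Reg_coset_zero fun_eq_iff)
  show "\<one>\<^bsub>bernstein_gr\<^esub> = bcls (1 :: ('p, 'n) free_alg fps)"
  proof
    fix i
    have "\<one>\<^bsub>frob_ring\<^esub> = (frob_class 1 :: ('p, 'n) frob_op)"
      using ring_hom_one[OF frob_class_hom[where ?'p = 'p and ?'n = 'n]] by simp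
    moreover have "{\<zero>\<^bsub>frob_ring\<^esub>} +>\<^bsub>frob_ring\<^esub> x = Reg.coset 0 x" for x :: "('p, 'n) frob_op"
      unfolding Reg.coset_def by (simp add: filt_pred_def regular_module_def a_r_coset_def r_coset_def)
    ultimately show "\<one>\<^bsub>bernstein_gr\<^esub> i = bcls (1 :: ('p, 'n) free_alg fps) i"
      using fun_cong[OF z, of i] by (simp add: bernstein_gr_def Let_def bcls_def bcoset_def fps_one_def)
  qed
  show "bcls A \<oplus>\<^bsub>bernstein_gr\<^esub> bcls B = bcls (A + B)" if "A \<in> bseq" "B \<in> bseq"
    using Reg.gr_add[OF gseq_bseq[OF that(1)] gseq_bseq[OF that(2)]]
    by (simp add: bernstein_gr_def Let_def bcls_gcls Reg_simps)
  show "bcls A \<otimes>\<^bsub>bernstein_gr\<^esub> bcls B = bcls (A * B)" if "A \<in> bseq" "B \<in> bseq"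
    using Reg.gr_smult[OF that(1) gseq_bseq[OF that(2)]]
    by (simp add: bernstein_gr_def Let_def bcls_gcls[of B] bcls_gcls[of "A * B"] Reg_simps Reg_finsum fps_mult_nth atLeast0AtMost)
qed

text \<open>The axioms are transported: \<open>bcls\<close> maps the subring \<open>bseq\<close> of
  the power series onto the carrier and respects both operations.\<close>

lemma ring_bernstein_gr: "ring (bernstein_gr :: (nat \<Rightarrow> ('p::prime_card, 'n::finite) frob_op set) ring)"
proof -
  let ?R = "class_ring :: ('p, 'n) free_alg fps ring"
  have "subring bseq ?R"
    by (rule ring.subringI[OF class_ring.ring_axioms]) (auto simp: bseq_fps class_ring_simps)
  then interpret B: ring "?R\<lparr>carrier := bseq\<rparr>" by (rule ring.subring_is_ring[OF class_ring.ring_axioms])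
  have "bcls \<in> Ring.ring_hom (?R\<lparr>carrier := bseq\<rparr>) (bernstein_gr :: (nat \<Rightarrow> ('p, 'n) frob_op set) ring)"
    by (rule ring_hom_memI) (auto simp: bernstein_gr_simps)
  from B.ring_hom_imp_img_ring[OF this] show ?thesis
    by (simp add: bernstein_gr_simps(1)[symmetric] bernstein_gr_simps(3)[symmetric])
qed

definition fps_single :: "nat \<Rightarrow> 'a::zero \<Rightarrow> 'a fps" where
  "fps_single d a = Abs_fps (\<lambda>i. if i = d then a else 0)"

lemma fps_single_mult: "fps_single d a * fps_single e b = fps_single (d + e) (a * b :: 'a::ring_1)"
proof (rule fps_ext)
  fix k
  have "fps_nth (fps_single d a * fps_single e b) k
      = (\<Sum>i\<in>{0..k}. if d = i then (if k - i = e then a * b else 0) else 0)"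
    unfolding fps_mult_nth by (rule sum.cong) (auto simp: fps_single_def)
  also have "\<dots> = fps_nth (fps_single (d + e) (a * b)) k"
    by (auto simp: fps_single_def)
  finally show "fps_nth (fps_single d a * fps_single e b) k = fps_nth (fps_single (d + e) (a * b)) k" .
qed

lemma fps_single_bseq: "a \<in> free_upto d \<Longrightarrow> fps_single d a \<in> bseq"
  unfolding bseq_def by (intro CollectI conjI exI[of _ "Suc d"]) (auto simp: fps_single_def)

lemma bcls_single_cong: "bcoset d a = bcoset d b \<Longrightarrow> bcls (fps_single d a) = bcls (fps_single d b)"
  by (rule ext) (simp add: bcls_def fps_single_def)

sublocale frob_root \<subseteq> frob_filtered M \<Omega>
  by unfold_locales (use \<Omega>_closed \<Omega>_zero \<Omega>_add \<Omega>_mono finite_\<Omega> \<Omega>_act in auto)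

section \<open>Finite presentation of the associated graded module\<close>

context frob_root
begin

abbreviation FS :: "(nat \<Rightarrow> ('p, 'n) frob_op set, nat \<Rightarrow> nat \<Rightarrow> ('p, 'n) frob_op set) module" where
  "FS \<equiv> ring.func_space bernstein_gr {..<rk}"

lemmas FS_def = ring.func_space_def[OF ring_bernstein_gr]

definition tcls :: "(nat \<Rightarrow> ('p, 'n) free_alg fps) \<Rightarrow> nat \<Rightarrow> nat \<Rightarrow> ('p, 'n) frob_op set" where
  "tcls U = (\<lambda>k\<in>{..<rk}. bcls (U k))"

definition tseq :: "(nat \<Rightarrow> ('p, 'n) free_alg fps) set" where
  "tseq = {U. \<forall>k<rk. U k \<in> bseq}"

definition rep :: "(nat \<Rightarrow> ('p, 'n) frob_op set) \<Rightarrow> ('p, 'n) free_alg fps" where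
  "rep f = (SOME A. A \<in> bseq \<and> bcls A = f)"

definition evs :: "(nat \<Rightarrow> ('p, 'n) free_alg fps) \<Rightarrow> nat \<Rightarrow> 'm" where
  "evs U = (\<lambda>i. ev (\<lambda>k. fps_nth (U k) i))"

definition pres :: "(nat \<Rightarrow> nat \<Rightarrow> ('p, 'n) frob_op set) \<Rightarrow> nat \<Rightarrow> 'm set" where
  "pres v = gcls (evs (\<lambda>k. rep (v k)))"

lemma FS_carrier: "carrier FS = tcls ` tseq"
proof
  show "tcls ` tseq \<subseteq> carrier FS"
    by (auto simp: FS_def tcls_def tseq_def bernstein_gr_simps(1))
  show "carrier FS \<subseteq> tcls ` tseq"
  proof
    fix v assume v: "v \<in> carrier FS"
    then have "\<forall>k\<in>{..<rk}. \<exists>A. A \<in> bseq \<and> v k = bcls A" by (auto simp: FS_def bernstein_gr_simps(1))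
    then obtain U where U: "\<And>k. k \<in> {..<rk} \<Longrightarrow> U k \<in> bseq \<and> v k = bcls (U k)" by metis
    have "v = tcls U"
      using v U by (intro ext) (auto simp: tcls_def FS_def PiE_def extensional_def)
    then show "v \<in> tcls ` tseq" using U by (auto simp: tseq_def)
  qed
qed

lemma FS_zero: "\<zero>\<^bsub>FS\<^esub> = tcls (\<lambda>_. 0)"
  by (simp add: FS_def tcls_def bernstein_gr_simps)

lemma FS_add: "U \<in> tseq \<Longrightarrow> V \<in> tseq \<Longrightarrow> tcls U \<oplus>\<^bsub>FS\<^esub> tcls V = tcls (\<lambda>k. U k + V k)"
  by (auto simp: FS_def tcls_def tseq_def bernstein_gr_simps)

lemma FS_smult: "A \<in> bseq \<Longrightarrow> U \<in> tseq \<Longrightarrow> bcls A \<odot>\<^bsub>FS\<^esub> tcls U = tcls (\<lambda>k. A * U k)"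
  by (auto simp: FS_def tcls_def tseq_def bernstein_gr_simps)

lemma tseq_bound:
  assumes "U \<in> tseq"
  shows "\<exists>N. \<forall>k<rk. \<forall>i\<ge>N. fps_nth (U k) i = 0"
proof -
  have "\<forall>k. \<exists>N. k < rk \<longrightarrow> (\<forall>i\<ge>N. fps_nth (U k) i = 0)" using assms by (auto simp: tseq_def bseq_def)
  then obtain n where n: "\<And>k. k < rk \<Longrightarrow> \<forall>i\<ge>n k. fps_nth (U k) i = 0" by metis
  have "n k \<le> Max (n ` {..<rk})" if "k < rk" for k using that by (intro Max_ge) auto
  with n show ?thesis by (intro exI[of _ "Max (n ` {..<rk})"]) (meson order_trans)
qed

lemma evs_gseq: 
  assumes "U \<in> tseq"
  shows "evs U \<in> gseq"
proof -
  obtain N where N: "\<forall>k<rk. \<forall>i\<ge>N. fps_nth (U k) i = 0" using tseq_bound[OF assms] by auto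
  have "evs U i = \<zero>\<^bsub>M\<^esub>" if "i \<ge> N" for i
  proof -
    have "evs U i = ev (\<lambda>_. 0)" unfolding evs_def by (rule ev_cong) (use N that in auto)
    then show ?thesis by simp
  qed
  moreover have "evs U i \<in> \<Omega> i" for i
    using assms by (auto simp: evs_def \<Omega>_def tuples_def tseq_def bseq_def)
  ultimately show ?thesis unfolding gseq_def by blast
qed

lemma ev_below:
  assumes "\<And>k. k < rk \<Longrightarrow> e k \<in> free_below i"
  shows "ev e \<in> P i"
proof (cases i)
  case 0
  then have "ev e = ev (\<lambda>_. 0)" using assms by (intro ev_cong) (auto simp: free_below_def)
  then show ?thesis using 0 by simp
next
  case (Suc j)
  then have "e \<in> tuples j" using assms by (auto simp: tuples_def free_below_def)
  then show ?thesis using Suc by (auto simp: \<Omega>_def)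
qed

text \<open>Makes \<open>pres\<close> independent of the representatives chosen by
  \<open>rep\<close>. Two of them differ by an element of \<open>frob_ideal\<close>, which acts as
  zero, and by one of lower degree, which lands in P i.\<close>

lemma coset_ev_cong:
  assumes "\<And>k. k < rk \<Longrightarrow> bcoset i (a k) = bcoset i (b k)"
  shows "coset i (ev a) = coset i (ev b)"
proof -
  have "\<forall>k. \<exists>e. k < rk \<longrightarrow> e \<in> free_below i \<and> a k - b k - e \<in> frob_ideal"
    using assms by (auto simp: bcoset_eq_iff)
  then obtain e where e: "\<And>k. k < rk \<Longrightarrow> e k \<in> free_below i \<and> a k - b k - e k \<in> frob_ideal" by metis
  have "ev a = ev (\<lambda>k. e k + b k)"
    using e by (intro ev_cong_ideal) (auto simp: algebra_simps)
  then have "ev a \<ominus>\<^bsub>M\<^esub> ev b = ev e"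
    by (simp add: ev_add M.minus_eq M.a_assoc M.r_neg)
  then show ?thesis using ev_below[of e i] e by (simp add: coset_eq_iff)
qed

lemma pres_tcls:
  assumes "U \<in> tseq"
  shows "pres (tcls U) = gcls (evs U)"
proof
  fix i
  have "bcoset i (fps_nth (rep (tcls U k)) i) = bcoset i (fps_nth (U k) i)" if "k < rk" for k
  proof -
    have "\<exists>A. A \<in> bseq \<and> bcls A = tcls U k" using assms that by (auto simp: tseq_def tcls_def)
    then have "rep (tcls U k) \<in> bseq \<and> bcls (rep (tcls U k)) = tcls U k" unfolding rep_def by (rule someI_ex)
    then have "bcls (rep (tcls U k)) i = bcls (U k) i" using that by (simp add: tcls_def)
    then show ?thesis by (simp add: bcls_def)
  qed
  then show "pres (tcls U) i = gcls (evs U) i"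
    unfolding pres_def gcls_def evs_def by (rule coset_ev_cong)
qed

lemma evs_add: "evs (\<lambda>k. U k + V k) = (\<lambda>i. evs U i \<oplus>\<^bsub>M\<^esub> evs V i)"
  by (simp add: evs_def ev_add)

lemma evs_mult: "evs (\<lambda>k. A * U k) = (\<lambda>i. \<Oplus>\<^bsub>M\<^esub>j\<in>{..i}. act (fps_nth A j) (evs U (i - j)))"
  by (simp add: evs_def fps_mult_nth ev_sum ev_mult atLeast0AtMost)

lemma tseq_closed: "U \<in> tseq \<Longrightarrow> V \<in> tseq \<Longrightarrow> (\<lambda>k. U k + V k) \<in> tseq"
  "A \<in> bseq \<Longrightarrow> U \<in> tseq \<Longrightarrow> (\<lambda>k. A * U k) \<in> tseq" "U \<in> tseq \<Longrightarrow> (\<lambda>k. - U k) \<in> tseq" "(\<lambda>_. 0) \<in> tseq"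
  by (auto simp: tseq_def bseq_fps)

lemma pres_hom: "pres \<in> module_hom bernstein_gr FS (gr_module M \<Omega>)"
  unfolding module_hom_def
proof (intro CollectI conjI allI impI funcsetI)
  show "pres v \<in> carrier (gr_module M \<Omega>)" if "v \<in> carrier FS" for v
    using that by (auto simp: FS_carrier pres_tcls gr_carrier evs_gseq)
  show "pres (v \<oplus>\<^bsub>FS\<^esub> w) = pres v \<oplus>\<^bsub>gr_module M \<Omega>\<^esub> pres w" if "v \<in> carrier FS \<and> w \<in> carrier FS" for v w
    using that by (auto simp: FS_carrier FS_add pres_tcls tseq_closed evs_add gr_add evs_gseq)
  show "pres (a \<odot>\<^bsub>FS\<^esub> v) = a \<odot>\<^bsub>gr_module M \<Omega>\<^esub> pres v" if "a \<in> carrier bernstein_gr \<and> v \<in> carrier FS" for a v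
    using that by (auto simp: FS_carrier bernstein_gr_simps(1) FS_smult pres_tcls tseq_closed evs_mult gr_smult evs_gseq)
qed

lemma pres_surj: "pres ` carrier FS = carrier (gr_module M \<Omega>)"
proof
  show "pres ` carrier FS \<subseteq> carrier (gr_module M \<Omega>)"
    using pres_hom by (auto simp: module_hom_def)
  show "carrier (gr_module M \<Omega>) \<subseteq> pres ` carrier FS"
  proof
    fix f assume "f \<in> carrier (gr_module M \<Omega>)"
    then obtain m where m: "m \<in> gseq" "f = gcls m" by (auto simp: gr_carrier)
    have "\<exists>u\<in>tuples i. m i = ev u \<and> (m i = \<zero>\<^bsub>M\<^esub> \<longrightarrow> u = (\<lambda>_. 0))" for i
    proof (cases "m i = \<zero>\<^bsub>M\<^esub>")
      case False
      then show ?thesis using m(1) by (auto simp: gseq_def \<Omega>_def)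
    qed (use tuples_zero in \<open>intro bexI[of _ "\<lambda>_. 0"]; simp\<close>)
    then obtain u where u: "\<And>i. u i \<in> tuples i \<and> m i = ev (u i) \<and> (m i = \<zero>\<^bsub>M\<^esub> \<longrightarrow> u i = (\<lambda>_. 0))" by metis
    define U where "U k = Abs_fps (\<lambda>i. u i k)" for k
    obtain N where "\<And>i. i \<ge> N \<Longrightarrow> m i = \<zero>\<^bsub>M\<^esub>" using m(1) unfolding gseq_def by blast
    then have "\<And>i. i \<ge> N \<Longrightarrow> u i = (\<lambda>_. 0)" using u by blast
    then have "U \<in> tseq" using u by (auto simp: tseq_def bseq_def U_def tuples_def intro!: exI[of _ N])
    moreover have "evs U i = m i" for i using u[of i] by (simp add: evs_def U_def)
    then have "evs U = m" by (rule ext)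
    ultimately show "f \<in> pres ` carrier FS" using m(2) by (auto simp: FS_carrier pres_tcls intro!: image_eqI[where x = "tcls U"])
  qed
qed

definition Ker :: "(nat \<Rightarrow> ('p, 'n) frob_op set, nat \<Rightarrow> nat \<Rightarrow> ('p, 'n) frob_op set) module" where
  "Ker = FS\<lparr>carrier := {v \<in> carrier FS. pres v = \<zero>\<^bsub>gr_module M \<Omega>\<^esub>}\<rparr>"

lemma Ker_carrier: "carrier Ker = tcls ` {U \<in> tseq. \<forall>i. evs U i \<in> P i}"
proof -
  have "pres (tcls U) = \<zero>\<^bsub>gr_module M \<Omega>\<^esub> \<longleftrightarrow> (\<forall>i. evs U i \<in> P i)" if "U \<in> tseq" for U
    using that coset_eq_P by (simp add: pres_tcls gr_zero gcls_def fun_eq_iff evs_def)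
  then show ?thesis by (auto simp: Ker_def FS_carrier)
qed

lemma Ker_simps: "add Ker = add FS" "smult Ker = smult FS" "zero Ker = zero FS"
  by (simp_all add: Ker_def)

lemma Ker_submodule: "Module.submodule (carrier Ker) bernstein_gr Ker"
proof (intro Module.submodule.intro submodule_axioms.intro)
  have "abelian_group Ker"
  proof (rule abelian_groupI; (unfold Ker_carrier Ker_simps)?)
    show "\<zero>\<^bsub>FS\<^esub> \<in> tcls ` {U \<in> tseq. \<forall>i. evs U i \<in> P i}"
      using P_zero tseq_closed by (auto simp: FS_zero evs_def)
    fix x assume x: "x \<in> tcls ` {U \<in> tseq. \<forall>i. evs U i \<in> P i}"
    then obtain U where U: "x = tcls U" "U \<in> tseq" "\<And>i. evs U i \<in> P i" by auto
    have "evs (\<lambda>k. - U k) i \<in> P i" for i using P_uminus[OF U(3)[of i]] by (simp add: evs_def ev_uminus)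
    moreover have "tcls (\<lambda>k. - U k) \<oplus>\<^bsub>FS\<^esub> x = \<zero>\<^bsub>FS\<^esub>"
      unfolding U(1) using U(2) tseq_closed(3)[OF U(2)] by (simp add: FS_add FS_zero)
    ultimately show "\<exists>y\<in>tcls ` {U \<in> tseq. \<forall>i. evs U i \<in> P i}. y \<oplus>\<^bsub>FS\<^esub> x = \<zero>\<^bsub>FS\<^esub>"
      using tseq_closed(3)[OF U(2)] by blast
  qed (auto simp: FS_add FS_zero tseq_closed evs_add P_add add_ac)
  then have "group (add_monoid Ker)" using abelian_group.a_comm_group comm_group.axioms(2) by blast
  from group.subgroup_self[OF this] show "subgroup (carrier Ker) (add_monoid Ker)" by simp
  show "a \<odot>\<^bsub>Ker\<^esub> x \<in> carrier Ker" if a: "a \<in> carrier bernstein_gr" "x \<in> carrier Ker" for a x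
  proof -
    obtain A U where A: "a = bcls A" "A \<in> bseq" and U: "x = tcls U" "U \<in> tseq" "\<And>i. evs U i \<in> P i"
      using a by (auto simp: Ker_carrier bernstein_gr_simps(1))
    have "act (fps_nth A j) (evs U (i - j)) \<in> P i" if "j \<le> i" for i j
      using act_P[of "fps_nth A j" j "evs U (i - j)" "i - j"] A U that by (auto simp: bseq_def)
    then have "evs (\<lambda>k. A * U k) i \<in> P i" for i
      unfolding evs_mult by (intro M.finsum_mem P_zero P_add P_closed) auto
    then show ?thesis using A U tseq_closed by (auto simp: Ker_carrier Ker_simps FS_smult)
  qed
qed

definition hom_tuple :: "nat \<Rightarrow> (nat \<Rightarrow> ('p, 'n) free_alg) \<Rightarrow> nat \<Rightarrow> nat \<Rightarrow> ('p, 'n) frob_op set" where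
  "hom_tuple d u = tcls (\<lambda>k. fps_single d (u k))"

text \<open>All homogeneous relations of degree at most \<open>stable\<close>. Since the field is
  finite, this whole set is finite and can serve as generating set without selecting a
  basis.\<close>

definition relations :: "(nat \<Rightarrow> nat \<Rightarrow> ('p, 'n) frob_op set) set" where
  "relations = (\<Union>d\<in>{..stable}. hom_tuple d ` {u \<in> tuples d. ev u \<in> \<Omega>_pred d})"

lemma single_tseq: "u \<in> tuples d \<Longrightarrow> (\<lambda>k. fps_single d (u k)) \<in> tseq"
  by (auto simp: tuples_def tseq_def fps_single_bseq)

lemma evs_single: "evs (\<lambda>k. fps_single d (u k)) i = (if i = d then ev u else \<zero>\<^bsub>M\<^esub>)"
  by (simp add: evs_def fps_single_def)

lemma hom_tuple_Ker: 
  assumes "u \<in> tuples d" "ev u \<in> \<Omega>_pred d"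
  shows "hom_tuple d u \<in> carrier Ker"
  unfolding hom_tuple_def Ker_carrier
  by (rule imageI) (use assms single_tseq P_zero in \<open>auto simp: evs_single \<Omega>_pred_def\<close>)

lemma finite_relations: "finite relations"
  unfolding relations_def
proof (intro finite_UN_I finite_atMost)
  fix d
  have "hom_tuple d ` {u \<in> tuples d. ev u \<in> \<Omega>_pred d} \<subseteq> hom_tuple d ` (PiE {..<rk} (\<lambda>_. free_upto d))"
  proof clarify
    fix u assume "u \<in> tuples d"
    then have "restrict u {..<rk} \<in> PiE {..<rk} (\<lambda>_. free_upto d)" by (auto simp: tuples_def)
    moreover have "hom_tuple d u = hom_tuple d (restrict u {..<rk})" by (auto simp: hom_tuple_def tcls_def)
    ultimately show "hom_tuple d u \<in> hom_tuple d ` (PiE {..<rk} (\<lambda>_. free_upto d))" by (metis imageI)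
  qed
  then show "finite (hom_tuple d ` {u \<in> tuples d. ev u \<in> \<Omega>_pred d})"
    by (rule finite_subset) (simp add: finite_PiE finite_free_upto)
qed

lemma Ker_generated:
  assumes N: "Module.submodule N bernstein_gr Ker" and rel: "relations \<subseteq> N"
  shows "carrier Ker \<subseteq> N"
proof -
  note sub = submodule.axioms(1)[OF N]
  have N_Ker: "N \<subseteq> carrier Ker" using subgroup.subset[OF sub] by simp
  have N_add: "x \<oplus>\<^bsub>FS\<^esub> y \<in> N" if "x \<in> N" "y \<in> N" for x y
    using subgroup.m_closed[OF sub that] by (simp add: Ker_simps)
  have N_zero: "\<zero>\<^bsub>FS\<^esub> \<in> N" using subgroup.one_closed[OF sub] by (simp add: Ker_simps)
  have N_smult: "bcls A \<odot>\<^bsub>FS\<^esub> x \<in> N" if "A \<in> bseq" "x \<in> N" for A x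
    using Module.submodule.smult_closed[OF N, of "bcls A" x] that by (simp add: Ker_simps bernstein_gr_simps(1))
  \<comment> \<open>The family of \<open>relations_generated\<close> is instantiated with the tuples
    whose homogeneous vector lies in N. Closure comes from the submodule axioms and from vectors of
    lower degree being zero; the base case is the hypothesis that N contains
    \<open>relations\<close>.\<close>
  define T where "T d = {u \<in> tuples d. hom_tuple d u \<in> N}" for d
  have hom_zero: "hom_tuple d u = \<zero>\<^bsub>FS\<^esub>" if "\<And>k. k < rk \<Longrightarrow> u k \<in> free_below d" for d u
  proof -
    have "bcls (fps_single d (u k)) = bcls 0" if k: "k < rk" for k
    proof -
      have "bcoset d (u k) = bcoset d 0"
        unfolding bcoset_eq_iff using \<open>\<And>k. k < rk \<Longrightarrow> u k \<in> free_below d\<close>[OF k] frob_ideal_closed(4)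
        by (intro bexI[of _ "u k"]) auto
      moreover have "fps_single d (0 :: ('p, 'n) free_alg) = 0" by (simp add: fps_single_def fps_eq_iff)
      ultimately show ?thesis using bcls_single_cong by metis
    qed
    then show ?thesis unfolding hom_tuple_def FS_zero tcls_def by (intro restrict_ext) auto
  qed
  have T_all: "u \<in> T d" if u: "u \<in> tuples d" "ev u \<in> \<Omega>_pred d" for d u
  proof (rule relations_generated[OF _ _ _ _ _ _ _ _ u])
    show "T d \<subseteq> tuples d" for d by (auto simp: T_def)
    show "(\<lambda>k. u k + w k) \<in> T d" if "u \<in> T d" "w \<in> T d" for d u w
    proof -
      have "fps_single d (u k + w k) = fps_single d (u k) + fps_single d (w k)" for k
        by (simp add: fps_single_def fps_eq_iff)
      then have "hom_tuple d (\<lambda>k. u k + w k) = hom_tuple d u \<oplus>\<^bsub>FS\<^esub> hom_tuple d w"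
        unfolding hom_tuple_def using that single_tseq by (simp add: FS_add T_def)
      then show ?thesis using that N_add tuples_add by (auto simp: T_def)
    qed
    show "u \<in> T (Suc d)" if "u \<in> tuples d" for d u
      using that hom_zero[of u "Suc d"] N_zero tuples_mono[of d "Suc d"]
      by (auto simp: T_def free_below_def tuples_def)
    show "(\<lambda>_. 0) \<in> T d" for d
      using hom_zero[of "\<lambda>_. 0" d] N_zero tuples_zero by (auto simp: T_def free_below_def split: nat.splits)
    show "(\<lambda>k. a * u k) \<in> T (e + d)" if "a \<in> free_upto e" "u \<in> T d" for d e a u
    proof -
      have "hom_tuple (e + d) (\<lambda>k. a * u k) = bcls (fps_single e a) \<odot>\<^bsub>FS\<^esub> hom_tuple d u"
        unfolding hom_tuple_def using that single_tseq by (simp add: FS_smult T_def fps_single_bseq fps_single_mult)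
      then show ?thesis using that N_smult tuples_mult by (auto simp: T_def fps_single_bseq)
    qed
    show "w \<in> T d" if "u \<in> T d" "w \<in> tuples d" "\<And>k. k < rk \<Longrightarrow> w k - u k \<in> frob_ideal" for d u w
    proof -
      have "bcoset d (w k) = bcoset d (u k)" if "k < rk" for k
        unfolding bcoset_def using frob_class_eqI[OF \<open>\<And>k. k < rk \<Longrightarrow> w k - u k \<in> frob_ideal\<close>[OF that]] by simp
      then have "hom_tuple d w = hom_tuple d u"
        unfolding hom_tuple_def tcls_def by (intro restrict_ext bcls_single_cong) auto
      then show ?thesis using that by (auto simp: T_def)
    qed
    show "u \<in> T d" if "d \<le> stable" "u \<in> tuples d" "ev u \<in> \<Omega>_pred d" for d u
      using that rel by (auto simp: T_def relations_def)
    show "ev u \<in> \<Omega>_pred d" if u: "u \<in> T d" for d u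
    proof -
      have "hom_tuple d u \<in> carrier Ker" using u N_Ker by (auto simp: T_def)
      then have "pres (hom_tuple d u) = \<zero>\<^bsub>gr_module M \<Omega>\<^esub>" by (simp add: Ker_def)
      moreover have "u \<in> tuples d" using u by (simp add: T_def)
      ultimately have "gcls (evs (\<lambda>k. fps_single d (u k))) = (\<lambda>i. P i)"
        unfolding hom_tuple_def by (simp add: pres_tcls single_tseq gr_zero)
      then have "gcls (evs (\<lambda>k. fps_single d (u k))) d = P d" by simp
      then show ?thesis by (simp add: gcls_def evs_single coset_eq_P \<Omega>_pred_def)
    qed
  qed
  show ?thesis
  proof
    fix v assume "v \<in> carrier Ker"
    then obtain U where U: "v = tcls U" "U \<in> tseq" "\<And>i. evs U i \<in> P i" by (auto simp: Ker_carrier)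
    \<comment> \<open>An element of the kernel is the sum of its homogeneous components, each of
      which lies in the kernel; \<open>tr n\<close> collects those of degree below n.\<close>
    define tr where "tr n k = Abs_fps (\<lambda>i. if i < n then fps_nth (U k) i else 0)" for n k
    have tr_seq: "tr n \<in> tseq" for n
      using U(2) unfolding tseq_def bseq_def tr_def
      by (intro CollectI allI impI conjI exI[of _ n]) auto
    have tp: "(\<lambda>k. fps_nth (U k) n) \<in> tuples n" for n using U(2) by (auto simp: tuples_def tseq_def bseq_def)
    have tr_N: "tcls (tr n) \<in> N" for n
    proof (induction n)
      case 0
      have "tr 0 = (\<lambda>_. 0)" by (auto simp: tr_def fps_eq_iff fun_eq_iff)
      then show ?case using N_zero by (simp add: FS_zero)
    next
      case (Suc n)
      have "tr (Suc n) = (\<lambda>k. tr n k + fps_single n (fps_nth (U k) n))"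
        by (auto simp: tr_def fps_single_def fps_eq_iff fun_eq_iff)
      then have "tcls (tr (Suc n)) = tcls (tr n) \<oplus>\<^bsub>FS\<^esub> hom_tuple n (\<lambda>k. fps_nth (U k) n)"
        unfolding hom_tuple_def using tr_seq single_tseq[OF tp] by (simp add: FS_add)
      moreover have "hom_tuple n (\<lambda>k. fps_nth (U k) n) \<in> N"
        using T_all[OF tp, of n] U(3)[of n] by (auto simp: T_def evs_def \<Omega>_pred_def)
      ultimately show ?case using Suc N_add by simp
    qed
    obtain n where n: "\<forall>k<rk. \<forall>i\<ge>n. fps_nth (U k) i = 0" using tseq_bound[OF U(2)] by auto
    have "tr n k = U k" if "k < rk" for k using n that by (auto simp: tr_def fps_eq_iff not_less)
    then have "tcls (tr n) = v" unfolding U(1) tcls_def by (intro restrict_ext) auto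
    then show "v \<in> N" using tr_N[of n] by simp
  qed
qed

lemma gr_finitely_presented: "finitely_presented bernstein_gr (gr_module M \<Omega>)"
proof -
  have "relations \<subseteq> carrier Ker" unfolding relations_def using hom_tuple_Ker by auto
  moreover have "generated_submodule bernstein_gr Ker relations = carrier Ker"
    using Ker_generated Ker_submodule \<open>relations \<subseteq> carrier Ker\<close> unfolding generated_submodule_def by blast
  ultimately have "finitely_generated bernstein_gr Ker"
    unfolding finitely_generated_def using finite_relations by blast
  then show ?thesis
    unfolding finitely_presented_def Ker_def using pres_hom pres_surj by blast
qed

end

section \<open>The Hilbert series\<close>

context frob_filtered
begin

definition gr_dim :: "nat \<Rightarrow> nat" where
  "gr_dim i = vectorspace.dim class_ring (gr_piece M W i)"

lemma card_W_power: "card (W i) = CARD('p) ^ (\<Sum>j\<le>i. gr_dim j)"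
proof (induction i)
  case 0
  then show ?case using card_W[of 0] by (simp add: gr_dim_def)
next
  case (Suc i)
  then show ?case using card_W[of "Suc i"] by (simp add: gr_dim_def power_add mult.commute)
qed

end

context frob_root
begin

text \<open>This is the logarithm to base p of \<open>card_\<Omega>\<close>.\<close>

lemma dim_recursion:
  assumes "stable \<le> i"
  shows "(\<Sum>j\<le>i. gr_dim j) = (\<Sum>c\<in>(digits CARD('p) :: ('n \<Rightarrow> nat) set). \<Sum>j\<le>i - 1 - weight c. gr_dim j)"
proof -
  have "CARD('p) ^ (\<Sum>j\<le>i. gr_dim j)
      = CARD('p) ^ (\<Sum>c\<in>(digits CARD('p) :: ('n \<Rightarrow> nat) set). \<Sum>j\<le>i - 1 - weight c. gr_dim j)"
    using card_\<Omega>[OF assms] by (simp only: card_W_power power_sum)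
  moreover have "CARD('p) > 1" using prime_card[where 'a = 'p, THEN prime_gt_1_nat] .
  ultimately show ?thesis by (meson power_inject_exp)
qed

text \<open>The polynomial \<open>1 - \<Sum>\<^sub>c t\<^bsup>1 + |c|\<^esup>\<close>, whose value at \<open>1\<close> is \<open>1 - p\<^sup>n\<close>, is a denominator of the
  Hilbert series.\<close>

lemma hilbert_no_pole: "rational_without_pole_at (hilbert_series M \<Omega>) 1"
proof -
  let ?D = "digits CARD('p) :: ('n \<Rightarrow> nat) set"
  \<comment> \<open>The recursion governs the dimensions of the steps rather than of the graded
    pieces, so it is applied to the cumulative series G, from which the Hilbert series arises by the
    factor 1 - t.\<close>
  define G :: "rat fps" where "G = Abs_fps (\<lambda>i. of_nat (\<Sum>j\<le>i. gr_dim j))"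
  define Q :: "rat poly" where "Q = 1 - (\<Sum>c\<in>?D. Polynomial.monom 1 (Suc (weight c)))"
  have H: "hilbert_series M \<Omega> = (1 - fps_X) * G"
  proof (rule fps_ext)
    fix i
    show "fps_nth (hilbert_series M \<Omega>) i = fps_nth ((1 - fps_X) * G) i"
      by (cases i) (simp_all add: hilbert_series_def G_def left_diff_distrib gr_dim_def)
  qed
  have QG: "fps_nth (fps_of_poly Q * G) i = 0" if i: "stable \<le> i" for i
  proof -
    have "fps_of_poly Q = 1 - (\<Sum>c\<in>?D. fps_X ^ Suc (weight c))"
      by (simp add: Q_def fps_of_poly_diff fps_of_poly_sum fps_of_poly_monom' del: power_Suc)
    then have "fps_nth (fps_of_poly Q * G) i = fps_nth G i - (\<Sum>c\<in>?D. fps_nth (fps_X ^ Suc (weight c) * G) i)"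
      by (simp add: left_diff_distrib sum_distrib_right fps_sum_nth del: power_Suc)
    also have "(\<Sum>c\<in>?D. fps_nth (fps_X ^ Suc (weight c) * G) i) = (\<Sum>c\<in>?D. fps_nth G (i - 1 - weight c))"
    proof (rule sum.cong)
      fix c :: "'n \<Rightarrow> nat" assume "c \<in> ?D"
      from stable_weight[OF this i] show "fps_nth (fps_X ^ Suc (weight c) * G) i = fps_nth G (i - 1 - weight c)"
        unfolding fps_X_power_mult_nth by simp
    qed simp
    also have "fps_nth G i - \<dots> = 0"
      using dim_recursion[OF i] by (simp add: G_def flip: of_nat_sum)
    finally show ?thesis .
  qed
  \<comment> \<open>By the recursion all coefficients from \<open>stable\<close> on vanish, so Q G
    is this polynomial.\<close>
  define B where "B = Poly (map (fps_nth (fps_of_poly Q * G)) [0..<stable])"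
  have QGB: "fps_of_poly Q * G = fps_of_poly B"
  proof (rule fps_ext)
    fix i show "fps_nth (fps_of_poly Q * G) i = fps_nth (fps_of_poly B) i"
      using QG[of i] by (cases "i < stable") (simp_all add: B_def nth_default_def)
  qed
  have "fps_of_poly Q * hilbert_series M \<Omega> = fps_of_poly ([:1, -1:] * B)"
  proof -
    have "fps_of_poly [:1, -1 :: rat:] = 1 - fps_X"
      by (rule fps_ext) (auto simp: coeff_pCons fps_X_def split: nat.splits)
    then show ?thesis unfolding H fps_of_poly_mult QGB[symmetric] by (simp only: mult_ac)
  qed
  moreover have "poly Q 1 \<noteq> 0"
  proof -
    have "poly Q 1 = 1 - of_nat (CARD('p) ^ CARD('n))"
      by (simp add: Q_def poly_sum poly_monom card_digits)
    moreover have "CARD('p) ^ CARD('n) > 1"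
      using prime_card[where 'a = 'p, THEN prime_gt_1_nat] by (intro one_less_power) auto
    then have "(1 :: rat) < of_nat (CARD('p) ^ CARD('n))"
      using of_nat_less_iff[where ?'a = rat, of 1] by (metis of_nat_1)
    ultimately show ?thesis by simp
  qed
  ultimately show ?thesis unfolding rational_without_pole_at_def by blast
qed

lemma \<Omega>_compatible: "compatible_filtration M \<Omega>"
  unfolding compatible_filtration_def
proof (intro conjI allI ballI)
  fix i j
  show "VectorSpace.subspace class_ring (\<Omega> i) (fp_space M)"
    by (intro VectorSpace.subspace.intro fp_vectorspace fp_submodule \<Omega>_closed \<Omega>_zero \<Omega>_add)
  show "vectorspace.fin_dim class_ring (fpW i)"
    using vectorspace.card_eq_power_dim(1)[OF fpW_vectorspace[of i]] finite_\<Omega> by simp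
  show "\<Omega> i \<subseteq> \<Omega> (Suc i)" by (rule \<Omega>_mono) simp
  show "(\<Union>i. \<Omega> i) = carrier M" by (rule \<Omega>_exhaustive)
  fix b :: "('p, 'n) frob_op" and x assume "b \<in> bernstein i" "x \<in> \<Omega> j"
  then show "b \<odot>\<^bsub>M\<^esub> x \<in> \<Omega> (i + j)"
    using \<Omega>_act unfolding bernstein_eq act_def by auto
qed

lemma F_holonomic: "F_holonomic M"
  unfolding F_holonomic_def great_filtration_def
  using left_module_axioms \<Omega>_compatible gr_finitely_presented hilbert_no_pole by blast

end

text \<open>The interface to both halves: for unit modules the hypotheses come from bijectivity of
  the structure morphism, for local cohomology from a homotopy inverse. The set T from
  \<open>root_exists\<close> contains S, so it still generates M.\<close>

lemma (in frob_left_module) F_holonomic_if_unit: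
  assumes "finite S" "S \<subseteq> carrier M" "frob_generated S"
    and decomp: "\<And>m. m \<in> carrier M \<Longrightarrow> \<exists>f \<in> digits CARD('p) \<rightarrow> carrier M. m = comb f"
    and unique: "\<And>f g c. f \<in> digits CARD('p) \<rightarrow> carrier M \<Longrightarrow> g \<in> digits CARD('p) \<rightarrow> carrier M \<Longrightarrow>
      comb f = comb g \<Longrightarrow> c \<in> digits CARD('p) \<Longrightarrow> f c = g c"
  shows "F_holonomic M"
proof -
  obtain T \<delta> where T: "finite T" "S \<subseteq> T" "T \<subseteq> carrier M" "T \<subseteq> M.asums (frob_multiples_upto \<delta> T)"
    using root_exists[OF assms(1-3) decomp] by blast
  have "frob_generated T"
    unfolding frob_generated_def
  proof (intro allI impI, elim conjE)
    fix H assume "T \<subseteq> H" "H \<subseteq> carrier M" "\<zero>\<^bsub>M\<^esub> \<in> H" "\<forall>x\<in>H. \<forall>y\<in>H. x \<oplus>\<^bsub>M\<^esub> y \<in> H"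
      "\<forall>x\<in>H. frob x \<in> H \<and> (\<forall>j. var j x \<in> H)"
    with T(2) show "H = carrier M" by (intro frob_generatedD[OF assms(3)]) auto
  qed
  then interpret frob_root M T \<delta> "1 + CARD('n) * (CARD('p) - 1)"
    by (intro frob_root.intro frob_left_module_axioms frob_root_axioms.intro)
      (use T unique in \<open>simp_all\<close>)
  show ?thesis by (rule F_holonomic)
qed

section \<open>The polynomial ring over its subring of \<open>p\<close>-th powers\<close>

definition exponent :: "('n::finite \<Rightarrow> nat) \<Rightarrow> 'n \<Rightarrow>\<^sub>0 nat" where
  "exponent c = Abs_poly_mapping c"

lemma lookup_exponent [simp]: "Poly_Mapping.lookup (exponent c) = c"
  unfolding exponent_def by (rule lookup_Abs_poly_mapping) simp

lemma exponent_lookup [simp]: "exponent (Poly_Mapping.lookup a) = a"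
  by (rule poly_mapping_eqI) simp

lemma exponent_add: "exponent (\<lambda>i. a i + b i) = exponent a + exponent b"
  by (rule poly_mapping_eqI) (simp add: lookup_add)

definition pol_mon :: "('n::finite \<Rightarrow> nat) \<Rightarrow> ('p::prime_card, 'n) pol" where
  "pol_mon c = Poly_Mapping.single (exponent c) 1"

lemma pol_mon_add: "pol_mon (\<lambda>i. a i + b i) = pol_mon a * pol_mon b"
  by (simp add: pol_mon_def mult_single exponent_add)

lemma pol_mon_zero [simp]: "pol_mon (\<lambda>_ :: 'n::finite. 0) = (1 :: ('p::prime_card, 'n) pol)"
proof -
  have "exponent (\<lambda>_ :: 'n. 0) = 0" by (rule poly_mapping_eqI) simp
  then show ?thesis by (simp add: pol_mon_def)
qed

lemma pol_mon_unit: "pol_mon (unit_exp j) = pol_var j"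
proof -
  have "exponent (unit_exp j) = Poly_Mapping.single j 1"
    by (rule poly_mapping_eqI) (auto simp: unit_exp_def lookup_single when_def)
  then show ?thesis by (simp add: pol_mon_def pol_var_def)
qed

lemma pol_induct [case_names zero add single]:
  assumes "P 0" "\<And>r s. P r \<Longrightarrow> P s \<Longrightarrow> P (r + s)" "\<And>a d. P (Poly_Mapping.single a d)"
  shows "P (r :: ('p::prime_card, 'n::finite) pol)"
proof -
  have "P (\<Sum>k\<in>A. Poly_Mapping.single k (f k))" for A f
    by (induction A rule: infinite_finite_induct) (auto intro: assms)
  then show ?thesis by (subst pm_sum_singles[of r])
qed

lemma single_eq_const_mon: "Poly_Mapping.single a d = pol_const d * pol_mon (Poly_Mapping.lookup a)"
  by (simp add: pol_const_def pol_mon_def mult_single)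

lemma CHAR_pol: "CHAR(('p::prime_card, 'n::finite) pol) = CARD('p)"
proof (rule CHAR_eqI)
  have *: "(of_nat k :: ('p, 'n) pol) = 0 \<longleftrightarrow> CARD('p) dvd k" for k
  proof -
    have "(of_nat k :: ('p, 'n) pol) = 0 \<longleftrightarrow> (of_nat k :: 'p mod_ring) = 0"
    proof
      assume "(of_nat k :: ('p, 'n) pol) = 0"
      then have "Poly_Mapping.lookup (Poly_Mapping.single 0 (of_nat k) :: ('p, 'n) pol) 0 = 0"
        by (simp add: single_of_nat)
      then show "(of_nat k :: 'p mod_ring) = 0" by (simp only: lookup_single_eq)
    next
      assume "(of_nat k :: 'p mod_ring) = 0"
      then have "(Poly_Mapping.single 0 (of_nat k) :: ('p, 'n) pol) = 0" by (simp only: single_zero)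
      then show "(of_nat k :: ('p, 'n) pol) = 0" by (simp add: single_of_nat)
    qed
    then show ?thesis by (simp add: of_nat_eq_0_iff_char_dvd)
  qed
  show "(of_nat CARD('p) :: ('p, 'n) pol) = 0" using * by simp
  show "CARD('p) dvd k" if "(of_nat k :: ('p, 'n) pol) = 0" for k using * that by simp
qed

lemma frobenius_add: "(r + s :: ('p::prime_card, 'n::finite) pol) ^ CARD('p) = r ^ CARD('p) + s ^ CARD('p)"
  using freshmans_dream[where ?'a = "('p, 'n) pol"] prime_card[where 'a = 'p] by (simp add: CHAR_pol)

lemma mod_ring_power_card: "(c :: 'p::prime_card mod_ring) ^ CARD('p) = c"
proof -
  obtain k where "c = of_nat k" by (rule mod_ring_of_nat)
  moreover have "(of_nat k :: 'p mod_ring) ^ CARD('p) = of_nat k" for k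
    using freshmans_dream[where ?'a = "'p mod_ring"] prime_card[where 'a = 'p]
    by (induction k) (simp_all add: power_0_left)
  ultimately show ?thesis by simp
qed

lemma single_power: "Poly_Mapping.single a d ^ k = Poly_Mapping.single (exponent (\<lambda>i. k * Poly_Mapping.lookup a i)) (d ^ k)"
  for a :: "'n::finite \<Rightarrow>\<^sub>0 nat" and d :: "'p::prime_card mod_ring"
proof (induction k)
  case 0
  have "exponent (\<lambda>i :: 'n. 0) = 0" by (rule poly_mapping_eqI) simp
  then show ?case by simp
next
  case (Suc k)
  then show ?case by (simp add: mult_single exponent_add)
qed

lemma frobenius_single: "Poly_Mapping.single a d ^ CARD('p)
    = Poly_Mapping.single (exponent (\<lambda>i. CARD('p) * Poly_Mapping.lookup a i)) (d :: 'p::prime_card mod_ring)"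
  by (simp add: single_power mod_ring_power_card)

text \<open>\<open>frob_coeff c r\<close> is the coefficient \<open>r\<^sub>c\<close> in \<open>r = \<Sum>\<^sub>c x\<^sup>c r\<^sub>c\<^sup>p\<close>.\<close>

definition frob_coeff :: "('n::finite \<Rightarrow> nat) \<Rightarrow> ('p::prime_card, 'n) pol \<Rightarrow> ('p, 'n) pol" where
  "frob_coeff c r = Abs_poly_mapping (\<lambda>b. Poly_Mapping.lookup r (exponent (\<lambda>i. c i + CARD('p) * Poly_Mapping.lookup b i)))"

lemma lookup_frob_coeff: "Poly_Mapping.lookup (frob_coeff c r) b
    = Poly_Mapping.lookup r (exponent (\<lambda>i. c i + CARD('p) * Poly_Mapping.lookup b i))"
  for r :: "('p::prime_card, 'n::finite) pol"
proof -
  let ?f = "\<lambda>b. exponent (\<lambda>i. c i + CARD('p) * Poly_Mapping.lookup b i)"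
  have "inj ?f"
  proof (rule injI)
    fix b b' assume "?f b = ?f b'"
    then have "Poly_Mapping.lookup (?f b) i = Poly_Mapping.lookup (?f b') i" for i by simp
    then show "b = b'" using prime_card[where 'a = 'p, THEN prime_gt_0_nat] by (intro poly_mapping_eqI) simp
  qed
  then have "finite (?f -` Poly_Mapping.keys r)" by (intro finite_vimageI) auto
  moreover have "?f -` Poly_Mapping.keys r = {b. Poly_Mapping.lookup r (?f b) \<noteq> 0}" by (auto simp: in_keys_iff)
  ultimately show ?thesis unfolding frob_coeff_def by (subst lookup_Abs_poly_mapping) auto
qed

lemma frob_coeff_add: "frob_coeff c (r + s) = frob_coeff c r + frob_coeff c s"
  by (rule poly_mapping_eqI) (simp add: lookup_frob_coeff lookup_add)

lemma frob_coeff_zero [simp]: "frob_coeff c 0 = 0"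
  by (rule poly_mapping_eqI) (simp add: lookup_frob_coeff)

lemma frob_coeff_sum: "frob_coeff c (sum f A) = (\<Sum>x\<in>A. frob_coeff c (f x))"
  by (induction A rule: infinite_finite_induct) (auto simp: frob_coeff_add)

lemma frob_coeff_single:
  assumes "c \<in> digits CARD('p)"
  shows "frob_coeff c (Poly_Mapping.single a d :: ('p::prime_card, 'n::finite) pol)
    = (if c = (\<lambda>i. Poly_Mapping.lookup a i mod CARD('p))
       then Poly_Mapping.single (exponent (\<lambda>i. Poly_Mapping.lookup a i div CARD('p))) d else 0)"
proof (rule poly_mapping_eqI)
  fix b
  have p: "CARD('p) > 0" using prime_card[where 'a = 'p, THEN prime_gt_0_nat] .
  have c: "c i < CARD('p)" for i using assms by (simp add: digits_def)
  have co: "x = ci + CARD('p) * y \<longleftrightarrow> ci = x mod CARD('p) \<and> x div CARD('p) = y" if "ci < CARD('p)" for x ci y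
    using that p by auto
  have "a = exponent (\<lambda>i. c i + CARD('p) * Poly_Mapping.lookup b i) \<longleftrightarrow>
      (\<forall>i. Poly_Mapping.lookup a i = c i + CARD('p) * Poly_Mapping.lookup b i)"
    unfolding poly_mapping_eq_iff fun_eq_iff by simp
  also have "\<dots> \<longleftrightarrow> c = (\<lambda>i. Poly_Mapping.lookup a i mod CARD('p)) \<and>
      exponent (\<lambda>i. Poly_Mapping.lookup a i div CARD('p)) = b"
    unfolding co[OF c] poly_mapping_eq_iff fun_eq_iff by auto
  finally show "Poly_Mapping.lookup (frob_coeff c (Poly_Mapping.single a d :: ('p, 'n) pol)) b
      = Poly_Mapping.lookup (if c = (\<lambda>i. Poly_Mapping.lookup a i mod CARD('p))
       then Poly_Mapping.single (exponent (\<lambda>i. Poly_Mapping.lookup a i div CARD('p))) d else 0) b"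
    by (auto simp: lookup_frob_coeff lookup_single when_def)
qed

text \<open>Linearity over the p-th powers, read through the Frobenius. It is what allows r
  \<otimes> m to be sent to r_c m on the base change.\<close>

lemma frob_coeff_mult_power:
  assumes c: "c \<in> digits CARD('p)"
  shows "frob_coeff c (r * s ^ CARD('p)) = frob_coeff c r * (s :: ('p::prime_card, 'n::finite) pol)"
proof (induction r rule: pol_induct)
  case (single a d)
  show ?case
  proof (induction s rule: pol_induct)
    case zero
    then show ?case by (simp add: power_0_left)
  next
    case (add r s)
    then show ?case by (simp add: frobenius_add distrib_left frob_coeff_add)
  next
    case (single b e)
    have p: "CARD('p) > 0" using prime_card[where 'a = 'p, THEN prime_gt_0_nat] .
    have "exponent (\<lambda>i. (Poly_Mapping.lookup a i + CARD('p) * Poly_Mapping.lookup b i) div CARD('p))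
        = exponent (\<lambda>i. Poly_Mapping.lookup a i div CARD('p)) + b"
      using p by (intro poly_mapping_eqI) (simp add: lookup_add)
    then show ?case
      using c by (simp add: frobenius_single mult_single frob_coeff_single lookup_add)
  qed
qed (simp_all add: distrib_right frob_coeff_add)

lemma frob_coeff_expand:
  "r = (\<Sum>c\<in>digits CARD('p). pol_mon c * frob_coeff c r ^ CARD('p))" for r :: "('p::prime_card, 'n::finite) pol"
proof (induction r rule: pol_induct)
  case zero
  then show ?case by (simp add: power_0_left)
next
  case (add r s)
  then show ?case by (simp add: frob_coeff_add frobenius_add distrib_left sum.distrib)
next
  case (single a d)
  let ?c = "\<lambda>i. Poly_Mapping.lookup a i mod CARD('p)"
  have c: "?c \<in> digits CARD('p)"
    using prime_card[where 'a = 'p, THEN prime_gt_0_nat] by (simp add: digits_def)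
  have "exponent ?c + exponent (\<lambda>i. CARD('p) * (Poly_Mapping.lookup a i div CARD('p))) = a"
    by (rule poly_mapping_eqI) (simp add: lookup_add)
  then have "pol_mon ?c * frob_coeff ?c (Poly_Mapping.single a d) ^ CARD('p) = Poly_Mapping.single a d"
    using c by (simp add: frob_coeff_single frobenius_single pol_mon_def mult_single)
  moreover have "pol_mon c * frob_coeff c (Poly_Mapping.single a d) ^ CARD('p) = 0"
    if "c \<in> digits CARD('p)" "c \<noteq> ?c" for c
    using that by (simp add: frob_coeff_single power_0_left)
  ultimately show ?case
    using sum.remove[OF finite_digits c, of "\<lambda>c. pol_mon c * frob_coeff c (Poly_Mapping.single a d) ^ CARD('p)"]
    by (simp add: sum.neutral)
qed

lemma frob_coeff_mon:
  assumes "c \<in> digits CARD('p)" "c' \<in> digits CARD('p)"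
  shows "frob_coeff c (pol_mon c' :: ('p::prime_card, 'n::finite) pol) = (if c = c' then 1 else 0)"
proof -
  have c': "c' i < CARD('p)" for i using assms(2) by (simp add: digits_def)
  have "exponent (\<lambda>i. c' i div CARD('p)) = 0" "(\<lambda>i. c' i mod CARD('p)) = c'"
    using c' by (auto intro!: poly_mapping_eqI)
  then show ?thesis using assms(1) by (simp add: pol_mon_def frob_coeff_single)
qed

text \<open>The symmetry behind the duality between the bases \<open>x\<^sup>c\<close> and \<open>x\<^bsup>p - 1 - c\<^esup>\<close>.\<close>

definition codigit :: "nat \<Rightarrow> ('n \<Rightarrow> nat) \<Rightarrow> 'n \<Rightarrow> nat" where
  "codigit q c = (\<lambda>i. q - 1 - c i)"

lemma codigit_digits: "q > 0 \<Longrightarrow> codigit q c \<in> digits q"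
  by (auto simp: codigit_def digits_def)

lemma codigit_codigit: "c \<in> digits q \<Longrightarrow> codigit q (codigit q c) = c"
proof
  fix i
  assume "c \<in> digits q"
  then have "c i < q" by (simp add: digits_def)
  then show "codigit q (codigit q c) i = c i" by (simp add: codigit_def)
qed

text \<open>Conceptually both sides are the top coefficient of r x^c x^(p-1-b), so the lemma
  expresses the symmetry of the form that sends (r, s) to the top coefficient of r s. The proof
  compares both sides on monomials r.\<close>

lemma frob_coeff_symmetric:
  assumes b: "b \<in> digits CARD('p)" and c: "c \<in> digits CARD('p)"
  shows "frob_coeff b (r * pol_mon c)
    = frob_coeff (codigit CARD('p) c) (r * pol_mon (codigit CARD('p) b) :: ('p::prime_card, 'n::finite) pol)"
proof (induction r rule: pol_induct)
  case (single a d)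
  let ?p = "CARD('p)"
  have p: "?p > 0" using prime_card[where 'a = 'p, THEN prime_gt_0_nat] .
  have bi: "b i < ?p" and ci: "c i < ?p" for i using b c by (simp_all add: digits_def)
  \<comment> \<open>The arithmetic of one variable: z + y = x + p q holds exactly when z + (p - 1 -
    x) = (p - 1 - y) + p q, with the same q. Hence the digits match simultaneously and the quotients
    agree.\<close>
  have key: "(x = (z + y) mod ?p \<longleftrightarrow> ?p - 1 - y = (z + (?p - 1 - x)) mod ?p) \<and>
      (x = (z + y) mod ?p \<longrightarrow> (z + y) div ?p = (z + (?p - 1 - x)) div ?p)" if "x < ?p" "y < ?p" for x y z
  proof -
    have *: "z + y = x + ?p * q \<longleftrightarrow> z + (?p - 1 - x) = (?p - 1 - y) + ?p * q" for q using that by linarith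
    have mod: "u = w mod ?p \<longleftrightarrow> (\<exists>q. w = u + ?p * q)" if "u < ?p" for u w
    proof
      assume "u = w mod ?p"
      then have "w = u + ?p * (w div ?p)" by simp
      then show "\<exists>q. w = u + ?p * q" ..
    qed (use that in auto)
    have 1: "x = (z + y) mod ?p \<longleftrightarrow> (\<exists>q. z + y = x + ?p * q)" by (rule mod[OF that(1)])
    have 2: "?p - 1 - y = (z + (?p - 1 - x)) mod ?p \<longleftrightarrow> (\<exists>q. z + (?p - 1 - x) = (?p - 1 - y) + ?p * q)"
      by (rule mod) (use that in auto)
    have "(z + y) div ?p = (z + (?p - 1 - x)) div ?p" if "x = (z + y) mod ?p"
    proof -
      have "z + y = x + ?p * ((z + y) div ?p)" using that by simp
      then have "z + (?p - 1 - x) = (?p - 1 - y) + ?p * ((z + y) div ?p)" using * by blast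
      then have "(z + (?p - 1 - x)) div ?p = ((?p - 1 - y) + ?p * ((z + y) div ?p)) div ?p" by simp
      also have "\<dots> = (z + y) div ?p" using p by simp
      finally show ?thesis by simp
    qed
    then show ?thesis using 1 2 * by blast
  qed
  let ?A = "\<lambda>i. Poly_Mapping.lookup a i"
  have e1: "b = (\<lambda>i. (?A i + c i) mod ?p) \<longleftrightarrow> codigit ?p c = (\<lambda>i. (?A i + codigit ?p b i) mod ?p)"
    unfolding fun_eq_iff codigit_def using key[OF bi ci] by blast
  have e2: "(\<lambda>i. (?A i + c i) div ?p) = (\<lambda>i. (?A i + codigit ?p b i) div ?p)" if "b = (\<lambda>i. (?A i + c i) mod ?p)"
  proof
    fix i show "(?A i + c i) div ?p = (?A i + codigit ?p b i) div ?p"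
      unfolding codigit_def using key[OF bi[of i] ci[of i], of "?A i"] fun_cong[OF that, of i] by blast
  qed
  show ?case
    using e1 e2 b codigit_digits[OF p, of c]
    by (auto simp: pol_mon_def mult_single frob_coeff_single lookup_add)
qed (simp_all add: distrib_right frob_coeff_add)

section \<open>Unit modules\<close>

lemma pol_to_frob_hom:
  "pol_to_frob (r + s) = pol_to_frob r \<oplus>\<^bsub>frob_ring\<^esub> (pol_to_frob s :: ('p::prime_card, 'n::finite) frob_op)"
  "pol_to_frob (r * s) = pol_to_frob r \<otimes>\<^bsub>frob_ring\<^esub> (pol_to_frob s :: ('p, 'n) frob_op)"
  "pol_to_frob 1 = (\<one>\<^bsub>frob_ring\<^esub> :: ('p, 'n) frob_op)"
  "(pol_to_frob r :: ('p, 'n) frob_op) \<in> carrier frob_ring"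
  using ring_hom_add[OF pol_to_frob_characterization(1)[where ?'a = 'p and ?'b = 'n], of r s]
    ring_hom_mult[OF pol_to_frob_characterization(1)[where ?'a = 'p and ?'b = 'n], of r s]
    ring_hom_one[OF pol_to_frob_characterization(1)[where ?'a = 'p and ?'b = 'n]]
    ring_hom_closed[OF pol_to_frob_characterization(1)[where ?'a = 'p and ?'b = 'n], of r] by simp_all

section \<open>Polynomial action and functionals on the Frobenius base change\<close>

context frob_left_module
begin

definition pact :: "('p, 'n) pol \<Rightarrow> 'm \<Rightarrow> 'm" where
  "pact r m = pol_to_frob r \<odot>\<^bsub>M\<^esub> m"

lemma pact_closed [simp, intro]: "m \<in> carrier M \<Longrightarrow> pact r m \<in> carrier M"
  unfolding pact_def using pol_to_frob_hom(4) by (rule smult_closed)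

lemma pact_add_l: "m \<in> carrier M \<Longrightarrow> pact (r + s) m = pact r m \<oplus>\<^bsub>M\<^esub> pact s m"
  unfolding pact_def pol_to_frob_hom(1) by (simp add: smult_l_distr pol_to_frob_hom(4))

lemma pact_add_r: "m \<in> carrier M \<Longrightarrow> m' \<in> carrier M \<Longrightarrow> pact r (m \<oplus>\<^bsub>M\<^esub> m') = pact r m \<oplus>\<^bsub>M\<^esub> pact r m'"
  unfolding pact_def by (simp add: smult_r_distr pol_to_frob_hom(4))

lemma pact_mult: "m \<in> carrier M \<Longrightarrow> pact (r * s) m = pact r (pact s m)"
  unfolding pact_def pol_to_frob_hom(2) by (simp add: smult_assoc pol_to_frob_hom(4))

lemma pact_one [simp]: "m \<in> carrier M \<Longrightarrow> pact 1 m = m"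
  unfolding pact_def pol_to_frob_hom(3) by (simp add: smult_one)

lemma pact_zero_l [simp]: "m \<in> carrier M \<Longrightarrow> pact 0 m = \<zero>\<^bsub>M\<^esub>"
  using pact_add_l[of m 0 0] pact_closed[of m 0] by (metis M.add.r_cancel_one' add_0)

lemma pact_zero_r [simp]: "pact r \<zero>\<^bsub>M\<^esub> = \<zero>\<^bsub>M\<^esub>"
  using pact_add_r[of "\<zero>\<^bsub>M\<^esub>" "\<zero>\<^bsub>M\<^esub>" r] pact_closed[of "\<zero>\<^bsub>M\<^esub>" r]
  by (metis M.add.r_cancel_one' M.zero_closed M.r_zero)

lemma pact_var: "pact (pol_var j) m = var j m"
  unfolding pact_def var_def act_def by (simp add: pol_to_frob_characterization(2) frob_monomial_def)

lemma pact_mon: "m \<in> carrier M \<Longrightarrow> pact (pol_mon a) m = mon a m"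
proof (induction "weight a" arbitrary: a)
  case 0
  then have "a = (\<lambda>_. 0)" by (auto simp: weight_def)
  then show ?case using 0 by simp
next
  case (Suc k)
  then have "weight a > 0" by simp
  then obtain j b where b: "a = (\<lambda>i. unit_exp j i + b i)" "weight a = Suc (weight b)" by (rule exp_split_unit)
  then show ?case using Suc by (simp add: pol_mon_add pol_mon_unit pact_mult pact_var var_mon)
qed

lemma pact_of_nat: "m \<in> carrier M \<Longrightarrow> pact (of_nat k) m = act (of_nat k) m"
  by (induction k) (simp_all add: pact_add_l act_add_l act_one)

lemma frob_pact: 
  assumes "m \<in> carrier M"
  shows "frob (pact r m) = pact (r ^ CARD('p)) (frob m)"
proof (induction r rule: pol_induct)
  case zero
  then show ?case using assms by (simp add: power_0_left)
next
  case (add r s)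
  then show ?case using assms by (simp add: frobenius_add pact_add_l frob_add)
next
  case (single a d)
  obtain k where k: "d = of_nat k" by (rule mod_ring_of_nat)
  have "frob (act (of_nat k) x) = act (of_nat k) (frob x)" if "x \<in> carrier M" for x
    using that by (induction k) (simp_all add: act_add_l act_one frob_add)
  note frob_of_nat = this
  have single: "Poly_Mapping.single b d = of_nat k * (pol_mon (Poly_Mapping.lookup b) :: ('p, 'n) pol)" for b
    by (subst single_eq_const_mon) (simp only: k pol_const_def single_of_nat)
  show ?case
    unfolding frobenius_single unfolding single
    using assms by (simp add: pact_mult pact_mon pact_of_nat frob_mon frob_of_nat)
qed

text \<open>Writing r as the sum of x^c r_c^p and moving r_c^p through F shows that every r F(m) is
  a value of \<open>comb\<close>. This turns surjectivity of the structure morphism into existence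
  of expansions.\<close>

lemma comb_pact:
  assumes "m \<in> carrier M"
  shows "comb (\<lambda>c. pact (frob_coeff c r) m) = pact r (frob m)"
proof -
  have "pact (sum f A) x = (\<Oplus>\<^bsub>M\<^esub>c\<in>A. pact (f c) x)" if "x \<in> carrier M" for f :: "('n \<Rightarrow> nat) \<Rightarrow> ('p, 'n) pol" and A x
    using that by (induction A rule: infinite_finite_induct) (auto simp: pact_add_l Pi_def)
  note pact_sum = this
  have "pact r (frob m) = pact (\<Sum>c\<in>digits CARD('p). pol_mon c * frob_coeff c r ^ CARD('p)) (frob m)"
    by (rule arg_cong[OF frob_coeff_expand, where f = "\<lambda>r. pact r (frob m)"])
  also have "\<dots> = (\<Oplus>\<^bsub>M\<^esub>c\<in>digits CARD('p). pact (pol_mon c * frob_coeff c r ^ CARD('p)) (frob m))"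
    using assms by (intro pact_sum) auto
  also have "\<dots> = comb (\<lambda>c. pact (frob_coeff c r) m)"
    unfolding comb_def using assms by (intro M.finsum_cong') (auto simp: pact_mult pact_mon frob_pact)
  finally show ?thesis ..
qed

abbreviation polM :: "(('p, 'n) pol, 'm) module" where
  "polM \<equiv> restrict_scalars pol_to_frob M"

definition lin :: "(('p, 'n) pol \<times> 'm \<Rightarrow> 'm) \<Rightarrow> (('p, 'n) pol \<times> 'm \<Rightarrow>\<^sub>0 int) \<Rightarrow> 'm" where
  "lin g z = (\<Oplus>\<^bsub>M\<^esub>k\<in>Poly_Mapping.keys z. [Poly_Mapping.lookup z k] \<cdot>\<^bsub>M\<^esub> g k)"

text \<open>The conditions under which the additive extension \<open>lin g\<close> vanishes on the
  relations that define the Frobenius base change.\<close>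

definition balanced :: "(('p, 'n) pol \<times> 'm \<Rightarrow> 'm) \<Rightarrow> bool" where
  "balanced g \<longleftrightarrow> (\<forall>r. \<forall>m\<in>carrier M. g (r, m) \<in> carrier M) \<and>
     (\<forall>r s. \<forall>m\<in>carrier M. g (r + s, m) = g (r, m) \<oplus>\<^bsub>M\<^esub> g (s, m)) \<and>
     (\<forall>r. \<forall>m\<in>carrier M. \<forall>m'\<in>carrier M. g (r, m \<oplus>\<^bsub>M\<^esub> m') = g (r, m) \<oplus>\<^bsub>M\<^esub> g (r, m')) \<and>
     (\<forall>r s. \<forall>m\<in>carrier M. g (r * s ^ CARD('p), m) = g (r, pact s m))"

lemma polM_simps: "carrier polM = carrier M" "add polM = add M" "zero polM = zero M" "r \<odot>\<^bsub>polM\<^esub> m = pact r m"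
  by (simp_all add: restrict_scalars_def pact_def)

lemma free_pairs_simps: "carrier (free_pairs polM) = {z. Poly_Mapping.keys z \<subseteq> UNIV \<times> carrier M}"
  "add (free_pairs polM) = (+)" "zero (free_pairs polM) = 0"
  "r \<odot>\<^bsub>free_pairs polM\<^esub> z = frag_extend (\<lambda>(s, m). frag_of (r * s, m)) z"
  by (simp_all add: free_pairs_def polM_simps)

lemma int_mult_simps:
  "x \<in> carrier M \<Longrightarrow> add_pow M (0 :: int) x = \<zero>\<^bsub>M\<^esub>"
  "x \<in> carrier M \<Longrightarrow> add_pow M (1 :: int) x = x"
  "x \<in> carrier M \<Longrightarrow> add_pow M (i - j :: int) x = [i] \<cdot>\<^bsub>M\<^esub> x \<ominus>\<^bsub>M\<^esub> [j] \<cdot>\<^bsub>M\<^esub> x"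
  "x \<in> carrier M \<Longrightarrow> add_pow M (i :: int) x \<in> carrier M"
proof -
  have A: "group (add_monoid M)" using M.a_comm_group comm_group.axioms(2) by blast
  note A1 = group.int_pow_1[OF A] and A2 = group.int_pow_diff[OF A] and A3 = group.int_pow_closed[OF A]
  show "x \<in> carrier M \<Longrightarrow> add_pow M (0 :: int) x = \<zero>\<^bsub>M\<^esub>" by (simp add: add_pow_def)
  show "x \<in> carrier M \<Longrightarrow> add_pow M (1 :: int) x = x" using A1[of x] by (simp add: add_pow_def)
  show "x \<in> carrier M \<Longrightarrow> add_pow M (i - j :: int) x = [i] \<cdot>\<^bsub>M\<^esub> x \<ominus>\<^bsub>M\<^esub> [j] \<cdot>\<^bsub>M\<^esub> x"
    using A2[of x i j] by (simp add: add_pow_def a_minus_def a_inv_def)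
  show "x \<in> carrier M \<Longrightarrow> add_pow M (i :: int) x \<in> carrier M"
    using A3[of x i] by (simp add: add_pow_def)
qed

lemma finsum_diff:
  assumes "f \<in> A \<rightarrow> carrier M" "g \<in> A \<rightarrow> carrier M"
  shows "(\<Oplus>\<^bsub>M\<^esub>k\<in>A. f k \<ominus>\<^bsub>M\<^esub> g k) = finsum M f A \<ominus>\<^bsub>M\<^esub> finsum M g A"
proof -
  have "(\<Oplus>\<^bsub>M\<^esub>k\<in>A. \<ominus>\<^bsub>M\<^esub> g k) = \<ominus>\<^bsub>M\<^esub> finsum M g A"
    using finsum_additive[OF M.abelian_monoid_axioms M.abelian_monoid_axioms _ _ _ assms(2), of "\<lambda>x. \<ominus>\<^bsub>M\<^esub> x"]
    by (simp add: M.minus_add M.minus_equality)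
  moreover have "(\<lambda>k. \<ominus>\<^bsub>M\<^esub> g k) \<in> A \<rightarrow> carrier M" using assms by auto
  ultimately show ?thesis using M.finsum_addf[OF assms(1), of "\<lambda>k. \<ominus>\<^bsub>M\<^esub> g k"] by (simp add: a_minus_def)
qed

lemma lin_superset:
  assumes g: "g \<in> UNIV \<times> carrier M \<rightarrow> carrier M"
    and K: "finite K" "Poly_Mapping.keys z \<subseteq> K" "K \<subseteq> UNIV \<times> carrier M"
  shows "lin g z = (\<Oplus>\<^bsub>M\<^esub>k\<in>K. [Poly_Mapping.lookup z k] \<cdot>\<^bsub>M\<^esub> g k)"
proof -
  have gK: "g k \<in> carrier M" if "k \<in> K" for k using K(3) g that by auto
  show ?thesis
  unfolding lin_def
proof (rule M.add.finprod_mono_neutral_cong_left[OF K(1,2)])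
  show "add_pow M (Poly_Mapping.lookup z i) (g i) = \<zero>\<^bsub>M\<^esub>" if "i \<in> K - Poly_Mapping.keys z" for i
    using that gK by (auto simp: in_keys_iff int_mult_simps)
  show "(\<lambda>k. [Poly_Mapping.lookup z k] \<cdot>\<^bsub>M\<^esub> g k) \<in> K \<rightarrow> carrier M"
    using gK by (auto intro!: int_mult_simps(4))
qed simp
qed

lemma lin_diff:
  assumes g: "g \<in> UNIV \<times> carrier M \<rightarrow> carrier M"
    and z: "Poly_Mapping.keys z \<subseteq> UNIV \<times> carrier M" "Poly_Mapping.keys z' \<subseteq> UNIV \<times> carrier M"
  shows "lin g (z - z') = lin g z \<ominus>\<^bsub>M\<^esub> lin g z'"
proof -
  let ?K = "Poly_Mapping.keys z \<union> Poly_Mapping.keys z'"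
  have K: "finite ?K" "?K \<subseteq> UNIV \<times> carrier M" using z by auto
  have gK: "g k \<in> carrier M" if "k \<in> ?K" for k using K(2) that g by auto
  have 1: "lin g (z - z') = (\<Oplus>\<^bsub>M\<^esub>k\<in>?K. [Poly_Mapping.lookup (z - z') k] \<cdot>\<^bsub>M\<^esub> g k)"
    by (rule lin_superset[OF g K(1) keys_diff K(2)])
  have 2: "lin g z = (\<Oplus>\<^bsub>M\<^esub>k\<in>?K. [Poly_Mapping.lookup z k] \<cdot>\<^bsub>M\<^esub> g k)"
    by (rule lin_superset[OF g K(1) _ K(2)]) auto
  have 3: "lin g z' = (\<Oplus>\<^bsub>M\<^esub>k\<in>?K. [Poly_Mapping.lookup z' k] \<cdot>\<^bsub>M\<^esub> g k)"
    by (rule lin_superset[OF g K(1) _ K(2)]) auto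
  have "(\<Oplus>\<^bsub>M\<^esub>k\<in>?K. [Poly_Mapping.lookup (z - z') k] \<cdot>\<^bsub>M\<^esub> g k)
      = (\<Oplus>\<^bsub>M\<^esub>k\<in>?K. [Poly_Mapping.lookup z k] \<cdot>\<^bsub>M\<^esub> g k \<ominus>\<^bsub>M\<^esub> [Poly_Mapping.lookup z' k] \<cdot>\<^bsub>M\<^esub> g k)"
    by (intro M.finsum_cong') (auto simp: lookup_minus int_mult_simps gK)
  also have "\<dots> = lin g z \<ominus>\<^bsub>M\<^esub> lin g z'"
    unfolding 2 3 by (rule finsum_diff) (auto simp: int_mult_simps gK)
  finally show ?thesis using 1 by simp
qed

lemma lin_zero [simp]: "lin g 0 = \<zero>\<^bsub>M\<^esub>"
  by (simp add: lin_def)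

lemma lin_of: "g k \<in> carrier M \<Longrightarrow> lin g (frag_of k) = g k"
  by (simp add: lin_def int_mult_simps)

lemma lin_closed: 
  assumes "g \<in> UNIV \<times> carrier M \<rightarrow> carrier M" "Poly_Mapping.keys z \<subseteq> UNIV \<times> carrier M"
  shows "lin g z \<in> carrier M"
  unfolding lin_def using assms by (intro M.finsum_closed) (auto intro!: int_mult_simps(4))

lemma lin_add:
  assumes g: "g \<in> UNIV \<times> carrier M \<rightarrow> carrier M"
    and z: "Poly_Mapping.keys z \<subseteq> UNIV \<times> carrier M" "Poly_Mapping.keys z' \<subseteq> UNIV \<times> carrier M"
  shows "lin g (z + z') = lin g z \<oplus>\<^bsub>M\<^esub> lin g z'"
proof -
  have l: "lin g x \<in> carrier M" if "Poly_Mapping.keys x \<subseteq> UNIV \<times> carrier M" for x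
    by (rule lin_closed[OF g that])
  have s: "Poly_Mapping.keys (z + z') \<subseteq> UNIV \<times> carrier M" using z keys_add[of z z'] by auto
  have "lin g z = lin g (z + z') \<ominus>\<^bsub>M\<^esub> lin g z'" using lin_diff[OF g s z(2)] by simp
  then show ?thesis using l[OF s] l[OF z(2)] by (simp add: M.minus_eq M.a_assoc M.l_neg)
qed

definition tensor_kernel :: "(('p, 'n) pol \<times> 'm \<Rightarrow>\<^sub>0 int) set" where
  "tensor_kernel = generated_submodule pol_ring (free_pairs polM) (frobenius_tensor_relations polM)"

lemma keys_smult: 
  assumes "Poly_Mapping.keys z \<subseteq> UNIV \<times> carrier M"
  shows "Poly_Mapping.keys (r \<odot>\<^bsub>free_pairs polM\<^esub> z) \<subseteq> UNIV \<times> carrier M"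
  using assms unfolding free_pairs_simps
proof (induction z rule: frag_induction)
  case (diff a b)
  then show ?case using keys_diff unfolding frag_extend_diff by fastforce
qed auto

lemma lin_tensor_kernel:
  assumes g: "balanced g" and z: "z \<in> tensor_kernel"
  shows "Poly_Mapping.keys z \<subseteq> UNIV \<times> carrier M" "lin g z = \<zero>\<^bsub>M\<^esub>"
proof -
  have gc: "g \<in> UNIV \<times> carrier M \<rightarrow> carrier M" using g by (auto simp: balanced_def)
  have gc': "g (r, m) \<in> carrier M" if "m \<in> carrier M" for r m using gc that by auto
  have lo: "lin g (frag_of (r, m)) = g (r, m)" if "m \<in> carrier M" for r m using gc'[OF that] by (rule lin_of)
  \<comment> \<open>Vanishing is demanded on all multiples of z, because \<open>lin g\<close> is in
    general merely additive, as for \<open>coeff_pair\<close>, while the tensor relations generate a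
    submodule over R.\<close>
  define N where "N = {z. Poly_Mapping.keys z \<subseteq> UNIV \<times> carrier M \<and> (\<forall>r. lin g (r \<odot>\<^bsub>free_pairs polM\<^esub> z) = \<zero>\<^bsub>M\<^esub>)}"
  have N_diff: "x - y \<in> N" if "x \<in> N" "y \<in> N" for x y
  proof -
    have "Poly_Mapping.keys (x - y) \<subseteq> UNIV \<times> carrier M" using that keys_diff[of x y] by (auto simp: N_def)
    moreover have "lin g (r \<odot>\<^bsub>free_pairs polM\<^esub> (x - y)) = \<zero>\<^bsub>M\<^esub>" for r
    proof -
      have "r \<odot>\<^bsub>free_pairs polM\<^esub> (x - y) = r \<odot>\<^bsub>free_pairs polM\<^esub> x - r \<odot>\<^bsub>free_pairs polM\<^esub> y"
        by (simp add: free_pairs_simps frag_extend_diff)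
      moreover have "lin g (r \<odot>\<^bsub>free_pairs polM\<^esub> x - r \<odot>\<^bsub>free_pairs polM\<^esub> y) = \<zero>\<^bsub>M\<^esub> \<ominus>\<^bsub>M\<^esub> \<zero>\<^bsub>M\<^esub>"
        using that by (subst lin_diff[OF gc keys_smult keys_smult]) (auto simp: N_def)
      ultimately show ?thesis by (simp add: M.minus_eq M.r_neg)
    qed
    ultimately show ?thesis by (simp add: N_def)
  qed
  have N0: "0 \<in> N" by (simp add: N_def free_pairs_simps)
  have N_minus: "- x \<in> N" if "x \<in> N" for x using N_diff[OF N0 that] by simp
  have N_add: "x + y \<in> N" if "x \<in> N" "y \<in> N" for x y using N_diff[OF that(1) N_minus[OF that(2)]] by simp
  have sub: "Module.submodule N pol_ring (free_pairs polM)"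
  proof (intro Module.submodule.intro submodule_axioms.intro)
    show "subgroup N (add_monoid (free_pairs polM))"
    proof (rule subgroup.intro)
      show "inv\<^bsub>add_monoid (free_pairs polM)\<^esub> x \<in> N" if x: "x \<in> N" for x
      proof -
        have "inv\<^bsub>add_monoid (free_pairs polM)\<^esub> x = - x"
          unfolding m_inv_def
        proof (rule the_equality)
          show "- x \<in> carrier (add_monoid (free_pairs polM)) \<and> x \<otimes>\<^bsub>add_monoid (free_pairs polM)\<^esub> - x = \<one>\<^bsub>add_monoid (free_pairs polM)\<^esub>
              \<and> - x \<otimes>\<^bsub>add_monoid (free_pairs polM)\<^esub> x = \<one>\<^bsub>add_monoid (free_pairs polM)\<^esub>"
            using x by (auto simp: free_pairs_simps N_def)
        qed (auto simp: free_pairs_simps eq_neg_iff_add_eq_0)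
        then show ?thesis using N_minus[OF x] by simp
      qed
      show "x \<otimes>\<^bsub>add_monoid (free_pairs polM)\<^esub> y \<in> N" if "x \<in> N" "y \<in> N" for x y
        using N_add[OF that] by (simp add: free_pairs_simps)
      show "\<one>\<^bsub>add_monoid (free_pairs polM)\<^esub> \<in> N" using N0 by (simp add: free_pairs_simps)
    qed (auto simp: N_def free_pairs_simps)
    show "a \<odot>\<^bsub>free_pairs polM\<^esub> x \<in> N" if "x \<in> N" for a x
    proof -
      have "frag_extend (\<lambda>(s, m). frag_of (r * s, m)) (frag_extend (\<lambda>(s, m). frag_of (a * s, m)) y)
          = frag_extend (\<lambda>(s, m). frag_of (r * a * s, m)) y" for r and y :: "('p, 'n) pol \<times> 'm \<Rightarrow>\<^sub>0 int"
        using subset_UNIV[of "Poly_Mapping.keys y"]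
        by (induction y rule: frag_induction) (auto simp: frag_extend_diff mult.assoc)
      then show ?thesis using that keys_smult[of x a] by (auto simp: N_def free_pairs_simps)
    qed
  qed
  have "frobenius_tensor_relations polM \<subseteq> N"
  proof
    fix y assume "y \<in> frobenius_tensor_relations polM"
    then show "y \<in> N"
      unfolding frobenius_tensor_relations_def polM_simps
    proof (elim UnE CollectE exE conjE)
      fix r s m assume y: "y = frag_of (r + s, m) - frag_of (r, m) - frag_of (s, m)" and m: "m \<in> carrier M"
      have "lin g (t \<odot>\<^bsub>free_pairs polM\<^esub> y) = g (t * r + t * s, m) \<ominus>\<^bsub>M\<^esub> g (t * r, m) \<ominus>\<^bsub>M\<^esub> g (t * s, m)" for t
        unfolding y free_pairs_simps frag_extend_diff using m gc gc' keys_diff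
        by (simp add: lin_diff[OF gc] lo keys_diff[THEN order_trans] distrib_left)
      also have "g (t * r + t * s, m) \<ominus>\<^bsub>M\<^esub> g (t * r, m) \<ominus>\<^bsub>M\<^esub> g (t * s, m) = \<zero>\<^bsub>M\<^esub>" for t
      proof -
        have "g (t * r + t * s, m) = g (t * s, m) \<oplus>\<^bsub>M\<^esub> g (t * r, m)" using g m gc' by (simp add: balanced_def M.a_comm)
        then show ?thesis using m gc' by (simp add: M.minus_eq M.a_assoc M.r_neg)
      qed
      finally have "lin g (t \<odot>\<^bsub>free_pairs polM\<^esub> y) = \<zero>\<^bsub>M\<^esub>" for t .
      moreover have "Poly_Mapping.keys y \<subseteq> UNIV \<times> carrier M"
        unfolding y using m by (intro order_trans[OF keys_diff] Un_least) auto
      ultimately show ?thesis by (simp add: N_def)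
    next
      fix r m m' assume y: "y = frag_of (r, m \<oplus>\<^bsub>M\<^esub> m') - frag_of (r, m) - frag_of (r, m')" and m: "m \<in> carrier M" "m' \<in> carrier M"
      have "lin g (t \<odot>\<^bsub>free_pairs polM\<^esub> y) = g (t * r, m \<oplus>\<^bsub>M\<^esub> m') \<ominus>\<^bsub>M\<^esub> g (t * r, m) \<ominus>\<^bsub>M\<^esub> g (t * r, m')" for t
        unfolding y free_pairs_simps frag_extend_diff using m gc gc' keys_diff
        by (simp add: lin_diff[OF gc] lo keys_diff[THEN order_trans])
      also have "g (t * r, m \<oplus>\<^bsub>M\<^esub> m') \<ominus>\<^bsub>M\<^esub> g (t * r, m) \<ominus>\<^bsub>M\<^esub> g (t * r, m') = \<zero>\<^bsub>M\<^esub>" for t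
      proof -
        have "g (t * r, m \<oplus>\<^bsub>M\<^esub> m') = g (t * r, m') \<oplus>\<^bsub>M\<^esub> g (t * r, m)" using g m gc' by (simp add: balanced_def M.a_comm)
        then show ?thesis using m gc' by (simp add: M.minus_eq M.a_assoc M.r_neg)
      qed
      finally have "lin g (t \<odot>\<^bsub>free_pairs polM\<^esub> y) = \<zero>\<^bsub>M\<^esub>" for t .
      moreover have "Poly_Mapping.keys y \<subseteq> UNIV \<times> carrier M"
        unfolding y using m by (intro order_trans[OF keys_diff] Un_least) auto
      ultimately show ?thesis by (simp add: N_def)
    next
      fix r s m assume y: "y = frag_of (r * s ^ CARD('p), m) - frag_of (r, pact s m)" and m: "m \<in> carrier M"
      have "lin g (t \<odot>\<^bsub>free_pairs polM\<^esub> y) = g (t * r * s ^ CARD('p), m) \<ominus>\<^bsub>M\<^esub> g (t * r, pact s m)" for t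
        unfolding y free_pairs_simps frag_extend_diff using m gc' by (simp add: lin_diff[OF gc] lo mult.assoc)
      also have "g (t * r * s ^ CARD('p), m) \<ominus>\<^bsub>M\<^esub> g (t * r, pact s m) = \<zero>\<^bsub>M\<^esub>" for t
        using g m gc' by (simp add: balanced_def M.minus_eq M.r_neg)
      finally have "lin g (t \<odot>\<^bsub>free_pairs polM\<^esub> y) = \<zero>\<^bsub>M\<^esub>" for t .
      moreover have "Poly_Mapping.keys y \<subseteq> UNIV \<times> carrier M"
        unfolding y using m by (intro order_trans[OF keys_diff] Un_least) auto
      ultimately show ?thesis by (simp add: N_def)
    qed
  qed
  then have "tensor_kernel \<subseteq> N" unfolding tensor_kernel_def generated_submodule_def using sub by blast
  then have zN: "z \<in> N" using z by blast
  have "1 \<odot>\<^bsub>free_pairs polM\<^esub> z = z"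
    using subset_UNIV[of "Poly_Mapping.keys z"] unfolding free_pairs_simps
    by (induction z rule: frag_induction) (auto simp: frag_extend_diff)
  moreover have "lin g (1 \<odot>\<^bsub>free_pairs polM\<^esub> z) = \<zero>\<^bsub>M\<^esub>" using zN by (simp add: N_def)
  ultimately show "lin g z = \<zero>\<^bsub>M\<^esub>" by simp
  show "Poly_Mapping.keys z \<subseteq> UNIV \<times> carrier M" using zN by (simp add: N_def)
qed

lemma zero_tensor_kernel: "0 \<in> tensor_kernel"
proof -
  have "0 \<in> N" if "Module.submodule N pol_ring (free_pairs polM)" for N
    using subgroup.one_closed[OF Module.submodule.axioms(1)[OF that]] by (simp add: free_pairs_simps)
  then show ?thesis unfolding tensor_kernel_def generated_submodule_def by blast
qed

abbreviation tcoset :: "(('p, 'n) pol \<times> 'm \<Rightarrow>\<^sub>0 int) \<Rightarrow> (('p, 'n) pol \<times> 'm \<Rightarrow>\<^sub>0 int) set" where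
  "tcoset z \<equiv> tensor_kernel +>\<^bsub>free_pairs polM\<^esub> z"

lemma tcoset_eq: "tcoset z = {j + z | j. j \<in> tensor_kernel}"
  unfolding a_r_coset_def' free_pairs_simps by blast

definition frob_pair :: "('p, 'n) pol \<times> 'm \<Rightarrow> 'm" where
  "frob_pair = (\<lambda>(r, m). pact r (frob m))"

text \<open>The coordinate that returns m_c on a sum of x^c \<otimes> m_c. It descends to the base
  change and thereby gives uniqueness of expansions.\<close>

definition coeff_pair :: "('n \<Rightarrow> nat) \<Rightarrow> ('p, 'n) pol \<times> 'm \<Rightarrow> 'm" where
  "coeff_pair c = (\<lambda>(r, m). pact (frob_coeff c r) m)"

lemma balanced_frob_pair: "balanced frob_pair"
  by (simp add: balanced_def frob_pair_def pact_add_l pact_add_r frob_add frob_pact pact_mult)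

lemma balanced_coeff_pair: "c \<in> digits CARD('p) \<Longrightarrow> balanced (coeff_pair c)"
  by (simp add: balanced_def coeff_pair_def pact_add_l pact_add_r frob_coeff_add frob_coeff_mult_power pact_mult)

lemma pair_closed: "frob_pair \<in> UNIV \<times> carrier M \<rightarrow> carrier M" "coeff_pair c \<in> UNIV \<times> carrier M \<rightarrow> carrier M"
  by (auto simp: frob_pair_def coeff_pair_def)

text \<open>The use of \<open>the_elem\<close> is justified by the balancedness of
  \<open>frob_pair\<close>: all representatives of a class have the same value.\<close>

lemma structure_morphism_coset:
  assumes "Poly_Mapping.keys z \<subseteq> UNIV \<times> carrier M"
  shows "structure_morphism M (tcoset z) = lin frob_pair z"
proof -
  have "lin frob_pair y = lin frob_pair z" if "y \<in> tcoset z" for y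
  proof -
    from that obtain j where j: "j \<in> tensor_kernel" "y = j + z" unfolding tcoset_eq by blast
    note k = lin_tensor_kernel[OF balanced_frob_pair j(1)]
    show ?thesis unfolding j(2) lin_add[OF pair_closed(1) k(1) assms] k(2)
      using lin_closed[OF pair_closed(1) assms] by simp
  qed
  moreover have "z \<in> tcoset z" unfolding tcoset_eq using zero_tensor_kernel by force
  ultimately have "lin frob_pair ` tcoset z = {lin frob_pair z}" by blast
  moreover have "structure_morphism M C = the_elem (lin frob_pair ` C)" for C
    unfolding structure_morphism_def lin_def[abs_def] frob_pair_def pact_def frob_def act_def frob_monomial_def
    by (simp add: case_prod_unfold)
  ultimately show ?thesis by simp
qed

lemma base_change_carrier:
  "carrier (frobenius_base_change polM) = tcoset ` {z. Poly_Mapping.keys z \<subseteq> UNIV \<times> carrier M}"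
  by (auto simp: frobenius_base_change_def quotient_module_def A_RCOSETS_def' tensor_kernel_def free_pairs_simps)

lemma lin_frob_pair_comb:
  assumes "Poly_Mapping.keys z \<subseteq> UNIV \<times> carrier M"
  shows "\<exists>f \<in> digits CARD('p) \<rightarrow> carrier M. lin frob_pair z = comb f"
proof -
  have "Poly_Mapping.keys z \<subseteq> UNIV \<times> carrier M \<and> (\<exists>f \<in> digits CARD('p) \<rightarrow> carrier M. lin frob_pair z = comb f)"
    using assms
  proof (induction z rule: frag_induction)
    case zero
    have "comb (\<lambda>_. \<zero>\<^bsub>M\<^esub>) = \<zero>\<^bsub>M\<^esub>" by (simp add: comb_def)
    then show ?case by (intro conjI bexI[of _ "\<lambda>_. \<zero>\<^bsub>M\<^esub>"]) auto
  next
    case (one x)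
    then obtain r m where x: "x = (r, m)" "m \<in> carrier M" by auto
    then have "lin frob_pair (frag_of x) = comb (\<lambda>c. pact (frob_coeff c r) m)"
      by (subst lin_of) (auto simp: frob_pair_def comb_pact)
    then show ?case using x by (intro conjI bexI[of _ "\<lambda>c. pact (frob_coeff c r) m"]) auto
  next
    case (diff a b)
    then obtain f g where f: "f \<in> digits CARD('p) \<rightarrow> carrier M" "lin frob_pair a = comb f"
      and g: "g \<in> digits CARD('p) \<rightarrow> carrier M" "lin frob_pair b = comb g" by blast
    have "lin frob_pair (a - b) = comb f \<ominus>\<^bsub>M\<^esub> comb g"
      using lin_diff[OF pair_closed(1)] diff f g by auto
    also have "\<dots> = comb (\<lambda>c. f c \<ominus>\<^bsub>M\<^esub> g c)"
    proof -
      have "comb (\<lambda>c. f c \<ominus>\<^bsub>M\<^esub> g c) \<oplus>\<^bsub>M\<^esub> comb g = comb (\<lambda>c. (f c \<ominus>\<^bsub>M\<^esub> g c) \<oplus>\<^bsub>M\<^esub> g c)"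
        by (rule comb_add[symmetric]) (use f g in auto)
      also have "\<dots> = comb f"
        unfolding comb_def using f g by (intro M.finsum_cong') (auto simp: M.minus_eq M.a_assoc M.l_neg Pi_iff)
      finally have eq: "comb (\<lambda>c. f c \<ominus>\<^bsub>M\<^esub> g c) \<oplus>\<^bsub>M\<^esub> comb g = comb f" .
      have "comb (\<lambda>c. f c \<ominus>\<^bsub>M\<^esub> g c) \<in> carrier M" "comb g \<in> carrier M"
        by (rule comb_closed, use f g in auto)+
      then show ?thesis unfolding eq[symmetric] by (simp add: M.minus_eq M.a_assoc M.r_neg)
    qed
    finally have "\<exists>f \<in> digits CARD('p) \<rightarrow> carrier M. lin frob_pair (a - b) = comb f"
      using f g by (intro bexI[of _ "\<lambda>c. f c \<ominus>\<^bsub>M\<^esub> g c"]) auto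
    then show ?case using diff keys_diff[of a b] by blast
  qed
  then show ?thesis by simp
qed

text \<open>Surjectivity of the structure morphism gives the expansions; its injectivity, combined
  with the coordinates \<open>coeff_pair\<close>, gives their uniqueness.\<close>

theorem unit_F_holonomic:
  assumes unit: "unit_frob_module M" and fg: "finitely_generated frob_ring M"
  shows "F_holonomic M"
proof -
  obtain S where S: "finite S" "S \<subseteq> carrier M" "generated_submodule frob_ring M S = carrier M"
    using fg unfolding finitely_generated_def by blast
  have bij: "bij_betw (structure_morphism M) (carrier (frobenius_base_change polM)) (carrier M)"
    using unit unfolding unit_frob_module_def by (simp add: Let_def polM_simps)
  show ?thesis
  proof (rule F_holonomic_if_unit[OF S(1,2)])
    show "frob_generated S"
      unfolding frob_generated_def
    proof (intro allI impI, elim conjE)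
      fix H assume H: "S \<subseteq> H" "H \<subseteq> carrier M" "\<zero>\<^bsub>M\<^esub> \<in> H" "\<forall>x\<in>H. \<forall>y\<in>H. x \<oplus>\<^bsub>M\<^esub> y \<in> H"
        "\<forall>x\<in>H. frob x \<in> H \<and> (\<forall>j. var j x \<in> H)"
      have "Module.submodule H frob_ring M"
      proof (intro Module.submodule.intro submodule_axioms.intro)
        show "subgroup H (add_monoid M)"
          using H uminus_mem[of _ H] by (intro M.add.subgroupI) (auto simp: a_inv_def)
        fix a :: "('p, 'n) frob_op" and x assume a: "a \<in> carrier frob_ring" and x: "x \<in> H"
        obtain b :: "('p, 'n) free_alg" where b: "a = frob_class b" using a by (auto simp: carrier_frob_ring)
        obtain i where i: "b \<in> free_upto i" using free_upto_ex by blast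
        have "act (free_monomial w) x \<in> H" for w
        proof (induction w)
          case (Cons l w)
          then show ?case using H x by (cases l) (auto simp: act_Cons)
        qed (use H x in auto)
        then have "act b x \<in> H" using H x by (intro act_mem[OF i]) auto
        then show "a \<odot>\<^bsub>M\<^esub> x \<in> H" by (simp add: b act_def)
      qed
      then have "carrier M \<subseteq> H" using S(3) H(1) unfolding generated_submodule_def by blast
      then show "H = carrier M" using H(2) by blast
    qed
    show "\<exists>f\<in>digits CARD('p) \<rightarrow> carrier M. m = comb f" if "m \<in> carrier M" for m
    proof -
      have "m \<in> structure_morphism M ` tcoset ` {z. Poly_Mapping.keys z \<subseteq> UNIV \<times> carrier M}"
        using bij that unfolding bij_betw_def base_change_carrier by simp
      then obtain z where z: "Poly_Mapping.keys z \<subseteq> UNIV \<times> carrier M" "structure_morphism M (tcoset z) = m"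
        by blast
      then have "m = lin frob_pair z" by (simp add: structure_morphism_coset)
      then show ?thesis using lin_frob_pair_comb[OF z(1)] by simp
    qed
    fix f g and c :: "'n \<Rightarrow> nat" assume f: "f \<in> digits CARD('p) \<rightarrow> carrier M" and g: "g \<in> digits CARD('p) \<rightarrow> carrier M"
      and eq: "comb f = comb g" and c: "c \<in> digits CARD('p)"
    \<comment> \<open>Z h represents the sum of x^c \<otimes> h c. The structure morphism sends its
      class to \<open>comb h\<close>, whereas the coordinate \<open>coeff_pair c\<close> recovers h
      c from it.\<close>
    define Z where "Z h = (\<Sum>c\<in>digits CARD('p). frag_of (pol_mon c :: ('p, 'n) pol, h c))" for h :: "('n \<Rightarrow> nat) \<Rightarrow> 'm"
    have Z: "Poly_Mapping.keys (\<Sum>c\<in>A. frag_of (pol_mon c :: ('p, 'n) pol, h c)) \<subseteq> UNIV \<times> carrier M \<and>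
        lin G (\<Sum>c\<in>A. frag_of (pol_mon c, h c)) = (\<Oplus>\<^bsub>M\<^esub>c\<in>A. G (pol_mon c, h c))"
      if h: "h \<in> A \<rightarrow> carrier M" and G: "G \<in> UNIV \<times> carrier M \<rightarrow> carrier M" for h A and G :: "('p, 'n) pol \<times> 'm \<Rightarrow> 'm"
      using h
    proof (induction A rule: infinite_finite_induct)
      case (insert x F)
      have hx: "h x \<in> carrier M" "h \<in> F \<rightarrow> carrier M" using insert by auto
      have k1: "Poly_Mapping.keys (frag_of (pol_mon x :: ('p, 'n) pol, h x)) \<subseteq> UNIV \<times> carrier M" using hx by simp
      note IH = insert.IH[OF hx(2)]
      have Gx: "G (pol_mon x, h x) \<in> carrier M" "(\<lambda>c. G (pol_mon c, h c)) \<in> F \<rightarrow> carrier M" using G hx by auto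
      show ?case
        using insert.hyps keys_add[of "frag_of (pol_mon x :: ('p, 'n) pol, h x)" "\<Sum>c\<in>F. frag_of (pol_mon c, h c)"] k1 IH Gx
        by (auto simp: lin_add[OF G k1] lin_of)
    qed (simp_all add: M.finsum_infinite)
    have Zk: "Poly_Mapping.keys (Z h) \<subseteq> UNIV \<times> carrier M" if "h \<in> digits CARD('p) \<rightarrow> carrier M" for h
      unfolding Z_def using Z[OF that pair_closed(1)] by simp
    have Zf: "structure_morphism M (tcoset (Z h)) = comb h" if "h \<in> digits CARD('p) \<rightarrow> carrier M" for h
    proof -
      have "structure_morphism M (tcoset (Z h)) = (\<Oplus>\<^bsub>M\<^esub>c\<in>digits CARD('p). frob_pair (pol_mon c, h c))"
        using Zk[OF that] Z[OF that pair_closed(1)] by (simp add: structure_morphism_coset Z_def)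
      also have "\<dots> = comb h"
        unfolding comb_def using that by (intro M.finsum_cong') (auto simp: frob_pair_def pact_mon Pi_iff)
      finally show ?thesis .
    qed
    have Zc: "lin (coeff_pair c) (Z h) = h c" if "h \<in> digits CARD('p) \<rightarrow> carrier M" for h
    proof -
      have "lin (coeff_pair c) (Z h) = (\<Oplus>\<^bsub>M\<^esub>b\<in>digits CARD('p). coeff_pair c (pol_mon b, h b))"
        using Z[OF that pair_closed(2)] by (simp add: Z_def)
      also have "\<dots> = (\<Oplus>\<^bsub>M\<^esub>b\<in>digits CARD('p). if c = b then h b else \<zero>\<^bsub>M\<^esub>)"
        using that c by (intro M.finsum_cong') (auto simp: coeff_pair_def frob_coeff_mon Pi_iff)
      also have "\<dots> = h c" using that c by (intro M.finsum_singleton finite_digits) auto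
      finally show ?thesis .
    qed
    have "inj_on (structure_morphism M) (tcoset ` {z. Poly_Mapping.keys z \<subseteq> UNIV \<times> carrier M})"
      using bij unfolding bij_betw_def base_change_carrier by blast
    then have "tcoset (Z f) = tcoset (Z g)"
      by (rule inj_onD) (use Zf[OF f] Zf[OF g] Zk[OF f] Zk[OF g] eq in simp_all)
    moreover have "Z f \<in> tcoset (Z f)" unfolding tcoset_eq using zero_tensor_kernel by force
    ultimately obtain j where j: "j \<in> tensor_kernel" "Z f = j + Z g" unfolding tcoset_eq by blast
    note k = lin_tensor_kernel[OF balanced_coeff_pair[OF c] j(1)]
    have "f c = lin (coeff_pair c) (j + Z g)" using Zc[OF f] j(2) by simp
    also have "\<dots> = g c"
      unfolding lin_add[OF pair_closed(2) k(1) Zk[OF g]] k(2) Zc[OF g] by (rule M.l_zero) (use g c in auto)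
    finally show "f c = g c" .
  qed
qed

end

section \<open>Finitely generated free modules over the polynomial ring are Noetherian\<close>

lemma nat_seq_mono_subseq:
  fixes t :: "nat \<Rightarrow> nat"
  obtains h :: "nat \<Rightarrow> nat" where "strict_mono h" "mono (t \<circ> h)"
proof -
  \<comment> \<open>The indices whose value is minimal among all later ones. There are infinitely
    many, since the minimum over any tail is attained.\<close>
  define I where "I = {i. \<forall>j>i. t i \<le> t j}"
  have "\<exists>i\<ge>n. i \<in> I" for n
  proof -
    obtain i where i: "i \<ge> n" "\<And>j. j \<ge> n \<Longrightarrow> t i \<le> t j"
      using ex_has_least_nat[of "\<lambda>i. i \<ge> n" n t] by auto
    then show ?thesis by (auto simp: I_def)
  qed
  then have "infinite I" unfolding infinite_nat_iff_unbounded_le by auto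
  then have h: "strict_mono (enumerate I)" "\<And>n. enumerate I n \<in> I"
    by (auto simp: strict_mono_enumerate enumerate_in_set)
  have "mono (t \<circ> enumerate I)"
  proof (rule monoI)
    fix i j :: nat assume "i \<le> j"
    then show "(t \<circ> enumerate I) i \<le> (t \<circ> enumerate I) j"
      using h(2)[of i] strict_monoD[OF h(1), of i j] by (cases "i = j") (auto simp: I_def)
  qed
  with h(1) show ?thesis by (rule that)
qed

lemma dickson_seq:
  fixes s :: "nat \<Rightarrow> 'k \<Rightarrow> nat"
  assumes "finite K"
  shows "\<exists>h :: nat \<Rightarrow> nat. strict_mono h \<and> (\<forall>k\<in>K. mono (\<lambda>i. s (h i) k))"
  using assms
proof (induction K)
  case empty
  show ?case by (rule exI[of _ id]) (simp add: strict_mono_def)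
next
  case (insert k K)
  then obtain h :: "nat \<Rightarrow> nat" where h: "strict_mono h" "\<forall>k\<in>K. mono (\<lambda>i. s (h i) k)" by blast
  obtain h' :: "nat \<Rightarrow> nat" where h': "strict_mono h'" "mono ((\<lambda>i. s (h i) k) \<circ> h')" by (rule nat_seq_mono_subseq[of "\<lambda>i. s (h i) k"])
  have "mono (\<lambda>i. s ((h \<circ> h') i) l)" if "l \<in> K" for l
  proof (rule monoI)
    fix i j :: nat assume "i \<le> j"
    then have "h' i \<le> h' j" using h'(1) by (simp add: strict_mono_less_eq)
    then show "s ((h \<circ> h') i) l \<le> s ((h \<circ> h') j) l" using h(2) that monoD[of "\<lambda>i. s (h i) l"] by simp
  qed
  moreover have "mono (\<lambda>i. s ((h \<circ> h') i) k)" using h'(2) by (simp add: comp_def)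
  ultimately show ?case using strict_mono_o[OF h(1) h'(1)] by (intro exI[of _ "h \<circ> h'"]) (auto simp: comp_def)
qed

text \<open>An infinite set of minimal exponents would contain a sequence of distinct ones, and a
  subsequence increasing in every coordinate would make one of them dominate another.\<close>

lemma dickson:
  fixes A :: "('n::finite \<Rightarrow> nat) set"
  shows "\<exists>B. finite B \<and> B \<subseteq> A \<and> (\<forall>a\<in>A. \<exists>b\<in>B. b \<le> a)"
proof -
  define B where "B = {a \<in> A. \<forall>b\<in>A. b \<le> a \<longrightarrow> b = a}"
  have "finite B"
  proof (rule ccontr)
    assume "infinite B"
    then obtain s :: "nat \<Rightarrow> 'n \<Rightarrow> nat" where s: "inj s" "range s \<subseteq> B"
      using infinite_countable_subset by blast
    obtain h :: "nat \<Rightarrow> nat" where h: "strict_mono h" "\<forall>k\<in>UNIV. mono (\<lambda>i. s (h i) k)"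
      using dickson_seq[of "UNIV :: 'n set" s] by auto
    have "s (h 0) k \<le> s (h 1) k" for k using h(2) monoD[of "\<lambda>i. s (h i) k" 0 1] by simp
    then have "s (h 0) \<le> s (h 1)" by (simp add: le_fun_def)
    then have "s (h 0) = s (h 1)" using s(2) unfolding B_def by blast
    moreover have "h 0 \<noteq> h 1" using strict_monoD[OF h(1), of 0 1] by simp
    ultimately show False using s(1) by (simp add: inj_eq)
  qed
  moreover have "\<exists>b\<in>B. b \<le> a" if "a \<in> A" for a
    using that
  proof (induction "weight a" arbitrary: a rule: less_induct)
    case less
    show ?case
    proof (cases "a \<in> B")
      case False
      then obtain b where b: "b \<in> A" "b \<le> a" "b \<noteq> a" using less.prems unfolding B_def by blast
      then obtain i where "b i \<noteq> a i" by auto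
      with b(2) have "b i < a i" by (simp add: le_fun_def order_less_le)
      then have "weight b < weight a"
        unfolding weight_def using b(2) by (intro sum_strict_mono_ex1) (auto simp: le_fun_def)
      from less.hyps[OF this b(1)] obtain b' where "b' \<in> B" "b' \<le> b" by blast
      then show ?thesis using b(2) order_trans by blast
    qed auto
  qed
  ultimately show ?thesis unfolding B_def by blast
qed

text \<open>The key puts the position before the exponent. All keys have the same length, so the
  length-lexicographic order on lists is lexicographic on them; it is a well-order and compatible
  with multiplication by monomials.\<close>

definition poskey :: "nat \<Rightarrow> ('n::finite \<Rightarrow> nat) \<Rightarrow> nat list" where
  "poskey j a = j # map a var_list"

lemma poskey_inject: "poskey j a = poskey j' a' \<longleftrightarrow> j = j' \<and> a = a'"
proof -
  have "map a var_list = map a' var_list \<longleftrightarrow> a = a'"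
    using var_list(1) by (auto simp: fun_eq_iff)
  then show ?thesis by (simp add: poskey_def)
qed

lemma list_add_less:
  fixes u v w :: "nat list"
  assumes "length u = length v" "length v = length w" "u < v"
  shows "map2 (+) u w < map2 (+) v w"
  using assms
proof (induction u v w rule: list_induct3)
  case (Cons x xs y ys z zs)
  then show ?case by (auto simp: list_less_def Cons_lenlex_iff)
qed (simp add: list_less_def)

lemma poskey_add_less:
  assumes "poskey j a < poskey j' a'"
  shows "poskey j (\<lambda>i. e i + a i) < poskey j' (\<lambda>i. e i + a' i)"
proof -
  have *: "map2 (+) (poskey k b) (0 # map e var_list) = poskey k (\<lambda>i. e i + b i)" for k b
    by (simp add: poskey_def map2_map_map add.commute)
  show ?thesis
    using list_add_less[OF _ _ assms, of "0 # map e var_list"] by (simp only: *) (simp add: poskey_def)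
qed

section \<open>Leading terms and division in free modules\<close>

definition coef :: "(nat \<Rightarrow> ('p::prime_card, 'n::finite) pol) \<Rightarrow> nat \<Rightarrow> ('n \<Rightarrow> nat) \<Rightarrow> 'p mod_ring" where
  "coef f j a = Poly_Mapping.lookup (f j) (exponent a)"

definition is_lead :: "(nat \<Rightarrow> ('p::prime_card, 'n::finite) pol) \<Rightarrow> nat \<Rightarrow> ('n \<Rightarrow> nat) \<Rightarrow> bool" where
  "is_lead f j a \<longleftrightarrow> coef f j a \<noteq> 0 \<and> (\<forall>k b. coef f k b \<noteq> 0 \<longrightarrow> poskey k b \<le> poskey j a)"

lemma lead_exists:
  fixes f :: "nat \<Rightarrow> ('p::prime_card, 'n::finite) pol"
  assumes "\<And>j. j \<ge> m \<Longrightarrow> f j = 0" "f \<noteq> (\<lambda>_. 0)"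
  shows "\<exists>j<m. \<exists>a. is_lead f j a"
proof -
  define P where "P = {(j, a). coef f j a \<noteq> 0}"
  have "P \<subseteq> (\<Union>j<m. (\<lambda>a. (j, Poly_Mapping.lookup a)) ` Poly_Mapping.keys (f j))"
  proof
    fix x assume "x \<in> P"
    then obtain j a where x: "x = (j, a)" "coef f j a \<noteq> 0" by (auto simp: P_def)
    then have "j < m" using assms(1)[of j] by (force simp: coef_def not_le[symmetric])
    moreover have "exponent a \<in> Poly_Mapping.keys (f j)" using x by (simp add: coef_def in_keys_iff)
    ultimately show "x \<in> (\<Union>j<m. (\<lambda>a. (j, Poly_Mapping.lookup a)) ` Poly_Mapping.keys (f j))"
      unfolding x(1) by (auto intro!: bexI[of _ j] image_eqI[of _ _ "exponent a"])
  qed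
  then have fin: "finite P" by (rule finite_subset) auto
  obtain j where "f j \<noteq> 0" using assms(2) by auto
  then obtain a where "a \<in> Poly_Mapping.keys (f j)" using keys_eq_empty[of "f j"] by blast
  then have "Poly_Mapping.lookup (f j) a \<noteq> 0" by (simp add: in_keys_iff)
  then have "(j, Poly_Mapping.lookup a) \<in> P" by (simp add: P_def coef_def)
  then have ne: "(\<lambda>(j, a). poskey j a) ` P \<noteq> {}" by auto
  let ?k = "Max ((\<lambda>(j, a). poskey j a) ` P)"
  have "?k \<in> (\<lambda>(j, a). poskey j a) ` P" using fin ne by (intro Max_in) auto
  then obtain j a where ja: "(j, a) \<in> P" "?k = poskey j a" by auto
  have "poskey k b \<le> poskey j a" if "coef f k b \<noteq> 0" for k b
    unfolding ja(2)[symmetric] using fin that by (intro Max_ge) (auto simp: P_def)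
  then have "is_lead f j a" using ja(1) by (auto simp: is_lead_def P_def)
  moreover have "j < m" using ja(1) assms(1)[of j] by (force simp: P_def coef_def not_le[symmetric])
  ultimately show ?thesis by blast
qed

lemma lookup_single_times: "Poly_Mapping.lookup (Poly_Mapping.single e d * g) (e + b) = d * Poly_Mapping.lookup g b"
  for g :: "('p::prime_card, 'n::finite) pol"
proof (induction g rule: pol_induct)
  case (single a v)
  then show ?case by (simp add: mult_single lookup_single when_def)
qed (simp_all add: distrib_left lookup_add)

lemma coef_single_times: "coef (\<lambda>j. Poly_Mapping.single (exponent e) d * g j) j (\<lambda>i. e i + b i) = d * coef g j b"
  by (simp add: coef_def exponent_add lookup_single_times)

lemma coef_single_times_nonzero:
  assumes "coef (\<lambda>j. Poly_Mapping.single (exponent e) d * g j) j a \<noteq> 0"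
  obtains b where "a = (\<lambda>i. e i + b i)" "coef g j b \<noteq> 0"
proof -
  have "exponent a \<in> Poly_Mapping.keys (Poly_Mapping.single (exponent e) d * g j)"
    using assms by (simp add: coef_def in_keys_iff)
  then obtain b' where b: "exponent a = exponent e + b'"
    using keys_mult[of "Poly_Mapping.single (exponent e) d" "g j"] by (fastforce split: if_splits)
  then have "Poly_Mapping.lookup (exponent a) = Poly_Mapping.lookup (exponent e + b')" by simp
  then have a: "a = (\<lambda>i. e i + Poly_Mapping.lookup b' i)" by (simp add: fun_eq_iff lookup_add)
  moreover have "coef g j (Poly_Mapping.lookup b') \<noteq> 0"
    using assms coef_single_times[of e d g j "Poly_Mapping.lookup b'"] unfolding a by auto
  ultimately show ?thesis by (rule that)
qed

text \<open>R^m is encoded by the sequences that vanish from m on, so that free modules of all ranks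
  share one type.\<close>

definition free_submodule :: "nat \<Rightarrow> (nat \<Rightarrow> ('p::prime_card, 'n::finite) pol) set \<Rightarrow> bool" where
  "free_submodule m K \<longleftrightarrow> (\<lambda>_. 0) \<in> K \<and> (\<forall>f\<in>K. \<forall>g\<in>K. (\<lambda>j. f j + g j) \<in> K) \<and>
     (\<forall>r. \<forall>f\<in>K. (\<lambda>j. r * f j) \<in> K) \<and> (\<forall>f\<in>K. \<forall>j\<ge>m. f j = 0)"

text \<open>A Groebner basis argument: Dickson's lemma selects finitely many leading exponents for
  each position, and subtracting monomial multiples of the chosen elements lowers the leading key of
  any f in K until nothing is left.\<close>

theorem free_submodule_fg:
  fixes K :: "(nat \<Rightarrow> ('p::prime_card, 'n::finite) pol) set"
  assumes K: "free_submodule m K"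
  shows "\<exists>(t::nat) g. (\<forall>l<t. g l \<in> K) \<and> (\<forall>f\<in>K. \<exists>a. f = (\<lambda>j. \<Sum>l<t. a l * g l j))"
proof -
  define A where "A j = {a. \<exists>f\<in>K. is_lead f j a}" for j
  have "\<forall>j. \<exists>B. finite B \<and> B \<subseteq> A j \<and> (\<forall>a\<in>A j. \<exists>b\<in>B. b \<le> a)" using dickson by blast
  then obtain B where B: "\<And>j. finite (B j)" "\<And>j. B j \<subseteq> A j" "\<And>j a. a \<in> A j \<Longrightarrow> \<exists>b\<in>B j. b \<le> a" by metis
  define G where "G j b = (SOME f. f \<in> K \<and> is_lead f j b)" for j b
  have G: "G j b \<in> K \<and> is_lead (G j b) j b" if "b \<in> B j" for j b
  proof -
    have "\<exists>f. f \<in> K \<and> is_lead f j b" using that B(2)[of j] unfolding A_def by blast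
    then show ?thesis unfolding G_def by (rule someI_ex)
  qed
  have "finite (\<Union>j<m. G j ` B j)" using B(1) by auto
  from finite_list[OF this] obtain gs where gs: "set gs = (\<Union>j<m. G j ` B j)" by (elim exE)
  define sp where "sp = {f. \<exists>a. f = (\<lambda>j. \<Sum>l<length gs. a l * (gs ! l) j)}"
  have sp_add: "(\<lambda>j. f j + r * g j) \<in> sp" if f: "f \<in> sp" and g: "g \<in> set gs" for f g r
  proof -
    obtain a where a: "f = (\<lambda>j. \<Sum>l<length gs. a l * (gs ! l) j)" using f by (auto simp: sp_def)
    obtain k where k: "k < length gs" "g = gs ! k" using g by (metis in_set_conv_nth)
    have "(\<Sum>l<length gs. (a(k := a k + r)) l * (gs ! l) j) = f j + r * g j" for j
    proof -
      have "(\<Sum>l<length gs. (a(k := a k + r)) l * (gs ! l) j)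
          = (\<Sum>l<length gs. a l * (gs ! l) j + (if k = l then r * (gs ! l) j else 0))"
        by (rule sum.cong) (auto simp: distrib_right)
      then show ?thesis using k by (simp add: sum.distrib a)
    qed
    then have "(\<lambda>j. f j + r * g j) = (\<lambda>j. \<Sum>l<length gs. (a(k := a k + r)) l * (gs ! l) j)" by simp
    then show ?thesis unfolding sp_def by blast
  qed
  have sp_zero: "(\<lambda>_. 0) \<in> sp" unfolding sp_def by (auto intro!: exI[of _ "\<lambda>_. 0"])
  have main: "f \<in> sp" if "f \<in> K" "is_lead f j a" for f j a
    using that
  proof (induction "poskey j a" arbitrary: f j a rule: less_induct)
    case less
    have fj: "\<forall>i\<ge>m. f i = 0" using K less.prems(1) by (auto simp: free_submodule_def)
    then have jm: "j < m" using less.prems(2) by (force simp: is_lead_def coef_def not_le[symmetric])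
    have "a \<in> A j" using less.prems by (auto simp: A_def)
    then obtain b where b: "b \<in> B j" "b \<le> a" using B(3) by blast
    let ?g = "G j b"
    have g: "?g \<in> K" "is_lead ?g j b" "?g \<in> set gs" using G[OF b(1)] b(1) jm gs by auto
    let ?e = "\<lambda>i. a i - b i"
    have ae: "a = (\<lambda>i. ?e i + b i)" using b(2) by (auto simp: le_fun_def)
    let ?d = "coef f j a / coef ?g j b"
    let ?s = "Poly_Mapping.single (exponent ?e) ?d"
    let ?f' = "\<lambda>i. f i + (- ?s) * ?g i"
    have cf': "coef ?f' k c = coef f k c - coef (\<lambda>i. ?s * ?g i) k c" for k c
      by (simp add: coef_def lookup_minus)
    have Kadd: "(\<lambda>i. u i + v i) \<in> K" if "u \<in> K" "v \<in> K" for u v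
      using K that by (simp add: free_submodule_def)
    have Ksm: "(\<lambda>i. r * u i) \<in> K" if "u \<in> K" for u r
      using K that by (simp add: free_submodule_def)
    have f'K: "?f' \<in> K" by (rule Kadd[OF less.prems(1) Ksm[OF g(1)]])
    have small: "poskey k c < poskey j a" if nz: "coef ?f' k c \<noteq> 0" for k c
    proof -
      have "poskey k c \<le> poskey j a"
      proof (cases "coef f k c = 0")
        case True
        then have "coef (\<lambda>i. ?s * ?g i) k c \<noteq> 0" using nz cf' by simp
        then obtain c' where c': "c = (\<lambda>i. ?e i + c' i)" "coef ?g k c' \<noteq> 0" by (rule coef_single_times_nonzero)
        then have "poskey k c' \<le> poskey j b" using g(2) by (auto simp: is_lead_def)
        then have "poskey k c' < poskey j b \<or> (k = j \<and> c' = b)" by (auto simp: order_le_less poskey_inject)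
        then show ?thesis
        proof
          assume "poskey k c' < poskey j b"
          from poskey_add_less[OF this, of ?e] show ?thesis unfolding c'(1) using ae by simp
        qed (use c'(1) ae in auto)
      next
        case False
        then show ?thesis using less.prems(2) by (auto simp: is_lead_def)
      qed
      moreover have "poskey k c \<noteq> poskey j a"
      proof
        assume "poskey k c = poskey j a"
        then have kc: "k = j" "c = a" by (auto simp: poskey_inject)
        have "coef (\<lambda>i. ?s * ?g i) j a = ?d * coef ?g j b"
          using coef_single_times[of ?e ?d ?g j b] ae by simp
        also have "\<dots> = coef f j a" using g(2) by (simp add: is_lead_def)
        finally show False using nz cf' kc by simp
      qed
      ultimately show ?thesis by simp
    qed
    have "?f' \<in> sp"
    proof (cases "?f' = (\<lambda>_. 0)")
      case False
      have "?f' i = 0" if "i \<ge> m" for i using K f'K that by (auto simp: free_submodule_def)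
      from lead_exists[OF this False] obtain k c where kc: "is_lead ?f' k c" by blast
      then have "poskey k c < poskey j a" using small by (auto simp: is_lead_def)
      from less.hyps[OF this f'K kc] show ?thesis .
    qed (use sp_zero in simp)
    from sp_add[OF this g(3), of ?s] show "f \<in> sp" by simp
  qed
  have spK: "f \<in> sp" if "f \<in> K" for f
  proof (cases "f = (\<lambda>_. 0)")
    case False
    have "f i = 0" if "i \<ge> m" for i using K \<open>f \<in> K\<close> that by (auto simp: free_submodule_def)
    from lead_exists[OF this False] show ?thesis using main[OF that] by blast
  qed (use sp_zero in simp)
  have gsK: "gs ! l \<in> K" if "l < length gs" for l
    using nth_mem[OF that] gs G by auto
  have 1: "\<forall>l<length gs. gs ! l \<in> K" using gsK by blast
  have 2: "\<forall>f\<in>K. \<exists>a. f = (\<lambda>j. \<Sum>l<length gs. a l * (gs ! l) j)"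
    using spK unfolding sp_def by simp
  show ?thesis by (rule exI[of _ "length gs"], rule exI[of _ "(!) gs"]) (rule conjI[OF 1 2])
qed

section \<open>Modules over a commutative ring and injective resolutions\<close>

lemma finsum_exchange:
  assumes "abelian_monoid G" "finite A" "finite B" "\<And>a b. a \<in> A \<Longrightarrow> b \<in> B \<Longrightarrow> f a b \<in> carrier G"
  shows "(\<Oplus>\<^bsub>G\<^esub>a\<in>A. \<Oplus>\<^bsub>G\<^esub>b\<in>B. f a b) = (\<Oplus>\<^bsub>G\<^esub>b\<in>B. \<Oplus>\<^bsub>G\<^esub>a\<in>A. f a b)"
proof -
  interpret abelian_monoid G by fact
  show ?thesis using assms(2,4)
  proof (induction A)
    case (insert x F)
    have c: "(\<lambda>a. \<Oplus>\<^bsub>G\<^esub>b\<in>B. f a b) \<in> F \<rightarrow> carrier G" "(\<Oplus>\<^bsub>G\<^esub>b\<in>B. f x b) \<in> carrier G"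
      "(\<lambda>b. f x b) \<in> B \<rightarrow> carrier G" "(\<lambda>b. \<Oplus>\<^bsub>G\<^esub>a\<in>F. f a b) \<in> B \<rightarrow> carrier G"
      using insert by (auto intro!: finsum_closed)
    have "(\<Oplus>\<^bsub>G\<^esub>b\<in>B. \<Oplus>\<^bsub>G\<^esub>a\<in>insert x F. f a b) = (\<Oplus>\<^bsub>G\<^esub>b\<in>B. f x b \<oplus>\<^bsub>G\<^esub> (\<Oplus>\<^bsub>G\<^esub>a\<in>F. f a b))"
      using insert by (intro finsum_cong') (auto intro!: finsum_insert finsum_closed)
    also have "\<dots> = (\<Oplus>\<^bsub>G\<^esub>b\<in>B. f x b) \<oplus>\<^bsub>G\<^esub> (\<Oplus>\<^bsub>G\<^esub>b\<in>B. \<Oplus>\<^bsub>G\<^esub>a\<in>F. f a b)"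
      by (rule finsum_addf[OF c(3,4)])
    also have "(\<Oplus>\<^bsub>G\<^esub>b\<in>B. \<Oplus>\<^bsub>G\<^esub>a\<in>F. f a b) = (\<Oplus>\<^bsub>G\<^esub>a\<in>F. \<Oplus>\<^bsub>G\<^esub>b\<in>B. f a b)"
      using insert by simp
    also have "(\<Oplus>\<^bsub>G\<^esub>b\<in>B. f x b) \<oplus>\<^bsub>G\<^esub> \<dots> = (\<Oplus>\<^bsub>G\<^esub>a\<in>insert x F. \<Oplus>\<^bsub>G\<^esub>b\<in>B. f a b)"
      using insert c by (intro finsum_insert[symmetric]) auto
    finally show ?case by simp
  qed simp
qed

locale cmod =
  fixes E :: "('r::comm_ring_1, 'e) module" (structure)
  assumes is_mod: "module class_ring E"
begin

sublocale module class_ring E by (rule is_mod)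

lemma cm_closed [simp, intro]: "x \<in> carrier E \<Longrightarrow> r \<odot> x \<in> carrier E"
  by (rule smult_closed) simp

lemma cm_add_l: "x \<in> carrier E \<Longrightarrow> (r + s) \<odot> x = r \<odot> x \<oplus> s \<odot> x"
  using smult_l_distr[of r s x] by simp

lemma cm_add_r: "x \<in> carrier E \<Longrightarrow> y \<in> carrier E \<Longrightarrow> r \<odot> (x \<oplus> y) = r \<odot> x \<oplus> r \<odot> y"
  using smult_r_distr[of r x y] by simp

lemma cm_mult: "x \<in> carrier E \<Longrightarrow> (r * s) \<odot> x = r \<odot> (s \<odot> x)"
  using smult_assoc1[of r s x] by simp

lemma cm_one [simp]: "x \<in> carrier E \<Longrightarrow> 1 \<odot> x = x"
  using smult_one[of x] by simp

lemma cm_zero_l [simp]: "x \<in> carrier E \<Longrightarrow> 0 \<odot> x = \<zero>"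
  using smult_l_null[of x] by simp

lemma cm_zero_r [simp]: "r \<odot> \<zero> = \<zero>"
  using smult_r_null[of r] by simp

lemma cm_uminus: "x \<in> carrier E \<Longrightarrow> (- 1) \<odot> x = \<ominus> x"
  using cm_add_l[of x "- 1" 1] minus_equality[of "(- 1) \<odot> x" x] by simp

lemma cm_minus_r: "x \<in> carrier E \<Longrightarrow> r \<odot> (\<ominus> x) = \<ominus> (r \<odot> x)"
  using smult_r_minus[of r x] by simp

lemma cm_finsum: "f \<in> A \<rightarrow> carrier E \<Longrightarrow> r \<odot> (finsum E f A) = (\<Oplus>x\<in>A. r \<odot> f x)"
  by (rule finsum_additive) (auto simp: cm_add_r abelian_monoid_axioms)

lemma cm_sum:
  assumes "x \<in> carrier E"
  shows "sum f A \<odot> x = (\<Oplus>a\<in>A. f a \<odot> x)"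
  by (induction A rule: infinite_finite_induct) (auto simp: assms cm_add_l Pi_def)

lemma cm_submoduleI:
  assumes "H \<subseteq> carrier E" "\<zero> \<in> H" "\<And>x y. x \<in> H \<Longrightarrow> y \<in> H \<Longrightarrow> x \<oplus> y \<in> H" "\<And>r x. x \<in> H \<Longrightarrow> r \<odot> x \<in> H"
  shows "Module.submodule H class_ring E"
proof (rule submoduleI)
  show "\<ominus> x \<in> H" if "x \<in> H" for x
    using assms(4)[OF that, of "- 1"] cm_uminus[of x] that assms(1) by auto
qed (use assms in auto)

lemma cancel_diff: "x \<in> carrier E \<Longrightarrow> y \<in> carrier E \<Longrightarrow> (x \<ominus> y) \<oplus> y = x"
  by (simp add: minus_eq a_assoc l_neg)

lemma diff_eq_zero: "x \<in> carrier E \<Longrightarrow> y \<in> carrier E \<Longrightarrow> x \<ominus> y = \<zero> \<longleftrightarrow> x = y"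
  by (metis cancel_diff l_zero minus_eq r_neg)

end

section \<open>Linear maps over a commutative ring and their extension to injective modules\<close>

abbreviation hom_set :: "('r::comm_ring_1, 'b) module \<Rightarrow> ('r, 'c) module \<Rightarrow> ('b \<Rightarrow> 'c) set" where
  "hom_set A B \<equiv> module_hom class_ring A B"

lemma hom_setI:
  assumes "\<And>x. x \<in> carrier A \<Longrightarrow> h x \<in> carrier B"
    "\<And>x y. x \<in> carrier A \<Longrightarrow> y \<in> carrier A \<Longrightarrow> h (x \<oplus>\<^bsub>A\<^esub> y) = h x \<oplus>\<^bsub>B\<^esub> h y"
    "\<And>r x. x \<in> carrier A \<Longrightarrow> h (r \<odot>\<^bsub>A\<^esub> x) = r \<odot>\<^bsub>B\<^esub> h x"
  shows "h \<in> hom_set A B"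
  using assms by (simp add: module_hom_def)

lemma hom_setD:
  assumes "h \<in> hom_set A B"
  shows "x \<in> carrier A \<Longrightarrow> h x \<in> carrier B"
    "x \<in> carrier A \<Longrightarrow> y \<in> carrier A \<Longrightarrow> h (x \<oplus>\<^bsub>A\<^esub> y) = h x \<oplus>\<^bsub>B\<^esub> h y"
    "x \<in> carrier A \<Longrightarrow> h (r \<odot>\<^bsub>A\<^esub> x) = r \<odot>\<^bsub>B\<^esub> h x"
  using assms by (auto simp: module_hom_def)

lemma hom_set_zero:
  assumes "cmod A" "cmod B" "h \<in> hom_set A B"
  shows "h \<zero>\<^bsub>A\<^esub> = \<zero>\<^bsub>B\<^esub>"
proof -
  interpret A: cmod A by fact
  interpret B: cmod B by fact
  show ?thesis using hom_setD(3)[OF assms(3), of "\<zero>\<^bsub>A\<^esub>" 0] hom_setD(1)[OF assms(3), of "\<zero>\<^bsub>A\<^esub>"] by simp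
qed

lemma hom_set_minus:
  assumes "cmod A" "cmod B" "h \<in> hom_set A B" "x \<in> carrier A"
  shows "h (\<ominus>\<^bsub>A\<^esub> x) = \<ominus>\<^bsub>B\<^esub> h x"
proof -
  interpret A: cmod A by fact
  interpret B: cmod B by fact
  show ?thesis using hom_setD(3)[OF assms(3,4), of "- 1"] hom_setD(1)[OF assms(3,4)] assms(4)
    by (simp add: A.cm_uminus B.cm_uminus)
qed

lemma hom_set_diff_elem:
  assumes "cmod A" "cmod B" "h \<in> hom_set A B" "x \<in> carrier A" "y \<in> carrier A"
  shows "h (x \<ominus>\<^bsub>A\<^esub> y) = h x \<ominus>\<^bsub>B\<^esub> h y"
proof -
  interpret A: cmod A by fact
  show ?thesis unfolding a_minus_def
    using hom_setD(2)[OF assms(3,4), of "\<ominus>\<^bsub>A\<^esub> y"] hom_set_minus[OF assms(1-3,5)] assms by simp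
qed

lemma hom_set_finsum:
  assumes "cmod A" "cmod B" "h \<in> hom_set A B" "f \<in> I \<rightarrow> carrier A"
  shows "h (finsum A f I) = (\<Oplus>\<^bsub>B\<^esub>i\<in>I. h (f i))"
proof -
  interpret A: cmod A by fact
  interpret B: cmod B by fact
  show ?thesis
    by (rule finsum_additive[OF A.abelian_monoid_axioms B.abelian_monoid_axioms])
      (use assms hom_set_zero[OF assms(1-3)] hom_setD[OF assms(3)] in auto)
qed

lemma hom_set_comp: "g \<in> hom_set B C \<Longrightarrow> h \<in> hom_set A B \<Longrightarrow> (\<lambda>x. g (h x)) \<in> hom_set A C"
  by (rule hom_setI) (simp_all add: hom_setD)

lemma hom_set_diff:
  assumes "cmod A" "cmod B" "g \<in> hom_set A B" "h \<in> hom_set A B"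
  shows "(\<lambda>x. g x \<ominus>\<^bsub>B\<^esub> h x) \<in> hom_set A B"
proof -
  interpret A: cmod A by fact
  interpret B: cmod B by fact
  note g = hom_setD[OF assms(3)] and h = hom_setD[OF assms(4)]
  show ?thesis
  proof (rule hom_setI)
    fix x y assume "x \<in> carrier A" "y \<in> carrier A"
    then show "g (x \<oplus>\<^bsub>A\<^esub> y) \<ominus>\<^bsub>B\<^esub> h (x \<oplus>\<^bsub>A\<^esub> y) = g x \<ominus>\<^bsub>B\<^esub> h x \<oplus>\<^bsub>B\<^esub> (g y \<ominus>\<^bsub>B\<^esub> h y)"
      by (simp add: g h B.minus_eq B.minus_add B.a_ac)
  next
    fix r x assume "x \<in> carrier A"
    then show "g (r \<odot>\<^bsub>A\<^esub> x) \<ominus>\<^bsub>B\<^esub> h (r \<odot>\<^bsub>A\<^esub> x) = r \<odot>\<^bsub>B\<^esub> (g x \<ominus>\<^bsub>B\<^esub> h x)"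
      by (simp add: g h B.minus_eq B.cm_add_r B.cm_minus_r)
  qed (use g(1) h(1) in auto)
qed

lemma cmod_regular: "cmod (regular_module (class_ring :: 'r::comm_ring_1 ring))"
proof (rule cmod.intro)
  have "abelian_group (regular_module (class_ring :: 'r ring))"
    by (rule abelian_groupI) (auto simp: regular_module_def add_ac intro: exI[of _ "- _"])
  then show "module class_ring (regular_module (class_ring :: 'r ring))"
    by (intro moduleI class_cring.cring_axioms) (auto simp: regular_module_def distrib_left distrib_right mult_ac)
qed

lemma cmod_submodule:
  assumes "cmod A" "Module.submodule H class_ring A"
  shows "cmod (A\<lparr>carrier := H\<rparr>)"
  using Module.submodule.submodule_is_module[OF assms(2)] assms(1) by (simp add: cmod_def)

text \<open>Baer's criterion, by Zorn's lemma applied to the graphs of partial extensions.\<close>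

lemma baer:
  fixes N :: "('r::comm_ring_1, 'b) module" and E :: "('r, 'e) module"
  assumes inj: "injective_module class_ring E" and N: "cmod N"
    and K: "Module.submodule K class_ring N" and h: "h \<in> hom_set (N\<lparr>carrier := K\<rparr>) E"
  shows "\<exists>g \<in> hom_set N E. \<forall>x\<in>K. g x = h x"
proof -
  interpret N: cmod N by (rule N)
  interpret E: cmod E using inj by (simp add: injective_module_def cmod_def)
  note K' = N.submoduleE[OF K]
  note h' = hom_setD[OF h, simplified]
  have K0: "\<zero>\<^bsub>N\<^esub> \<in> K" using subgroup.one_closed[OF Module.submodule.axioms(1)[OF K]] by simp
  \<comment> \<open>For a submodule of the product of N and E, being a graph amounts to containing
    (0, e) only for e = 0. In this form single-valuedness passes to unions of chains.\<close>
  define Gr where "Gr = {G. G \<subseteq> carrier N \<times> carrier E \<and>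
    (\<forall>x e y f. (x, e) \<in> G \<longrightarrow> (y, f) \<in> G \<longrightarrow> (x \<oplus>\<^bsub>N\<^esub> y, e \<oplus>\<^bsub>E\<^esub> f) \<in> G) \<and>
    (\<forall>r x e. (x, e) \<in> G \<longrightarrow> (r \<odot>\<^bsub>N\<^esub> x, r \<odot>\<^bsub>E\<^esub> e) \<in> G) \<and>
    (\<forall>e. (\<zero>\<^bsub>N\<^esub>, e) \<in> G \<longrightarrow> e = \<zero>\<^bsub>E\<^esub>) \<and> (\<lambda>x. (x, h x)) ` K \<subseteq> G}"
  have GrD: "G \<subseteq> carrier N \<times> carrier E"
      "\<And>x e y f. (x, e) \<in> G \<Longrightarrow> (y, f) \<in> G \<Longrightarrow> (x \<oplus>\<^bsub>N\<^esub> y, e \<oplus>\<^bsub>E\<^esub> f) \<in> G"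
      "\<And>r x e. (x, e) \<in> G \<Longrightarrow> (r \<odot>\<^bsub>N\<^esub> x, r \<odot>\<^bsub>E\<^esub> e) \<in> G"
      "\<And>e. (\<zero>\<^bsub>N\<^esub>, e) \<in> G \<Longrightarrow> e = \<zero>\<^bsub>E\<^esub>" "(\<lambda>x. (x, h x)) ` K \<subseteq> G" if "G \<in> Gr" for G
    using that by (simp_all add: Gr_def)
  have h0: "h \<zero>\<^bsub>N\<^esub> = \<zero>\<^bsub>E\<^esub>" using h'(3)[OF K0, of 0] h'(1)[OF K0] by simp
  have "(\<lambda>x. (x, h x)) ` K \<in> Gr"
    unfolding Gr_def using K'(1,4,5) h' h0 by auto
  moreover have "\<Union>C \<in> Gr" if C: "C \<noteq> {}" "subset.chain Gr C" for C
  proof -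
    have CG: "\<And>G. G \<in> C \<Longrightarrow> G \<in> Gr" and lin: "\<And>G H. G \<in> C \<Longrightarrow> H \<in> C \<Longrightarrow> G \<subseteq> H \<or> H \<subseteq> G"
      using C(2) by (auto simp: subset.chain_def)
    have "\<Union>C \<subseteq> carrier N \<times> carrier E" by (rule Union_least) (rule GrD(1)[OF CG])
    moreover have "(x \<oplus>\<^bsub>N\<^esub> y, e \<oplus>\<^bsub>E\<^esub> f) \<in> \<Union>C" if xe: "(x, e) \<in> \<Union>C" "(y, f) \<in> \<Union>C" for x e y f
    proof -
      obtain G H where GH: "G \<in> C" "H \<in> C" "(x, e) \<in> G" "(y, f) \<in> H" using xe by auto
      then obtain L where L: "L \<in> C" "(x, e) \<in> L" "(y, f) \<in> L" using lin[OF GH(1,2)] by blast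
      show ?thesis by (rule UnionI[OF L(1) GrD(2)[OF CG[OF L(1)] L(2,3)]])
    qed
    moreover have "(r \<odot>\<^bsub>N\<^esub> x, r \<odot>\<^bsub>E\<^esub> e) \<in> \<Union>C" if xe: "(x, e) \<in> \<Union>C" for r x e
    proof -
      obtain L where L: "L \<in> C" "(x, e) \<in> L" using xe by auto
      show ?thesis by (rule UnionI[OF L(1) GrD(3)[OF CG[OF L(1)] L(2)]])
    qed
    moreover have "e = \<zero>\<^bsub>E\<^esub>" if ze: "(\<zero>\<^bsub>N\<^esub>, e) \<in> \<Union>C" for e
    proof -
      obtain L where L: "L \<in> C" "(\<zero>\<^bsub>N\<^esub>, e) \<in> L" using ze by auto
      show ?thesis by (rule GrD(4)[OF CG[OF L(1)] L(2)])
    qed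
    moreover have "(\<lambda>x. (x, h x)) ` K \<subseteq> \<Union>C"
    proof -
      obtain L where L: "L \<in> C" using C(1) by auto
      show ?thesis by (rule order_trans[OF GrD(5)[OF CG[OF L]] Union_upper[OF L]])
    qed
    ultimately show ?thesis unfolding Gr_def by simp
  qed
  ultimately obtain G where G: "G \<in> Gr" and maxi: "\<And>G'. G' \<in> Gr \<Longrightarrow> G \<subseteq> G' \<Longrightarrow> G' = G"
    using subset_Zorn_nonempty[of Gr] by blast
  note G' = GrD[OF G]
  have Gc: "x \<in> carrier N" "e \<in> carrier E" if "(x, e) \<in> G" for x e using that G'(1) by auto
  note Ga = G'(2) and Gs = G'(3) and Gz = G'(4)
  have Gh: "(x, h x) \<in> G" if "x \<in> K" for x using that G'(5) by auto
  have Gf: "e = f" if "(x, e) \<in> G" "(x, f) \<in> G" for x e f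
  proof -
    have "(x \<oplus>\<^bsub>N\<^esub> (- 1) \<odot>\<^bsub>N\<^esub> x, e \<oplus>\<^bsub>E\<^esub> (- 1) \<odot>\<^bsub>E\<^esub> f) \<in> G" by (rule Ga[OF that(1) Gs[OF that(2)]])
    moreover have "x \<oplus>\<^bsub>N\<^esub> (- 1) \<odot>\<^bsub>N\<^esub> x = \<zero>\<^bsub>N\<^esub>" using Gc[OF that(1)] by (simp add: N.cm_uminus N.r_neg)
    ultimately have "e \<oplus>\<^bsub>E\<^esub> (- 1) \<odot>\<^bsub>E\<^esub> f = \<zero>\<^bsub>E\<^esub>" using Gz by simp
    then show ?thesis using E.diff_eq_zero[of e f] Gc[OF that(1)] Gc[OF that(2)] by (simp add: E.cm_uminus a_minus_def)
  qed
  have total: "\<exists>e. (x, e) \<in> G" if x: "x \<in> carrier N" for x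
  proof -
    let ?RM = "regular_module (class_ring :: 'r ring)"
    interpret RM: cmod ?RM by (rule cmod_regular)
    \<comment> \<open>The scalars that carry x into the domain of G form an ideal. The assumed
      injectivity, which speaks of modules on the type of the ring, is applied to the inclusion of
      this ideal into the regular module.\<close>
    define I where "I = {a. \<exists>e. (a \<odot>\<^bsub>N\<^esub> x, e) \<in> G}"
    define h1 where "h1 a = (THE e. (a \<odot>\<^bsub>N\<^esub> x, e) \<in> G)" for a
    have h1: "h1 a = e" if "(a \<odot>\<^bsub>N\<^esub> x, e) \<in> G" for a e
      unfolding h1_def using that Gf by (intro the_equality) auto
    have h1G: "(a \<odot>\<^bsub>N\<^esub> x, h1 a) \<in> G" if "a \<in> I" for a using that h1 unfolding I_def by auto
    have Ia: "((a + b) \<odot>\<^bsub>N\<^esub> x, h1 a \<oplus>\<^bsub>E\<^esub> h1 b) \<in> G" if "a \<in> I" "b \<in> I" for a b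
      using Ga[OF h1G[OF that(1)] h1G[OF that(2)]] x by (simp add: N.cm_add_l)
    have Is: "((r * a) \<odot>\<^bsub>N\<^esub> x, r \<odot>\<^bsub>E\<^esub> h1 a) \<in> G" if "a \<in> I" for r a
      using Gs[OF h1G[OF that]] x by (simp add: N.cm_mult)
    have "(0 \<odot>\<^bsub>N\<^esub> x, \<zero>\<^bsub>E\<^esub>) \<in> G" using Gh[OF K0] h0 x by simp
    then have I: "Module.submodule I class_ring ?RM"
    proof (intro RM.cm_submoduleI)
      show "a \<oplus>\<^bsub>?RM\<^esub> b \<in> I" if "a \<in> I" "b \<in> I" for a b
        unfolding I_def using Ia[OF that] by (auto simp: regular_module_def)
      show "r \<odot>\<^bsub>?RM\<^esub> a \<in> I" if "a \<in> I" for r a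
        unfolding I_def using Is[OF that, of r] by (auto simp: regular_module_def)
    qed (auto simp: regular_module_def I_def)
    have "h1 \<in> hom_set (?RM\<lparr>carrier := I\<rparr>) E"
      using h1[OF Ia] h1[OF Is] Gc(2)[OF h1G] by (intro hom_setI) (auto simp: regular_module_def)
    then obtain g1 where g1: "g1 \<in> hom_set ?RM E" "\<And>a. a \<in> I \<Longrightarrow> g1 a = h1 a"
      using inj I RM.is_mod unfolding injective_module_def by blast
    define e0 where "e0 = g1 1"
    have e0: "e0 \<in> carrier E" using hom_setD(1)[OF g1(1), of 1] by (simp add: e0_def regular_module_def)
    have g1e: "g1 a = a \<odot>\<^bsub>E\<^esub> e0" for a
      using hom_setD(3)[OF g1(1), of 1 a] by (simp add: e0_def regular_module_def)
    define G' where "G' = {(y \<oplus>\<^bsub>N\<^esub> a \<odot>\<^bsub>N\<^esub> x, f \<oplus>\<^bsub>E\<^esub> a \<odot>\<^bsub>E\<^esub> e0) | y f a. (y, f) \<in> G}"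
    have GG': "G \<subseteq> G'"
    proof clarify
      fix y f assume yf: "(y, f) \<in> G"
      then have "(y, f) = (y \<oplus>\<^bsub>N\<^esub> 0 \<odot>\<^bsub>N\<^esub> x, f \<oplus>\<^bsub>E\<^esub> 0 \<odot>\<^bsub>E\<^esub> e0)" using Gc[OF yf] x e0 by simp
      then show "(y, f) \<in> G'" unfolding G'_def using yf by blast
    qed
    have "G' \<in> Gr"
      unfolding Gr_def
    proof (intro CollectI conjI allI impI)
      show "G' \<subseteq> carrier N \<times> carrier E" using Gc x e0 by (auto simp: G'_def)
      show "(\<lambda>x. (x, h x)) ` K \<subseteq> G'" using Gh GG' by auto
      fix y f
      { fix y' f' assume "(y, f) \<in> G'" "(y', f') \<in> G'"
        then obtain u v a u' v' a' where uv: "y = u \<oplus>\<^bsub>N\<^esub> a \<odot>\<^bsub>N\<^esub> x" "f = v \<oplus>\<^bsub>E\<^esub> a \<odot>\<^bsub>E\<^esub> e0" "(u, v) \<in> G"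
            "y' = u' \<oplus>\<^bsub>N\<^esub> a' \<odot>\<^bsub>N\<^esub> x" "f' = v' \<oplus>\<^bsub>E\<^esub> a' \<odot>\<^bsub>E\<^esub> e0" "(u', v') \<in> G"
          unfolding G'_def by blast
        then have "y \<oplus>\<^bsub>N\<^esub> y' = (u \<oplus>\<^bsub>N\<^esub> u') \<oplus>\<^bsub>N\<^esub> (a + a') \<odot>\<^bsub>N\<^esub> x" "f \<oplus>\<^bsub>E\<^esub> f' = (v \<oplus>\<^bsub>E\<^esub> v') \<oplus>\<^bsub>E\<^esub> (a + a') \<odot>\<^bsub>E\<^esub> e0"
          using Gc[OF uv(3)] Gc[OF uv(6)] x e0 by (simp_all add: N.cm_add_l E.cm_add_l N.a_ac E.a_ac)
        then show "(y \<oplus>\<^bsub>N\<^esub> y', f \<oplus>\<^bsub>E\<^esub> f') \<in> G'" unfolding G'_def using Ga[OF uv(3,6)] by blast }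
      { fix r assume "(y, f) \<in> G'"
        then obtain u v a where uv: "y = u \<oplus>\<^bsub>N\<^esub> a \<odot>\<^bsub>N\<^esub> x" "f = v \<oplus>\<^bsub>E\<^esub> a \<odot>\<^bsub>E\<^esub> e0" "(u, v) \<in> G"
          unfolding G'_def by blast
        then have "r \<odot>\<^bsub>N\<^esub> y = r \<odot>\<^bsub>N\<^esub> u \<oplus>\<^bsub>N\<^esub> (r * a) \<odot>\<^bsub>N\<^esub> x" "r \<odot>\<^bsub>E\<^esub> f = r \<odot>\<^bsub>E\<^esub> v \<oplus>\<^bsub>E\<^esub> (r * a) \<odot>\<^bsub>E\<^esub> e0"
          using Gc[OF uv(3)] x e0 by (simp_all add: N.cm_add_r E.cm_add_r N.cm_mult E.cm_mult)
        then show "(r \<odot>\<^bsub>N\<^esub> y, r \<odot>\<^bsub>E\<^esub> f) \<in> G'" unfolding G'_def using Gs[OF uv(3)] by blast }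
      { assume "(\<zero>\<^bsub>N\<^esub>, f) \<in> G'"
        then obtain u v a where uv: "\<zero>\<^bsub>N\<^esub> = u \<oplus>\<^bsub>N\<^esub> a \<odot>\<^bsub>N\<^esub> x" "f = v \<oplus>\<^bsub>E\<^esub> a \<odot>\<^bsub>E\<^esub> e0" "(u, v) \<in> G"
          unfolding G'_def by blast
        have "a \<odot>\<^bsub>N\<^esub> x = (- 1) \<odot>\<^bsub>N\<^esub> u"
          using N.minus_equality[of "a \<odot>\<^bsub>N\<^esub> x" u] uv(1) Gc[OF uv(3)] x by (simp add: N.cm_uminus N.a_comm)
        then have aG: "(a \<odot>\<^bsub>N\<^esub> x, (- 1) \<odot>\<^bsub>E\<^esub> v) \<in> G" using Gs[OF uv(3), of "- 1"] by simp
        then have "a \<odot>\<^bsub>E\<^esub> e0 = (- 1) \<odot>\<^bsub>E\<^esub> v" using g1(2)[of a] h1[OF aG] g1e[of a] unfolding I_def by auto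
        then show "f = \<zero>\<^bsub>E\<^esub>" unfolding uv(2) using Gc[OF uv(3)] by (simp add: E.cm_uminus E.r_neg) }
    qed
    then have "G' = G" using maxi GG' by blast
    moreover have "(\<zero>\<^bsub>N\<^esub> \<oplus>\<^bsub>N\<^esub> 1 \<odot>\<^bsub>N\<^esub> x, \<zero>\<^bsub>E\<^esub> \<oplus>\<^bsub>E\<^esub> 1 \<odot>\<^bsub>E\<^esub> e0) \<in> G'"
      unfolding G'_def using Gh[OF K0] h0 by auto
    ultimately have "(x, e0) \<in> G" using x e0 by simp
    then show ?thesis ..
  qed
  define g where "g x = (THE e. (x, e) \<in> G)" for x
  have g: "g x = e" if "(x, e) \<in> G" for x e unfolding g_def using that Gf by (intro the_equality) auto
  have gG: "(x, g x) \<in> G" if "x \<in> carrier N" for x using total[OF that] g by auto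
  have "g \<in> hom_set N E"
    by (rule hom_setI) (use Gc(2)[OF gG] g[OF Ga[OF gG gG]] g[OF Gs[OF gG]] in auto)
  moreover have "\<forall>x\<in>K. g x = h x" using g Gh by blast
  ultimately show ?thesis by blast
qed

text \<open>The form in which injectivity feeds the comparison theorem: f descends to the image of
  \<beta> because it kills the kernel, and Baer's criterion extends it from there to C.\<close>

lemma factor_through:
  assumes B: "cmod B" and C: "cmod C" and inj: "injective_module class_ring E"
    and \<beta>: "\<beta> \<in> hom_set B C" and f: "f \<in> hom_set B E"
    and ker: "\<And>b. b \<in> carrier B \<Longrightarrow> \<beta> b = \<zero>\<^bsub>C\<^esub> \<Longrightarrow> f b = \<zero>\<^bsub>E\<^esub>"
  shows "\<exists>g \<in> hom_set C E. \<forall>b\<in>carrier B. g (\<beta> b) = f b"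
proof -
  interpret B: cmod B by (rule B)
  interpret C: cmod C by (rule C)
  interpret E: cmod E using inj by (simp add: injective_module_def cmod_def)
  note \<beta>' = hom_setD[OF \<beta>] and f' = hom_setD[OF f]
  have E: "cmod E" by unfold_locales
  have K: "Module.submodule (\<beta> ` carrier B) class_ring C"
  proof (rule C.cm_submoduleI)
    show "\<zero>\<^bsub>C\<^esub> \<in> \<beta> ` carrier B" using hom_set_zero[OF B C \<beta>] by (metis B.zero_closed imageI)
    show "x \<oplus>\<^bsub>C\<^esub> y \<in> \<beta> ` carrier B" if "x \<in> \<beta> ` carrier B" "y \<in> \<beta> ` carrier B" for x y
      using that \<beta>'(2)[symmetric] by auto
    show "r \<odot>\<^bsub>C\<^esub> x \<in> \<beta> ` carrier B" if "x \<in> \<beta> ` carrier B" for r x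
      using that \<beta>'(3)[symmetric] by auto
  qed (use \<beta>'(1) in auto)
  have wd: "f b = f b'" if "b \<in> carrier B" "b' \<in> carrier B" "\<beta> b = \<beta> b'" for b b'
  proof -
    have "\<beta> (b \<ominus>\<^bsub>B\<^esub> b') = \<zero>\<^bsub>C\<^esub>"
      using that \<beta>'(1) by (simp add: hom_set_diff_elem[OF B C \<beta>] C.diff_eq_zero)
    then have "f b \<ominus>\<^bsub>E\<^esub> f b' = \<zero>\<^bsub>E\<^esub>" using ker[of "b \<ominus>\<^bsub>B\<^esub> b'"] that by (simp add: hom_set_diff_elem[OF B E f])
    then show ?thesis using that f'(1) by (simp add: E.diff_eq_zero)
  qed
  define h where "h y = f (SOME b. b \<in> carrier B \<and> \<beta> b = y)" for y
  have h: "h (\<beta> b) = f b" if "b \<in> carrier B" for b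
  proof -
    have "\<exists>b'. b' \<in> carrier B \<and> \<beta> b' = \<beta> b" using that by blast
    from someI_ex[OF this] show ?thesis unfolding h_def using wd that by blast
  qed
  have "h \<in> hom_set (C\<lparr>carrier := \<beta> ` carrier B\<rparr>) E"
  proof (rule hom_setI)
    fix x y assume "x \<in> carrier (C\<lparr>carrier := \<beta> ` carrier B\<rparr>)" "y \<in> carrier (C\<lparr>carrier := \<beta> ` carrier B\<rparr>)"
    then obtain b b' where "b \<in> carrier B" "b' \<in> carrier B" "x = \<beta> b" "y = \<beta> b'" by auto
    then show "h (x \<oplus>\<^bsub>C\<lparr>carrier := \<beta> ` carrier B\<rparr>\<^esub> y) = h x \<oplus>\<^bsub>E\<^esub> h y"
      using h[of "b \<oplus>\<^bsub>B\<^esub> b'"] by (simp add: \<beta>' f' h)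
  next
    fix r x assume "x \<in> carrier (C\<lparr>carrier := \<beta> ` carrier B\<rparr>)"
    then obtain b where "b \<in> carrier B" "x = \<beta> b" by auto
    then show "h (r \<odot>\<^bsub>C\<lparr>carrier := \<beta> ` carrier B\<rparr>\<^esub> x) = r \<odot>\<^bsub>E\<^esub> h x"
      using h[of "r \<odot>\<^bsub>B\<^esub> b"] by (simp add: \<beta>' f' h)
  qed (use h f'(1) in auto)
  from baer[OF inj C K this] show ?thesis using h by auto
qed

section \<open>Comparison maps and homotopies between injective resolutions\<close>

locale resolution =
  fixes E :: "nat \<Rightarrow> ('r::comm_ring_1, 'e) module" and d :: "nat \<Rightarrow> 'e \<Rightarrow> 'e" and \<epsilon> :: "'r \<Rightarrow> 'e"
  assumes res: "injective_resolution class_ring E d \<epsilon>"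
begin

lemma E_inj: "injective_module class_ring (E i)"
  and \<epsilon>_hom: "\<epsilon> \<in> hom_set (regular_module class_ring) (E 0)"
  and \<epsilon>_inj: "inj \<epsilon>"
  and d_hom: "d i \<in> hom_set (E i) (E (Suc i))"
  and exact_0: "range \<epsilon> = {x \<in> carrier (E 0). d 0 x = \<zero>\<^bsub>E 1\<^esub>}"
  and exact_Suc: "d i ` carrier (E i) = {x \<in> carrier (E (Suc i)). d (Suc i) x = \<zero>\<^bsub>E (Suc (Suc i))\<^esub>}"
  using res by (simp_all add: injective_resolution_def)

lemma E_cmod: "cmod (E i)"
  using E_inj[of i] by (simp add: injective_module_def cmod_def)

sublocale E: cmod "E i" for i by (rule E_cmod)

lemmas d_closed = hom_setD(1)[OF d_hom] and d_add = hom_setD(2)[OF d_hom] and d_smult = hom_setD(3)[OF d_hom]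

lemma d_zero [simp]: "d i \<zero>\<^bsub>E i\<^esub> = \<zero>\<^bsub>E (Suc i)\<^esub>"
  by (rule hom_set_zero[OF E_cmod E_cmod d_hom])

lemma d_d: "x \<in> carrier (E i) \<Longrightarrow> d (Suc i) (d i x) = \<zero>\<^bsub>E (Suc (Suc i))\<^esub>"
  using exact_Suc[of i] by blast

lemma d_\<epsilon>: "d 0 (\<epsilon> r) = \<zero>\<^bsub>E 1\<^esub>" and \<epsilon>_closed: "\<epsilon> r \<in> carrier (E 0)"
  using exact_0 by blast+

lemma exact_0D: "x \<in> carrier (E 0) \<Longrightarrow> d 0 x = \<zero>\<^bsub>E 1\<^esub> \<Longrightarrow> \<exists>r. x = \<epsilon> r"
  using exact_0 by blast

lemma exact_SucD: "x \<in> carrier (E (Suc i)) \<Longrightarrow> d (Suc i) x = \<zero>\<^bsub>E (Suc (Suc i))\<^esub> \<Longrightarrow> \<exists>y\<in>carrier (E i). x = d i y"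
  using exact_Suc[of i] by blast

lemma \<epsilon>_add: "\<epsilon> (r + s) = \<epsilon> r \<oplus>\<^bsub>E 0\<^esub> \<epsilon> s" and \<epsilon>_smult: "\<epsilon> (r * s) = r \<odot>\<^bsub>E 0\<^esub> \<epsilon> s"
  using hom_setD(2)[OF \<epsilon>_hom, of r s] hom_setD(3)[OF \<epsilon>_hom, of s r] by (simp_all add: regular_module_def)

end

locale two_resolutions = E: resolution E d \<epsilon> + E': resolution E' d' \<epsilon>'
  for E :: "nat \<Rightarrow> ('r::comm_ring_1, 'e) module" and d \<epsilon> and E' :: "nat \<Rightarrow> ('r, 'f) module" and d' \<epsilon>'
begin

lemma chain_map_exists:
  "\<exists>\<chi>. (\<forall>i. \<chi> i \<in> hom_set (E i) (E' i)) \<and> (\<forall>i. \<forall>x\<in>carrier (E i). \<chi> (Suc i) (d i x) = d' i (\<chi> i x)) \<and>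
    (\<forall>r. \<chi> 0 (\<epsilon> r) = \<epsilon>' r)"
proof -
  \<comment> \<open>That cocycles go to cocycles belongs to the invariant: it is the kernel
    condition under which \<open>factor_through\<close> extends the composite of \<chi> and d' along
    d to the next degree.\<close>
  define P where "P n \<chi> \<longleftrightarrow> \<chi> \<in> hom_set (E n) (E' n) \<and>
    (\<forall>x\<in>carrier (E n). d n x = \<zero>\<^bsub>E (Suc n)\<^esub> \<longrightarrow> d' n (\<chi> x) = \<zero>\<^bsub>E' (Suc n)\<^esub>) \<and>
    (n = 0 \<longrightarrow> (\<forall>r. \<chi> (\<epsilon> r) = \<epsilon>' r))" for n \<chi>
  have "\<exists>\<chi>. P 0 \<chi>"
  proof -
    have "\<exists>g\<in>hom_set (E 0) (E' 0). \<forall>b\<in>carrier (regular_module class_ring). g (\<epsilon> b) = \<epsilon>' b"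
    proof (rule factor_through[OF cmod_regular E.E_cmod E'.E_inj E.\<epsilon>_hom E'.\<epsilon>_hom])
      fix b assume "\<epsilon> b = \<zero>\<^bsub>E 0\<^esub>"
      then have "\<epsilon> b = \<epsilon> 0" using E.\<epsilon>_smult[of 0 b] E.\<epsilon>_closed by simp
      then have "b = 0" using E.\<epsilon>_inj by (simp add: inj_eq)
      then show "\<epsilon>' b = \<zero>\<^bsub>E' 0\<^esub>" using E'.\<epsilon>_smult[of 0 b] E'.\<epsilon>_closed by simp
    qed
    then obtain \<chi> where \<chi>: "\<chi> \<in> hom_set (E 0) (E' 0)" "\<And>r. \<chi> (\<epsilon> r) = \<epsilon>' r" by (auto simp: regular_module_def)
    moreover have "d' 0 (\<chi> x) = \<zero>\<^bsub>E' (Suc 0)\<^esub>" if "x \<in> carrier (E 0)" "d 0 x = \<zero>\<^bsub>E (Suc 0)\<^esub>" for x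
      using E.exact_0D[of x] that \<chi>(2) E'.d_\<epsilon> by auto
    ultimately show ?thesis unfolding P_def by blast
  qed
  moreover have "\<exists>\<chi>'. P (Suc n) \<chi>' \<and> (\<forall>x\<in>carrier (E n). \<chi>' (d n x) = d' n (\<chi> x))" if "P n \<chi>" for n \<chi>
  proof -
    have \<chi>h: "\<chi> \<in> hom_set (E n) (E' n)" using that by (simp add: P_def)
    have h: "(\<lambda>x. d' n (\<chi> x)) \<in> hom_set (E n) (E' (Suc n))"
      by (rule hom_set_comp[OF E'.d_hom \<chi>h])
    have "\<exists>g\<in>hom_set (E (Suc n)) (E' (Suc n)). \<forall>b\<in>carrier (E n). g (d n b) = d' n (\<chi> b)"
      by (rule factor_through[OF E.E_cmod E.E_cmod E'.E_inj E.d_hom h]) (use that in \<open>auto simp: P_def\<close>)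
    then obtain g where g: "g \<in> hom_set (E (Suc n)) (E' (Suc n))" "\<And>b. b \<in> carrier (E n) \<Longrightarrow> g (d n b) = d' n (\<chi> b)" by blast
    have "d' (Suc n) (g x) = \<zero>\<^bsub>E' (Suc (Suc n))\<^esub>" if x: "x \<in> carrier (E (Suc n))" "d (Suc n) x = \<zero>\<^bsub>E (Suc (Suc n))\<^esub>" for x
    proof -
      obtain y where y: "y \<in> carrier (E n)" "x = d n y" using E.exact_SucD[OF x] by blast
      show ?thesis unfolding y(2) g(2)[OF y(1)] by (rule E'.d_d[OF hom_setD(1)[OF \<chi>h y(1)]])
    qed
    then have "P (Suc n) g" using g(1) by (simp add: P_def)
    then show ?thesis using g(2) by blast
  qed
  ultimately obtain \<chi> where "\<And>n. P n (\<chi> n) \<and> (\<forall>x\<in>carrier (E n). \<chi> (Suc n) (d n x) = d' n (\<chi> n x))"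
    using dependent_nat_choice[of P "\<lambda>n \<chi> \<chi>'. \<forall>x\<in>carrier (E n). \<chi>' (d n x) = d' n (\<chi> x)"] by blast
  then show ?thesis unfolding P_def by blast
qed

text \<open>On a cocycle the term s d of a homotopy vanishes, so only d' s is recorded, and only in
  positive degree. A cocycle of degree 0 lies in the image of \<epsilon>, where f and g agree;
  \<open>chain_homotopy_0\<close> covers it.\<close>

lemma chain_homotopy:
  assumes f: "\<And>i. f i \<in> hom_set (E i) (E' i)" "\<And>i x. x \<in> carrier (E i) \<Longrightarrow> f (Suc i) (d i x) = d' i (f i x)"
    and g: "\<And>i. g i \<in> hom_set (E i) (E' i)" "\<And>i x. x \<in> carrier (E i) \<Longrightarrow> g (Suc i) (d i x) = d' i (g i x)"
    and fg: "\<And>r. f 0 (\<epsilon> r) = g 0 (\<epsilon> r)"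
  shows "\<exists>s. (\<forall>i. s i \<in> hom_set (E (Suc i)) (E' i)) \<and>
    (\<forall>i. \<forall>z\<in>carrier (E (Suc i)). d (Suc i) z = \<zero>\<^bsub>E (Suc (Suc i))\<^esub> \<longrightarrow>
      f (Suc i) z = g (Suc i) z \<oplus>\<^bsub>E' (Suc i)\<^esub> d' i (s i z))"
proof -
  define k where "k i x = f i x \<ominus>\<^bsub>E' i\<^esub> g i x" for i x
  have k: "k i \<in> hom_set (E i) (E' i)" for i
    unfolding k_def[abs_def] by (rule hom_set_diff[OF E.E_cmod E'.E_cmod f(1) g(1)])
  have kd: "k (Suc i) (d i x) = d' i (k i x)" if "x \<in> carrier (E i)" for i x
    unfolding k_def using that f g hom_setD(1)[OF f(1)] hom_setD(1)[OF g(1)]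
    by (simp add: hom_set_diff_elem[OF E'.E_cmod E'.E_cmod E'.d_hom])
  \<comment> \<open>By this invariant k - d' s is zero in the next degree on the image of d, which
    by exactness is the kernel of the following differential; so it extends along that differential
    and yields the next s.\<close>
  define P where "P n s \<longleftrightarrow> s \<in> hom_set (E (Suc n)) (E' n) \<and>
    (\<forall>y\<in>carrier (E n). d' n (k n y) = d' n (s (d n y)))" for n s
  have "\<exists>s. P 0 s"
  proof -
    have "\<exists>s\<in>hom_set (E (Suc 0)) (E' 0). \<forall>b\<in>carrier (E 0). s (d 0 b) = k 0 b"
    proof (rule factor_through[OF E.E_cmod E.E_cmod E'.E_inj E.d_hom k])
      fix b assume b: "b \<in> carrier (E 0)" "d 0 b = \<zero>\<^bsub>E (Suc 0)\<^esub>"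
      then obtain r where r: "b = \<epsilon> r" using E.exact_0D[of b] by auto
      show "k 0 b = \<zero>\<^bsub>E' 0\<^esub>"
        using b(1) hom_setD(1)[OF g(1)] unfolding k_def r fg by (simp add: E'.E.diff_eq_zero)
    qed
    then show ?thesis unfolding P_def by force
  qed
  moreover have "\<exists>s'. P (Suc n) s' \<and> (\<forall>x\<in>carrier (E (Suc n)). k (Suc n) x = d' n (s x) \<oplus>\<^bsub>E' (Suc n)\<^esub> s' (d (Suc n) x))"
    if s: "P n s" for n s
  proof -
    have sh: "s \<in> hom_set (E (Suc n)) (E' n)" and sk: "\<And>y. y \<in> carrier (E n) \<Longrightarrow> d' n (k n y) = d' n (s (d n y))"
      using s unfolding P_def by auto
    have ds: "(\<lambda>x. d' n (s x)) \<in> hom_set (E (Suc n)) (E' (Suc n))" by (rule hom_set_comp[OF E'.d_hom sh])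
    have h: "(\<lambda>x. k (Suc n) x \<ominus>\<^bsub>E' (Suc n)\<^esub> d' n (s x)) \<in> hom_set (E (Suc n)) (E' (Suc n))"
      by (rule hom_set_diff[OF E.E_cmod E'.E_cmod k ds])
    have "\<exists>s'\<in>hom_set (E (Suc (Suc n))) (E' (Suc n)). \<forall>b\<in>carrier (E (Suc n)).
        s' (d (Suc n) b) = k (Suc n) b \<ominus>\<^bsub>E' (Suc n)\<^esub> d' n (s b)"
    proof (rule factor_through[OF E.E_cmod E.E_cmod E'.E_inj E.d_hom h])
      fix b assume b: "b \<in> carrier (E (Suc n))" "d (Suc n) b = \<zero>\<^bsub>E (Suc (Suc n))\<^esub>"
      then obtain y where y: "y \<in> carrier (E n)" "b = d n y" using E.exact_SucD[OF b] by blast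
      have "k (Suc n) b = d' n (s b)" unfolding y(2) kd[OF y(1)] by (rule sk[OF y(1)])
      then show "k (Suc n) b \<ominus>\<^bsub>E' (Suc n)\<^esub> d' n (s b) = \<zero>\<^bsub>E' (Suc n)\<^esub>"
        using hom_setD(1)[OF ds b(1)] by (simp add: E'.E.diff_eq_zero)
    qed
    then obtain s' where s': "s' \<in> hom_set (E (Suc (Suc n))) (E' (Suc n))"
      "\<And>b. b \<in> carrier (E (Suc n)) \<Longrightarrow> s' (d (Suc n) b) = k (Suc n) b \<ominus>\<^bsub>E' (Suc n)\<^esub> d' n (s b)" by blast
    have eq: "k (Suc n) x = d' n (s x) \<oplus>\<^bsub>E' (Suc n)\<^esub> s' (d (Suc n) x)" if x: "x \<in> carrier (E (Suc n))" for x
      using s'(2)[OF x] E'.E.cancel_diff[of "k (Suc n) x" "Suc n" "d' n (s x)"] hom_setD(1)[OF k x] hom_setD(1)[OF ds x]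
      by (simp add: E'.E.a_comm)
    have "d' (Suc n) (k (Suc n) x) = d' (Suc n) (s' (d (Suc n) x))" if x: "x \<in> carrier (E (Suc n))" for x
    proof -
      have "s' (d (Suc n) x) \<in> carrier (E' (Suc n))" using hom_setD(1)[OF s'(1)] E.d_closed[OF x] by blast
      then show ?thesis
        unfolding eq[OF x] using hom_setD(1)[OF ds x] hom_setD(1)[OF sh x] E'.d_closed
        by (simp add: E'.d_add E'.d_d)
    qed
    then show ?thesis using s'(1) eq unfolding P_def by blast
  qed
  ultimately obtain s where s: "\<And>n. P n (s n) \<and> (\<forall>x\<in>carrier (E (Suc n)). k (Suc n) x = d' n (s n x) \<oplus>\<^bsub>E' (Suc n)\<^esub> s (Suc n) (d (Suc n) x))"
    using dependent_nat_choice[of P "\<lambda>n s s'. \<forall>x\<in>carrier (E (Suc n)). k (Suc n) x = d' n (s x) \<oplus>\<^bsub>E' (Suc n)\<^esub> s' (d (Suc n) x)"]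
    by blast
  have sh: "s i \<in> hom_set (E (Suc i)) (E' i)" for i using s[of i] unfolding P_def by blast
  have "f (Suc i) z = g (Suc i) z \<oplus>\<^bsub>E' (Suc i)\<^esub> d' i (s i z)"
    if z: "z \<in> carrier (E (Suc i))" "d (Suc i) z = \<zero>\<^bsub>E (Suc (Suc i))\<^esub>" for i z
  proof -
    have c: "f (Suc i) z \<in> carrier (E' (Suc i))" "g (Suc i) z \<in> carrier (E' (Suc i))" "d' i (s i z) \<in> carrier (E' (Suc i))"
      using hom_setD(1)[OF f(1) z(1)] hom_setD(1)[OF g(1) z(1)] hom_setD(1)[OF sh z(1)] E'.d_closed by auto
    have "k (Suc i) z = d' i (s i z) \<oplus>\<^bsub>E' (Suc i)\<^esub> s (Suc i) \<zero>\<^bsub>E (Suc (Suc i))\<^esub>" using s[of i] z by auto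
    then have "k (Suc i) z = d' i (s i z)" using c hom_set_zero[OF E.E_cmod E'.E_cmod sh] by simp
    then show ?thesis using E'.E.cancel_diff[OF c(1,2)] c unfolding k_def by (simp add: E'.E.a_comm)
  qed
  then show ?thesis using sh by blast
qed

lemma chain_homotopy_0:
  assumes "\<And>r. f (\<epsilon> r) = g (\<epsilon> r)" "z \<in> carrier (E 0)" "d 0 z = \<zero>\<^bsub>E (Suc 0)\<^esub>"
  shows "f z = g z"
  using E.exact_0D[of z] assms by auto

end

section \<open>Finiteness of the modules \<open>Ext\<^sup>i(R\<^sup>n / K, R)\<close>\<close>

context cmod
begin

definition dot :: "nat \<Rightarrow> (nat \<Rightarrow> 'r) \<Rightarrow> (nat \<Rightarrow> 'e) \<Rightarrow> 'e" where
  "dot n f y = (\<Oplus>j\<in>{..<n}. f j \<odot> y j)"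

definition vecs :: "nat \<Rightarrow> (nat \<Rightarrow> 'e) set" where
  "vecs n = {y. \<forall>j<n. y j \<in> carrier E}"

text \<open>The vectors of \<open>E\<^sup>n\<close> killed by \<open>K\<close> are the homomorphisms from \<open>R\<^sup>n / K\<close> to \<open>E\<close>.\<close>

definition killed :: "nat \<Rightarrow> (nat \<Rightarrow> 'r) set \<Rightarrow> (nat \<Rightarrow> 'e) set" where
  "killed n K = {y \<in> vecs n. \<forall>f\<in>K. dot n f y = \<zero>}"

lemma vecsD: "y \<in> vecs n \<Longrightarrow> j < n \<Longrightarrow> y j \<in> carrier E"
  by (simp add: vecs_def)

lemma dot_closed [simp]: "y \<in> vecs n \<Longrightarrow> dot n f y \<in> carrier E"
  unfolding dot_def by (rule finsum_closed) (auto simp: vecs_def)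

lemma dot_0 [simp]: "dot 0 f y = \<zero>"
  by (simp add: dot_def)

lemma dot_Suc: "y \<in> vecs (Suc n) \<Longrightarrow> dot (Suc n) f y = dot n f y \<oplus> f n \<odot> y n"
  unfolding dot_def lessThan_Suc by (subst finsum_insert) (auto simp: vecs_def a_comm)

lemma vecs_Suc: "y \<in> vecs (Suc n) \<longleftrightarrow> y \<in> vecs n \<and> y n \<in> carrier E"
  by (auto simp: vecs_def less_Suc_eq)

lemma dot_cong:
  assumes "\<And>j. j < n \<Longrightarrow> f j = g j" "\<And>j. j < n \<Longrightarrow> y j = z j" "z \<in> vecs n"
  shows "dot n f y = dot n g z"
  unfolding dot_def using assms by (intro finsum_cong') (auto simp: vecs_def)

lemma dot_zero_l: "y \<in> vecs n \<Longrightarrow> dot n (\<lambda>_. 0) y = \<zero>"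
  by (induction n) (auto simp: dot_Suc vecs_Suc)

lemma dot_zero_r: "dot n f (\<lambda>_. \<zero>) = \<zero>"
proof (induction n)
  case (Suc n)
  have "(\<lambda>_. \<zero>) \<in> vecs (Suc n)" by (simp add: vecs_def)
  then show ?case using Suc by (simp add: dot_Suc)
qed simp

lemma dot_add_l: "y \<in> vecs n \<Longrightarrow> dot n (\<lambda>j. f j + g j) y = dot n f y \<oplus> dot n g y"
  by (induction n) (auto simp: dot_Suc vecs_Suc cm_add_l a_ac)

lemma dot_mult_l: "y \<in> vecs n \<Longrightarrow> dot n (\<lambda>j. r * f j) y = r \<odot> dot n f y"
  by (induction n) (auto simp: dot_Suc vecs_Suc cm_add_r cm_mult)

lemma vecs_add: "y \<in> vecs n \<Longrightarrow> z \<in> vecs n \<Longrightarrow> (\<lambda>j. y j \<oplus> z j) \<in> vecs n"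
  by (simp add: vecs_def)

lemma dot_add_r: "y \<in> vecs n \<Longrightarrow> z \<in> vecs n \<Longrightarrow> dot n f (\<lambda>j. y j \<oplus> z j) = dot n f y \<oplus> dot n f z"
proof (induction n)
  case (Suc n)
  then show ?case using vecs_add[OF Suc.prems] by (auto simp: dot_Suc vecs_Suc cm_add_r a_ac)
qed simp

lemma dot_mult_r: "y \<in> vecs n \<Longrightarrow> dot n f (\<lambda>j. r \<odot> y j) = r \<odot> dot n f y"
proof (induction n)
  case (Suc n)
  then have "(\<lambda>j. r \<odot> y j) \<in> vecs (Suc n)" by (simp add: vecs_def)
  then show ?case using Suc by (auto simp: dot_Suc vecs_Suc cm_add_r mult.commute simp flip: cm_mult)
qed simp

lemma dot_sum_l:
  assumes y: "y \<in> vecs n"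
  shows "dot n (\<lambda>j. \<Sum>l<t. a l * g l j) y = dot t a (\<lambda>l. dot n (g l) y)"
proof (induction t)
  case (Suc t)
  have "(\<lambda>l. dot n (g l) y) \<in> vecs (Suc t)" using y by (simp add: vecs_def)
  then show ?case using Suc by (simp add: dot_Suc dot_add_l[OF y] dot_mult_l[OF y])
qed (simp add: dot_zero_l[OF y])

lemma dot_dot:
  assumes "\<And>l. l < t \<Longrightarrow> z l \<in> vecs n"
  shows "dot n f (\<lambda>j. dot t a (\<lambda>l. z l j)) = dot t a (\<lambda>l. dot n f (z l))"
  using assms
proof (induction t)
  case (Suc t)
  have z: "z t \<in> vecs n" "\<And>l. l < t \<Longrightarrow> z l \<in> vecs n" using Suc.prems by auto
  have v: "(\<lambda>l. z l j) \<in> vecs (Suc t)" if "j < n" for j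
    using Suc.prems that by (auto simp: vecs_def)
  have v1: "(\<lambda>j. dot t a (\<lambda>l. z l j)) \<in> vecs n"
    using v by (auto simp: vecs_def[of n] vecs_Suc)
  have v2: "(\<lambda>j. a t \<odot> z t j) \<in> vecs n" using z by (simp add: vecs_def)
  have "dot n f (\<lambda>j. dot (Suc t) a (\<lambda>l. z l j)) = dot n f (\<lambda>j. dot t a (\<lambda>l. z l j) \<oplus> a t \<odot> z t j)"
    using v vecs_add[OF v1 v2] by (intro dot_cong) (auto simp: dot_Suc)
  also have "\<dots> = dot t a (\<lambda>l. dot n f (z l)) \<oplus> a t \<odot> dot n f (z t)"
    using z by (simp add: dot_add_r[OF v1 v2] dot_mult_r Suc.IH)
  also have "\<dots> = dot (Suc t) a (\<lambda>l. dot n f (z l))"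
    using Suc.prems by (subst dot_Suc) (auto simp: vecs_def[of "Suc t"])
  finally show ?case .
qed (simp add: dot_zero_r)

end

lemma hom_set_dot:
  assumes "cmod A" "cmod B" "h \<in> hom_set A B" "y \<in> cmod.vecs A n"
  shows "h (cmod.dot A n f y) = cmod.dot B n f (\<lambda>j. h (y j))"
proof -
  interpret A: cmod A by fact
  interpret B: cmod B by fact
  have "h (A.dot n f y) = (\<Oplus>\<^bsub>B\<^esub>j\<in>{..<n}. h (f j \<odot>\<^bsub>A\<^esub> y j))"
    unfolding A.dot_def by (rule hom_set_finsum[OF assms(1-3)]) (use A.vecsD[OF assms(4)] in auto)
  also have "\<dots> = B.dot n f (\<lambda>j. h (y j))"
    unfolding B.dot_def using A.vecsD[OF assms(4)] hom_setD[OF assms(3)] by (intro B.finsum_cong') auto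
  finally show ?thesis .
qed

text \<open>The module of all sequences. Source and target of the matrix k both fit into it, so free
  modules of different ranks need no separate carriers.\<close>

definition funs :: "('r::comm_ring_1, nat \<Rightarrow> 'r) module" where
  "funs = \<lparr>carrier = UNIV, mult = undefined, one = undefined, zero = (\<lambda>_. 0),
     add = (\<lambda>f g j. f j + g j), smult = (\<lambda>r f j. r * f j)\<rparr>"

lemma cmod_funs: "cmod (funs :: ('r::comm_ring_1, nat \<Rightarrow> 'r) module)"
proof (rule cmod.intro)
  have "abelian_group (funs :: ('r, nat \<Rightarrow> 'r) module)"
  proof (rule abelian_groupI)
    show "\<exists>y\<in>carrier funs. y \<oplus>\<^bsub>funs\<^esub> x = \<zero>\<^bsub>funs\<^esub>" for x :: "nat \<Rightarrow> 'r"
      by (rule bexI[of _ "\<lambda>j. - x j"]) (auto simp: funs_def)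
  qed (auto simp: funs_def add_ac)
  then show "module class_ring (funs :: ('r, nat \<Rightarrow> 'r) module)"
    by (intro moduleI class_cring.cring_axioms) (auto simp: funs_def distrib_left distrib_right mult_ac)
qed

text \<open>Injectivity extends homomorphisms along the inclusion of the submodule generated by the
  \<open>k l\<close> into the free module.\<close>

lemma injective_lift:
  fixes E :: "('r::comm_ring_1, 'e) module"
  assumes inj: "injective_module class_ring E"
    and k: "\<And>l j. l < m \<Longrightarrow> j \<ge> n \<Longrightarrow> k l j = 0"
    and w: "w \<in> cmod.killed E m {a. (\<forall>l\<ge>m. a l = 0) \<and> (\<forall>j. (\<Sum>l<m. a l * k l j) = 0)}"
  shows "\<exists>w'. w' \<in> cmod.vecs E n \<and> (\<forall>l<m. cmod.dot E n (k l) w' = w l)"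
proof -
  interpret E: cmod E using inj by (simp add: injective_module_def cmod_def)
  have E: "cmod E" by unfold_locales
  have wv: "w \<in> E.vecs m" using w by (simp add: E.killed_def)
  define \<beta> where "\<beta> a = (\<lambda>j. \<Sum>l<m. a l * k l j)" for a :: "nat \<Rightarrow> 'r"
  have \<beta>: "\<beta> \<in> hom_set funs funs"
    by (rule hom_setI) (auto simp: funs_def \<beta>_def distrib_right sum.distrib sum_distrib_left mult.assoc)
  have f: "(\<lambda>a. E.dot m a w) \<in> hom_set funs E"
    by (rule hom_setI) (auto simp: funs_def wv E.dot_add_l E.dot_mult_l)
  have "\<exists>g\<in>hom_set funs E. \<forall>b\<in>carrier funs. g (\<beta> b) = E.dot m b w"
  proof (rule factor_through[OF cmod_funs cmod_funs inj \<beta> f])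
    fix a :: "nat \<Rightarrow> 'r" assume a: "\<beta> a = \<zero>\<^bsub>funs\<^esub>"
    \<comment> \<open>The hypothesis on w concerns syzygies that vanish from m on, so a is cut off
      there; neither \<beta> nor the product with w sees the later entries.\<close>
    define a' where "a' l = (if l < m then a l else 0)" for l
    have "(\<Sum>l<m. a' l * k l j) = 0" for j
      using fun_cong[OF a, of j] by (simp add: \<beta>_def funs_def a'_def)
    then have "E.dot m a' w = \<zero>\<^bsub>E\<^esub>" using w by (simp add: E.killed_def a'_def)
    moreover have "E.dot m a w = E.dot m a' w" by (rule E.dot_cong) (simp_all add: a'_def wv)
    ultimately show "E.dot m a w = \<zero>\<^bsub>E\<^esub>" by simp
  qed
  then obtain g where g: "g \<in> hom_set funs E" "\<And>b. g (\<beta> b) = E.dot m b w" by (auto simp: funs_def)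
  define e where "e l = (\<lambda>j. if j = l then 1 else 0 :: 'r)" for l :: nat
  define w' where "w' j = g (e j)" for j
  note g' = hom_setD[OF g(1)]
  have w'c: "w' j \<in> carrier E" for j unfolding w'_def by (rule g'(1)) (simp add: funs_def)
  then have w'v: "w' \<in> E.vecs i" for i by (simp add: E.vecs_def)
  have gd: "g (\<lambda>j. if j < i then f j else 0) = E.dot i f w'" for f i
  proof (induction i)
    case 0
    show ?case using hom_set_zero[OF cmod_funs E g(1)] by (simp add: funs_def)
  next
    case (Suc i)
    have 1: "(\<lambda>j. if j < Suc i then f j else 0) = (\<lambda>j. if j < i then f j else 0) \<oplus>\<^bsub>funs\<^esub> (f i \<odot>\<^bsub>funs\<^esub> e i)"
      by (auto simp: funs_def e_def less_Suc_eq)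
    have 2: "g (\<lambda>j. if j < i then f j else 0) \<oplus>\<^bsub>E\<^esub> g (f i \<odot>\<^bsub>funs\<^esub> e i) = E.dot (Suc i) f w'"
      unfolding Suc E.dot_Suc[OF w'v] w'_def by (subst g'(3)) (simp_all add: funs_def)
    show ?case unfolding 1 2[symmetric] by (rule g'(2)) (simp_all add: funs_def)
  qed
  have "E.dot n (k l) w' = w l" if l: "l < m" for l
  proof -
    have "\<beta> (e l) = k l" using l by (auto simp: \<beta>_def e_def fun_eq_iff if_distrib[of "\<lambda>x. x * _"] cong: if_cong)
    moreover have "(\<lambda>j. if j < n then k l j else 0) = k l" using k[OF l] by (auto simp: fun_eq_iff not_less)
    ultimately have "E.dot n (k l) w' = E.dot m (e l) w" using gd[of n "k l"] g(2)[of "e l"] by simp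
    also have "\<dots> = (\<Oplus>\<^bsub>E\<^esub>j\<in>{..<m}. if l = j then w j else \<zero>\<^bsub>E\<^esub>)"
      unfolding E.dot_def using E.vecsD[OF wv] by (intro E.finsum_cong') (auto simp: e_def)
    also have "\<dots> = w l" using E.vecsD[OF wv] l by (intro E.finsum_singleton) auto
    finally show ?thesis .
  qed
  then show ?thesis using w'v by blast
qed

locale pol_resolution = resolution E d \<epsilon>
  for E :: "nat \<Rightarrow> (('p::prime_card, 'n::finite) pol, 'e) module" and d \<epsilon>
begin

definition cocyc :: "nat \<Rightarrow> nat \<Rightarrow> (nat \<Rightarrow> ('p, 'n) pol) set \<Rightarrow> (nat \<Rightarrow> 'e) set" where
  "cocyc i n K = {y \<in> E.killed i n K. \<forall>j<n. d i (y j) = \<zero>\<^bsub>E (Suc i)\<^esub>}"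

definition cobdry :: "nat \<Rightarrow> nat \<Rightarrow> (nat \<Rightarrow> ('p, 'n) pol) set \<Rightarrow> (nat \<Rightarrow> 'e) set" where
  "cobdry i n K = (case i of 0 \<Rightarrow> {b. \<forall>j<n. b j = \<zero>\<^bsub>E 0\<^esub>}
     | Suc k \<Rightarrow> {b. \<exists>w\<in>E.killed k n K. \<forall>j<n. b j = d k (w j)})"

text \<open>Induction on \<open>i\<close>: for a presentation \<open>R\<^sup>m \<rightarrow> R\<^sup>n\<close> with image \<open>K\<close> and kernel the syzygies
  \<open>K'\<close>, the connecting map \<open>Ext\<^sup>i(R\<^sup>m / K', R) \<rightarrow> Ext\<^bsup>i+1\<^esup>(R\<^sup>n / K, R)\<close> is onto.\<close>

theorem ext_fg:
  assumes "free_submodule n K"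
  shows "\<exists>(t::nat) z. (\<forall>l<t. z l \<in> cocyc i n K) \<and> (\<forall>y\<in>cocyc i n K. \<exists>a. \<exists>b\<in>cobdry i n K.
    b \<in> E.vecs i n \<and> (\<forall>j<n. y j = E.dot i t a (\<lambda>l. z l j) \<oplus>\<^bsub>E i\<^esub> b j))"
  using assms
proof (induction i arbitrary: n K)
  case 0
  \<comment> \<open>A cocycle of degree 0 killed by K is the image under \<epsilon> of a vector in
    R^n orthogonal to K, and such vectors form a submodule of the Noetherian module R^n.\<close>
  define K' where "K' = {r. (\<forall>j\<ge>n. r j = 0) \<and> (\<forall>f\<in>K. (\<Sum>j<n. f j * r j) = 0)}"
  have \<epsilon>0: "\<epsilon> r = \<zero>\<^bsub>E 0\<^esub> \<longleftrightarrow> r = 0" for r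
  proof -
    have "\<epsilon> (0 * 1) = 0 \<odot>\<^bsub>E 0\<^esub> \<epsilon> 1" by (rule \<epsilon>_smult)
    then have "\<epsilon> 0 = \<zero>\<^bsub>E 0\<^esub>" unfolding E.cm_zero_l[OF \<epsilon>_closed] by (simp only: mult_zero_left)
    then show ?thesis using inj_eq[OF \<epsilon>_inj, of r 0] by metis
  qed
  have \<epsilon>v: "(\<lambda>j. \<epsilon> (r j)) \<in> E.vecs 0 n'" for r n' by (simp add: E.vecs_def \<epsilon>_closed)
  have \<epsilon>dot: "E.dot 0 n' f (\<lambda>j. \<epsilon> (r j)) = \<epsilon> (\<Sum>j<n'. f j * r j)" for f r n'
    by (induction n') (simp_all add: E.dot_Suc[OF \<epsilon>v] \<epsilon>_add \<epsilon>_smult iffD2[OF \<epsilon>0 refl])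
  have "free_submodule n K'"
    unfolding free_submodule_def K'_def
    by (auto simp: distrib_left sum.distrib mult.left_commute simp flip: sum_distrib_left)
  from free_submodule_fg[OF this] obtain t :: nat and g where
    g: "\<And>l. l < t \<Longrightarrow> g l \<in> K'" "\<And>r. r \<in> K' \<Longrightarrow> \<exists>a. r = (\<lambda>j. \<Sum>l<t. a l * g l j)" by blast
  have z: "(\<lambda>j. \<epsilon> (g l j)) \<in> cocyc 0 n K" if "l < t" for l
    using g(1)[OF that] by (auto simp: cocyc_def E.killed_def \<epsilon>v \<epsilon>dot d_\<epsilon> K'_def \<epsilon>0)
  have "\<exists>a. \<exists>b\<in>cobdry 0 n K. b \<in> E.vecs 0 n \<and> (\<forall>j<n. y j = E.dot 0 t a (\<lambda>l. \<epsilon> (g l j)) \<oplus>\<^bsub>E 0\<^esub> b j)"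
    if y: "y \<in> cocyc 0 n K" for y
  proof -
    have yv: "y \<in> E.vecs 0 n" and yd: "\<And>j. j < n \<Longrightarrow> d 0 (y j) = \<zero>\<^bsub>E (Suc 0)\<^esub>"
      and yK: "\<And>f. f \<in> K \<Longrightarrow> E.dot 0 n f y = \<zero>\<^bsub>E 0\<^esub>" using y by (auto simp: cocyc_def E.killed_def)
    have "\<exists>r. \<forall>j<n. y j = \<epsilon> (r j)"
    proof -
      have "\<forall>j. \<exists>r. j < n \<longrightarrow> y j = \<epsilon> r" using exact_0D E.vecsD[OF yv] yd by auto
      then show ?thesis by metis
    qed
    then obtain r0 where r0: "\<And>j. j < n \<Longrightarrow> y j = \<epsilon> (r0 j)" by blast
    define r where "r j = (if j < n then r0 j else 0)" for j
    have r: "y j = \<epsilon> (r j)" if "j < n" for j using r0[OF that] that by (simp add: r_def)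
    have "(\<Sum>j<n. f j * r j) = 0" if "f \<in> K" for f
    proof -
      have "E.dot 0 n f y = E.dot 0 n f (\<lambda>j. \<epsilon> (r j))" by (rule E.dot_cong) (simp_all add: r \<epsilon>v)
      then have "\<epsilon> (\<Sum>j<n. f j * r j) = \<zero>\<^bsub>E 0\<^esub>" using yK[OF that] \<epsilon>dot by metis
      then show ?thesis by (simp only: \<epsilon>0)
    qed
    then have "r \<in> K'" by (simp add: K'_def r_def)
    from g(2)[OF this] obtain a where a: "r = (\<lambda>j. \<Sum>l<t. a l * g l j)" by blast
    have "y j = E.dot 0 t a (\<lambda>l. \<epsilon> (g l j)) \<oplus>\<^bsub>E 0\<^esub> \<zero>\<^bsub>E 0\<^esub>" if "j < n" for j
      using r[OF that] fun_cong[OF a, of j] by (simp add: \<epsilon>dot \<epsilon>_closed)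
    then show ?thesis by (intro exI[of _ a] bexI[of _ "\<lambda>_. \<zero>\<^bsub>E 0\<^esub>"]) (auto simp: cobdry_def E.vecs_def)
  qed
  with z show ?case by (intro exI[of _ t] exI[of _ "\<lambda>l j. \<epsilon> (g l j)"]) blast
next
  case (Suc i)
  from free_submodule_fg[OF Suc.prems] obtain m :: nat and k where
    k: "\<And>l. l < m \<Longrightarrow> k l \<in> K" "\<And>f. f \<in> K \<Longrightarrow> \<exists>a. f = (\<lambda>j. \<Sum>l<m. a l * k l j)" by blast
  have k0: "k l j = 0" if "l < m" "j \<ge> n" for l j
    using Suc.prems k(1)[OF that(1)] that(2) by (auto simp: free_submodule_def)
  define K' where "K' = {a. (\<forall>l\<ge>m. a l = 0) \<and> (\<forall>j. (\<Sum>l<m. a l * k l j) = 0)}"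
  have "free_submodule m K'"
    unfolding free_submodule_def K'_def
    by (auto simp: distrib_right sum.distrib mult.assoc simp flip: sum_distrib_left)
  from Suc.IH[OF this] obtain t :: nat and z where z: "\<And>l. l < t \<Longrightarrow> z l \<in> cocyc i m K'"
    and zy: "\<And>y. y \<in> cocyc i m K' \<Longrightarrow> \<exists>a. \<exists>b\<in>cobdry i m K'. b \<in> E.vecs i m \<and>
      (\<forall>j<m. y j = E.dot i t a (\<lambda>l. z l j) \<oplus>\<^bsub>E i\<^esub> b j)" by blast
  have lift: "\<exists>w'. w' \<in> E.vecs i' n \<and> (\<forall>l<m. E.dot i' n (k l) w' = w l)" if "w \<in> E.killed i' m K'" for i' w
    using injective_lift[OF E_inj k0 that[unfolded K'_def]] by blast
  have killedI: "y \<in> E.killed i' n K" if yv: "y \<in> E.vecs i' n" and "\<And>l. l < m \<Longrightarrow> E.dot i' n (k l) y = \<zero>\<^bsub>E i'\<^esub>" for i' y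
  proof -
    have "E.dot i' n f y = \<zero>\<^bsub>E i'\<^esub>" if "f \<in> K" for f
    proof -
      from k(2)[OF that] obtain a where a: "f = (\<lambda>j. \<Sum>l<m. a l * k l j)" by blast
      have "E.dot i' n f y = E.dot i' m a (\<lambda>l. E.dot i' n (k l) y)" unfolding a by (rule E.dot_sum_l[OF yv])
      also have "\<dots> = E.dot i' m a (\<lambda>l. \<zero>\<^bsub>E i'\<^esub>)"
        using \<open>\<And>l. l < m \<Longrightarrow> E.dot i' n (k l) y = \<zero>\<^bsub>E i'\<^esub>\<close> by (intro E.dot_cong) (auto simp: E.vecs_def)
      finally show ?thesis by (simp add: E.dot_zero_r)
    qed
    then show ?thesis using yv by (simp add: E.killed_def)
  qed
  have dv: "(\<lambda>j. d i' (y j)) \<in> E.vecs (Suc i') n'" if "y \<in> E.vecs i' n'" for i' y n'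
    using that by (simp add: E.vecs_def d_closed)
  have ddot: "d i' (E.dot i' n' f y) = E.dot (Suc i') n' f (\<lambda>j. d i' (y j))" if "y \<in> E.vecs i' n'" for i' y n' f
    by (rule hom_set_dot[OF E_cmod E_cmod d_hom that])
  \<comment> \<open>The generators found in degree i are homomorphisms on K, the quotient of R^m by
    its syzygies. Extending them to R^n and applying d is the connecting map on
    representatives.\<close>
  have "\<exists>v. v \<in> E.vecs i n \<and> (\<forall>l'<m. E.dot i n (k l') v = z l l')" if "l < t" for l
    by (rule lift) (use z[OF that] in \<open>simp add: cocyc_def\<close>)
  then obtain v where v: "\<And>l. l < t \<Longrightarrow> v l \<in> E.vecs i n" "\<And>l l'. l < t \<Longrightarrow> l' < m \<Longrightarrow> E.dot i n (k l') (v l) = z l l'"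
    by metis
  have gen: "(\<lambda>j. d i (v l j)) \<in> cocyc (Suc i) n K" if l: "l < t" for l
  proof -
    have "E.dot (Suc i) n (k l') (\<lambda>j. d i (v l j)) = \<zero>\<^bsub>E (Suc i)\<^esub>" if "l' < m" for l'
      using ddot[OF v(1)[OF l], of "k l'"] v(2)[OF l that] z[OF l] that by (simp add: cocyc_def)
    then show ?thesis
      using killedI[OF dv[OF v(1)[OF l]]] E.vecsD[OF v(1)[OF l]] by (simp add: cocyc_def d_d)
  qed
  have "\<exists>a. \<exists>b\<in>cobdry (Suc i) n K. b \<in> E.vecs (Suc i) n \<and>
      (\<forall>j<n. y j = E.dot (Suc i) t a (\<lambda>l. d i (v l j)) \<oplus>\<^bsub>E (Suc i)\<^esub> b j)"
    if y: "y \<in> cocyc (Suc i) n K" for y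
  proof -
    have yv: "y \<in> E.vecs (Suc i) n" and yd: "\<And>j. j < n \<Longrightarrow> d (Suc i) (y j) = \<zero>\<^bsub>E (Suc (Suc i))\<^esub>"
      and yK: "\<And>f. f \<in> K \<Longrightarrow> E.dot (Suc i) n f y = \<zero>\<^bsub>E (Suc i)\<^esub>" using y by (auto simp: cocyc_def E.killed_def)
    have "\<forall>j. \<exists>u. j < n \<longrightarrow> u \<in> carrier (E i) \<and> y j = d i u"
      using exact_SucD E.vecsD[OF yv] yd by blast
    then obtain u where u: "\<And>j. j < n \<Longrightarrow> u j \<in> carrier (E i)" "\<And>j. j < n \<Longrightarrow> y j = d i (u j)" by metis
    have uv: "u \<in> E.vecs i n" using u(1) by (simp add: E.vecs_def)
    \<comment> \<open>Evaluating the primitive u of y on the generators of K gives a cocycle for K',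
      whose class the connecting map sends to the class of y.\<close>
    define x where "x l = E.dot i n (k l) u" for l
    have xv: "x \<in> E.vecs i m" using uv by (simp add: x_def E.vecs_def[of _ m])
    have "d i (x l) = \<zero>\<^bsub>E (Suc i)\<^esub>" if "l < m" for l
    proof -
      have "d i (x l) = E.dot (Suc i) n (k l) y"
        unfolding x_def ddot[OF uv] using u(2) yv by (intro E.dot_cong) auto
      then show ?thesis using yK k(1) that by simp
    qed
    moreover have "E.dot i m a x = \<zero>\<^bsub>E i\<^esub>" if "a \<in> K'" for a
    proof -
      have "E.dot i m a x = E.dot i n (\<lambda>j. \<Sum>l<m. a l * k l j) u"
        unfolding x_def by (rule E.dot_sum_l[OF uv, symmetric])
      then show ?thesis using that E.dot_zero_l[OF uv] by (simp add: K'_def)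
    qed
    ultimately have "x \<in> cocyc i m K'" using xv by (simp add: cocyc_def E.killed_def)
    from zy[OF this] obtain a b where b: "b \<in> cobdry i m K'" "b \<in> E.vecs i m"
      and xab: "\<And>l. l < m \<Longrightarrow> x l = E.dot i t a (\<lambda>l'. z l' l) \<oplus>\<^bsub>E i\<^esub> b l" by blast
    \<comment> \<open>A coboundary for K' extends to a cocycle on R^n: its primitive is extended
      first and differentiated afterwards.\<close>
    have "\<exists>b'. b' \<in> E.vecs i n \<and> (\<forall>j<n. d i (b' j) = \<zero>\<^bsub>E (Suc i)\<^esub>) \<and> (\<forall>l<m. E.dot i n (k l) b' = b l)"
    proof (cases i)
      case 0
      have "b l = \<zero>\<^bsub>E 0\<^esub>" if "l < m" for l using b(1) that 0 by (simp add: cobdry_def)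
      then show ?thesis unfolding 0 by (intro exI[of _ "\<lambda>_. \<zero>\<^bsub>E 0\<^esub>"]) (simp add: E.vecs_def E.dot_zero_r)
    next
      case i: (Suc i')
      obtain w where w: "w \<in> E.killed i' m K'" "\<And>l. l < m \<Longrightarrow> b l = d i' (w l)"
        using b(1) unfolding i cobdry_def by auto
      obtain w' where w': "w' \<in> E.vecs i' n" "\<And>l. l < m \<Longrightarrow> E.dot i' n (k l) w' = w l"
        using lift[OF w(1)] by auto
      show ?thesis unfolding i
        using dv[OF w'(1)] E.vecsD[OF w'(1)] w' w(2) by (intro exI[of _ "\<lambda>j. d i' (w' j)"]) (simp add: d_d flip: ddot)
    qed
    then obtain b' where b': "b' \<in> E.vecs i n" "\<And>j. j < n \<Longrightarrow> d i (b' j) = \<zero>\<^bsub>E (Suc i)\<^esub>"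
      "\<And>l. l < m \<Longrightarrow> E.dot i n (k l) b' = b l" by blast
    define c where "c j = E.dot i t a (\<lambda>l. v l j) \<oplus>\<^bsub>E i\<^esub> b' j" for j
    have vj: "(\<lambda>l. v l j) \<in> E.vecs i t" if "j < n" for j using v(1) that by (simp add: E.vecs_def)
    have c1: "(\<lambda>j. E.dot i t a (\<lambda>l. v l j)) \<in> E.vecs i n" using vj by (simp add: E.vecs_def[of _ n])
    have cv: "c \<in> E.vecs i n" unfolding c_def by (rule E.vecs_add[OF c1 b'(1)])
    \<comment> \<open>The difference of u and c evaluates to zero on K, so its differential is a
      coboundary for K and accounts for the rest of y.\<close>
    define s where "s j = u j \<oplus>\<^bsub>E i\<^esub> (- 1) \<odot>\<^bsub>E i\<^esub> c j" for j
    have cv': "(\<lambda>j. (- 1) \<odot>\<^bsub>E i\<^esub> c j) \<in> E.vecs i n" using cv by (simp add: E.vecs_def)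
    have sv: "s \<in> E.vecs i n" unfolding s_def by (rule E.vecs_add[OF uv cv'])
    have "E.dot i n (k l) s = \<zero>\<^bsub>E i\<^esub>" if l: "l < m" for l
    proof -
      have "E.dot i n (k l) c = E.dot i t a (\<lambda>l'. E.dot i n (k l) (v l')) \<oplus>\<^bsub>E i\<^esub> b l"
        unfolding c_def E.dot_add_r[OF c1 b'(1)] by (simp add: E.dot_dot[OF v(1)] b'(3)[OF l])
      also have "E.dot i t a (\<lambda>l'. E.dot i n (k l) (v l')) = E.dot i t a (\<lambda>l'. z l' l)"
        using v(2)[OF _ l] z l by (intro E.dot_cong) (auto simp: cocyc_def E.killed_def E.vecs_def)
      finally have "E.dot i n (k l) c = x l" using xab[OF l] by simp
      then show ?thesis
        unfolding s_def E.dot_add_r[OF uv cv'] E.dot_mult_r[OF cv] using E.vecsD[OF xv l]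
        by (simp add: x_def E.cm_uminus E.r_neg)
    qed
    then have sK: "s \<in> E.killed i n K" by (rule killedI[OF sv])
    have "y j = E.dot (Suc i) t a (\<lambda>l. d i (v l j)) \<oplus>\<^bsub>E (Suc i)\<^esub> d i (s j)" if j: "j < n" for j
    proof -
      note cc = E.vecsD[OF cv j] E.vecsD[OF uv j] E.vecsD[OF c1 j] E.vecsD[OF b'(1) j]
      have "c j \<oplus>\<^bsub>E i\<^esub> s j = u j"
        using E.cancel_diff[OF cc(2,1)] E.a_comm[OF cc(1) E.vecsD[OF sv j]] cc(1)
        by (simp add: s_def E.cm_uminus a_minus_def)
      then have "y j = d i (c j \<oplus>\<^bsub>E i\<^esub> s j)" using u(2)[OF j] by simp
      also have "\<dots> = d i (c j) \<oplus>\<^bsub>E (Suc i)\<^esub> d i (s j)" by (rule d_add[OF cc(1) E.vecsD[OF sv j]])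
      also have "d i (c j) = E.dot (Suc i) t a (\<lambda>l. d i (v l j))"
        unfolding c_def using cc d_closed by (simp add: d_add b'(2)[OF j] ddot[OF vj[OF j]] dv[OF vj[OF j]])
      finally show ?thesis .
    qed
    moreover have "(\<lambda>j. d i (s j)) \<in> cobdry (Suc i) n K" using sK by (auto simp: cobdry_def)
    ultimately show ?thesis using dv[OF sv] by blast
  qed
  with gen show ?case by (intro exI[of _ t] exI[of _ "\<lambda>l j. d i (v l j)"]) blast
qed

end

section \<open>The resolution coinduced along the Frobenius\<close>

text \<open>\<open>coind E\<close> is \<open>Hom\<close> over \<open>R\<^sup>p\<close> from \<open>R\<close> to \<open>E\<close>, where \<open>s\<^sup>p \<in> R\<^sup>p\<close> acts on \<open>E\<close> as \<open>s\<close>.\<close>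

definition coind :: "(('p::prime_card, 'n::finite) pol, 'e) module
    \<Rightarrow> (('p, 'n) pol, ('p, 'n) pol \<Rightarrow> 'e) module" where
  "coind E = \<lparr>carrier = {u. (\<forall>r. u r \<in> carrier E) \<and> (\<forall>r s. u (r + s) = u r \<oplus>\<^bsub>E\<^esub> u s) \<and>
       (\<forall>r s. u (s ^ CARD('p) * r) = s \<odot>\<^bsub>E\<^esub> u r)},
     mult = undefined, one = undefined, zero = (\<lambda>_. \<zero>\<^bsub>E\<^esub>),
     add = (\<lambda>u v r. u r \<oplus>\<^bsub>E\<^esub> v r), smult = (\<lambda>a u r. u (a * r))\<rparr>"

lemma coindD:
  fixes E :: "(('p::prime_card, 'n::finite) pol, 'e) module"
  assumes "u \<in> carrier (coind E)"
  shows "u r \<in> carrier E" "u (r + s) = u r \<oplus>\<^bsub>E\<^esub> u s" "u (s ^ CARD('p) * r) = s \<odot>\<^bsub>E\<^esub> u r"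
  using assms by (auto simp: coind_def)

lemma coindI:
  fixes E :: "(('p::prime_card, 'n::finite) pol, 'e) module"
  assumes "\<And>r. u r \<in> carrier E" "\<And>r s. u (r + s) = u r \<oplus>\<^bsub>E\<^esub> u s" "\<And>r s. u (s ^ CARD('p) * r) = s \<odot>\<^bsub>E\<^esub> u r"
  shows "u \<in> carrier (coind E)"
  using assms by (auto simp: coind_def)

lemma coind_simps:
  "\<zero>\<^bsub>coind E\<^esub> = (\<lambda>_. \<zero>\<^bsub>E\<^esub>)" "u \<oplus>\<^bsub>coind E\<^esub> v = (\<lambda>r. u r \<oplus>\<^bsub>E\<^esub> v r)" "a \<odot>\<^bsub>coind E\<^esub> u = (\<lambda>r. u (a * r))"
  by (simp_all add: coind_def)

lemma cmod_coind:
  fixes E :: "(('p::prime_card, 'n::finite) pol, 'e) module"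
  assumes "cmod E"
  shows "cmod (coind E)"
proof -
  interpret E: cmod E by fact
  have add: "u \<oplus>\<^bsub>coind E\<^esub> v \<in> carrier (coind E)" if "u \<in> carrier (coind E)" "v \<in> carrier (coind E)" for u v
    unfolding coind_simps by (rule coindI) (use coindD[OF that(1)] coindD[OF that(2)] in \<open>simp_all add: E.cm_add_r E.a_ac\<close>)
  have zero: "\<zero>\<^bsub>coind E\<^esub> \<in> carrier (coind E)"
    unfolding coind_simps by (rule coindI) simp_all
  have sm: "a \<odot>\<^bsub>coind E\<^esub> u \<in> carrier (coind E)" if "u \<in> carrier (coind E)" for a u
    unfolding coind_simps
    by (rule coindI) (use coindD[OF that] in \<open>simp_all add: distrib_left mult.left_commute[of a]\<close>)
  have u0: "u 0 = \<zero>\<^bsub>E\<^esub>" if "u \<in> carrier (coind E)" for u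
    using coindD(3)[OF that, of 0 0] coindD(1)[OF that] by simp
  have "abelian_group (coind E)"
  proof (rule abelian_groupI)
    fix u assume u: "u \<in> carrier (coind E)"
    have "(- 1) \<odot>\<^bsub>coind E\<^esub> u \<oplus>\<^bsub>coind E\<^esub> u = \<zero>\<^bsub>coind E\<^esub>"
      using coindD(2)[OF u, of "- r" r for r] u0[OF u] by (simp add: coind_simps fun_eq_iff)
    then show "\<exists>v\<in>carrier (coind E). v \<oplus>\<^bsub>coind E\<^esub> u = \<zero>\<^bsub>coind E\<^esub>" using sm[OF u] by blast
  next
    fix u v w assume uvw: "u \<in> carrier (coind E)" "v \<in> carrier (coind E)" "w \<in> carrier (coind E)"
    show "u \<oplus>\<^bsub>coind E\<^esub> v \<oplus>\<^bsub>coind E\<^esub> w = u \<oplus>\<^bsub>coind E\<^esub> (v \<oplus>\<^bsub>coind E\<^esub> w)"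
      using coindD(1)[OF uvw(1)] coindD(1)[OF uvw(2)] coindD(1)[OF uvw(3)] by (simp add: coind_simps E.a_assoc)
  next
    fix u v assume uv: "u \<in> carrier (coind E)" "v \<in> carrier (coind E)"
    show "u \<oplus>\<^bsub>coind E\<^esub> v = v \<oplus>\<^bsub>coind E\<^esub> u"
      using coindD(1)[OF uv(1)] coindD(1)[OF uv(2)] by (simp add: coind_simps E.a_comm)
  next
    fix u assume u: "u \<in> carrier (coind E)"
    show "\<zero>\<^bsub>coind E\<^esub> \<oplus>\<^bsub>coind E\<^esub> u = u" using coindD(1)[OF u] by (simp add: coind_simps)
  qed (use add zero in auto)
  then have "module class_ring (coind E)"
    using sm by (intro moduleI class_cring.cring_axioms)
      (auto simp: coind_simps coindD(2) distrib_right mult.assoc mult.left_commute)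
  then show ?thesis by (rule cmod.intro)
qed

text \<open>Coinduction is right adjoint to restriction along the Frobenius. Evaluation at 1 turns h
  into a map to E on the restricted module, Baer's criterion extends this to g0, and n goes back to
  the function sending r to g0 (r n).\<close>

lemma injective_coind:
  fixes E :: "(('p::prime_card, 'n::finite) pol, 'e) module"
  assumes inj: "injective_module class_ring E"
  shows "injective_module class_ring (coind E)"
proof -
  interpret E: cmod E using inj by (simp add: injective_module_def cmod_def)
  have E: "cmod E" by unfold_locales
  have "\<exists>g\<in>hom_set N (coind E). \<forall>x\<in>K. g x = h x"
    if N: "module class_ring N" and K: "Module.submodule K class_ring N" and h: "h \<in> hom_set (N\<lparr>carrier := K\<rparr>) (coind E)"
    for N :: "(('p, 'n) pol, ('p, 'n) pol) module" and K h
  proof -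
    interpret N: cmod N by (rule cmod.intro[OF N])
    let ?N = "restrict_scalars (\<lambda>r. r ^ CARD('p)) N"
    have sN: "carrier ?N = carrier N" "\<zero>\<^bsub>?N\<^esub> = \<zero>\<^bsub>N\<^esub>" "x \<oplus>\<^bsub>?N\<^esub> y = x \<oplus>\<^bsub>N\<^esub> y" "a \<odot>\<^bsub>?N\<^esub> x = a ^ CARD('p) \<odot>\<^bsub>N\<^esub> x" for x y a
      by (simp_all add: restrict_scalars_def)
    have "abelian_group ?N"
    proof (rule abelian_groupI)
      show "\<exists>y\<in>carrier ?N. y \<oplus>\<^bsub>?N\<^esub> x = \<zero>\<^bsub>?N\<^esub>" if "x \<in> carrier ?N" for x
        using that by (intro bexI[of _ "\<ominus>\<^bsub>N\<^esub> x"]) (simp_all add: sN N.l_neg)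
    qed (auto simp: sN N.a_assoc intro: N.a_comm)
    then have "module class_ring ?N"
      by (intro moduleI class_cring.cring_axioms)
        (auto simp: sN frobenius_add power_mult_distrib N.cm_add_l N.cm_add_r N.cm_mult)
    then interpret N': cmod ?N by (rule cmod.intro)
    note K' = N.submoduleE[OF K]
    have K0: "\<zero>\<^bsub>N\<^esub> \<in> K" using subgroup.one_closed[OF Module.submodule.axioms(1)[OF K]] by simp
    have K2: "Module.submodule K class_ring ?N"
      by (rule N'.cm_submoduleI) (use K' K0 in \<open>auto simp: sN\<close>)
    note h' = hom_setD[OF h, simplified]
    have k: "(\<lambda>x. h x 1) \<in> hom_set (?N\<lparr>carrier := K\<rparr>) E"
    proof (rule hom_setI)
      fix x r assume "x \<in> carrier (?N\<lparr>carrier := K\<rparr>)"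
      then have x: "x \<in> K" by simp
      have "h (r ^ CARD('p) \<odot>\<^bsub>N\<^esub> x) 1 = h x (r ^ CARD('p) * 1)" unfolding h'(3)[OF x] by (simp add: coind_simps)
      also have "\<dots> = r \<odot>\<^bsub>E\<^esub> h x 1" by (rule coindD(3)[OF h'(1)[OF x]])
      finally show "h (r \<odot>\<^bsub>?N\<lparr>carrier := K\<rparr>\<^esub> x) 1 = r \<odot>\<^bsub>E\<^esub> h x 1" by (simp add: restrict_scalars_def)
    qed (use h' in \<open>auto simp: restrict_scalars_def coind_simps intro: coindD(1)\<close>)
    from baer[OF inj N'.cmod_axioms K2 k]
    obtain g0 where g0: "g0 \<in> hom_set ?N E" "\<And>x. x \<in> K \<Longrightarrow> g0 x = h x 1" by blast
    note g0' = hom_setD[OF g0(1), unfolded sN]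
    have g: "(\<lambda>n r. g0 (r \<odot>\<^bsub>N\<^esub> n)) \<in> hom_set N (coind E)"
    proof (rule hom_setI)
      fix n assume n: "n \<in> carrier N"
      show "(\<lambda>r. g0 (r \<odot>\<^bsub>N\<^esub> n)) \<in> carrier (coind E)"
        by (rule coindI) (use n in \<open>simp_all add: g0' N.cm_add_l N.cm_mult\<close>)
      show "(\<lambda>r. g0 (r \<odot>\<^bsub>N\<^esub> (a \<odot>\<^bsub>N\<^esub> n))) = a \<odot>\<^bsub>coind E\<^esub> (\<lambda>r. g0 (r \<odot>\<^bsub>N\<^esub> n))" for a
        unfolding coind_simps using n by (simp add: mult.commute[of a] flip: N.cm_mult)
    qed (simp add: coind_simps g0' N.cm_add_r)
    have "(\<lambda>r. g0 (r \<odot>\<^bsub>N\<^esub> x)) = h x" if x: "x \<in> K" for x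
    proof
      fix r
      have "r \<odot>\<^bsub>N\<^esub> x \<in> K" using K'(4)[of r x] x by simp
      then have "g0 (r \<odot>\<^bsub>N\<^esub> x) = h (r \<odot>\<^bsub>N\<^esub> x) 1" by (rule g0(2))
      then show "g0 (r \<odot>\<^bsub>N\<^esub> x) = h x r" unfolding h'(3)[OF x] by (simp add: coind_simps)
    qed
    with g show ?thesis by (intro bexI[of _ "\<lambda>n r. g0 (r \<odot>\<^bsub>N\<^esub> n)"]) auto
  qed
  then show ?thesis
    using cmod.is_mod[OF cmod_coind[OF E]] unfolding injective_module_def by blast
qed

context cmod
begin

lemma finsum_delta: "finite A \<Longrightarrow> i \<in> A \<Longrightarrow> f \<in> A \<rightarrow> carrier E \<Longrightarrow> (\<Oplus>j\<in>A. (if i = j then 1 else 0) \<odot> f j) = f i"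
  by (subst finsum_cong'[of A A "\<lambda>j. if i = j then f j else \<zero>"]) (auto intro!: finsum_singleton simp: Pi_iff)

end

lemma coind_sum:
  fixes E :: "(('p::prime_card, 'n::finite) pol, 'e) module"
  assumes "cmod E" "u \<in> carrier (coind E)"
  shows "u (sum f A) = (\<Oplus>\<^bsub>E\<^esub>c\<in>A. u (f c))"
proof -
  interpret E: cmod E by fact
  have "u 0 = \<zero>\<^bsub>E\<^esub>" using coindD(3)[OF assms(2), of 0 0] coindD(1)[OF assms(2)] by simp
  then show ?thesis
    by (induction A rule: infinite_finite_induct) (auto simp: coindD[OF assms(2)] Pi_def E.finsum_infinite)
qed

lemma coind_expand:
  fixes E :: "(('p::prime_card, 'n::finite) pol, 'e) module"
  assumes "cmod E" "u \<in> carrier (coind E)"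
  shows "u t = (\<Oplus>\<^bsub>E\<^esub>c\<in>digits CARD('p). frob_coeff c t \<odot>\<^bsub>E\<^esub> u (pol_mon c))"
proof -
  have "u t = u (\<Sum>c\<in>digits CARD('p). frob_coeff c t ^ CARD('p) * pol_mon c)"
    using frob_coeff_expand[of t] by (simp add: mult.commute)
  then show ?thesis unfolding coind_sum[OF assms] coindD(3)[OF assms(2)] .
qed

lemma coind_eqI:
  fixes E :: "(('p::prime_card, 'n::finite) pol, 'e) module"
  assumes "cmod E" "u \<in> carrier (coind E)" "v \<in> carrier (coind E)"
    and "\<And>c. c \<in> digits CARD('p) \<Longrightarrow> u (pol_mon c) = v (pol_mon c)"
  shows "u = v"
proof
  fix t
  interpret E: cmod E by fact
  show "u t = v t"
    unfolding coind_expand[OF assms(1,2), of t] coind_expand[OF assms(1,3), of t]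
    using assms(4) coindD(1)[OF assms(3)] by (intro E.finsum_cong') auto
qed

text \<open>Together with \<open>coind_eqI\<close> this identifies \<open>coind E\<close> with the
  families in E indexed by digits: an element is determined by its values at the monomials x^c, and
  these may be prescribed freely.\<close>

lemma coind_build:
  fixes E :: "(('p::prime_card, 'n::finite) pol, 'e) module"
  assumes "cmod E" "\<And>c. c \<in> digits CARD('p) \<Longrightarrow> y c \<in> carrier E"
  shows "\<exists>u\<in>carrier (coind E). \<forall>c\<in>digits CARD('p). u (pol_mon c) = y c"
proof
  interpret E: cmod E by fact
  let ?u = "\<lambda>t. \<Oplus>\<^bsub>E\<^esub>c\<in>digits CARD('p). frob_coeff c t \<odot>\<^bsub>E\<^esub> y c"
  have yc: "(\<lambda>c. a c \<odot>\<^bsub>E\<^esub> y c) \<in> digits CARD('p) \<rightarrow> carrier E" for a using assms(2) by auto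
  show "?u \<in> carrier (coind E)"
  proof (rule coindI)
    show "?u r \<in> carrier E" for r by (rule E.finsum_closed[OF yc])
    show "?u (r + s) = ?u r \<oplus>\<^bsub>E\<^esub> ?u s" for r s
      unfolding E.finsum_addf[OF yc yc, symmetric]
      by (rule E.finsum_cong') (use assms(2) in \<open>auto simp: frob_coeff_add E.cm_add_l\<close>)
    show "?u (s ^ CARD('p) * r) = s \<odot>\<^bsub>E\<^esub> ?u r" for r s
      unfolding E.cm_finsum[OF yc]
      by (rule E.finsum_cong') (use assms(2) in \<open>auto simp: mult.commute[of "s ^ CARD('p)"] frob_coeff_mult_power mult.commute[of _ s] E.cm_mult\<close>)
  qed
  show "\<forall>b\<in>digits CARD('p). ?u (pol_mon b) = y b"
  proof
    fix b :: "'n \<Rightarrow> nat" assume b: "b \<in> digits CARD('p)"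
    have "?u (pol_mon b) = (\<Oplus>\<^bsub>E\<^esub>c\<in>digits CARD('p). (if b = c then 1 else 0) \<odot>\<^bsub>E\<^esub> y c)"
      by (rule E.finsum_cong') (use assms(2) b in \<open>auto simp: frob_coeff_mon\<close>)
    also have "\<dots> = y b" using assms(2) b by (intro E.finsum_delta finite_digits) auto
    finally show "?u (pol_mon b) = y b" .
  qed
qed

abbreviation top_digit :: "nat \<Rightarrow> 'n \<Rightarrow> nat" where
  "top_digit q \<equiv> codigit q (\<lambda>_. 0)"

lemma digits_pos: "top_digit CARD('p) \<in> digits CARD('p)" "codigit CARD('p) c \<in> digits CARD('p)" "(\<lambda>_. 0) \<in> digits CARD('p)"
  for c :: "'n::finite \<Rightarrow> nat" and p :: "'p::prime_card itself"
  using prime_card[where 'a = 'p, THEN prime_gt_0_nat] by (auto simp: codigit_digits) (simp add: digits_def)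

lemma frob_coeff_top:
  fixes r :: "('p::prime_card, 'n::finite) pol"
  assumes c: "c \<in> digits CARD('p)"
  shows "frob_coeff (top_digit CARD('p)) (r * pol_mon c) = frob_coeff (codigit CARD('p) c) r"
proof -
  have "codigit CARD('p) (top_digit CARD('p)) = (\<lambda>_ :: 'n. 0)"
    by (rule codigit_codigit) (rule digits_pos(3))
  then show ?thesis using frob_coeff_symmetric[OF digits_pos(1) c, of r] by simp
qed

lemma sum_codigit: "(\<Sum>c\<in>digits CARD('p). f (codigit CARD('p) c)) = (\<Sum>c\<in>digits CARD('p). f c)"
  for f :: "('n::finite \<Rightarrow> nat) \<Rightarrow> ('p::prime_card, 'n) pol"
  by (rule sum.reindex_bij_witness[of _ "codigit CARD('p)" "codigit CARD('p)"]) (auto simp: codigit_codigit digits_pos)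

lemma codigit_expand: "(\<Sum>c\<in>digits CARD('p). pol_mon (codigit CARD('p) c) * frob_coeff (codigit CARD('p) c) r ^ CARD('p)) = r"
  for r :: "('p::prime_card, 'n::finite) pol"
  using sum_codigit[of "\<lambda>c. pol_mon c * frob_coeff c r ^ CARD('p)"] frob_coeff_expand[of r] by simp

context pol_resolution
begin

definition dd :: "nat \<Rightarrow> (('p, 'n) pol \<Rightarrow> 'e) \<Rightarrow> ('p, 'n) pol \<Rightarrow> 'e" where
  "dd i u r = d i (u r)"

text \<open>\<open>Hom\<close> over \<open>R\<^sup>p\<close> from \<open>R\<close> to \<open>R\<^sup>p\<close> is free over \<open>R\<close> on the coefficient of the top monomial.\<close>

definition \<epsilon>\<epsilon> :: "('p, 'n) pol \<Rightarrow> ('p, 'n) pol \<Rightarrow> 'e" where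
  "\<epsilon>\<epsilon> r t = \<epsilon> (frob_coeff (top_digit CARD('p)) (r * t))"

lemma coind_cmod: "cmod (coind (E i))"
  by (rule cmod_coind[OF E_cmod])

lemma \<epsilon>\<epsilon>_closed: "\<epsilon>\<epsilon> r \<in> carrier (coind (E 0))"
proof (rule coindI)
  show "\<epsilon>\<epsilon> r (s ^ CARD('p) * t) = s \<odot>\<^bsub>E 0\<^esub> \<epsilon>\<epsilon> r t" for s t
    using frob_coeff_mult_power[OF digits_pos(1), of "r * t" s]
    by (simp add: \<epsilon>\<epsilon>_def mult_ac flip: \<epsilon>_smult)
qed (simp_all add: \<epsilon>\<epsilon>_def \<epsilon>_closed distrib_left frob_coeff_add \<epsilon>_add)

lemma \<epsilon>\<epsilon>_mon: "c \<in> digits CARD('p) \<Longrightarrow> \<epsilon>\<epsilon> r (pol_mon c) = \<epsilon> (frob_coeff (codigit CARD('p) c) r)"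
  by (simp add: \<epsilon>\<epsilon>_def frob_coeff_top)

lemma dd_closed: "u \<in> carrier (coind (E i)) \<Longrightarrow> dd i u \<in> carrier (coind (E (Suc i)))"
  by (rule coindI) (simp_all add: dd_def coindD d_closed d_add d_smult)

text \<open>Exactness can be checked on values at the x^c, where it is the exactness of E. In degree
  0 the self-duality of R over R^p identifies the kernel with R.\<close>

lemma coind_resolution: "resolution (\<lambda>i. coind (E i)) dd \<epsilon>\<epsilon>"
proof (rule resolution.intro)
  have \<epsilon>h: "\<epsilon>\<epsilon> \<in> hom_set (regular_module class_ring) (coind (E 0))"
  proof (rule hom_setI)
    show "\<epsilon>\<epsilon> (x \<oplus>\<^bsub>regular_module class_ring\<^esub> y) = \<epsilon>\<epsilon> x \<oplus>\<^bsub>coind (E 0)\<^esub> \<epsilon>\<epsilon> y" for x y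
      by (simp add: regular_module_def coind_simps \<epsilon>\<epsilon>_def fun_eq_iff distrib_right frob_coeff_add \<epsilon>_add)
    show "\<epsilon>\<epsilon> (r \<odot>\<^bsub>regular_module class_ring\<^esub> x) = r \<odot>\<^bsub>coind (E 0)\<^esub> \<epsilon>\<epsilon> x" for r x
      by (simp add: regular_module_def coind_simps \<epsilon>\<epsilon>_def fun_eq_iff mult_ac)
  qed (rule \<epsilon>\<epsilon>_closed)
  have \<epsilon>i: "inj \<epsilon>\<epsilon>"
  proof (rule injI)
    fix r s assume rs: "\<epsilon>\<epsilon> r = \<epsilon>\<epsilon> s"
    have "frob_coeff c r = frob_coeff c s" if c: "c \<in> digits CARD('p)" for c
    proof -
      have "\<epsilon> (frob_coeff c r) = \<epsilon> (frob_coeff c s)"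
        using fun_cong[OF rs, of "pol_mon (codigit CARD('p) c)"] by (simp add: \<epsilon>\<epsilon>_mon digits_pos codigit_codigit[OF c])
      then show ?thesis by (rule injD[OF \<epsilon>_inj])
    qed
    then have "(\<Sum>c\<in>digits CARD('p). pol_mon c * frob_coeff c r ^ CARD('p))
        = (\<Sum>c\<in>digits CARD('p). pol_mon c * frob_coeff c s ^ CARD('p))" by (intro sum.cong) auto
    then show "r = s" unfolding frob_coeff_expand[symmetric] .
  qed
  have dh: "dd i \<in> hom_set (coind (E i)) (coind (E (Suc i)))" for i
  proof (rule hom_setI)
    show "dd i (u \<oplus>\<^bsub>coind (E i)\<^esub> v) = dd i u \<oplus>\<^bsub>coind (E (Suc i))\<^esub> dd i v"
      if "u \<in> carrier (coind (E i))" "v \<in> carrier (coind (E i))" for u v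
      using coindD(1)[OF that(1)] coindD(1)[OF that(2)] by (simp add: coind_simps dd_def fun_eq_iff d_add)
  qed (simp_all add: dd_closed coind_simps dd_def fun_eq_iff)
  have k0: "range \<epsilon>\<epsilon> = {u \<in> carrier (coind (E 0)). dd 0 u = \<zero>\<^bsub>coind (E 1)\<^esub>}"
  proof (intro equalityI subsetI)
    fix u assume "u \<in> {u \<in> carrier (coind (E 0)). dd 0 u = \<zero>\<^bsub>coind (E 1)\<^esub>}"
    then have u: "u \<in> carrier (coind (E 0))" and "\<And>r. d 0 (u r) = \<zero>\<^bsub>E 1\<^esub>" by (auto simp: coind_simps dd_def fun_eq_iff)
    then have "\<forall>c. \<exists>y. u (pol_mon c) = \<epsilon> y" using exact_0D coindD(1)[OF u] by blast
    then obtain y where y: "\<And>c. u (pol_mon c) = \<epsilon> (y c)" by metis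
    \<comment> \<open>The coefficients sit at complementary digits because \<epsilon>\<epsilon> r
      takes at x^c the value of \<epsilon> on the coefficient of x^(p-1-c) in r.\<close>
    define r where "r = (\<Sum>c\<in>digits CARD('p). pol_mon c * y (codigit CARD('p) c) ^ CARD('p))"
    have "frob_coeff b r = y (codigit CARD('p) b)" if b: "b \<in> digits CARD('p)" for b
    proof -
      have "frob_coeff b r = (\<Sum>c\<in>digits CARD('p). if c = b then y (codigit CARD('p) c) else 0)"
        unfolding r_def frob_coeff_sum
        by (rule sum.cong) (auto simp: frob_coeff_mult_power[OF b] frob_coeff_mon[OF b])
      then show ?thesis using b by (simp add: finite_digits)
    qed
    then have "u = \<epsilon>\<epsilon> r"
      by (intro coind_eqI[OF E_cmod u \<epsilon>\<epsilon>_closed]) (simp add: \<epsilon>\<epsilon>_mon y digits_pos codigit_codigit)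
    then show "u \<in> range \<epsilon>\<epsilon>" by blast
  qed (auto simp: \<epsilon>\<epsilon>_closed coind_simps dd_def fun_eq_iff \<epsilon>\<epsilon>_def d_\<epsilon>)
  have kS: "dd i ` carrier (coind (E i)) = {u \<in> carrier (coind (E (Suc i))). dd (Suc i) u = \<zero>\<^bsub>coind (E (Suc (Suc i)))\<^esub>}" for i
  proof (intro equalityI subsetI)
    fix u assume "u \<in> {u \<in> carrier (coind (E (Suc i))). dd (Suc i) u = \<zero>\<^bsub>coind (E (Suc (Suc i)))\<^esub>}"
    then have u: "u \<in> carrier (coind (E (Suc i)))" and "\<And>r. d (Suc i) (u r) = \<zero>\<^bsub>E (Suc (Suc i))\<^esub>"
      by (auto simp: coind_simps dd_def fun_eq_iff)
    then have "\<forall>c. \<exists>y. y \<in> carrier (E i) \<and> u (pol_mon c) = d i y" using exact_SucD coindD(1)[OF u] by blast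
    then obtain y where y: "\<And>c. y c \<in> carrier (E i)" "\<And>c. u (pol_mon c) = d i (y c)" by metis
    obtain v where v: "v \<in> carrier (coind (E i))" "\<And>c. c \<in> digits CARD('p) \<Longrightarrow> v (pol_mon c) = y c"
      using coind_build[OF E_cmod[of i], of y] y(1) by blast
    have "u = dd i v"
      by (intro coind_eqI[OF E_cmod u dd_closed[OF v(1)]]) (simp add: dd_def v y)
    then show "u \<in> dd i ` carrier (coind (E i))" using v(1) by blast
  qed (auto simp: dd_closed coind_simps dd_def fun_eq_iff coindD(1) d_d)
  show "injective_resolution class_ring (\<lambda>i. coind (E i)) dd \<epsilon>\<epsilon>"
    unfolding injective_resolution_def using injective_coind[OF E_inj] \<epsilon>h \<epsilon>i dh k0 kS by simp
qed

end

section \<open>The comparison map attached to a lift of the Frobenius\<close>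

locale frob_resolution = pol_resolution E d \<epsilon>
  for E :: "nat \<Rightarrow> (('p::prime_card, 'n::finite) pol, 'e) module" and d \<epsilon> +
  fixes \<phi> :: "nat \<Rightarrow> 'e \<Rightarrow> 'e"
  assumes lift: "frobenius_lift E d \<epsilon> \<phi>"
begin

lemma \<phi>_closed: "x \<in> carrier (E i) \<Longrightarrow> \<phi> i x \<in> carrier (E i)"
  and \<phi>_add: "x \<in> carrier (E i) \<Longrightarrow> y \<in> carrier (E i) \<Longrightarrow> \<phi> i (x \<oplus>\<^bsub>E i\<^esub> y) = \<phi> i x \<oplus>\<^bsub>E i\<^esub> \<phi> i y"
  and \<phi>_smult: "x \<in> carrier (E i) \<Longrightarrow> \<phi> i (r \<odot>\<^bsub>E i\<^esub> x) = r ^ CARD('p) \<odot>\<^bsub>E i\<^esub> \<phi> i x"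
  and \<phi>_d: "x \<in> carrier (E i) \<Longrightarrow> \<phi> (Suc i) (d i x) = d i (\<phi> i x)"
  and \<phi>_\<epsilon>: "\<phi> 0 (\<epsilon> r) = \<epsilon> (r ^ CARD('p))"
  using lift by (auto simp: frobenius_lift_def module_hom_def restrict_scalars_def)

lemma \<phi>_zero [simp]: "\<phi> i \<zero>\<^bsub>E i\<^esub> = \<zero>\<^bsub>E i\<^esub>"
  using \<phi>_smult[of "\<zero>\<^bsub>E i\<^esub>" i 0] \<phi>_closed[of "\<zero>\<^bsub>E i\<^esub>" i] by (simp add: power_0_left)

lemma \<phi>_finsum: "f \<in> A \<rightarrow> carrier (E i) \<Longrightarrow> \<phi> i (finsum (E i) f A) = (\<Oplus>\<^bsub>E i\<^esub>a\<in>A. \<phi> i (f a))"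
  by (rule finsum_additive) (auto simp: \<phi>_add \<phi>_closed E.abelian_monoid_axioms)

text \<open>Pairs the value at x^c with the dual monomial x^(p-1-c). This use of dual bases makes
  the map R-linear although \<phi> is only p-linear.\<close>

definition \<Theta> :: "nat \<Rightarrow> (('p, 'n) pol \<Rightarrow> 'e) \<Rightarrow> 'e" where
  "\<Theta> i u = (\<Oplus>\<^bsub>E i\<^esub>c\<in>digits CARD('p). pol_mon (codigit CARD('p) c) \<odot>\<^bsub>E i\<^esub> \<phi> i (u (pol_mon c)))"

lemma \<Theta>_term: "u \<in> carrier (coind (E i)) \<Longrightarrow>
    (\<lambda>c. pol_mon (f c) \<odot>\<^bsub>E i\<^esub> \<phi> i (u (g c))) \<in> A \<rightarrow> carrier (E i)"
  by (auto simp: \<phi>_closed coindD(1))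

lemma \<Theta>_hom: "\<Theta> i \<in> hom_set (coind (E i)) (E i)"
proof (rule hom_setI)
  show "\<Theta> i u \<in> carrier (E i)" if "u \<in> carrier (coind (E i))" for u
    unfolding \<Theta>_def by (rule E.finsum_closed[OF \<Theta>_term[OF that]])
  show "\<Theta> i (u \<oplus>\<^bsub>coind (E i)\<^esub> v) = \<Theta> i u \<oplus>\<^bsub>E i\<^esub> \<Theta> i v"
    if "u \<in> carrier (coind (E i))" "v \<in> carrier (coind (E i))" for u v
    unfolding \<Theta>_def E.finsum_addf[OF \<Theta>_term[OF that(1)] \<Theta>_term[OF that(2)], symmetric] coind_simps
    by (rule E.finsum_cong') (use coindD(1)[OF that(1)] coindD(1)[OF that(2)] in \<open>auto simp: \<phi>_add \<phi>_closed E.cm_add_r\<close>)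
next
  fix a u assume u: "u \<in> carrier (coind (E i))"
  let ?D = "digits CARD('p) :: ('n \<Rightarrow> nat) set"
  let ?c = "codigit CARD('p)"
  have \<phi>u: "\<phi> i (u t) \<in> carrier (E i)" for t using coindD(1)[OF u] by (rule \<phi>_closed)
  have 1: "\<phi> i (u t) = (\<Oplus>\<^bsub>E i\<^esub>b\<in>?D. frob_coeff b t ^ CARD('p) \<odot>\<^bsub>E i\<^esub> \<phi> i (u (pol_mon b)))" for t
  proof -
    have "\<phi> i (u t) = \<phi> i (\<Oplus>\<^bsub>E i\<^esub>b\<in>?D. frob_coeff b t \<odot>\<^bsub>E i\<^esub> u (pol_mon b))"
      using coind_expand[OF E_cmod u, of t] by simp
    also have "\<dots> = (\<Oplus>\<^bsub>E i\<^esub>b\<in>?D. \<phi> i (frob_coeff b t \<odot>\<^bsub>E i\<^esub> u (pol_mon b)))"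
      by (rule \<phi>_finsum) (auto simp: coindD(1)[OF u])
    finally show ?thesis by (simp add: \<phi>_smult coindD(1)[OF u])
  qed
  have "\<Theta> i (a \<odot>\<^bsub>coind (E i)\<^esub> u) = (\<Oplus>\<^bsub>E i\<^esub>c\<in>?D. pol_mon (?c c) \<odot>\<^bsub>E i\<^esub> \<phi> i (u (a * pol_mon c)))"
    by (simp add: \<Theta>_def coind_simps)
  also have "\<dots> = (\<Oplus>\<^bsub>E i\<^esub>c\<in>?D. \<Oplus>\<^bsub>E i\<^esub>b\<in>?D.
      (pol_mon (?c c) * frob_coeff b (a * pol_mon c) ^ CARD('p)) \<odot>\<^bsub>E i\<^esub> \<phi> i (u (pol_mon b)))"
  proof (rule E.finsum_cong')
    fix c
    show "pol_mon (?c c) \<odot>\<^bsub>E i\<^esub> \<phi> i (u (a * pol_mon c)) = (\<Oplus>\<^bsub>E i\<^esub>b\<in>?D.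
        (pol_mon (?c c) * frob_coeff b (a * pol_mon c) ^ CARD('p)) \<odot>\<^bsub>E i\<^esub> \<phi> i (u (pol_mon b)))"
      unfolding 1[of "a * pol_mon c"]
      by (subst E.cm_finsum) (auto simp: \<phi>u E.cm_mult)
  qed (auto intro!: E.finsum_closed simp: \<phi>u)
  also have "\<dots> = (\<Oplus>\<^bsub>E i\<^esub>b\<in>?D. \<Oplus>\<^bsub>E i\<^esub>c\<in>?D.
      (pol_mon (?c c) * frob_coeff b (a * pol_mon c) ^ CARD('p)) \<odot>\<^bsub>E i\<^esub> \<phi> i (u (pol_mon b)))"
    by (rule finsum_exchange[OF E.abelian_monoid_axioms finite_digits finite_digits]) (simp add: \<phi>u)
  also have "\<dots> = (\<Oplus>\<^bsub>E i\<^esub>b\<in>?D. (a * pol_mon (?c b)) \<odot>\<^bsub>E i\<^esub> \<phi> i (u (pol_mon b)))"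
  proof (rule E.finsum_cong')
    fix b assume b: "b \<in> ?D"
    \<comment> \<open>The symmetry moves the factor a from the argument of u to the dual basis; the
      sum over c is then the expansion of a x^(p-1-b) itself.\<close>
    have "(\<Sum>c\<in>?D. pol_mon (?c c) * frob_coeff b (a * pol_mon c) ^ CARD('p))
        = (\<Sum>c\<in>?D. pol_mon (?c c) * frob_coeff (?c c) (a * pol_mon (?c b)) ^ CARD('p))"
      by (rule sum.cong) (simp_all add: frob_coeff_symmetric[OF b])
    then show "(\<Oplus>\<^bsub>E i\<^esub>c\<in>?D. (pol_mon (?c c) * frob_coeff b (a * pol_mon c) ^ CARD('p)) \<odot>\<^bsub>E i\<^esub> \<phi> i (u (pol_mon b)))
        = (a * pol_mon (?c b)) \<odot>\<^bsub>E i\<^esub> \<phi> i (u (pol_mon b))"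
      unfolding E.cm_sum[OF \<phi>u, symmetric] codigit_expand by simp
  qed (auto simp: \<phi>u)
  also have "\<dots> = a \<odot>\<^bsub>E i\<^esub> \<Theta> i u"
    unfolding \<Theta>_def E.cm_finsum[OF \<Theta>_term[OF u]] by (rule E.finsum_cong') (auto simp: \<phi>u E.cm_mult)
  finally show "\<Theta> i (a \<odot>\<^bsub>coind (E i)\<^esub> u) = a \<odot>\<^bsub>E i\<^esub> \<Theta> i u" .
qed

lemma \<Theta>_d: "u \<in> carrier (coind (E i)) \<Longrightarrow> \<Theta> (Suc i) (dd i u) = d i (\<Theta> i u)"
  unfolding \<Theta>_def hom_set_finsum[OF E_cmod E_cmod d_hom \<Theta>_term]
  by (rule E.finsum_cong') (auto simp: dd_def \<phi>_d coindD(1) d_smult \<phi>_closed d_closed)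

text \<open>Thus \<Theta> lifts the identity of R, which is what the comparison theorem asks of it.
  The sum is the Frobenius expansion of r, indexed by complementary digits.\<close>

lemma \<Theta>_\<epsilon>: "\<Theta> 0 (\<epsilon>\<epsilon> r) = \<epsilon> r"
proof -
  have "\<Theta> 0 (\<epsilon>\<epsilon> r) = (\<Oplus>\<^bsub>E 0\<^esub>c\<in>digits CARD('p). \<epsilon> (pol_mon (codigit CARD('p) c) * frob_coeff (codigit CARD('p) c) r ^ CARD('p)))"
    unfolding \<Theta>_def by (rule E.finsum_cong') (auto simp: \<epsilon>\<epsilon>_mon \<phi>_\<epsilon> \<epsilon>_closed \<epsilon>_smult)
  also have "\<dots> = \<epsilon> (\<Sum>c\<in>digits CARD('p). pol_mon (codigit CARD('p) c) * frob_coeff (codigit CARD('p) c) r ^ CARD('p))"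
  proof -
    have "\<epsilon> (0 * 1) = 0 \<odot>\<^bsub>E 0\<^esub> \<epsilon> 1" by (rule \<epsilon>_smult)
    then have "\<epsilon> 0 = \<zero>\<^bsub>E 0\<^esub>" unfolding E.cm_zero_l[OF \<epsilon>_closed] by (simp only: mult_zero_left)
    then have "\<epsilon> (sum f A) = (\<Oplus>\<^bsub>E 0\<^esub>c\<in>A. \<epsilon> (f c))" for f :: "('n \<Rightarrow> nat) \<Rightarrow> _" and A
      by (induction A rule: infinite_finite_induct) (auto simp: \<epsilon>_add \<epsilon>_closed Pi_def E.finsum_infinite)
    then show ?thesis by simp
  qed
  finally show ?thesis by (simp add: codigit_expand)
qed

text \<open>With (J) the ideal generated by J, this is Hom(R/(J), E i); hence Z modulo B computes
  the Ext modules of R/(J) with values in R.\<close>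

definition ann :: "('p, 'n) pol set \<Rightarrow> nat \<Rightarrow> 'e set" where
  "ann J i = {x \<in> carrier (E i). \<forall>a\<in>J. a \<odot>\<^bsub>E i\<^esub> x = \<zero>\<^bsub>E i\<^esub>}"

definition Z :: "('p, 'n) pol set \<Rightarrow> nat \<Rightarrow> 'e set" where
  "Z J i = {x \<in> ann J i. d i x = \<zero>\<^bsub>E (Suc i)\<^esub>}"

definition B :: "('p, 'n) pol set \<Rightarrow> nat \<Rightarrow> 'e set" where
  "B J i = (case i of 0 \<Rightarrow> {\<zero>\<^bsub>E 0\<^esub>} | Suc k \<Rightarrow> d k ` ann J k)"

definition frob_image :: "('p, 'n) pol set \<Rightarrow> ('p, 'n) pol set" where
  "frob_image J = (\<lambda>a. a ^ CARD('p)) ` J"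

lemma ann_hom: "h \<in> hom_set (E i) (E j) \<Longrightarrow> x \<in> ann J i \<Longrightarrow> h x \<in> ann J j"
  using hom_set_zero[OF E_cmod[of i] E_cmod[of j], of h]
  by (auto simp: ann_def hom_setD simp flip: hom_setD(3))

text \<open>Since (a^p u)(r) = a u(r), coinduction turns torsion for the p-th powers of J into
  torsion for J itself. Every descent by one Frobenius power rests on this.\<close>

lemma coind_ann:
  assumes u: "u \<in> carrier (coind (E i))"
  shows "(\<forall>a\<in>frob_image J. a \<odot>\<^bsub>coind (E i)\<^esub> u = \<zero>\<^bsub>coind (E i)\<^esub>) \<longleftrightarrow> (\<forall>r. u r \<in> ann J i)"
  using coindD(1,3)[OF u] by (auto simp: frob_image_def ann_def coind_simps fun_eq_iff)

text \<open>By the comparison theorem \<open>\<Theta>\<close> has an inverse up to homotopy.\<close>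

theorem frobenius_comparison:
  "\<exists>\<chi>. (\<forall>i. \<chi> i \<in> hom_set (E i) (coind (E i))) \<and>
     (\<forall>i. \<forall>x\<in>carrier (E i). \<chi> (Suc i) (d i x) = dd i (\<chi> i x)) \<and>
     (\<forall>J i. \<forall>z\<in>Z J i. \<exists>w\<in>B J i. \<Theta> i (\<chi> i z) = z \<oplus>\<^bsub>E i\<^esub> w) \<and>
     (\<forall>J i. \<forall>u\<in>carrier (coind (E i)). (\<forall>r. u r \<in> Z J i) \<longrightarrow>
        (\<exists>v. \<forall>r. v r \<in> B J i \<and> \<chi> i (\<Theta> i u) r = u r \<oplus>\<^bsub>E i\<^esub> v r))"
proof -
  let ?C = "\<lambda>i. coind (E i)"
  interpret C: resolution ?C dd \<epsilon>\<epsilon> by (rule coind_resolution)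
  interpret EC: two_resolutions E d \<epsilon> ?C dd \<epsilon>\<epsilon> ..
  interpret EE: two_resolutions E d \<epsilon> E d \<epsilon> ..
  interpret CC: two_resolutions ?C dd \<epsilon>\<epsilon> ?C dd \<epsilon>\<epsilon> ..
  obtain \<chi> where \<chi>: "\<And>i. \<chi> i \<in> hom_set (E i) (?C i)" "\<And>i x. x \<in> carrier (E i) \<Longrightarrow> \<chi> (Suc i) (d i x) = dd i (\<chi> i x)"
    "\<And>r. \<chi> 0 (\<epsilon> r) = \<epsilon>\<epsilon> r" using EC.chain_map_exists by blast
  note \<chi>c = hom_setD(1)[OF \<chi>(1)] and \<Theta>c = hom_setD(1)[OF \<Theta>_hom]
  have idE: "(\<lambda>x. x) \<in> hom_set (E i) (E i)" and idC: "(\<lambda>x. x) \<in> hom_set (?C i) (?C i)" for i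
    by (rule hom_setI; simp)+
  have "\<exists>s. (\<forall>i. s i \<in> hom_set (E (Suc i)) (E i)) \<and>
    (\<forall>i. \<forall>z\<in>carrier (E (Suc i)). d (Suc i) z = \<zero>\<^bsub>E (Suc (Suc i))\<^esub> \<longrightarrow>
      \<Theta> (Suc i) (\<chi> (Suc i) z) = z \<oplus>\<^bsub>E (Suc i)\<^esub> d i (s i z))"
    using EE.chain_homotopy[of "\<lambda>i x. \<Theta> i (\<chi> i x)" "\<lambda>i x. x"] hom_set_comp[OF \<Theta>_hom \<chi>(1)] idE
    by (simp add: \<chi> \<Theta>_d \<chi>c \<Theta>_\<epsilon>)
  then obtain s where s: "\<And>i. s i \<in> hom_set (E (Suc i)) (E i)"
    "\<And>i z. z \<in> carrier (E (Suc i)) \<Longrightarrow> d (Suc i) z = \<zero>\<^bsub>E (Suc (Suc i))\<^esub> \<Longrightarrow>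
      \<Theta> (Suc i) (\<chi> (Suc i) z) = z \<oplus>\<^bsub>E (Suc i)\<^esub> d i (s i z)" by blast
  have "\<exists>s. (\<forall>i. s i \<in> hom_set (?C (Suc i)) (?C i)) \<and>
    (\<forall>i. \<forall>z\<in>carrier (?C (Suc i)). dd (Suc i) z = \<zero>\<^bsub>?C (Suc (Suc i))\<^esub> \<longrightarrow>
      \<chi> (Suc i) (\<Theta> (Suc i) z) = z \<oplus>\<^bsub>?C (Suc i)\<^esub> dd i (s i z))"
    using CC.chain_homotopy[of "\<lambda>i x. \<chi> i (\<Theta> i x)" "\<lambda>i x. x"] hom_set_comp[OF \<chi>(1) \<Theta>_hom] idC
    by (simp add: \<chi> \<Theta>_d \<Theta>c \<Theta>_\<epsilon>)
  then obtain s' where s': "\<And>i. s' i \<in> hom_set (?C (Suc i)) (?C i)"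
    "\<And>i z. z \<in> carrier (?C (Suc i)) \<Longrightarrow> dd (Suc i) z = \<zero>\<^bsub>?C (Suc (Suc i))\<^esub> \<Longrightarrow>
      \<chi> (Suc i) (\<Theta> (Suc i) z) = z \<oplus>\<^bsub>?C (Suc i)\<^esub> dd i (s' i z)" by blast
  have 1: "\<exists>w\<in>B J i. \<Theta> i (\<chi> i z) = z \<oplus>\<^bsub>E i\<^esub> w" if z: "z \<in> Z J i" for J i z
  proof (cases i)
    case 0
    then have "z \<in> carrier (E 0)" "d 0 z = \<zero>\<^bsub>E (Suc 0)\<^esub>" using z by (auto simp: Z_def ann_def)
    then have "\<Theta> 0 (\<chi> 0 z) = z"
      using EE.chain_homotopy_0[of "\<lambda>x. \<Theta> 0 (\<chi> 0 x)" "\<lambda>x. x" z] by (simp add: \<chi> \<Theta>_\<epsilon>)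
    then show ?thesis using \<open>z \<in> carrier (E 0)\<close> by (simp add: 0 B_def)
  next
    case (Suc k)
    then have "z \<in> ann J (Suc k)" "z \<in> carrier (E (Suc k))" "d (Suc k) z = \<zero>\<^bsub>E (Suc (Suc k))\<^esub>"
      using z by (auto simp: Z_def ann_def)
    then show ?thesis
      using s(2)[of z k] ann_hom[OF s(1)[of k], of z J] unfolding Suc B_def by auto
  qed
  have 2: "\<exists>v. \<forall>r. v r \<in> B J i \<and> \<chi> i (\<Theta> i u) r = u r \<oplus>\<^bsub>E i\<^esub> v r"
    if u: "u \<in> carrier (?C i)" and uZ: "\<And>r. u r \<in> Z J i" for J i u
  proof (cases i)
    case 0
    have "dd 0 u = \<zero>\<^bsub>?C (Suc 0)\<^esub>" using uZ by (auto simp: dd_def fun_eq_iff coind_simps Z_def 0)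
    then have "\<chi> 0 (\<Theta> 0 u) = u"
      using CC.chain_homotopy_0[of "\<lambda>x. \<chi> 0 (\<Theta> 0 x)" "\<lambda>x. x" u] u by (simp add: \<chi> \<Theta>_\<epsilon> 0)
    then show ?thesis
      using coindD(1)[OF u] by (intro exI[of _ "\<lambda>_. \<zero>\<^bsub>E i\<^esub>"]) (simp add: 0 B_def)
  next
    case (Suc k)
    have "dd (Suc k) u = \<zero>\<^bsub>?C (Suc (Suc k))\<^esub>" using uZ by (auto simp: dd_def fun_eq_iff coind_simps Z_def Suc)
    then have eq: "\<chi> (Suc k) (\<Theta> (Suc k) u) = u \<oplus>\<^bsub>?C (Suc k)\<^esub> dd k (s' k u)" using s'(2)[of u k] u by (simp add: Suc)
    note uc = u[unfolded Suc]
    note sc = hom_setD(1)[OF s'(1) uc]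
    \<comment> \<open>The homotopy is R-linear, so it preserves being killed by the p-th powers.
      Through \<open>coind_ann\<close> its values lie in \<open>ann J\<close>, which makes the error
      term a coboundary for the same J.\<close>
    have "\<forall>a\<in>frob_image J. a \<odot>\<^bsub>?C (Suc k)\<^esub> u = \<zero>\<^bsub>?C (Suc k)\<^esub>"
      using coind_ann[OF uc, of J] uZ by (simp add: Z_def Suc)
    then have "\<forall>a\<in>frob_image J. a \<odot>\<^bsub>?C k\<^esub> s' k u = \<zero>\<^bsub>?C k\<^esub>"
      using hom_setD(3)[OF s'(1) uc] hom_set_zero[OF coind_cmod coind_cmod s'(1)] by metis
    then have "s' k u r \<in> ann J k" for r using coind_ann[OF sc, of J] by blast
    then show ?thesis
      unfolding Suc eq by (intro exI[of _ "dd k (s' k u)"]) (auto simp: B_def coind_simps dd_def)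
  qed
  show ?thesis using \<chi>(1,2) 1 2 by blast
qed

end

section \<open>Frobenius actions on modules\<close>

lemma free_alg_induct [case_names zero add single]:
  assumes "P 0" "\<And>r s. P r \<Longrightarrow> P s \<Longrightarrow> P (r + s)" "\<And>w c. P (Poly_Mapping.single w c)"
  shows "P (a :: ('p::prime_card, 'n::finite) free_alg)"
proof -
  have "P (\<Sum>k\<in>A. Poly_Mapping.single k (f k))" for A f
    by (induction A rule: infinite_finite_induct) (auto intro: assms)
  then show ?thesis by (subst pm_sum_singles[of a])
qed

locale frob_action = N: cmod N
  for N :: "(('p::prime_card, 'n::finite) pol, 'm) module" +
  fixes \<psi> :: "'m \<Rightarrow> 'm"
  assumes \<psi>_closed: "x \<in> carrier N \<Longrightarrow> \<psi> x \<in> carrier N"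
    and \<psi>_add: "x \<in> carrier N \<Longrightarrow> y \<in> carrier N \<Longrightarrow> \<psi> (x \<oplus>\<^bsub>N\<^esub> y) = \<psi> x \<oplus>\<^bsub>N\<^esub> \<psi> y"
    and \<psi>_smult: "x \<in> carrier N \<Longrightarrow> \<psi> (r \<odot>\<^bsub>N\<^esub> x) = r ^ CARD('p) \<odot>\<^bsub>N\<^esub> \<psi> x"
begin

definition wact :: "'n letter list \<Rightarrow> 'm \<Rightarrow> 'm" where
  "wact w m = foldr (letter_action N \<psi>) w m"

lemma wact_simps [simp]: "wact [] m = m" "wact (X i # w) m = pol_var i \<odot>\<^bsub>N\<^esub> wact w m" "wact (Fr # w) m = \<psi> (wact w m)"
  "wact (v @ w) m = wact v (wact w m)"
  by (simp_all add: wact_def)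

lemma wact_closed [simp]: "m \<in> carrier N \<Longrightarrow> wact w m \<in> carrier N"
proof (induction w)
  case (Cons l w)
  then show ?case by (cases l) (auto simp: \<psi>_closed)
qed simp

lemma wact_add: "m \<in> carrier N \<Longrightarrow> m' \<in> carrier N \<Longrightarrow> wact w (m \<oplus>\<^bsub>N\<^esub> m') = wact w m \<oplus>\<^bsub>N\<^esub> wact w m'"
proof (induction w)
  case (Cons l w)
  then show ?case by (cases l) (auto simp: \<psi>_add N.cm_add_r)
qed simp

lemma const_power: "pol_const c ^ CARD('p) = (pol_const c :: ('p, 'n) pol)"
proof -
  have "exponent (\<lambda>i :: 'n. 0) = 0" by (rule poly_mapping_eqI) simp
  then show ?thesis by (simp add: pol_const_def single_power mod_ring_power_card)
qed

lemma wact_const: "m \<in> carrier N \<Longrightarrow> wact w (pol_const c \<odot>\<^bsub>N\<^esub> m) = pol_const c \<odot>\<^bsub>N\<^esub> wact w m"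
proof (induction w)
  case (Cons l w)
  then show ?case
    by (cases l) (auto simp: \<psi>_smult const_power mult.commute simp flip: N.cm_mult)
qed simp

lemma const_simps: "pol_const (c + d) = pol_const c + (pol_const d :: ('p, 'n) pol)"
  "pol_const (c * d) = pol_const c * (pol_const d :: ('p, 'n) pol)" "pol_const 0 = (0 :: ('p, 'n) pol)"
  "pol_const 1 = (1 :: ('p, 'n) pol)"
  by (simp_all add: pol_const_def single_add mult_single)

abbreviation faa :: "('p, 'n) free_alg \<Rightarrow> 'm \<Rightarrow> 'm" where
  "faa \<equiv> free_alg_action N \<psi>"

lemma faa_superset:
  assumes "finite A" "Poly_Mapping.keys a \<subseteq> A" "m \<in> carrier N"
  shows "faa a m = (\<Oplus>\<^bsub>N\<^esub>w\<in>A. pol_const (Poly_Mapping.lookup a w) \<odot>\<^bsub>N\<^esub> wact (letters w) m)"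
  unfolding free_alg_action_def wact_def[symmetric]
proof (rule N.add.finprod_mono_neutral_cong_left)
  show "\<And>i. i \<in> A - Poly_Mapping.keys a \<Longrightarrow> pol_const (Poly_Mapping.lookup a i) \<odot>\<^bsub>N\<^esub> wact (letters i) m = \<zero>\<^bsub>N\<^esub>"
    using assms(3) by (auto simp: in_keys_iff const_simps)
qed (use assms in auto)

lemma faa_closed [simp]: "m \<in> carrier N \<Longrightarrow> faa a m \<in> carrier N"
  unfolding free_alg_action_def wact_def[symmetric] by (rule N.finsum_closed) auto

lemma faa_add_l:
  assumes m: "m \<in> carrier N"
  shows "faa (a + b) m = faa a m \<oplus>\<^bsub>N\<^esub> faa b m"
proof -
  let ?A = "Poly_Mapping.keys a \<union> Poly_Mapping.keys b"
  have fin: "finite ?A" by simp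
  show ?thesis
    unfolding faa_superset[OF fin Poly_Mapping.keys_add m] faa_superset[OF fin Un_upper1 m] faa_superset[OF fin Un_upper2 m]
    by (subst N.finsum_addf[symmetric]) (auto simp: m lookup_add const_simps N.cm_add_l)
qed

lemma faa_add_r: "m \<in> carrier N \<Longrightarrow> m' \<in> carrier N \<Longrightarrow> faa a (m \<oplus>\<^bsub>N\<^esub> m') = faa a m \<oplus>\<^bsub>N\<^esub> faa a m'"
  unfolding free_alg_action_def wact_def[symmetric]
  by (subst N.finsum_addf[symmetric]) (auto simp: wact_add N.cm_add_r)

lemma faa_zero_l [simp]: "faa 0 m = \<zero>\<^bsub>N\<^esub>"
  by (simp add: free_alg_action_def)

lemma faa_single:
  assumes "m \<in> carrier N"
  shows "faa (Poly_Mapping.single w c) m = pol_const c \<odot>\<^bsub>N\<^esub> wact (letters w) m"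
  using faa_superset[of "{w}" "Poly_Mapping.single w c" m] assms by simp

lemma faa_mult:
  assumes m: "m \<in> carrier N"
  shows "faa (a * b) m = faa a (faa b m)"
proof (induction a rule: free_alg_induct)
  case (add r s)
  then show ?case by (simp add: distrib_right faa_add_l m)
next
  case (single w c)
  show ?case
  proof (induction b rule: free_alg_induct)
    case zero
    show ?case using faa_add_r[of "\<zero>\<^bsub>N\<^esub>" "\<zero>\<^bsub>N\<^esub>" "Poly_Mapping.single w c"] by simp
  next
    case (add r s)
    then show ?case by (simp add: distrib_left faa_add_l faa_add_r m)
  next
    case (single v e)
    show ?case by (simp add: mult_single faa_single m plus_fword_def const_simps N.cm_mult wact_const)
  qed
qed simp

lemma faa_monomial: "m \<in> carrier N \<Longrightarrow> faa (free_monomial w) m = wact w m"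
  by (simp add: free_monomial_def faa_single const_simps)

lemma faa_one: "m \<in> carrier N \<Longrightarrow> faa 1 m = m"
  using faa_monomial[of m "[]"] by (simp add: free_monomial_def zero_fword_def[symmetric])

lemma faa_uminus:
  assumes m: "m \<in> carrier N"
  shows "faa (- a) m = \<ominus>\<^bsub>N\<^esub> faa a m"
  using N.minus_equality[of "faa (- a) m" "faa a m"] faa_add_l[OF m, of "- a" a] m by simp

text \<open>The elements of the free algebra that act as zero form a two-sided ideal, so only the
  defining relations have to be checked; the relation x_i^p F = F x_i is the p-linearity of
  \<psi>.\<close>

lemma faa_frob_ideal:
  assumes "a \<in> frob_ideal" "m \<in> carrier N"
  shows "faa a m = \<zero>\<^bsub>N\<^esub>"
proof -
  define A where "A = {a. \<forall>m\<in>carrier N. faa a m = \<zero>\<^bsub>N\<^esub>}"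
  have f0: "faa a \<zero>\<^bsub>N\<^esub> = \<zero>\<^bsub>N\<^esub>" for a using faa_mult[of "\<zero>\<^bsub>N\<^esub>" a 0] by simp
  have uminus: "\<ominus>\<^bsub>class_ring\<^esub> x = - x" for x :: "('p, 'n) free_alg"
    by (rule abelian_group.minus_equality[OF ring.is_abelian_group[OF class_ring.ring_axioms]]) simp_all
  have uminus': "inv\<^bsub>\<lparr>carrier = UNIV, mult = (+), one = 0\<rparr>\<^esub> x = - x" for x :: "('p, 'n) free_alg"
    using uminus[of x, unfolded a_inv_def] by simp
  have fd: "faa (a - b) m = faa a m \<oplus>\<^bsub>N\<^esub> \<ominus>\<^bsub>N\<^esub> faa b m" if "m \<in> carrier N" for a b m
    using faa_add_l[OF that, of a "- b"] faa_uminus[OF that, of b] by simp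
  have "ideal A class_ring"
  proof (rule idealI[OF class_ring.ring_axioms])
    show "subgroup A (add_monoid class_ring)"
      by (rule subgroup.intro) (auto simp: A_def faa_add_l faa_uminus uminus')
  qed (auto simp: A_def faa_mult f0)
  moreover have "frob_relations \<subseteq> A"
  proof
    fix r :: "('p, 'n) free_alg" assume "r \<in> frob_relations"
    then consider i j where "r = free_monomial [X i, X j] - free_monomial [X j, X i]"
      | i where "r = free_monomial (replicate CARD('p) (X i) @ [Fr]) - free_monomial [Fr, X i]"
      unfolding frob_relations_def by blast
    then show "r \<in> A"
    proof cases
      case 1
      have sw: "pol_var i \<odot>\<^bsub>N\<^esub> (pol_var j \<odot>\<^bsub>N\<^esub> x) = pol_var j \<odot>\<^bsub>N\<^esub> (pol_var i \<odot>\<^bsub>N\<^esub> x)" if "x \<in> carrier N" for x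
        unfolding N.cm_mult[OF that, symmetric] by (simp only: mult.commute)
      show ?thesis unfolding 1 by (simp add: A_def fd faa_monomial sw N.r_neg)
    next
      case 2
      have rep: "wact (replicate k (X i)) x = pol_var i ^ k \<odot>\<^bsub>N\<^esub> x" if "x \<in> carrier N" for k x
        by (induction k) (simp_all add: that N.cm_mult)
      show ?thesis unfolding 2 by (simp add: A_def fd faa_monomial rep \<psi>_smult \<psi>_closed N.r_neg)
    qed
  qed
  ultimately have "frob_ideal \<subseteq> A"
    unfolding frob_ideal_def by (rule ring.genideal_minimal[OF class_ring.ring_axioms])
  then show ?thesis using assms unfolding A_def by blast
qed

abbreviation FM :: "(('p, 'n) frob_op, 'm) module" where
  "FM \<equiv> frob_module_of N \<psi>"

lemma FM_simps [simp]: "carrier FM = carrier N" "\<zero>\<^bsub>FM\<^esub> = \<zero>\<^bsub>N\<^esub>" "x \<oplus>\<^bsub>FM\<^esub> y = x \<oplus>\<^bsub>N\<^esub> y"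
  by (simp_all add: frob_module_of_def)

lemma FM_smult:
  assumes m: "m \<in> carrier N"
  shows "frob_class a \<odot>\<^bsub>FM\<^esub> m = faa a m"
proof -
  have mem: "b \<in> frob_class a \<longleftrightarrow> b - a \<in> frob_ideal" for b :: "('p, 'n) free_alg"
  proof -
    have "frob_class a = {h + a | h. h \<in> frob_ideal}" unfolding frob_class_def a_r_coset_def r_coset_def by auto
    then show ?thesis by (auto intro!: exI[of _ "b - a"])
  qed
  have "a \<in> frob_class a" unfolding mem by (simp add: frob_ideal_closed)
  then have "(SOME b. b \<in> frob_class a) \<in> frob_class a" by (rule someI)
  then have d: "(SOME b. b \<in> frob_class a) - a \<in> frob_ideal" unfolding mem .
  have "faa (SOME b. b \<in> frob_class a) m = faa (((SOME b. b \<in> frob_class a) - a) + a) m" by simp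
  also have "\<dots> = faa a m" unfolding faa_add_l[OF m] faa_frob_ideal[OF d m] using m by simp
  finally show ?thesis by (simp add: frob_module_of_def)
qed

lemma left_module_FM: "left_module frob_ring FM"
proof (rule left_module.intro[OF ring_frob_ring])
  show "abelian_group FM"
  proof (rule abelian_groupI)
    show "\<exists>y\<in>carrier FM. y \<oplus>\<^bsub>FM\<^esub> x = \<zero>\<^bsub>FM\<^esub>" if "x \<in> carrier FM" for x
      using that by (intro bexI[of _ "\<ominus>\<^bsub>N\<^esub> x"]) (simp_all add: N.l_neg)
  qed (auto simp: N.a_assoc intro: N.a_comm)
  note hom = ring_hom_mult[OF frob_class_hom[where ?'p = 'p and ?'n = 'n], symmetric]
    ring_hom_add[OF frob_class_hom[where ?'p = 'p and ?'n = 'n], symmetric] ring_hom_one[OF frob_class_hom[where ?'p = 'p and ?'n = 'n], symmetric]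
  show "left_module_axioms frob_ring FM"
    by unfold_locales
      (auto simp: carrier_frob_ring hom[simplified] FM_smult faa_add_l faa_add_r faa_mult faa_one)
qed

sublocale F: frob_left_module FM
  by (rule frob_left_module.intro[OF left_module_FM])

lemma FM_act: "m \<in> carrier N \<Longrightarrow> F.act a m = faa a m"
  by (simp add: F.act_def FM_smult)

lemma FM_frob: "m \<in> carrier N \<Longrightarrow> F.frob m = \<psi> m"
  by (simp add: F.frob_def FM_act faa_monomial)

lemma FM_var: "m \<in> carrier N \<Longrightarrow> F.var j m = pol_var j \<odot>\<^bsub>N\<^esub> m"
  by (simp add: F.var_def FM_act faa_monomial)

lemma FM_mon:
  assumes m: "m \<in> carrier N"
  shows "F.mon a m = pol_mon a \<odot>\<^bsub>N\<^esub> m"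
proof (induction "weight a" arbitrary: a)
  case 0
  then have "a = (\<lambda>_. 0)" by (auto simp: weight_def)
  then show ?case using m F.mon_zero[of m] by simp
next
  case (Suc k)
  then have "weight a > 0" by simp
  then obtain j b where jb: "a = (\<lambda>i. unit_exp j i + b i)" "weight a = Suc (weight b)" by (rule exp_split_unit)
  have "F.mon a m = F.var j (F.mon b m)" using F.var_mon[of m j b] m jb(1) by simp
  also have "\<dots> = pol_var j \<odot>\<^bsub>N\<^esub> (pol_mon b \<odot>\<^bsub>N\<^esub> m)" using Suc jb m by (simp add: FM_var)
  also have "\<dots> = pol_mon a \<odot>\<^bsub>N\<^esub> m" using m by (simp add: jb(1) pol_mon_add pol_mon_unit N.cm_mult)
  finally show ?case .
qed

lemma FM_finsum: "f \<in> A \<rightarrow> carrier N \<Longrightarrow> finsum FM f A = finsum N f A"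
  by (induction A rule: infinite_finite_induct) (auto simp: Pi_def F.M.finsum_infinite N.finsum_infinite)

lemma FM_comb: "f \<in> digits CARD('p) \<rightarrow> carrier N \<Longrightarrow>
    F.comb f = (\<Oplus>\<^bsub>N\<^esub>c\<in>digits CARD('p). pol_mon c \<odot>\<^bsub>N\<^esub> \<psi> (f c))"
  unfolding F.comb_def
  by (subst FM_finsum) (auto intro!: N.finsum_cong' simp: FM_frob FM_mon \<psi>_closed Pi_iff)

lemma FM_pol_mem:
  assumes H: "H \<subseteq> carrier N" "\<zero>\<^bsub>N\<^esub> \<in> H" "\<And>x y. x \<in> H \<Longrightarrow> y \<in> H \<Longrightarrow> x \<oplus>\<^bsub>N\<^esub> y \<in> H"
    "\<And>j x. x \<in> H \<Longrightarrow> F.var j x \<in> H" and x: "x \<in> H"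
  shows "r \<odot>\<^bsub>N\<^esub> x \<in> H"
proof (induction r rule: pol_induct)
  case (add r s)
  then show ?case using H x by (auto simp: N.cm_add_l)
next
  case (single a c)
  have "pol_mon b \<odot>\<^bsub>N\<^esub> x \<in> H" for b
  proof (induction "weight b" arbitrary: b)
    case 0
    then have "b = (\<lambda>_. 0)" by (auto simp: weight_def)
    then show ?case using x H(1) by auto
  next
    case (Suc k)
    then have "weight b > 0" by simp
    then obtain j b' where jb: "b = (\<lambda>i. unit_exp j i + b' i)" "weight b = Suc (weight b')" by (rule exp_split_unit)
    have "F.var j (pol_mon b' \<odot>\<^bsub>N\<^esub> x) \<in> H" using Suc jb by (intro H(4)) simp
    then show ?case using x H(1) by (auto simp: jb(1) FM_var pol_mon_add pol_mon_unit N.cm_mult)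
  qed
  from F.const_mem[OF this, of c] show ?case
    using H x by (auto simp: single_eq_const_mon N.cm_mult FM_act faa_single zero_fword_def)
qed (use H x in auto)

end

section \<open>Torsion with respect to powers of an ideal\<close>

lemma ideals_set_simps:
  "\<one>\<^bsub>ideals_set R\<^esub> = carrier R" "I \<otimes>\<^bsub>ideals_set R\<^esub> J = ideal_prod R I J"
  by (simp_all add: ideals_set_def)

lemma power_mem_ideal_pow:
  "(a :: 'r::comm_ring_1) \<in> I \<Longrightarrow> a ^ k \<in> I [^]\<^bsub>ideals_set class_ring\<^esub> (k::nat)"
proof (induction k)
  case (Suc k)
  then show ?case using ideal_prod.prod[of "a ^ k" "I [^]\<^bsub>ideals_set class_ring\<^esub> k" a I class_ring]
    by (simp add: ideals_set_simps mult.commute)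
qed (simp add: ideals_set_simps)

text \<open>Pigeonhole on the multiplicities of the factors.\<close>

lemma long_product_divisible:
  fixes ls :: "'r::comm_ring_1 list"
  assumes "set ls \<subseteq> G" "finite G" "length ls > card G * q"
  shows "\<exists>g\<in>G. g ^ q dvd prod_list ls"
proof -
  have "\<exists>g\<in>G. count (mset ls) g \<ge> q"
  proof (rule ccontr)
    assume "\<not> ?thesis"
    then have "count (mset ls) g \<le> q" if "g \<in> G" for g using that by (auto simp: not_le intro: less_imp_le)
    then have "sum (count (mset ls)) (set ls) \<le> card (set ls) * q"
      using assms(1) by (intro order_trans[OF sum_bounded_above[of "set ls" "count (mset ls)" q]]) auto
    moreover have "length ls = sum (count (mset ls)) (set ls)"
      using size_multiset_overloaded_eq[of "mset ls"] by simp
    moreover have "card (set ls) * q \<le> card G * q" using card_mono[OF assms(2,1)] by simp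
    ultimately show False using assms(3) by linarith
  qed
  then obtain g where g: "g \<in> G" "count (mset ls) g \<ge> q" by blast
  then have "replicate_mset q g \<subseteq># mset ls" by (simp add: count_le_replicate_mset_subset_eq)
  then obtain M where "mset ls = replicate_mset q g + M" by (auto simp: mset_subset_eq_exists_conv)
  then have "prod_list ls = g ^ q * prod_mset M" by (simp flip: prod_mset_prod_list)
  then show ?thesis using g(1) dvd_triv_left by metis
qed

text \<open>A long product of generators contains the q-th power of one of them, so some power of I
  lies in the ideal generated by the q-th powers of the g l.\<close>

lemma torsion_by_generators:
  fixes E :: "('r::comm_ring_1, 'e) module"
  assumes E: "cmod E" and gen: "\<And>a. a \<in> I \<Longrightarrow> \<exists>c. a = (\<Sum>l<t::nat. c l * g l)"
    and x: "x \<in> carrier E" "\<And>l. l < t \<Longrightarrow> g l ^ q \<odot>\<^bsub>E\<^esub> x = \<zero>\<^bsub>E\<^esub>"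
  shows "\<exists>k::nat. \<forall>a \<in> I [^]\<^bsub>ideals_set class_ring\<^esub> k. a \<odot>\<^bsub>E\<^esub> x = \<zero>\<^bsub>E\<^esub>"
proof -
  interpret E: cmod E by fact
  let ?G = "g ` {..<t}"
  \<comment> \<open>Induction on k with y varying: one factor i from I is applied to y and expanded
    in the generators, and the remaining factors act on i y.\<close>
  have kill: "a \<odot>\<^bsub>E\<^esub> y = \<zero>\<^bsub>E\<^esub>" if "y \<in> carrier E"
    "\<And>ls. set ls \<subseteq> ?G \<Longrightarrow> length ls = k \<Longrightarrow> prod_list ls \<odot>\<^bsub>E\<^esub> y = \<zero>\<^bsub>E\<^esub>"
    "a \<in> I [^]\<^bsub>ideals_set class_ring\<^esub> k" for a y and k :: nat
    using that
  proof (induction k arbitrary: a y)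
    case 0
    then have "y = \<zero>\<^bsub>E\<^esub>" using 0(2)[of "[]"] by simp
    then show ?case by simp
  next
    case (Suc k)
    have "a \<in> ideal_prod class_ring (I [^]\<^bsub>ideals_set class_ring\<^esub> k) I" using Suc.prems(3) by (simp add: ideals_set_simps)
    then show ?case
    proof (induction a rule: ideal_prod.induct)
      case (prod b i)
      from gen[OF prod(2)] obtain c where c: "i = (\<Sum>l<t. c l * g l)" by blast
      have "b \<odot>\<^bsub>E\<^esub> (i \<odot>\<^bsub>E\<^esub> y) = \<zero>\<^bsub>E\<^esub>"
      proof (rule Suc.IH[OF _ _ prod(1)])
        show "i \<odot>\<^bsub>E\<^esub> y \<in> carrier E" using Suc.prems(1) by blast
        fix ls assume ls: "set ls \<subseteq> ?G" "length ls = k"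
        have "prod_list ls \<odot>\<^bsub>E\<^esub> (i \<odot>\<^bsub>E\<^esub> y) = (\<Sum>l<t. c l * prod_list (g l # ls)) \<odot>\<^bsub>E\<^esub> y"
          using Suc.prems(1) by (simp add: c sum_distrib_left mult_ac flip: E.cm_mult)
        also have "\<dots> = (\<Oplus>\<^bsub>E\<^esub>l\<in>{..<t}. c l \<odot>\<^bsub>E\<^esub> (prod_list (g l # ls) \<odot>\<^bsub>E\<^esub> y))"
          unfolding E.cm_sum[OF Suc.prems(1)] using Suc.prems(1) by (intro E.finsum_cong') (auto simp: E.cm_mult)
        also have "\<dots> = (\<Oplus>\<^bsub>E\<^esub>l\<in>{..<t}. \<zero>\<^bsub>E\<^esub>)"
        proof (rule E.finsum_cong')
          fix l assume "l \<in> {..<t}"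
          then have "prod_list (g l # ls) \<odot>\<^bsub>E\<^esub> y = \<zero>\<^bsub>E\<^esub>" using ls by (intro Suc.prems(2)) auto
          then show "c l \<odot>\<^bsub>E\<^esub> (prod_list (g l # ls) \<odot>\<^bsub>E\<^esub> y) = \<zero>\<^bsub>E\<^esub>" by (simp only: E.cm_zero_r)
        qed auto
        finally show "prod_list ls \<odot>\<^bsub>E\<^esub> (i \<odot>\<^bsub>E\<^esub> y) = \<zero>\<^bsub>E\<^esub>" by simp
      qed
      then show ?case using Suc.prems(1) by (simp add: E.cm_mult)
    next
      case (sum s1 s2)
      then show ?case using Suc.prems(1) by (simp add: E.cm_add_l)
    qed
  qed
  have "prod_list ls \<odot>\<^bsub>E\<^esub> x = \<zero>\<^bsub>E\<^esub>" if "set ls \<subseteq> ?G" "length ls = Suc (card ?G * q)" for ls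
  proof -
    have "\<exists>h\<in>?G. h ^ q dvd prod_list ls" by (rule long_product_divisible) (use that in auto)
    then obtain h where h: "h \<in> ?G" "h ^ q dvd prod_list ls" by blast
    then obtain b where "prod_list ls = b * h ^ q" by (auto simp: dvd_def mult.commute)
    then show ?thesis using h(1) x by (auto simp: E.cm_mult)
  qed
  then show ?thesis using kill[OF x(1)] by blast
qed

section \<open>Local cohomology\<close>

context frob_resolution
begin

lemma ann_closed: "\<zero>\<^bsub>E j\<^esub> \<in> ann J j" "x \<in> ann J j \<Longrightarrow> y \<in> ann J j \<Longrightarrow> x \<oplus>\<^bsub>E j\<^esub> y \<in> ann J j"
  "x \<in> ann J j \<Longrightarrow> r \<odot>\<^bsub>E j\<^esub> x \<in> ann J j" "ann J j \<subseteq> carrier (E j)"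
proof -
  show "r \<odot>\<^bsub>E j\<^esub> x \<in> ann J j" if x: "x \<in> ann J j"
  proof -
    have "a \<odot>\<^bsub>E j\<^esub> (r \<odot>\<^bsub>E j\<^esub> x) = \<zero>\<^bsub>E j\<^esub>" if "a \<in> J" for a
    proof -
      have "a \<odot>\<^bsub>E j\<^esub> (r \<odot>\<^bsub>E j\<^esub> x) = r \<odot>\<^bsub>E j\<^esub> (a \<odot>\<^bsub>E j\<^esub> x)"
        using x by (simp add: ann_def mult.commute flip: E.cm_mult)
      then show ?thesis using x that by (simp add: ann_def)
    qed
    then show ?thesis using x by (simp add: ann_def)
  qed
qed (auto simp: ann_def E.cm_add_r)

lemma Z_closed: "\<zero>\<^bsub>E j\<^esub> \<in> Z J j" "x \<in> Z J j \<Longrightarrow> y \<in> Z J j \<Longrightarrow> x \<oplus>\<^bsub>E j\<^esub> y \<in> Z J j"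
  "x \<in> Z J j \<Longrightarrow> r \<odot>\<^bsub>E j\<^esub> x \<in> Z J j" "Z J j \<subseteq> carrier (E j)"
  using ann_closed[where j = j and J = J] by (auto simp: Z_def d_add d_smult subset_iff)

lemma B_closed: "\<zero>\<^bsub>E j\<^esub> \<in> B J j" "x \<in> B J j \<Longrightarrow> y \<in> B J j \<Longrightarrow> x \<oplus>\<^bsub>E j\<^esub> y \<in> B J j"
  "x \<in> B J j \<Longrightarrow> r \<odot>\<^bsub>E j\<^esub> x \<in> B J j" "B J j \<subseteq> Z J j"
proof -
  show "\<zero>\<^bsub>E j\<^esub> \<in> B J j"
    using ann_closed(1)[of "j - 1" J] by (cases j) (auto simp: B_def simp flip: d_zero)
  show "B J j \<subseteq> Z J j"
    using ann_hom[OF d_hom] ann_closed(4) Z_closed(1)[of 0] by (cases j) (auto simp: B_def Z_def d_d subset_iff)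
  show "x \<oplus>\<^bsub>E j\<^esub> y \<in> B J j" if xy: "x \<in> B J j" "y \<in> B J j"
  proof (cases j)
    case (Suc k)
    then obtain u v where uv: "u \<in> ann J k" "v \<in> ann J k" "x = d k u" "y = d k v" using xy by (auto simp: B_def)
    have "d k (u \<oplus>\<^bsub>E k\<^esub> v) = x \<oplus>\<^bsub>E j\<^esub> y" unfolding uv(3,4) Suc using uv(1,2) ann_closed(4)[of J k] by (intro d_add) auto
    then show ?thesis using imageI[OF ann_closed(2)[OF uv(1,2)], of "d k"] by (simp add: B_def Suc)
  qed (use xy in \<open>auto simp: B_def\<close>)
  show "r \<odot>\<^bsub>E j\<^esub> x \<in> B J j" if x: "x \<in> B J j"
  proof (cases j)
    case (Suc k)
    then obtain u where u: "u \<in> ann J k" "x = d k u" using x by (auto simp: B_def)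
    have "d k (r \<odot>\<^bsub>E k\<^esub> u) = r \<odot>\<^bsub>E j\<^esub> x" unfolding u(2) Suc using u(1) ann_closed(4)[of J k] by (intro d_smult) auto
    then show ?thesis using imageI[OF ann_closed(3)[OF u(1), of r], of "d k"] by (simp add: B_def Suc)
  qed (use x in \<open>auto simp: B_def\<close>)
qed

lemma \<phi>_ann: "x \<in> ann J j \<Longrightarrow> \<phi> j x \<in> ann (frob_image J) j"
  by (auto simp: ann_def frob_image_def \<phi>_closed simp flip: \<phi>_smult)

lemma \<phi>_Z: "x \<in> Z J j \<Longrightarrow> \<phi> j x \<in> Z (frob_image J) j"
  using \<phi>_ann[of x J j] ann_closed(4) by (auto simp: Z_def subset_iff simp flip: \<phi>_d)

lemma \<phi>_B: "x \<in> B J j \<Longrightarrow> \<phi> j x \<in> B (frob_image J) j"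
  using \<phi>_ann[of _ J "j - 1"] ann_closed(4)[of J "j - 1"] by (cases j) (auto simp: B_def \<phi>_d subset_iff)

end

section \<open>Local cohomology as a module with Frobenius action\<close>

locale local_cohomology_action = frob_resolution E d \<epsilon> \<phi>
  for E :: "nat \<Rightarrow> (('p::prime_card, 'n::finite) pol, 'e) module" and d \<epsilon> \<phi> +
  fixes I :: "('p, 'n) pol set" and i :: nat
  assumes I: "ideal I pol_ring"
begin

lemma I_closed: "0 \<in> I" "a \<in> I \<Longrightarrow> b \<in> I \<Longrightarrow> a + b \<in> I" "a \<in> I \<Longrightarrow> r * a \<in> I"
  using additive_subgroup.zero_closed[OF ideal.axioms(1)[OF I]] additive_subgroup.a_closed[OF ideal.axioms(1)[OF I], of a b]
    ideal.I_l_closed[OF I, of a r] by simp_all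

text \<open>The powers of \<open>I\<close> are cofinal with its Frobenius powers, for which torsion is easier to follow.\<close>

definition Ie :: "nat \<Rightarrow> ('p, 'n) pol set" where
  "Ie e = (\<lambda>a. a ^ (CARD('p) ^ e)) ` I"

lemma Ie_0: "Ie 0 = I"
  by (simp add: Ie_def)

lemma Ie_Suc: "Ie (Suc e) = frob_image (Ie e)"
  by (auto simp: Ie_def frob_image_def image_image power_mult mult.commute[of "CARD('p)"])

text \<open>The ideal I as a submodule of R^1, the form in which \<open>free_submodule_fg\<close>
  and \<open>ext_fg\<close> apply to it.\<close>

definition K1 :: "(nat \<Rightarrow> ('p, 'n) pol) set" where
  "K1 = {f. f 0 \<in> I \<and> (\<forall>j\<ge>1. f j = 0)}"

lemma free_K1: "free_submodule 1 K1"
  unfolding free_submodule_def K1_def using I_closed by auto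

lemma ann_mono: "ann (Ie e) j \<subseteq> ann (Ie (Suc e)) j"
proof
  fix x assume x: "x \<in> ann (Ie e) j"
  have "a ^ (CARD('p) ^ Suc e) \<odot>\<^bsub>E j\<^esub> x = \<zero>\<^bsub>E j\<^esub>" if "a \<in> I" for a
  proof -
    have "CARD('p) ^ e \<le> CARD('p) ^ Suc e" by simp
    then have "a ^ (CARD('p) ^ Suc e) = a ^ (CARD('p) ^ Suc e - CARD('p) ^ e) * a ^ (CARD('p) ^ e)"
      by (simp only: flip: power_add) simp
    then show ?thesis using x that by (simp add: ann_def Ie_def E.cm_mult)
  qed
  then show "x \<in> ann (Ie (Suc e)) j" using x by (auto simp: ann_def Ie_def)
qed

lemma ann_le: "e \<le> e' \<Longrightarrow> ann (Ie e) j \<subseteq> ann (Ie e') j"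
  by (rule lift_Suc_mono_le[of "\<lambda>e. ann (Ie e) j"]) (rule ann_mono)

lemma Z_le: "e \<le> e' \<Longrightarrow> Z (Ie e) j \<subseteq> Z (Ie e') j"
  using ann_le[of e e' j] by (auto simp: Z_def)

lemma B_le: "e \<le> e' \<Longrightarrow> B (Ie e) j \<subseteq> B (Ie e') j"
  using ann_le[of e e' "j - 1"] by (cases j) (auto simp: B_def)

text \<open>One inclusion uses k <= p^k. The other uses that I is finitely generated, so that a
  large power of I lies in the ideal generated by the p^e-th powers.\<close>

lemma torsion_eq: "torsion_part pol_ring I (E j) = (\<Union>e. ann (Ie e) j)"
proof (intro equalityI subsetI)
  fix x assume "x \<in> torsion_part pol_ring I (E j)"
  then obtain k :: nat where x: "x \<in> carrier (E j)" "\<And>a. a \<in> I [^]\<^bsub>ideals_set pol_ring\<^esub> k \<Longrightarrow> a \<odot>\<^bsub>E j\<^esub> x = \<zero>\<^bsub>E j\<^esub>"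
    by (auto simp: torsion_part_def)
  have "a ^ (CARD('p) ^ k) \<odot>\<^bsub>E j\<^esub> x = \<zero>\<^bsub>E j\<^esub>" if "a \<in> I" for a
  proof -
    have "k \<le> CARD('p) ^ k"
      using power_gt_expt[of "CARD('p)" k] prime_card[where 'a = 'p, THEN prime_gt_1_nat] by simp
    then have "a ^ (CARD('p) ^ k) = a ^ (CARD('p) ^ k - k) * a ^ k" by (simp flip: power_add)
    then show ?thesis using x power_mem_ideal_pow[OF that, of k] by (simp add: E.cm_mult)
  qed
  then show "x \<in> (\<Union>e. ann (Ie e) j)" using x(1) by (auto simp: ann_def Ie_def)
next
  fix x assume "x \<in> (\<Union>e. ann (Ie e) j)"
  then obtain e where x: "x \<in> carrier (E j)" "\<And>a. a \<in> I \<Longrightarrow> a ^ (CARD('p) ^ e) \<odot>\<^bsub>E j\<^esub> x = \<zero>\<^bsub>E j\<^esub>"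
    by (auto simp: ann_def Ie_def)
  from free_submodule_fg[OF free_K1] obtain t :: nat and g where
    g: "\<And>l. l < t \<Longrightarrow> g l \<in> K1" "\<And>f. f \<in> K1 \<Longrightarrow> \<exists>a. f = (\<lambda>j. \<Sum>l<t. a l * g l j)" by blast
  have "\<exists>k::nat. \<forall>a \<in> I [^]\<^bsub>ideals_set pol_ring\<^esub> k. a \<odot>\<^bsub>E j\<^esub> x = \<zero>\<^bsub>E j\<^esub>"
  proof (rule torsion_by_generators[OF E_cmod _ x(1)])
    fix a assume a: "a \<in> I"
    have "(\<lambda>j. if j = 0 then a else 0) \<in> K1" using a by (simp add: K1_def)
    from g(2)[OF this] obtain c where c: "(\<lambda>j. if j = 0 then a else 0) = (\<lambda>j. \<Sum>l<t. c l * g l j)" by blast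
    show "\<exists>c. a = (\<Sum>l<t. c l * g l 0)" using fun_cong[OF c, of 0] by auto
  next
    show "g l 0 ^ (CARD('p) ^ e) \<odot>\<^bsub>E j\<^esub> x = \<zero>\<^bsub>E j\<^esub>" if "l < t" for l
      using g(1)[OF that] by (intro x(2)) (simp add: K1_def)
  qed
  then show "x \<in> torsion_part pol_ring I (E j)" using x(1) by (simp add: torsion_part_def)
qed

definition ZT :: "'e set" where "ZT = lc_cocycles pol_ring I E d i"
definition BT :: "'e set" where "BT = lc_coboundaries pol_ring I E d i"

lemma ZT_eq: "ZT = (\<Union>e. Z (Ie e) i)"
  by (auto simp: ZT_def lc_cocycles_def torsion_eq Z_def)

lemma BT_eq: "BT = (\<Union>e. B (Ie e) i)"
  unfolding BT_def lc_coboundaries_def torsion_eq B_def by (cases i) auto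

lemma ZT_closed: "\<zero>\<^bsub>E i\<^esub> \<in> ZT" "x \<in> ZT \<Longrightarrow> y \<in> ZT \<Longrightarrow> x \<oplus>\<^bsub>E i\<^esub> y \<in> ZT"
  "x \<in> ZT \<Longrightarrow> r \<odot>\<^bsub>E i\<^esub> x \<in> ZT" "ZT \<subseteq> carrier (E i)"
proof -
  show "x \<oplus>\<^bsub>E i\<^esub> y \<in> ZT" if xy: "x \<in> ZT" "y \<in> ZT"
  proof -
    obtain e e' where "x \<in> Z (Ie e) i" "y \<in> Z (Ie e') i" using xy by (auto simp: ZT_eq)
    then have "x \<in> Z (Ie (max e e')) i" "y \<in> Z (Ie (max e e')) i"
      using Z_le[of e "max e e'" i] Z_le[of e' "max e e'" i] by auto
    then show ?thesis using Z_closed(2) unfolding ZT_eq by blast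
  qed
  show "r \<odot>\<^bsub>E i\<^esub> x \<in> ZT" if "x \<in> ZT" using that Z_closed(3) unfolding ZT_eq by blast
  show "ZT \<subseteq> carrier (E i)" using Z_closed(4) unfolding ZT_eq by blast
qed (use Z_closed(1) in \<open>auto simp: ZT_eq\<close>)

lemma BT_closed: "\<zero>\<^bsub>E i\<^esub> \<in> BT" "x \<in> BT \<Longrightarrow> y \<in> BT \<Longrightarrow> x \<oplus>\<^bsub>E i\<^esub> y \<in> BT"
  "x \<in> BT \<Longrightarrow> r \<odot>\<^bsub>E i\<^esub> x \<in> BT" "BT \<subseteq> ZT"
proof -
  show "x \<oplus>\<^bsub>E i\<^esub> y \<in> BT" if xy: "x \<in> BT" "y \<in> BT"
  proof -
    obtain e e' where "x \<in> B (Ie e) i" "y \<in> B (Ie e') i" using xy by (auto simp: BT_eq)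
    then have "x \<in> B (Ie (max e e')) i" "y \<in> B (Ie (max e e')) i"
      using B_le[of e "max e e'" i] B_le[of e' "max e e'" i] by auto
    then show ?thesis using B_closed(2) unfolding BT_eq by blast
  qed
  show "BT \<subseteq> ZT" using B_closed(4) unfolding BT_eq ZT_eq by blast
  show "r \<odot>\<^bsub>E i\<^esub> x \<in> BT" if "x \<in> BT" using that B_closed(3) unfolding BT_eq by blast
qed (use B_closed(1) in \<open>auto simp: BT_eq\<close>)

lemma ZTc [simp]: "x \<in> ZT \<Longrightarrow> x \<in> carrier (E i)"
  using ZT_closed(4) by blast

lemma \<phi>_ZT: "x \<in> ZT \<Longrightarrow> \<phi> i x \<in> ZT" and \<phi>_BT: "x \<in> BT \<Longrightarrow> \<phi> i x \<in> BT"
  using \<phi>_Z[of x "Ie e" i for e] \<phi>_B[of x "Ie e" i for e] unfolding ZT_eq BT_eq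
  by (auto simp flip: Ie_Suc)

abbreviation MD :: "(('p, 'n) pol, 'e) module" where "MD \<equiv> (E i)\<lparr>carrier := ZT\<rparr>"

lemma cmod_MD: "cmod MD"
  by (rule cmod_submodule[OF E_cmod]) (rule E.cm_submoduleI; use ZT_closed in blast)

sublocale MD: cmod MD by (rule cmod_MD)

sublocale Q: module_with_submodule class_ring MD BT
proof (intro module_with_submodule.intro module_with_submodule_axioms.intro MD.is_mod MD.cm_submoduleI)
qed (use BT_closed in auto)

abbreviation N :: "(('p, 'n) pol, 'e set) module" where
  "N \<equiv> local_cohomology pol_ring I E d i"

lemma N_eq: "N = quotient_module MD BT"
  by (simp add: local_cohomology_def ZT_def BT_def)

definition cls :: "'e \<Rightarrow> 'e set" where
  "cls x = BT +>\<^bsub>E i\<^esub> x"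

lemma cls_MD: "BT +>\<^bsub>MD\<^esub> x = cls x"
  by (simp add: cls_def a_r_coset_def r_coset_def)

lemma N_simps: "carrier N = cls ` ZT" "\<zero>\<^bsub>N\<^esub> = cls \<zero>\<^bsub>E i\<^esub>"
  "x \<in> ZT \<Longrightarrow> y \<in> ZT \<Longrightarrow> cls x \<oplus>\<^bsub>N\<^esub> cls y = cls (x \<oplus>\<^bsub>E i\<^esub> y)"
  "x \<in> ZT \<Longrightarrow> r \<odot>\<^bsub>N\<^esub> cls x = cls (r \<odot>\<^bsub>E i\<^esub> x)"
  using Q.quotient_carrier Q.quotient_zero Q.quotient_add[of x y] Q.quotient_smult[of r x] unfolding N_eq cls_MD by simp_all

lemma BT_subgroup: "subgroup BT (add_monoid MD)"
  using Module.submodule.axioms(1)[OF Q.N] .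

lemma MD_diff: "x \<in> ZT \<Longrightarrow> y \<in> ZT \<Longrightarrow> x \<ominus>\<^bsub>MD\<^esub> y = x \<ominus>\<^bsub>E i\<^esub> y"
  using MD.cm_uminus[of y] E.cm_uminus[of y i] by (simp add: a_minus_def)

lemma cls_eq_iff: "x \<in> ZT \<Longrightarrow> y \<in> ZT \<Longrightarrow> cls x = cls y \<longleftrightarrow> x \<ominus>\<^bsub>E i\<^esub> y \<in> BT"
  using MD.coset_eq_iff[OF BT_subgroup, of x y] by (simp add: cls_MD MD_diff)

lemma ZT_diff: "x \<in> ZT \<Longrightarrow> y \<in> ZT \<Longrightarrow> x \<ominus>\<^bsub>E i\<^esub> y \<in> ZT"
  using ZT_closed(2)[of x "(- 1) \<odot>\<^bsub>E i\<^esub> y"] ZT_closed(3)[of y "- 1"] by (simp add: E.cm_uminus a_minus_def)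

lemma cls_add_BT:
  assumes "x \<in> ZT" "b \<in> BT"
  shows "cls (x \<oplus>\<^bsub>E i\<^esub> b) = cls x"
proof -
  have b: "b \<in> ZT" using assms BT_closed(4) by blast
  have "(x \<oplus>\<^bsub>E i\<^esub> b) \<ominus>\<^bsub>E i\<^esub> x = b"
    using assms b by (simp add: a_minus_def E.a_ac E.r_neg)
  then show ?thesis using assms b by (subst cls_eq_iff) (auto intro: ZT_closed(2))
qed

abbreviation \<psi> :: "'e set \<Rightarrow> 'e set" where
  "\<psi> \<equiv> lc_frobenius E d \<phi> I i"

lemma \<psi>_cls:
  assumes x: "x \<in> ZT"
  shows "\<psi> (cls x) = cls (\<phi> i x)"
proof -
  have "\<psi> (cls x) = (\<Union>x'\<in>cls x. cls (\<phi> i x'))" by (simp add: lc_frobenius_def cls_def BT_def)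
  moreover have "cls (\<phi> i x') = cls (\<phi> i x)" if "x' \<in> cls x" for x'
  proof -
    from that obtain b where b: "b \<in> BT" "x' = b \<oplus>\<^bsub>E i\<^esub> x" by (auto simp: cls_def a_r_coset_def')
    have "b \<in> carrier (E i)" using b(1) BT_closed(4) by auto
    then have "\<phi> i x' = \<phi> i x \<oplus>\<^bsub>E i\<^esub> \<phi> i b" using x by (simp add: b(2) \<phi>_add E.a_comm \<phi>_closed)
    then show ?thesis using cls_add_BT[OF \<phi>_ZT[OF x] \<phi>_BT[OF b(1)]] by simp
  qed
  moreover have "x \<in> cls x" using MD.mem_coset_self[OF BT_subgroup, of x] x by (simp add: cls_MD)
  ultimately show ?thesis by blast
qed

sublocale A: frob_action N \<psi>
proof (intro frob_action.intro frob_action_axioms.intro)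
  show "cmod N" unfolding N_eq by (rule cmod.intro[OF Q.quotient_module])
  show "\<psi> C \<in> carrier N" if "C \<in> carrier N" for C using that by (auto simp: N_simps(1) \<psi>_cls \<phi>_ZT)
  show "\<psi> (C \<oplus>\<^bsub>N\<^esub> C') = \<psi> C \<oplus>\<^bsub>N\<^esub> \<psi> C'" if "C \<in> carrier N" "C' \<in> carrier N" for C C'
    using that by (auto simp: N_simps(1,3) \<psi>_cls \<phi>_ZT ZT_closed(2) \<phi>_add)
  show "\<psi> (r \<odot>\<^bsub>N\<^esub> C) = r ^ CARD('p) \<odot>\<^bsub>N\<^esub> \<psi> C" if "C \<in> carrier N" for r C
    using that by (auto simp: N_simps(1,4) \<psi>_cls \<phi>_ZT ZT_closed(3) \<phi>_smult)
qed

lemma cls_finsum: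
  "f \<in> A \<rightarrow> ZT \<Longrightarrow> finsum (E i) f A \<in> ZT \<and> finsum N (\<lambda>a. cls (f a)) A = cls (finsum (E i) f A)"
proof (induction A rule: infinite_finite_induct)
  case (insert x F)
  then have f: "f x \<in> ZT" "f \<in> F \<rightarrow> ZT" "f \<in> F \<rightarrow> carrier (E i)" "(\<lambda>a. cls (f a)) \<in> F \<rightarrow> carrier N" "cls (f x) \<in> carrier N"
    by (auto simp: N_simps(1) Pi_iff)
  then show ?case using insert.hyps insert.IH f by (simp add: N_simps(3) ZT_closed(2))
qed (auto simp: A.N.finsum_infinite E.finsum_infinite ZT_closed(1) N_simps(2))

text \<open>The counterpart of \<open>comb\<close> on cocycles, where, unlike on classes, the level
  e of a coboundary can be followed.\<close>

definition tot :: "(('n \<Rightarrow> nat) \<Rightarrow> 'e) \<Rightarrow> 'e" where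
  "tot y = (\<Oplus>\<^bsub>E i\<^esub>c\<in>digits CARD('p). pol_mon c \<odot>\<^bsub>E i\<^esub> \<phi> i (y c))"

lemma comb_cls:
  assumes y: "\<And>c. c \<in> digits CARD('p) \<Longrightarrow> y c \<in> ZT" and f: "\<And>c. c \<in> digits CARD('p) \<Longrightarrow> f c = cls (y c)"
  shows "A.F.comb f = cls (tot y)" "tot y \<in> ZT"
proof -
  have Zt: "(\<lambda>c. pol_mon c \<odot>\<^bsub>E i\<^esub> \<phi> i (y c)) \<in> digits CARD('p) \<rightarrow> ZT"
    using y by (auto intro: ZT_closed(3) \<phi>_ZT)
  have fc: "f \<in> digits CARD('p) \<rightarrow> carrier N" using y f by (auto simp: N_simps(1))
  have "A.F.comb f = (\<Oplus>\<^bsub>N\<^esub>c\<in>digits CARD('p). cls (pol_mon c \<odot>\<^bsub>E i\<^esub> \<phi> i (y c)))"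
    unfolding A.FM_comb[OF fc]
    by (rule A.N.finsum_cong') (use y f Zt in \<open>auto simp: \<psi>_cls N_simps(1,4) \<phi>_ZT\<close>)
  then show "A.F.comb f = cls (tot y)" "tot y \<in> ZT" using cls_finsum[OF Zt] by (simp_all add: tot_def)
qed

lemma \<Theta>_tot:
  assumes "u \<in> carrier (coind (E i))"
  shows "\<Theta> i u = tot (\<lambda>c. u (pol_mon (codigit CARD('p) c)))"
proof -
  let ?D = "digits CARD('p) :: ('n \<Rightarrow> nat) set" and ?c = "codigit CARD('p)"
  let ?g = "\<lambda>c. pol_mon c \<odot>\<^bsub>E i\<^esub> \<phi> i (u (pol_mon (?c c)))"
  have img: "?c ` ?D = ?D"
    using codigit_codigit[of _ "CARD('p)"] digits_pos(2)[where 'p = 'p] by (metis (no_types, lifting) image_eqI image_subset_iff subsetI subset_antisym)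
  have inj: "inj_on ?c ?D" by (rule inj_on_inverseI[of _ ?c]) (rule codigit_codigit)
  have "tot (\<lambda>c. u (pol_mon (?c c))) = finsum (E i) ?g (?c ` ?D)" unfolding img tot_def ..
  also have "\<dots> = (\<Oplus>\<^bsub>E i\<^esub>c\<in>?D. ?g (?c c))"
    by (rule E.add.finprod_reindex[OF \<Theta>_term[OF assms] inj])
  also have "\<dots> = \<Theta> i u"
    unfolding \<Theta>_def by (rule E.finsum_cong') (auto simp: codigit_codigit \<phi>_closed coindD(1)[OF assms])
  finally show ?thesis ..
qed

text \<open>Linear maps respect annihilators, so h z is killed by the p-th powers of J, and by
  \<open>coind_ann\<close> its values are killed by J: one Frobenius power is gained.\<close>

lemma coind_Z:
  assumes h: "h \<in> hom_set (E j) (coind (E j))" and z: "z \<in> ann (frob_image J) j"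
  shows "h z r \<in> ann J j"
proof -
  have zc: "z \<in> carrier (E j)" using z by (simp add: ann_def)
  have "\<forall>a\<in>frob_image J. a \<odot>\<^bsub>coind (E j)\<^esub> h z = \<zero>\<^bsub>coind (E j)\<^esub>"
    using z hom_set_zero[OF E_cmod coind_cmod h] by (auto simp: ann_def simp flip: hom_setD(3)[OF h])
  then show ?thesis using coind_ann[OF hom_setD(1)[OF h zc], of J] by blast
qed

lemma tot_add:
  assumes "\<And>c. c \<in> digits CARD('p) \<Longrightarrow> y c \<in> ZT" "\<And>c. c \<in> digits CARD('p) \<Longrightarrow> y' c \<in> ZT"
  shows "tot (\<lambda>c. y c \<oplus>\<^bsub>E i\<^esub> y' c) = tot y \<oplus>\<^bsub>E i\<^esub> tot y'"
proof -
  have t: "(\<lambda>c. pol_mon c \<odot>\<^bsub>E i\<^esub> \<phi> i (y c)) \<in> digits CARD('p) \<rightarrow> carrier (E i)"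
    "(\<lambda>c. pol_mon c \<odot>\<^bsub>E i\<^esub> \<phi> i (y' c)) \<in> digits CARD('p) \<rightarrow> carrier (E i)"
    using assms by (auto simp: \<phi>_closed)
  show ?thesis
    unfolding tot_def E.finsum_addf[OF t, symmetric]
    by (rule E.finsum_cong') (use assms in \<open>auto simp: \<phi>_add \<phi>_closed E.cm_add_r\<close>)
qed

theorem F_holonomic_local_cohomology: "F_holonomic (local_cohomology_frob I E d \<phi> i)"
proof -
  let ?D = "digits CARD('p) :: ('n \<Rightarrow> nat) set" and ?c = "codigit CARD('p)"
  from frobenius_comparison obtain \<chi> where
    x1: "\<forall>j. \<chi> j \<in> hom_set (E j) (coind (E j))" and
    x2: "\<forall>j. \<forall>x\<in>carrier (E j). \<chi> (Suc j) (d j x) = dd j (\<chi> j x)" and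
    x3: "\<forall>J j. \<forall>z\<in>Z J j. \<exists>w\<in>B J j. \<Theta> j (\<chi> j z) = z \<oplus>\<^bsub>E j\<^esub> w" and
    x4: "\<forall>J j. \<forall>u\<in>carrier (coind (E j)). (\<forall>r. u r \<in> Z J j) \<longrightarrow>
        (\<exists>v. \<forall>r. v r \<in> B J j \<and> \<chi> j (\<Theta> j u) r = u r \<oplus>\<^bsub>E j\<^esub> v r)"
    by (elim exE conjE) (rule that)
  note \<chi> = x1[rule_format] x2[rule_format] x3[rule_format] x4[rule_format]
  have \<chi>0: "\<chi> j \<zero>\<^bsub>E j\<^esub> = (\<lambda>_. \<zero>\<^bsub>E j\<^esub>)" for j
    using hom_set_zero[OF E_cmod coind_cmod \<chi>(1)] by (simp add: coind_simps)
  \<comment> \<open>A cocycle z of level e + 1 is cohomologous to \<Theta> (\<chi> z), and \<chi> z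
    takes values of level e.\<close>
  have step: "\<exists>u\<in>carrier (coind (E i)). (\<forall>r. u r \<in> Z (Ie e) i) \<and> cls z = cls (\<Theta> i u)"
    if z: "z \<in> Z (Ie (Suc e)) i" for z e
  proof (intro bexI conjI allI)
    have za: "z \<in> ann (frob_image (Ie e)) i" and zc: "z \<in> carrier (E i)" and zd: "d i z = \<zero>\<^bsub>E (Suc i)\<^esub>"
      using z by (auto simp: Z_def ann_def Ie_Suc)
    show "\<chi> i z \<in> carrier (coind (E i))" by (rule hom_setD(1)[OF \<chi>(1) zc])
    show "\<chi> i z r \<in> Z (Ie e) i" for r
      using coind_Z[OF \<chi>(1) za, of r] fun_cong[OF \<chi>(2)[OF zc], of r] by (simp add: Z_def zd \<chi>0 dd_def)
    obtain w where w: "w \<in> B (Ie (Suc e)) i" "\<Theta> i (\<chi> i z) = z \<oplus>\<^bsub>E i\<^esub> w" using \<chi>(3)[OF z] by blast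
    have "z \<in> ZT" "w \<in> BT" using z w(1) unfolding ZT_eq BT_eq by blast+
    then show "cls z = cls (\<Theta> i (\<chi> i z))" unfolding w(2) by (simp add: cls_add_BT)
  qed
  have comb_\<Theta>: "A.F.comb (\<lambda>c. cls (u (pol_mon (?c c)))) = cls (\<Theta> i u)"
    if "u \<in> carrier (coind (E i))" "\<And>r. u r \<in> ZT" for u
    unfolding \<Theta>_tot[OF that(1)] by (rule comb_cls(1)) (use that(2) in auto)
  have decomp: "\<exists>f\<in>?D \<rightarrow> carrier A.FM. m = A.F.comb f" if m: "m \<in> carrier A.FM" for m
  proof -
    obtain z e where z: "m = cls z" "z \<in> Z (Ie e) i" using m by (auto simp: N_simps(1) ZT_eq)
    \<comment> \<open>The level is raised by one so that \<open>step\<close> applies even for e = 0;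
      the values it yields then have the original level.\<close>
    have "z \<in> Z (Ie (Suc e)) i" using z(2) Z_le[of e "Suc e" i] by auto
    from step[OF this] obtain u where u: "u \<in> carrier (coind (E i))" "\<And>r. u r \<in> Z (Ie e) i" "m = cls (\<Theta> i u)"
      using z(1) by blast
    have uZ: "u r \<in> ZT" for r using u(2) by (auto simp: ZT_eq)
    show ?thesis
      by (rule bexI[of _ "\<lambda>c. cls (u (pol_mon (?c c)))"]) (use comb_\<Theta>[OF u(1) uZ] u(3) uZ in \<open>auto simp: N_simps(1)\<close>)
  qed
  have \<chi>B: "\<chi> j w r \<in> B J j" if w: "w \<in> B (frob_image J) j" for j w J r
  proof (cases j)
    case 0
    then show ?thesis using w \<chi>0[of 0] by (simp add: B_def)
  next
    case (Suc k)
    then obtain x where x: "x \<in> ann (frob_image J) k" "w = d k x" using w by (auto simp: B_def)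
    have "x \<in> carrier (E k)" using x(1) by (simp add: ann_def)
    then have "\<chi> j w r = d k (\<chi> k x r)" unfolding Suc x(2) by (simp add: \<chi>(2) dd_def)
    then show ?thesis using coind_Z[OF \<chi>(1) x(1), of r] by (simp add: B_def Suc)
  qed
  \<comment> \<open>Let the combination of the differences be a coboundary. Its image under \<chi>
    has coboundaries as values, and up to coboundaries it is the function built from the
    differences; so each difference is a coboundary.\<close>
  have unique: "f b = g b"
    if f: "f \<in> ?D \<rightarrow> carrier A.FM" and g: "g \<in> ?D \<rightarrow> carrier A.FM" and eq: "A.F.comb f = A.F.comb g" and b: "b \<in> ?D" for f g b
  proof -
    have "\<forall>h\<in>?D \<rightarrow> carrier A.FM. \<exists>y. \<forall>c\<in>?D. y c \<in> ZT \<and> h c = cls (y c)"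
    proof
      fix h assume "h \<in> ?D \<rightarrow> carrier A.FM"
      then have "\<forall>c\<in>?D. \<exists>y. y \<in> ZT \<and> h c = cls y" by (auto simp: N_simps(1) Pi_iff image_iff)
      then show "\<exists>y. \<forall>c\<in>?D. y c \<in> ZT \<and> h c = cls (y c)" by (rule bchoice)
    qed
    then obtain y y' where y: "\<And>c. c \<in> ?D \<Longrightarrow> y c \<in> ZT" "\<And>c. c \<in> ?D \<Longrightarrow> f c = cls (y c)"
      and y': "\<And>c. c \<in> ?D \<Longrightarrow> y' c \<in> ZT" "\<And>c. c \<in> ?D \<Longrightarrow> g c = cls (y' c)" using f g by metis
    define \<delta> where "\<delta> c = y c \<ominus>\<^bsub>E i\<^esub> y' c" for c
    have \<delta>: "\<delta> c \<in> ZT" "\<delta> c \<oplus>\<^bsub>E i\<^esub> y' c = y c" if "c \<in> ?D" for c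
      using ZT_diff[OF y(1)[OF that] y'(1)[OF that]] E.cancel_diff[of "y c" i "y' c"] y(1)[OF that] y'(1)[OF that]
      by (auto simp: \<delta>_def)
    note ty = comb_cls[OF y] and ty' = comb_cls[OF y']
    have t\<delta>: "tot \<delta> \<in> ZT" by (rule comb_cls(2)[OF \<delta>(1) refl])
    have "tot \<delta> \<oplus>\<^bsub>E i\<^esub> tot y' = tot (\<lambda>c. \<delta> c \<oplus>\<^bsub>E i\<^esub> y' c)" by (rule tot_add[OF \<delta>(1) y'(1), symmetric])
    also have "\<dots> = tot y"
      unfolding tot_def by (rule E.finsum_cong') (use y(1) \<delta>(2) in \<open>auto simp: \<phi>_closed\<close>)
    finally have sum: "tot \<delta> \<oplus>\<^bsub>E i\<^esub> tot y' = tot y" .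
    have "tot y \<ominus>\<^bsub>E i\<^esub> tot y' \<in> BT"
      using eq ty(1) ty'(1) cls_eq_iff[OF ty(2) ty'(2)] by simp
    moreover have "tot y \<ominus>\<^bsub>E i\<^esub> tot y' = tot \<delta>"
      using t\<delta> ty'(2) unfolding sum[symmetric] by (simp add: a_minus_def E.a_assoc E.r_neg)
    ultimately obtain e2 where e2: "tot \<delta> \<in> B (Ie e2) i" by (auto simp: BT_eq)
    have "\<forall>c\<in>?D. \<exists>e. \<delta> c \<in> Z (Ie e) i" using \<delta>(1) by (auto simp: ZT_eq)
    then obtain ec where ec: "\<And>c. c \<in> ?D \<Longrightarrow> \<delta> c \<in> Z (Ie (ec c)) i" by metis
    \<comment> \<open>All data are moved to common levels, the differences to e and the coboundary
      to e + 1, because \<chi> lowers the level by one.\<close>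
    define e where "e = Max (insert e2 (ec ` ?D))"
    have ele: "e2 \<le> e" "\<And>c. c \<in> ?D \<Longrightarrow> ec c \<le> e" unfolding e_def by (auto intro!: Max_ge simp: finite_digits)
    have \<delta>Z: "\<delta> c \<in> Z (Ie e) i" if "c \<in> ?D" for c using ec[OF that] Z_le[OF ele(2)[OF that]] by blast
    have t\<delta>B: "tot \<delta> \<in> B (Ie (Suc e)) i" using e2 B_le[of e2 "Suc e" i] ele(1) by auto
    \<comment> \<open>The complementary digits undo the reindexing in \<open>\<Theta>_tot\<close>,
      so that \<Theta> u becomes the combination of the differences themselves.\<close>
    have "\<exists>u\<in>carrier (coind (E i)). \<forall>c\<in>?D. u (pol_mon c) = \<delta> (?c c)"
      by (rule coind_build[OF E_cmod]) (rule ZTc[OF \<delta>(1)], rule digits_pos(2))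
    then obtain u where u: "u \<in> carrier (coind (E i))" "\<And>c. c \<in> ?D \<Longrightarrow> u (pol_mon c) = \<delta> (?c c)" by blast
    have uc: "u (pol_mon (?c c)) = \<delta> c" if "c \<in> ?D" for c
      using u(2)[OF digits_pos(2), of c] codigit_codigit[OF that] by simp
    have uZ: "u r \<in> Z (Ie e) i" for r
      unfolding coind_expand[OF E_cmod u(1), of r]
    proof (rule E.finsum_mem)
      show "frob_coeff c r \<odot>\<^bsub>E i\<^esub> u (pol_mon c) \<in> Z (Ie e) i" if "c \<in> ?D" for c
        unfolding u(2)[OF that] by (rule Z_closed(3)[OF \<delta>Z]) (rule digits_pos(2))
    qed (use Z_closed in auto)
    have "\<Theta> i u = tot \<delta>"
      unfolding \<Theta>_tot[OF u(1)] tot_def by (rule E.finsum_cong') (use uc \<delta>(1) in \<open>auto simp: \<phi>_closed\<close>)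
    then have \<chi>\<Theta>: "\<chi> i (\<Theta> i u) r \<in> B (Ie e) i" for r using \<chi>B[of "tot \<delta>" "Ie e" i r] t\<delta>B by (simp add: Ie_Suc)
    obtain v where v: "\<And>r. v r \<in> B (Ie e) i" "\<And>r. \<chi> i (\<Theta> i u) r = u r \<oplus>\<^bsub>E i\<^esub> v r"
      using \<chi>(4)[OF u(1) uZ] by blast
    let ?r = "pol_mon (?c b)"
    have vc: "v ?r \<in> carrier (E i)" using v(1) B_closed(4) Z_closed(4) by blast
    have "\<chi> i (\<Theta> i u) ?r \<oplus>\<^bsub>E i\<^esub> (- 1) \<odot>\<^bsub>E i\<^esub> v ?r \<in> B (Ie e) i"
      by (rule B_closed(2)[OF \<chi>\<Theta> B_closed(3)[OF v(1)]])
    then have "\<delta> b \<in> B (Ie e) i"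
      using vc coindD(1)[OF u(1), of ?r] uc[OF b] by (simp add: v(2) E.cm_uminus E.a_assoc E.r_neg)
    then have "\<delta> b \<in> BT" by (auto simp: BT_eq)
    from cls_add_BT[OF y'(1)[OF b] this] show "f b = g b"
      using \<delta>(2)[OF b] y(2)[OF b] y'(2)[OF b] ZTc[OF \<delta>(1)[OF b]] ZTc[OF y'(1)[OF b]] by (simp add: E.a_comm)
  qed
  \<comment> \<open>With n = 1 and K the ideal I this yields finitely many cocycles that generate
    Ext^i(R/I, R); their classes will generate over the ring of Frobenius operators.\<close>
  from ext_fg[OF free_K1, of i] obtain t :: nat and z where
    z: "\<And>l. l < t \<Longrightarrow> z l \<in> cocyc i 1 K1" "\<And>y. y \<in> cocyc i 1 K1 \<Longrightarrow> \<exists>a. \<exists>b\<in>cobdry i 1 K1.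
      b \<in> E.vecs i 1 \<and> (\<forall>j<1. y j = E.dot i t a (\<lambda>l. z l j) \<oplus>\<^bsub>E i\<^esub> b j)" by blast
  have dot1: "E.dot j 1 f y = f 0 \<odot>\<^bsub>E j\<^esub> y 0" if "y 0 \<in> carrier (E j)" for j f y
    using E.dot_Suc[of y j 0 f] that by (simp add: E.vecs_def)
  have killed1: "y \<in> E.killed j 1 K1 \<longleftrightarrow> y 0 \<in> ann I j" for j y
  proof -
    have eq: "(\<forall>f\<in>K1. f 0 \<odot>\<^bsub>E j\<^esub> x = \<zero>\<^bsub>E j\<^esub>) \<longleftrightarrow> (\<forall>a\<in>I. a \<odot>\<^bsub>E j\<^esub> x = \<zero>\<^bsub>E j\<^esub>)" for x
    proof
      assume *: "\<forall>f\<in>K1. f 0 \<odot>\<^bsub>E j\<^esub> x = \<zero>\<^bsub>E j\<^esub>"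
      show "\<forall>a\<in>I. a \<odot>\<^bsub>E j\<^esub> x = \<zero>\<^bsub>E j\<^esub>"
      proof
        fix a assume "a \<in> I"
        then have "(\<lambda>j. if j = 0 then a else 0) \<in> K1" by (simp add: K1_def)
        from bspec[OF * this] show "a \<odot>\<^bsub>E j\<^esub> x = \<zero>\<^bsub>E j\<^esub>" by simp
      qed
    qed (auto simp: K1_def)
    show ?thesis
      using dot1[of y j] eq[of "y 0"]
      by (cases "y 0 \<in> carrier (E j)") (simp_all add: E.killed_def E.vecs_def ann_def)
  qed
  have cocyc1: "y \<in> cocyc i 1 K1 \<longleftrightarrow> y 0 \<in> Z (Ie 0) i" for y
    unfolding cocyc_def Z_def Ie_0 by (simp add: killed1[simplified])
  have cobdry1: "b 0 \<in> B (Ie 0) i" if "b \<in> cobdry i 1 K1" for b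
    using that unfolding cobdry_def B_def Ie_0 by (cases i) (auto simp: killed1[simplified])
  define S where "S = (\<lambda>l. cls (z l 0)) ` {..<t}"
  have zZ: "z l 0 \<in> ZT" if "l < t" for l using z(1)[OF that] unfolding cocyc1 ZT_eq by blast
  have "A.F.frob_generated S"
    unfolding A.F.frob_generated_def
  proof (intro allI impI, elim conjE)
    fix H assume H: "S \<subseteq> H" "H \<subseteq> carrier A.FM" "\<zero>\<^bsub>A.FM\<^esub> \<in> H" "\<forall>x\<in>H. \<forall>y\<in>H. x \<oplus>\<^bsub>A.FM\<^esub> y \<in> H"
      "\<forall>x\<in>H. A.F.frob x \<in> H \<and> (\<forall>j. A.F.var j x \<in> H)"
    have pol: "r \<odot>\<^bsub>N\<^esub> x \<in> H" if "x \<in> H" for r x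
      by (rule A.FM_pol_mem) (use H that in auto)
    \<comment> \<open>Induction on the level: level 0 comes from Ext^i(R/I, R), and by
      \<open>step\<close> each further level lies in the R-span of the Frobenius images of the
      previous one.\<close>
    have gen: "cls y \<in> H" if "y \<in> Z (Ie e) i" for e y
      using that
    proof (induction e arbitrary: y)
      case 0
      then have "(\<lambda>_. y) \<in> cocyc i 1 K1" unfolding cocyc1 by simp
      from z(2)[OF this] obtain a b where b: "b \<in> cobdry i 1 K1" "y = E.dot i t a (\<lambda>l. z l 0) \<oplus>\<^bsub>E i\<^esub> b 0" by auto
      have "b 0 \<in> BT" using cobdry1[OF b(1)] unfolding BT_eq by blast
      have az: "(\<lambda>l. a l \<odot>\<^bsub>E i\<^esub> z l 0) \<in> {..<t} \<rightarrow> ZT" using zZ ZT_closed(3) by auto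
      note fin = cls_finsum[OF az]
      have "cls y = cls (E.dot i t a (\<lambda>l. z l 0))"
        unfolding b(2) by (rule cls_add_BT[OF _ \<open>b 0 \<in> BT\<close>]) (use fin in \<open>simp add: E.dot_def\<close>)
      also have "\<dots> = (\<Oplus>\<^bsub>N\<^esub>l\<in>{..<t}. cls (a l \<odot>\<^bsub>E i\<^esub> z l 0))" using fin by (simp add: E.dot_def)
      also have "\<dots> \<in> H"
      proof (rule A.N.finsum_mem)
        fix l assume "l \<in> {..<t}"
        then have l: "l < t" by simp
        have "cls (z l 0) \<in> H" using H(1) l by (auto simp: S_def)
        then show "cls (a l \<odot>\<^bsub>E i\<^esub> z l 0) \<in> H" using pol[of "cls (z l 0)" "a l"] zZ[OF l] by (simp add: N_simps(4))
      qed (use H in auto)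
      finally show ?case .
    next
      case (Suc e)
      from step[OF Suc.prems] obtain u where u: "u \<in> carrier (coind (E i))" "\<And>r. u r \<in> Z (Ie e) i" "cls y = cls (\<Theta> i u)" by blast
      have uZ: "u r \<in> ZT" for r using u(2) by (auto simp: ZT_eq)
      have uH: "cls (u r) \<in> H" for r by (rule Suc.IH[OF u(2)])
      have "cls y = A.F.comb (\<lambda>c. cls (u (pol_mon (?c c))))" using u(3) comb_\<Theta>[OF u(1) uZ] by simp
      also have "\<dots> = (\<Oplus>\<^bsub>N\<^esub>c\<in>?D. pol_mon c \<odot>\<^bsub>N\<^esub> \<psi> (cls (u (pol_mon (?c c)))))"
        by (rule A.FM_comb) (use uZ in \<open>auto simp: N_simps(1)\<close>)
      also have "\<dots> \<in> H"
      proof (rule A.N.finsum_mem)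
        fix c
        have "A.F.frob (cls (u (pol_mon (?c c)))) \<in> H" using H(5) uH by blast
        moreover have "cls (u (pol_mon (?c c))) \<in> carrier N" using uZ by (simp add: N_simps(1))
        ultimately have "\<psi> (cls (u (pol_mon (?c c)))) \<in> H" by (simp only: A.FM_frob)
        then show "pol_mon c \<odot>\<^bsub>N\<^esub> \<psi> (cls (u (pol_mon (?c c)))) \<in> H" by (rule pol)
      qed (use H in auto)
      finally show ?case .
    qed
    have "carrier A.FM \<subseteq> H" using gen by (auto simp: N_simps(1) ZT_eq)
    then show "H = carrier A.FM" using H(2) by blast
  qed
  moreover have "finite S" "S \<subseteq> carrier A.FM" using zZ by (auto simp: S_def N_simps(1))
  ultimately have "F_holonomic A.FM" using decomp unique by (intro A.F.F_holonomic_if_unit[of S]) auto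
  then show ?thesis by (simp add: local_cohomology_frob_def)
qed

end

theorem corollary6p10:
  shows "(\<forall>M :: (('p::prime_card, 'n::finite) frob_op, 'm) module.
            left_module frob_ring M \<and> finitely_generated frob_ring M \<and> unit_frob_module M
              \<longrightarrow> F_holonomic M) \<and>
         (\<forall>(I :: ('p, 'n) pol set) (i :: nat)
            (E :: nat \<Rightarrow> (('p, 'n) pol, 'e) module) d \<epsilon> \<phi>.
            ideal I pol_ring \<and> injective_resolution pol_ring E d \<epsilon> \<and> frobenius_lift E d \<epsilon> \<phi>
              \<longrightarrow> F_holonomic (local_cohomology_frob I E d \<phi> i))"
proof (intro conjI allI impI; elim conjE)
  fix M :: "(('p, 'n) frob_op, 'm) module"
  assume M: "left_module frob_ring M" "finitely_generated frob_ring M" "unit_frob_module M"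
  show "F_holonomic M"
    by (rule frob_left_module.unit_F_holonomic[OF frob_left_module.intro[OF M(1)] M(3,2)])
next
  fix I :: "('p, 'n) pol set" and i :: nat and E :: "nat \<Rightarrow> (('p, 'n) pol, 'e) module" and d \<epsilon> \<phi>
  assume "ideal I pol_ring" "injective_resolution pol_ring E d \<epsilon>" "frobenius_lift E d \<epsilon> \<phi>"
  then interpret local_cohomology_action E d \<epsilon> \<phi> I i
    by (intro local_cohomology_action.intro local_cohomology_action_axioms.intro frob_resolution.intro
        frob_resolution_axioms.intro pol_resolution.intro resolution.intro)
  show "F_holonomic (local_cohomology_frob I E d \<phi> i)"
    by (rule F_holonomic_local_cohomology)
qed

end
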